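(* Let $K$ be a field of characteristic different from $2$ with an involution $\sigma$ (possibly trivial), and let $\alpha\colon\mathbb{Z}[t,t^{-1}]\to K$ be a ring homomorphism with $\alpha(t^{-1})=\sigma(\alpha(t))$ and $\alpha(t)\neq1$. For each $n\ge2$, let $r_n$ be the unitary homomorphism on $B_n$ obtained from the Burau representation, as described in the context. Then for each $n\ge 2$ there is a unique map $$f_n\colon B_n\longrightarrow WH(K,\sigma)$$ with the property that $f_n(\sigma_i)=0$ for $1\le i\le n-1$ and $$f_n(\beta\gamma)=f_n(\beta)+f_n(\gamma)+\tau\big(\Gamma_1,\ \Gamma_{r_n(\beta)},\ \Gamma_{r_n(\beta\gamma)}\big)$$ for all $\beta,\gamma\in B_n$. Moreover, the collection $(f_n)_{n\ge2}$ is a Markov function.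
   Context: $B_n$ is the braid group on $n$ strands with standard generators $\sigma_1,\dots,\sigma_{n-1}$, and $\iota_n\colon B_n\to B_{n+1}$ is the standard inclusion. A collection of maps $f_n\colon B_n\to E$ ($n\ge2$, $E$ a set) is a Markov function if (i) $f_n(\gamma^{-1}\beta\gamma)=f_n(\beta)$ for all $n\ge 2$, $\beta,\gamma\in B_n$, and (ii) $f_{n+1}(\iota_n(\beta)\sigma_n^{\pm1})=f_n(\beta)$ for all $n\ge2$, $\beta\in B_n$. Hermitian algebra. Write $\bar x=\sigma(x)$. All spaces are finite-dimensional. A hermitian (resp. anti-hermitian) form $h\colon V\times V\to K$ is linear in the second variable, with $h(y,x)=\overline{h(x,y)}$ (resp. $h(y,x)=-\overline{h(x,y)}$). A lagrangian of a space is a subspace $\ell$ with $\ell=\ell^\perp$; a space is hyperbolic if it is the direct sum of two lagrangians. $WH(K,\sigma)$ is the hermitian Witt ring: the quotient of the Grothendieck ring of non-degenerate hermitian spaces by the ideal of hyperbolic spaces. $U(V)$ is the group of isometries of $(V,h)$. Maslov index. For lagrangians $\ell_1,\ell_2,\ell_3$ in a non-degenerate hyperbolic anti-hermitian space with form $h$, $\tau(\ell_1,\ell_2,\ell_3)\in WH(K,\sigma)$ is the class of the hermitian form on $\ell_1\oplus\ell_2\oplus\ell_3$ given by $H(\mathbf v,\mathbf w)=h(v_1,w_2-w_3)+h(v_2,w_3-w_1)+h(v_3,w_1-w_2)$, after dividing by its kernel. For a non-degenerate anti-hermitian space $(V,h)$ put $\mathcal{D}(V)=(V,-h)\oplus(V,h)$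 (orthogonal sum); for $g\in U(V)$ the graph $\Gamma_g=\{(x,gx)\}$ is a lagrangian of $\mathcal{D}(V)$, and the Maslov indices of graphs are computed in $\mathcal{D}(V)$. Burau representation. $B_n$ acts on $V_n=K^n$, $\sigma_i$ acting by the matrix $\Sigma_i$ which is the identity except for the $2\times2$ diagonal block $\begin{pmatrix}1-t&1\\ t&0\end{pmatrix}$ in rows and columns $i,i+1$ (with $t$ replaced by $\alpha(t)$). Let $\Omega_n$ be the $n\times n$ lower triangular matrix with $1$ on the diagonal and $1-\alpha(t)$ in every entry below it, and $H_n=\Omega_n-{}^T\overline{\Omega_n}$. The anti-hermitian form $h_n(x,y)={}^T\bar x\,H_n\,y$ on $V_n$ is $B_n$-invariant. Given $n$, let $N\ge n$ be the smallest integer for which $h_N$ is non-degenerate ($N\in\{n,n+1\}$ since $\alpha(t)\ne1$); then $r_n\colon B_n\to U(V_N)$ is the inclusion $B_n\subset B_N$ followed by the action of $B_N$ on $V_N=K^N$ in which each generator $\sigma_i$ ($1\le i\le N-1$) acts by the $N\times N$ matrix $\Sigma_i$ equal to the identity except for the $2\times2$ diagonal block $\begin{pmatrix}1-\alpha(t)&1\\ \alpha(t)&0\end{pmatrix}$ in rows and columns $i,i+1$. *)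

theory Defs
  imports
    "HOL-Library.Poly_Mapping"
    "HOL-Algebra.QuotRing"
    "Jordan_Normal_Form.VS_Connect"
begin

section \<open>Braid groups\<close>

text \<open>
  The letter \<open>(i, True)\<close> stands for the generator of index \<open>i\<close>, with \<open>1 \<le> i < n\<close>,
  and \<open>(i, False)\<close> for its inverse. The braid group is given by Artin's presentation:
  words modulo free reduction, far commutation and the braid relation.
\<close>

type_synonym braid_word = "(nat \<times> bool) list"

definition braid_words :: "nat \<Rightarrow> braid_word set" where
  "braid_words n = lists ({1..<n} \<times> UNIV)"

inductive braid_equiv :: "nat \<Rightarrow> braid_word \<Rightarrow> braid_word \<Rightarrow> bool" for n where
  be_refl: "w \<in> braid_words n \<Longrightarrow> braid_equiv n w w"
| be_sym: "braid_equiv n v w \<Longrightarrow> braid_equiv n w v"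
| be_trans: "braid_equiv n u v \<Longrightarrow> braid_equiv n v w \<Longrightarrow> braid_equiv n u w"
| be_cancel: "u \<in> braid_words n \<Longrightarrow> v \<in> braid_words n \<Longrightarrow> i \<in> {1..<n} \<Longrightarrow>
    braid_equiv n (u @ [(i, b), (i, \<not> b)] @ v) (u @ v)"
| be_comm: "u \<in> braid_words n \<Longrightarrow> v \<in> braid_words n \<Longrightarrow> i \<in> {1..<n} \<Longrightarrow> j \<in> {1..<n} \<Longrightarrow>
    i + 2 \<le> j \<Longrightarrow>
    braid_equiv n (u @ [(i, True), (j, True)] @ v) (u @ [(j, True), (i, True)] @ v)"
| be_braid: "u \<in> braid_words n \<Longrightarrow> v \<in> braid_words n \<Longrightarrow> i \<in> {1..<n} \<Longrightarrow> i + 1 \<in> {1..<n} \<Longrightarrow>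
    braid_equiv n (u @ [(i, True), (i + 1, True), (i, True)] @ v)
                  (u @ [(i + 1, True), (i, True), (i + 1, True)] @ v)"

definition braid_rel :: "nat \<Rightarrow> (braid_word \<times> braid_word) set" where
  "braid_rel n = {(v, w). braid_equiv n v w}"

definition braid_group :: "nat \<Rightarrow> braid_word set monoid" where
  "braid_group n =
     \<lparr>carrier = braid_words n // braid_rel n,
      mult = (\<lambda>X Y. \<Union>v\<in>X. \<Union>w\<in>Y. braid_rel n `` {v @ w}),
      one = braid_rel n `` {[]}\<rparr>"

definition braid_gen :: "nat \<Rightarrow> nat \<Rightarrow> braid_word set" where
  "braid_gen n i = braid_rel n `` {[(i, True)]}"

text \<open>The standard homomorphism from \<open>braid_group n\<close> to \<open>braid_group m\<close> for \<open>n \<le> m\<close>.\<close>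

definition braid_incl :: "nat \<Rightarrow> nat \<Rightarrow> braid_word set \<Rightarrow> braid_word set" where
  "braid_incl n m X = (\<Union>w\<in>X. braid_rel m `` {w})"

definition markov_function :: "'e set \<Rightarrow> (nat \<Rightarrow> braid_word set \<Rightarrow> 'e) \<Rightarrow> bool" where
  "markov_function E f \<longleftrightarrow>
     (\<forall>n\<ge>2. f n \<in> carrier (braid_group n) \<rightarrow> E) \<and>
     (\<forall>n\<ge>2. \<forall>\<beta>\<in>carrier (braid_group n). \<forall>\<gamma>\<in>carrier (braid_group n).
        f n (inv\<^bsub>braid_group n\<^esub> \<gamma> \<otimes>\<^bsub>braid_group n\<^esub> \<beta> \<otimes>\<^bsub>braid_group n\<^esub> \<gamma>) = f n \<beta>) \<and>
     (\<forall>n\<ge>2. \<forall>\<beta>\<in>carrier (braid_group n).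
        f (n + 1) (braid_incl n (n + 1) \<beta> \<otimes>\<^bsub>braid_group (n + 1)\<^esub> braid_gen (n + 1) n) = f n \<beta> \<and>
        f (n + 1) (braid_incl n (n + 1) \<beta> \<otimes>\<^bsub>braid_group (n + 1)\<^esub>
                   inv\<^bsub>braid_group (n + 1)\<^esub> (braid_gen (n + 1) n)) = f n \<beta>)"


section \<open>Hermitian spaces\<close>

text \<open>
  A space is given by a vector space \<open>V\<close> over the field \<open>'k\<close> (viewed as the ring
  \<open>class_ring\<close>) and a form \<open>h\<close>, of which only the values on \<open>carrier V\<close> matter.
  Forms are linear in the second variable.
\<close>

definition field_involution :: "('k::field \<Rightarrow> 'k) \<Rightarrow> bool" where
  "field_involution \<sigma> \<longleftrightarrow> comm_ring_hom \<sigma> \<and> (\<forall>x. \<sigma> (\<sigma> x) = x)"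

definition hermitian_space ::
  "('k::field \<Rightarrow> 'k) \<Rightarrow> ('k, 'v) module \<Rightarrow> ('v \<Rightarrow> 'v \<Rightarrow> 'k) \<Rightarrow> bool" where
  "hermitian_space \<sigma> V h \<longleftrightarrow>
     vectorspace class_ring V \<and> vectorspace.fin_dim class_ring V \<and>
     (\<forall>x\<in>carrier V. \<forall>y\<in>carrier V. \<forall>z\<in>carrier V. h x (y \<oplus>\<^bsub>V\<^esub> z) = h x y + h x z) \<and>
     (\<forall>x\<in>carrier V. \<forall>y\<in>carrier V. \<forall>c. h x (c \<odot>\<^bsub>V\<^esub> y) = c * h x y) \<and>
     (\<forall>x\<in>carrier V. \<forall>y\<in>carrier V. h y x = \<sigma> (h x y))"

text \<open>
  All forms below are hermitian or anti-hermitian, so that left and right orthogonality agree.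
\<close>

definition orth :: "('k::field, 'v) module \<Rightarrow> ('v \<Rightarrow> 'v \<Rightarrow> 'k) \<Rightarrow> 'v set \<Rightarrow> 'v set" where
  "orth V h L = {v \<in> carrier V. \<forall>w\<in>L. h v w = 0}"

abbreviation form_kernel :: "('k::field, 'v) module \<Rightarrow> ('v \<Rightarrow> 'v \<Rightarrow> 'k) \<Rightarrow> 'v set" where
  "form_kernel V h \<equiv> orth V h (carrier V)"

definition nondegenerate :: "('k::field, 'v) module \<Rightarrow> ('v \<Rightarrow> 'v \<Rightarrow> 'k) \<Rightarrow> bool" where
  "nondegenerate V h \<longleftrightarrow> form_kernel V h = {\<zero>\<^bsub>V\<^esub>}"

definition lagrangian :: "('k::field, 'v) module \<Rightarrow> ('v \<Rightarrow> 'v \<Rightarrow> 'k) \<Rightarrow> 'v set \<Rightarrow> bool" where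
  "lagrangian V h L \<longleftrightarrow> submodule class_ring L V \<and> L = orth V h L"

definition hyperbolic :: "('k::field, 'v) module \<Rightarrow> ('v \<Rightarrow> 'v \<Rightarrow> 'k) \<Rightarrow> bool" where
  "hyperbolic V h \<longleftrightarrow>
     (\<exists>L L'. lagrangian V h L \<and> lagrangian V h L' \<and>
             L \<inter> L' = {\<zero>\<^bsub>V\<^esub>} \<and> L <+>\<^bsub>V\<^esub> L' = carrier V)"

definition isometric ::
  "('k::field, 'v) module \<Rightarrow> ('v \<Rightarrow> 'v \<Rightarrow> 'k) \<Rightarrow> ('k, 'w) module \<Rightarrow> ('w \<Rightarrow> 'w \<Rightarrow> 'k) \<Rightarrow> bool" where
  "isometric V h W k \<longleftrightarrow>
     (\<exists>\<phi>. \<phi> \<in> LinearCombinations.module_hom class_ring V W \<and> bij_betw \<phi> (carrier V) (carrier W) \<and>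
          (\<forall>x\<in>carrier V. \<forall>y\<in>carrier V. k (\<phi> x) (\<phi> y) = h x y))"

definition quot_module :: "('k::field, 'v) module \<Rightarrow> 'v set \<Rightarrow> ('k, 'v set) module" where
  "quot_module V N =
     \<lparr>carrier = a_rcosets\<^bsub>V\<^esub> N, mult = (\<lambda>_ _. N), one = N, zero = N, add = set_add V,
      smult = (\<lambda>c X. \<Union>x\<in>X. N +>\<^bsub>V\<^esub> (c \<odot>\<^bsub>V\<^esub> x))\<rparr>"

definition quot_form :: "('v \<Rightarrow> 'v \<Rightarrow> 'k) \<Rightarrow> 'v set \<Rightarrow> 'v set \<Rightarrow> 'k" where
  "quot_form h X Y = the_elem {h x y | x y. x \<in> X \<and> y \<in> Y}"

definition coord_space :: "nat \<Rightarrow> ('k::field, 'k vec) module" where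
  "coord_space n = module_vec TYPE('k) n"

definition gram_form :: "('k::field \<Rightarrow> 'k) \<Rightarrow> 'k mat \<Rightarrow> 'k vec \<Rightarrow> 'k vec \<Rightarrow> 'k" where
  "gram_form \<sigma> G x y = map_vec \<sigma> x \<bullet> (G *\<^sub>v y)"


section \<open>The hermitian Witt ring\<close>

text \<open>
  To have a set of representatives of the isometry classes of non-degenerate hermitian spaces,
  the Witt ring is built from the spaces \<open>(K^n, gram_form \<sigma> G)\<close>, each encoded by
  its Gram matrix \<open>G\<close>. An orthogonal sum then is a block diagonal matrix and a tensor
  product, in the basis of the \<open>e_i \<otimes> e_j\<close>, a Kronecker product.
\<close>

definition hermitian_mats :: "('k::field \<Rightarrow> 'k) \<Rightarrow> 'k mat set" where
  "hermitian_mats \<sigma> =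
     {G. square_mat G \<and> hermitian_space \<sigma> (coord_space (dim_row G)) (gram_form \<sigma> G) \<and>
         nondegenerate (coord_space (dim_row G)) (gram_form \<sigma> G)}"

definition mat_isometric :: "('k::field \<Rightarrow> 'k) \<Rightarrow> 'k mat \<Rightarrow> 'k mat \<Rightarrow> bool" where
  "mat_isometric \<sigma> A B \<longleftrightarrow>
     isometric (coord_space (dim_row A)) (gram_form \<sigma> A) (coord_space (dim_row B)) (gram_form \<sigma> B)"

abbreviation mat_sum :: "'k::field mat \<Rightarrow> 'k mat \<Rightarrow> 'k mat" where
  "mat_sum A B \<equiv> diag_block_mat [A, B]"

definition mat_tensor :: "'k::field mat \<Rightarrow> 'k mat \<Rightarrow> 'k mat" where
  "mat_tensor A B = mat (dim_row A * dim_row B) (dim_col A * dim_col B)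
     (\<lambda>(i, j). A $$ (i div dim_row B, j div dim_col B) * B $$ (i mod dim_row B, j mod dim_col B))"

text \<open>
  The Grothendieck ring of the semiring of isometry classes: \<open>(A, B)\<close> represents
  the formal difference \<open>[A] - [B]\<close>.
\<close>

definition groth_rel ::
  "('k::field \<Rightarrow> 'k) \<Rightarrow> (('k mat \<times> 'k mat) \<times> ('k mat \<times> 'k mat)) set" where
  "groth_rel \<sigma> =
     {((A, B), (C, D)).
        A \<in> hermitian_mats \<sigma> \<and> B \<in> hermitian_mats \<sigma> \<and> C \<in> hermitian_mats \<sigma> \<and> D \<in> hermitian_mats \<sigma> \<and>
        (\<exists>E\<in>hermitian_mats \<sigma>. mat_isometric \<sigma> (mat_sum (mat_sum A D) E) (mat_sum (mat_sum C B) E))}"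

definition groth_ring :: "('k::field \<Rightarrow> 'k) \<Rightarrow> ('k mat \<times> 'k mat) set ring" where
  "groth_ring \<sigma> =
     \<lparr>carrier = (hermitian_mats \<sigma> \<times> hermitian_mats \<sigma>) // groth_rel \<sigma>,
      mult = (\<lambda>X Y. \<Union>(A, B)\<in>X. \<Union>(C, D)\<in>Y. groth_rel \<sigma> ``
               {(mat_sum (mat_tensor A C) (mat_tensor B D),
                 mat_sum (mat_tensor A D) (mat_tensor B C))}),
      one = groth_rel \<sigma> `` {(1\<^sub>m 1, 0\<^sub>m 0 0)},
      zero = groth_rel \<sigma> `` {(0\<^sub>m 0 0, 0\<^sub>m 0 0)},
      add = (\<lambda>X Y. \<Union>(A, B)\<in>X. \<Union>(C, D)\<in>Y. groth_rel \<sigma> `` {(mat_sum A C, mat_sum B D)})\<rparr>"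

definition groth_class :: "('k::field \<Rightarrow> 'k) \<Rightarrow> 'k mat \<Rightarrow> ('k mat \<times> 'k mat) set" where
  "groth_class \<sigma> G = groth_rel \<sigma> `` {(G, 0\<^sub>m 0 0)}"

definition hyperbolic_ideal :: "('k::field \<Rightarrow> 'k) \<Rightarrow> ('k mat \<times> 'k mat) set set" where
  "hyperbolic_ideal \<sigma> = Idl\<^bsub>groth_ring \<sigma>\<^esub>
     {groth_class \<sigma> G | G. G \<in> hermitian_mats \<sigma> \<and> hyperbolic (coord_space (dim_row G)) (gram_form \<sigma> G)}"

definition witt_ring :: "('k::field \<Rightarrow> 'k) \<Rightarrow> ('k mat \<times> 'k mat) set set ring" where
  "witt_ring \<sigma> = groth_ring \<sigma> Quot hyperbolic_ideal \<sigma>"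

text \<open>
  The Witt class of an arbitrary non-degenerate hermitian space, through a Gram matrix of it; any
  two of these are isometric.
\<close>

definition witt_class ::
  "('k::field \<Rightarrow> 'k) \<Rightarrow> ('k, 'v) module \<Rightarrow> ('v \<Rightarrow> 'v \<Rightarrow> 'k) \<Rightarrow> ('k mat \<times> 'k mat) set set" where
  "witt_class \<sigma> V h =
     hyperbolic_ideal \<sigma> +>\<^bsub>groth_ring \<sigma>\<^esub> groth_class \<sigma>
       (SOME G. G \<in> hermitian_mats \<sigma> \<and> isometric V h (coord_space (dim_row G)) (gram_form \<sigma> G))"


section \<open>The Maslov index\<close>

definition maslov_space ::
  "('k::field, 'v) module \<Rightarrow> 'v set \<Rightarrow> 'v set \<Rightarrow> 'v set \<Rightarrow> ('k, 'v \<times> 'v \<times> 'v) module" where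
  "maslov_space V L1 L2 L3 =
     direct_sum (V\<lparr>carrier := L1\<rparr>) (direct_sum (V\<lparr>carrier := L2\<rparr>) (V\<lparr>carrier := L3\<rparr>))"

definition maslov_form ::
  "('k::field, 'v) module \<Rightarrow> ('v \<Rightarrow> 'v \<Rightarrow> 'k) \<Rightarrow> 'v \<times> 'v \<times> 'v \<Rightarrow> 'v \<times> 'v \<times> 'v \<Rightarrow> 'k" where
  "maslov_form V h = (\<lambda>(v1, v2, v3) (w1, w2, w3).
     h v1 (w2 \<ominus>\<^bsub>V\<^esub> w3) + h v2 (w3 \<ominus>\<^bsub>V\<^esub> w1) + h v3 (w1 \<ominus>\<^bsub>V\<^esub> w2))"

definition maslov ::
  "('k::field \<Rightarrow> 'k) \<Rightarrow> ('k, 'v) module \<Rightarrow> ('v \<Rightarrow> 'v \<Rightarrow> 'k) \<Rightarrow> 'v set \<Rightarrow> 'v set \<Rightarrow> 'v set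
     \<Rightarrow> ('k mat \<times> 'k mat) set set" where
  "maslov \<sigma> V h L1 L2 L3 =
     (let S = maslov_space V L1 L2 L3; H = maslov_form V h
      in witt_class \<sigma> (quot_module S (form_kernel S H)) (quot_form H))"

definition double_form :: "('v \<Rightarrow> 'v \<Rightarrow> 'k::field) \<Rightarrow> 'v \<times> 'v \<Rightarrow> 'v \<times> 'v \<Rightarrow> 'k" where
  "double_form h = (\<lambda>(x, x') (y, y'). - h x y + h x' y')"

definition graph :: "('k::field, 'v) module \<Rightarrow> ('v \<Rightarrow> 'v) \<Rightarrow> ('v \<times> 'v) set" where
  "graph V g = {(x, g x) | x. x \<in> carrier V}"

definition graph_maslov ::
  "('k::field \<Rightarrow> 'k) \<Rightarrow> ('k, 'v) module \<Rightarrow> ('v \<Rightarrow> 'v \<Rightarrow> 'k) \<Rightarrow> ('v \<Rightarrow> 'v) \<Rightarrow> ('v \<Rightarrow> 'v) \<Rightarrow> ('v \<Rightarrow> 'v)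
     \<Rightarrow> ('k mat \<times> 'k mat) set set" where
  "graph_maslov \<sigma> V h g1 g2 g3 =
     maslov \<sigma> (direct_sum V V) (double_form h) (graph V g1) (graph V g2) (graph V g3)"


section \<open>The Burau representation\<close>

text \<open>
  Throughout, \<open>a\<close> is the image of the Laurent variable in the field. Matrix indices start at
  0, whereas braid generators are numbered from 1.
\<close>

definition burau_gen :: "'k::field \<Rightarrow> nat \<Rightarrow> nat \<Rightarrow> 'k mat" where
  "burau_gen a N i = mat N N (\<lambda>(r, c).
     if r = i - 1 \<and> c = i - 1 then 1 - a
     else if r = i - 1 \<and> c = i then 1
     else if r = i \<and> c = i - 1 then a
     else if r = i \<and> c = i then 0
     else if r = c then 1 else 0)"

definition burau_letter :: "'k::field \<Rightarrow> nat \<Rightarrow> nat \<times> bool \<Rightarrow> 'k mat" where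
  "burau_letter a N = (\<lambda>(i, b).
     if b then burau_gen a N i else inv\<^bsub>ring_mat TYPE('k) N ()\<^esub> (burau_gen a N i))"

definition burau_word :: "'k::field \<Rightarrow> nat \<Rightarrow> braid_word \<Rightarrow> 'k mat" where
  "burau_word a N w = foldr (\<lambda>l M. burau_letter a N l * M) w (1\<^sub>m N)"

text \<open>\<open>the_elem\<close> picks the common value on all the words representing the braid.\<close>

definition burau :: "'k::field \<Rightarrow> nat \<Rightarrow> braid_word set \<Rightarrow> 'k mat" where
  "burau a N \<beta> = the_elem (burau_word a N ` \<beta>)"

definition burau_omega :: "'k::field \<Rightarrow> nat \<Rightarrow> 'k mat" where
  "burau_omega a n = mat n n (\<lambda>(i, j). if i = j then 1 else if j < i then 1 - a else 0)"

definition burau_form :: "('k::field \<Rightarrow> 'k) \<Rightarrow> 'k \<Rightarrow> nat \<Rightarrow> 'k vec \<Rightarrow> 'k vec \<Rightarrow> 'k" where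
  "burau_form \<sigma> a n =
     gram_form \<sigma> (burau_omega a n - transpose_mat (map_mat \<sigma> (burau_omega a n)))"

definition burau_dim :: "('k::field \<Rightarrow> 'k) \<Rightarrow> 'k \<Rightarrow> nat \<Rightarrow> nat" where
  "burau_dim \<sigma> a n = (LEAST N. n \<le> N \<and> nondegenerate (coord_space N) (burau_form \<sigma> a N))"

definition unitary_burau ::
  "('k::field \<Rightarrow> 'k) \<Rightarrow> 'k \<Rightarrow> nat \<Rightarrow> braid_word set \<Rightarrow> 'k vec \<Rightarrow> 'k vec" where
  "unitary_burau \<sigma> a n \<beta> =
     (\<lambda>x. burau a (burau_dim \<sigma> a n) (braid_incl n (burau_dim \<sigma> a n) \<beta>) *\<^sub>v x)"

definition burau_maslov ::
  "('k::field \<Rightarrow> 'k) \<Rightarrow> 'k \<Rightarrow> nat \<Rightarrow> braid_word set \<Rightarrow> braid_word set \<Rightarrow> ('k mat \<times> 'k mat) set set" where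
  "burau_maslov \<sigma> a n \<beta> \<gamma> =
     (let N = burau_dim \<sigma> a n; r = unitary_burau \<sigma> a n
      in graph_maslov \<sigma> (coord_space N) (burau_form \<sigma> a N)
           (\<lambda>x. x) (r \<beta>) (r (\<beta> \<otimes>\<^bsub>braid_group n\<^esub> \<gamma>)))"

text \<open>The property characterising the map on the \<open>n\<close>-strand braid group.\<close>

definition burau_maslov_map ::
  "('k::field \<Rightarrow> 'k) \<Rightarrow> 'k \<Rightarrow> nat \<Rightarrow> (braid_word set \<Rightarrow> ('k mat \<times> 'k mat) set set) \<Rightarrow> bool" where
  "burau_maslov_map \<sigma> a n f \<longleftrightarrow>
     (\<forall>i\<in>{1..n - 1}. f (braid_gen n i) = \<zero>\<^bsub>witt_ring \<sigma>\<^esub>) \<and>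
     (\<forall>\<beta>\<in>carrier (braid_group n). \<forall>\<gamma>\<in>carrier (braid_group n).
        f (\<beta> \<otimes>\<^bsub>braid_group n\<^esub> \<gamma>) =
          f \<beta> \<oplus>\<^bsub>witt_ring \<sigma>\<^esub> f \<gamma> \<oplus>\<^bsub>witt_ring \<sigma>\<^esub> burau_maslov \<sigma> a n \<beta> \<gamma>)"


section \<open>Laurent polynomials\<close>

text \<open>
  The ring of integral Laurent polynomials is the group ring \<open>int \<Rightarrow>\<^sub>0 int\<close> of the
  integers, with convolution as product.
\<close>

abbreviation laurent_t :: "int \<Rightarrow>\<^sub>0 int" where
  "laurent_t \<equiv> Poly_Mapping.single 1 1"

abbreviation laurent_t_inv :: "int \<Rightarrow>\<^sub>0 int" where
  "laurent_t_inv \<equiv> Poly_Mapping.single (- 1) 1"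

end

theory Submission
  imports Defs "HOL-Library.Function_Algebras" "HOL-Library.Product_Plus"
begin

text \<open>
  Everything rests on a Witt reduction: if \<open>L\<close> is an isotropic subspace of a possibly degenerate
  hermitian space and the orthogonal of \<open>L\<close> is contained in \<open>L\<close> plus the kernel, then the space
  has class 0. Applied to suitable subspaces, it shows that \<open>\<tau>\<close> is an alternating cocycle which
  vanishes on \<open>(\<ell>1, \<ell>2, \<ell>3)\<close> when \<open>\<ell>1 = \<ell>1 \<inter> \<ell>2 + \<ell>1 \<inter> \<ell>3\<close>. For the cocycle relation,
  \<open>\<tau>(\<ell>1, \<ell>2, \<ell>3)\<close> is first rewritten as the class of a form on \<open>{v1 + v2 + v3 = 0}\<close>, and
  both sides are then compared with a form on \<open>{v1 + v2 + v3 + v4 = 0}\<close> that is invariant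
  under cyclic permutations.

  Hence \<open>c(g, k) = \<tau>(\<Gamma>_1, \<Gamma>_g, \<Gamma>_{gk})\<close> is a 2-cocycle on the isometry group; it is invariant
  under conjugation and, since inversion changes the sign of \<open>\<tau>\<close>, symmetric. The value of \<open>f\<close> on a word
  in the generators is forced, and these two properties imply that it respects the braid
  relations and conjugation. For the stabilization, the correction \<open>c(\<beta>, \<sigma>_n)\<close> vanishes
  because the space is the sum of the fixed vectors of \<open>\<beta>\<close> and of \<open>\<sigma>_n\<close>, and passing to a larger
  Burau space does not change \<open>\<tau>\<close>, by orthogonal projection onto the smaller one.
\<close>

section \<open>Gram matrices and isometries\<close>

text \<open>Quotients by kernels are avoided: a possibly degenerate space is represented by a linear
  surjection onto K^n along which its form is pulled back from an invertible Gram matrix. A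
  form-preserving surjection, be it an isometry, a permutation of factors or an orthogonal
  projection, then preserves the Witt class by mere composition. Spaces V1 and V2 that are not
  related by such a map are compared by applying the Witt reduction in V1 + (-V2) to the graph of a
  form-preserving map defined on part of V1. Characteristic different from 2 enters at two places: a
  vector is made isotropic by a division by 2 when a lagrangian complement is built, and on {v1 + v2
  + v3 = 0} the form is twice a single pairing, whose factor has to be cancelled. The construction
  lives on words: the value is defined by recursion on letters, and the braid relations are checked
  afterwards. Since h_n may be degenerate, the Burau spaces for n and n + 1 strands can have equal
  or different dimensions, so the value of a word must be shown independent of the ambient
  space.\<close>

locale involutive_field =
  fixes \<sigma> :: "'k::field \<Rightarrow> 'k"
  assumes involution: "field_involution \<sigma>"
begin

sublocale comm_ring_hom \<sigma>
  using involution by (simp add: field_involution_def)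

lemma invol [simp]: "\<sigma> (\<sigma> x) = x"
  using involution by (simp add: field_involution_def)

lemma conj_eq_0 [simp]: "\<sigma> x = 0 \<longleftrightarrow> x = 0"
  by (metis hom_zero invol)

lemma carrier_coord_space [simp]: "carrier (coord_space n :: ('k, 'k vec) module) = carrier_vec n"
  and zero_coord_space [simp]: "\<zero>\<^bsub>coord_space n :: ('k, 'k vec) module\<^esub> = 0\<^sub>v n"
  and add_coord_space [simp]: "add (coord_space n :: ('k, 'k vec) module) = (+)"
  and smult_coord_space [simp]: "module.smult (coord_space n :: ('k, 'k vec) module) = (\<cdot>\<^sub>v)"
  by (simp_all add: coord_space_def module_vec_simps)

lemma gram_form_sum:
  assumes "G \<in> carrier_mat m n" "x \<in> carrier_vec m" "y \<in> carrier_vec n"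
  shows "gram_form \<sigma> G x y = (\<Sum>i<m. \<Sum>j<n. \<sigma> (x $ i) * G $$ (i, j) * y $ j)"
  using assms
  by (auto simp: gram_form_def scalar_prod_def sum_distrib_left mult.assoc lessThan_atLeast0 intro!: sum.cong)

lemma gram_form_unit_vec:
  assumes "G \<in> carrier_mat m n" "i < m" "j < n"
  shows "gram_form \<sigma> G (unit_vec m i) (unit_vec n j) = G $$ (i, j)"
proof -
  have "(\<Sum>k<m. \<Sum>l<n. \<sigma> (unit_vec m i $ k) * G $$ (k, l) * unit_vec n j $ l)
      = (\<Sum>k<m. if k = i then G $$ (i, j) else 0)"
  proof (rule sum.cong[OF refl])
    fix k assume k: "k \<in> {..<m}"
    have "(\<Sum>l<n. \<sigma> (unit_vec m i $ k) * G $$ (k, l) * unit_vec n j $ l)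
        = (\<Sum>l<n. if l = j then (if k = i then G $$ (i, j) else 0) else 0)"
      using k assms by (intro sum.cong) (auto simp: unit_vec_def)
    then show "(\<Sum>l<n. \<sigma> (unit_vec m i $ k) * G $$ (k, l) * unit_vec n j $ l) = (if k = i then G $$ (i, j) else 0)"
      using assms by simp
  qed
  then show ?thesis using assms by (simp add: gram_form_sum)
qed

definition hermitian_mat :: "'k mat \<Rightarrow> bool" where
  "hermitian_mat G \<longleftrightarrow> square_mat G \<and> (\<forall>i<dim_row G. \<forall>j<dim_row G. G $$ (j, i) = \<sigma> (G $$ (i, j)))"

lemma hermitian_space_iff:
  assumes G: "G \<in> carrier_mat n n"
  shows "hermitian_space \<sigma> (coord_space n) (gram_form \<sigma> G) \<longleftrightarrow> hermitian_mat G"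
proof
  assume h: "hermitian_space \<sigma> (coord_space n) (gram_form \<sigma> G)"
  show "hermitian_mat G"
    unfolding hermitian_mat_def
  proof (intro conjI allI impI)
    show "square_mat G" using G by auto
    fix i j assume ij: "i < dim_row G" "j < dim_row G"
    have "gram_form \<sigma> G (unit_vec n j) (unit_vec n i) = \<sigma> (gram_form \<sigma> G (unit_vec n i) (unit_vec n j))"
      using h unit_vec_carrier[of n] unfolding hermitian_space_def carrier_coord_space by blast
    then show "G $$ (j, i) = \<sigma> (G $$ (i, j))" using ij G by (simp add: gram_form_unit_vec)
  qed
next
  assume "hermitian_mat G"
  then have h: "\<sigma> (G $$ (i, j)) = G $$ (j, i)" if "i < n" "j < n" for i j
    using G that unfolding hermitian_mat_def by (metis carrier_matD(1))
  show "hermitian_space \<sigma> (coord_space n) (gram_form \<sigma> G)"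
    unfolding hermitian_space_def
  proof (intro conjI ballI allI)
    show "vectorspace class_ring (coord_space n :: ('k, 'k vec) module)"
      unfolding coord_space_def by (rule vec_vs)
    show "vectorspace.fin_dim class_ring (coord_space n :: ('k, 'k vec) module)"
      unfolding coord_space_def by (rule vec_space.fin_dim)
    fix x y :: "'k vec"
    assume x: "x \<in> carrier (coord_space n)" and y: "y \<in> carrier (coord_space n)"
    then have xy: "x \<in> carrier_vec n" "y \<in> carrier_vec n" by (simp_all add: coord_space_def module_vec_simps)
    show "gram_form \<sigma> G x (y \<oplus>\<^bsub>coord_space n\<^esub> z) = gram_form \<sigma> G x y + gram_form \<sigma> G x z"
      if z: "z \<in> carrier (coord_space n)" for z :: "'k vec"
      using z xy G by (simp add: gram_form_sum coord_space_def module_vec_simps algebra_simps sum.distrib)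
    show "gram_form \<sigma> G x (c \<odot>\<^bsub>coord_space n\<^esub> y) = c * gram_form \<sigma> G x y" for c
      using xy G by (simp add: gram_form_sum coord_space_def module_vec_simps algebra_simps sum_distrib_left)
    have "\<sigma> (gram_form \<sigma> G x y) = (\<Sum>i<n. \<Sum>j<n. x $ i * G $$ (j, i) * \<sigma> (y $ j))"
      using xy G h by (simp add: gram_form_sum hom_sum hom_mult)
    also have "\<dots> = (\<Sum>j<n. \<Sum>i<n. x $ i * G $$ (j, i) * \<sigma> (y $ j))"
      by (rule sum.swap)
    also have "\<dots> = gram_form \<sigma> G y x"
      using xy G by (simp add: gram_form_sum algebra_simps)
    finally show "gram_form \<sigma> G y x = \<sigma> (gram_form \<sigma> G x y)" by simp
  qed
qed

lemma hermitian_matD: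
  assumes "hermitian_mat G" "G \<in> carrier_mat n n" "x \<in> carrier_vec n" "y \<in> carrier_vec n"
  shows "gram_form \<sigma> G y x = \<sigma> (gram_form \<sigma> G x y)"
  using assms hermitian_space_iff[OF assms(2)]
  unfolding hermitian_space_def carrier_coord_space by blast

text \<open>Orthogonality is symmetric for hermitian G, so a vector killed by G lies in the radical.
  Non-degeneracy thus becomes invertibility, a condition that block sums and Kronecker products
  visibly preserve.\<close>

lemma nondegenerate_iff:
  assumes G: "G \<in> carrier_mat n n" and h: "hermitian_mat G"
  shows "nondegenerate (coord_space n) (gram_form \<sigma> G) \<longleftrightarrow> (\<exists>G'\<in>carrier_mat n n. G * G' = 1\<^sub>m n)"
proof
  assume nd: "nondegenerate (coord_space n) (gram_form \<sigma> G)"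
  have "det G \<noteq> 0"
  proof
    assume "det G = 0"
    then obtain v where v: "v \<in> carrier_vec n" "v \<noteq> 0\<^sub>v n" "G *\<^sub>v v = 0\<^sub>v n"
      using det_0_iff_vec_prod_zero_field[OF G] by blast
    have "gram_form \<sigma> G v w = 0" if w: "w \<in> carrier_vec n" for w
    proof -
      have "gram_form \<sigma> G w v = 0" using v w by (simp add: gram_form_def)
      then show ?thesis using hermitian_matD[OF h G w v(1)] by simp
    qed
    then have "v \<in> form_kernel (coord_space n) (gram_form \<sigma> G)"
      using v by (simp add: orth_def)
    then show False using nd v by (simp add: nondegenerate_def)
  qed
  then have "G \<in> Units (ring_mat TYPE('k) n ())" using det_non_zero_imp_unit[OF G] by simp
  then show "\<exists>G'\<in>carrier_mat n n. G * G' = 1\<^sub>m n"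
    by (auto simp: Units_def ring_mat_simps)
next
  assume "\<exists>G'\<in>carrier_mat n n. G * G' = 1\<^sub>m n"
  then obtain G' where G': "G' \<in> carrier_mat n n" "G * G' = 1\<^sub>m n" by blast
  have "v = 0\<^sub>v n" if v: "v \<in> carrier_vec n" "\<forall>w\<in>carrier_vec n. gram_form \<sigma> G v w = 0" for v
  proof (rule eq_vecI)
    fix i assume i: "i < dim_vec (0\<^sub>v n :: 'k vec)"
    have "gram_form \<sigma> G v (G' *\<^sub>v unit_vec n i) = map_vec \<sigma> v \<bullet> ((G * G') *\<^sub>v unit_vec n i)"
      unfolding gram_form_def using G G' by (subst assoc_mult_mat_vec[OF G G'(1)]) auto
    also have "\<dots> = \<sigma> (v $ i)" using G' v i by simp
    finally have "\<sigma> (v $ i) = 0" using v G' by (metis mult_mat_vec_carrier unit_vec_carrier)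
    then show "v $ i = 0\<^sub>v n $ i" using i by simp
  qed (use v in simp)
  moreover have "0\<^sub>v n \<in> form_kernel (coord_space n) (gram_form \<sigma> G)"
    using G by (simp add: orth_def gram_form_sum)
  ultimately show "nondegenerate (coord_space n) (gram_form \<sigma> G)"
    unfolding nondegenerate_def orth_def by auto
qed

lemma hermitian_mats_iff:
  "G \<in> hermitian_mats \<sigma> \<longleftrightarrow> hermitian_mat G \<and> (\<exists>G'\<in>carrier_mat (dim_row G) (dim_row G). G * G' = 1\<^sub>m (dim_row G))"
proof (cases "square_mat G")
  case True
  then have "G \<in> carrier_mat (dim_row G) (dim_row G)" by auto
  then show ?thesis
    using hermitian_space_iff nondegenerate_iff True unfolding hermitian_mats_def by blast
qed (auto simp: hermitian_mats_def hermitian_mat_def)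

lemma linear_vec_eq_mat:
  fixes \<phi> :: "'k vec \<Rightarrow> 'k vec"
  assumes "\<And>x. x \<in> carrier_vec m \<Longrightarrow> \<phi> x \<in> carrier_vec n"
    and add: "\<And>x y. x \<in> carrier_vec m \<Longrightarrow> y \<in> carrier_vec m \<Longrightarrow> \<phi> (x + y) = \<phi> x + \<phi> y"
    and smult: "\<And>c x. x \<in> carrier_vec m \<Longrightarrow> \<phi> (c \<cdot>\<^sub>v x) = c \<cdot>\<^sub>v \<phi> x"
    and x: "x \<in> carrier_vec m"
  shows "\<phi> x = mat n m (\<lambda>(i, j). \<phi> (unit_vec m j) $ i) *\<^sub>v x"
proof -
  have "\<phi> (0 \<cdot>\<^sub>v 0\<^sub>v m) = 0 \<cdot>\<^sub>v \<phi> (0\<^sub>v m)" by (rule smult) simp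
  moreover have "(0 :: 'k) \<cdot>\<^sub>v 0\<^sub>v m = 0\<^sub>v m" by auto
  moreover have "0 \<cdot>\<^sub>v \<phi> (0\<^sub>v m) = 0\<^sub>v n" using assms(1)[of "0\<^sub>v m"] by auto
  ultimately have zero: "\<phi> (0\<^sub>v m) = 0\<^sub>v n" by metis
  \<comment> \<open>Induction over the truncations of x to its first k coordinates: each step adds
    one multiple of a unit vector.\<close>
  have "k \<le> m \<Longrightarrow> \<phi> (vec m (\<lambda>i. if i < k then x $ i else 0)) = vec n (\<lambda>r. \<Sum>j<k. \<phi> (unit_vec m j) $ r * x $ j)" for k
  proof (induction k)
    case 0
    have "vec m (\<lambda>i. if i < 0 then x $ i else 0) = 0\<^sub>v m" by auto
    then show ?case using zero by auto
  next
    case (Suc k)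
    have "vec m (\<lambda>i. if i < Suc k then x $ i else 0) =
       vec m (\<lambda>i. if i < k then x $ i else 0) + x $ k \<cdot>\<^sub>v unit_vec m k"
      using Suc.prems by (intro eq_vecI) (auto simp: less_Suc_eq unit_vec_def)
    then have "\<phi> (vec m (\<lambda>i. if i < Suc k then x $ i else 0)) =
       \<phi> (vec m (\<lambda>i. if i < k then x $ i else 0)) + x $ k \<cdot>\<^sub>v \<phi> (unit_vec m k)"
      using add smult by simp
    then show ?case using Suc assms(1)[of "unit_vec m k"] by (auto simp: mult.commute)
  qed
  from this[of m] have "\<phi> (vec m (\<lambda>i. if i < m then x $ i else 0)) = vec n (\<lambda>r. \<Sum>j<m. \<phi> (unit_vec m j) $ r * x $ j)" by simp
  moreover have "vec m (\<lambda>i. if i < m then x $ i else 0) = x" using x by auto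
  ultimately show ?thesis using x by (auto simp: scalar_prod_def lessThan_atLeast0)
qed

section \<open>Conjugate transposes and congruence of Gram matrices\<close>

definition star :: "'k mat \<Rightarrow> 'k mat" where
  "star P = map_mat \<sigma> P\<^sup>T"

lemma star_carrier [simp]: "P \<in> carrier_mat n m \<Longrightarrow> star P \<in> carrier_mat m n"
  by (simp add: star_def)

lemma dim_star [simp]: "dim_row (star P) = dim_col P" "dim_col (star P) = dim_row P"
  by (simp_all add: star_def)

lemma star_index [simp]: "i < dim_col P \<Longrightarrow> j < dim_row P \<Longrightarrow> star P $$ (i, j) = \<sigma> (P $$ (j, i))"
  by (simp add: star_def)

lemma star_mult:
  assumes "A \<in> carrier_mat m n" "B \<in> carrier_mat n l"
  shows "star (A * B) = star B * star A"
  using assms by (auto simp: scalar_prod_def hom_sum hom_mult mult.commute intro!: eq_matI sum.cong)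

lemma star_one [simp]: "star (1\<^sub>m n) = 1\<^sub>m n"
  by (rule eq_matI) simp_all

lemma gram_form_congruence:
  assumes "P \<in> carrier_mat n m" "B \<in> carrier_mat n n" "x \<in> carrier_vec m" "y \<in> carrier_vec m"
  shows "gram_form \<sigma> B (P *\<^sub>v x) (P *\<^sub>v y) = gram_form \<sigma> (star P * B * P) x y"
proof -
  have 1: "map_vec \<sigma> (P *\<^sub>v x) = transpose_mat (star P) *\<^sub>v map_vec \<sigma> x"
    using assms by (auto simp: scalar_prod_def star_def hom_sum hom_mult)
  have c: "star P \<in> carrier_mat m n" using assms(1) by simp
  have d: "star P * B \<in> carrier_mat m n" using c assms(2) by simp
  have "star P * B * P *\<^sub>v y = star P *\<^sub>v (B *\<^sub>v (P *\<^sub>v y))"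
    using assoc_mult_mat_vec[OF d assms(1,4)] assoc_mult_mat_vec[OF c assms(2), of "P *\<^sub>v y"] assms by auto
  moreover have "map_vec \<sigma> x \<bullet> (star P *\<^sub>v z) = (transpose_mat (star P) *\<^sub>v map_vec \<sigma> x) \<bullet> z"
    if "z \<in> carrier_vec n" for z
    using transpose_vec_mult_scalar[OF c that, of "map_vec \<sigma> x"] assms by simp
  ultimately show ?thesis using 1 assms by (simp add: gram_form_def)
qed

text \<open>The inverse Q belongs to the witness, so that composites, block sums and Kronecker
  products of witnesses are again mutually inverse by a direct computation.\<close>

definition congruent_mat :: "'k mat \<Rightarrow> 'k mat \<Rightarrow> bool" where
  "congruent_mat A B \<longleftrightarrow>
     (\<exists>P\<in>carrier_mat (dim_row B) (dim_row A). \<exists>Q\<in>carrier_mat (dim_row A) (dim_row B).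
        P * Q = 1\<^sub>m (dim_row B) \<and> Q * P = 1\<^sub>m (dim_row A) \<and> A = star P * B * P)"

lemma mat_eqI_gram_form:
  assumes "A \<in> carrier_mat n n" "B \<in> carrier_mat n n"
    and "\<And>x y. x \<in> carrier_vec n \<Longrightarrow> y \<in> carrier_vec n \<Longrightarrow> gram_form \<sigma> A x y = gram_form \<sigma> B x y"
  shows "A = B"
  using assms by (intro eq_matI) (auto simp flip: gram_form_unit_vec)

lemma mat_eqI_mult_vec:
  fixes A :: "'k mat"
  assumes "A \<in> carrier_mat m n" "B \<in> carrier_mat m n"
    and "\<And>x. x \<in> carrier_vec n \<Longrightarrow> A *\<^sub>v x = B *\<^sub>v x"
  shows "A = B"
proof (rule eq_matI)
  fix i j assume "i < dim_row B" "j < dim_col B"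
  then have "i < m" "j < n" using assms by auto
  then show "A $$ (i, j) = B $$ (i, j)"
    using arg_cong[OF assms(3)[of "unit_vec n j"], of "\<lambda>v. v $ i"] assms(1,2) by simp
qed (use assms in auto)

text \<open>Trades the abstract module homomorphisms in the definition of isometry for matrices. The
  inverse of a linear bijection is linear as well, so both maps have matrices, read off on unit
  vectors.\<close>

lemma mat_isometric_iff:
  assumes A: "square_mat A" and B: "square_mat B"
  shows "mat_isometric \<sigma> A B \<longleftrightarrow> congruent_mat A B"
proof
  let ?m = "dim_row A" and ?n = "dim_row B"
  have A': "A \<in> carrier_mat ?m ?m" and B': "B \<in> carrier_mat ?n ?n" using A B by auto
  assume "mat_isometric \<sigma> A B"
  then obtain \<phi> where \<phi>: "\<phi> \<in> LinearCombinations.module_hom class_ring (coord_space ?m) (coord_space ?n)"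
    and bij: "bij_betw \<phi> (carrier_vec ?m) (carrier_vec ?n)"
    and iso: "\<And>x y. x \<in> carrier_vec ?m \<Longrightarrow> y \<in> carrier_vec ?m \<Longrightarrow> gram_form \<sigma> B (\<phi> x) (\<phi> y) = gram_form \<sigma> A x y"
    unfolding mat_isometric_def isometric_def by auto
  have f: "\<phi> x \<in> carrier_vec ?n" "\<phi> (x + y) = \<phi> x + \<phi> y" "\<phi> (c \<cdot>\<^sub>v x) = c \<cdot>\<^sub>v \<phi> x"
    if "x \<in> carrier_vec ?m" "y \<in> carrier_vec ?m" for x y c
    using \<phi> that unfolding LinearCombinations.module_hom_def by auto
  define \<psi> where "\<psi> = inv_into (carrier_vec ?m) \<phi>"
  have \<psi>: "\<psi> y \<in> carrier_vec ?m" "\<phi> (\<psi> y) = y" if "y \<in> carrier_vec ?n" for y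
    using bij that unfolding \<psi>_def bij_betw_def by (auto intro: inv_into_into f_inv_into_f)
  have \<psi>\<phi>: "\<psi> (\<phi> x) = x" if "x \<in> carrier_vec ?m" for x
    using bij that unfolding \<psi>_def bij_betw_def by auto
  have g: "\<psi> (x + y) = \<psi> x + \<psi> y" "\<psi> (c \<cdot>\<^sub>v x) = c \<cdot>\<^sub>v \<psi> x"
    if "x \<in> carrier_vec ?n" "y \<in> carrier_vec ?n" for x y c
  proof -
    have "\<psi> (\<phi> (\<psi> x + \<psi> y)) = \<psi> x + \<psi> y" using \<psi> that by (intro \<psi>\<phi>) auto
    then show "\<psi> (x + y) = \<psi> x + \<psi> y" using \<psi> that f(2) by simp
    have "\<psi> (\<phi> (c \<cdot>\<^sub>v \<psi> x)) = c \<cdot>\<^sub>v \<psi> x" using \<psi> that by (intro \<psi>\<phi>) auto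
    then show "\<psi> (c \<cdot>\<^sub>v x) = c \<cdot>\<^sub>v \<psi> x" using \<psi> that f(3)[of "\<psi> x" "\<psi> x"] by simp
  qed
  define P where "P = mat ?n ?m (\<lambda>(i, j). \<phi> (unit_vec ?m j) $ i)"
  define Q where "Q = mat ?m ?n (\<lambda>(i, j). \<psi> (unit_vec ?n j) $ i)"
  have P: "\<phi> x = P *\<^sub>v x" if "x \<in> carrier_vec ?m" for x
    unfolding P_def by (rule linear_vec_eq_mat) (use f that in auto)
  have Q: "\<psi> x = Q *\<^sub>v x" if "x \<in> carrier_vec ?n" for x
    unfolding Q_def by (rule linear_vec_eq_mat) (use \<psi> g that in auto)
  have Pc: "P \<in> carrier_mat ?n ?m" and Qc: "Q \<in> carrier_mat ?m ?n" by (simp_all add: P_def Q_def)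
  have "P * Q = 1\<^sub>m ?n"
    by (rule mat_eqI_mult_vec[of _ ?n ?n]) (use Pc Qc \<psi> P Q in \<open>auto simp: assoc_mult_mat_vec\<close>)
  moreover have "Q * P = 1\<^sub>m ?m"
    by (rule mat_eqI_mult_vec[of _ ?m ?m]) (use Pc Qc f \<psi>\<phi> P Q in \<open>auto simp: assoc_mult_mat_vec\<close>)
  moreover have "A = star P * B * P"
  proof (rule mat_eqI_gram_form[OF A'])
    show "star P * B * P \<in> carrier_mat ?m ?m" using mult_carrier_mat[OF mult_carrier_mat[OF star_carrier[OF Pc] B'] Pc] .
    fix x y :: "'k vec" assume xy: "x \<in> carrier_vec ?m" "y \<in> carrier_vec ?m"
    then have "gram_form \<sigma> A x y = gram_form \<sigma> B (P *\<^sub>v x) (P *\<^sub>v y)" using iso[OF xy] P by metis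
    then show "gram_form \<sigma> A x y = gram_form \<sigma> (star P * B * P) x y" using gram_form_congruence[OF Pc B' xy] by simp
  qed
  ultimately show "congruent_mat A B" unfolding congruent_mat_def using Pc Qc by blast
next
  let ?m = "dim_row A" and ?n = "dim_row B"
  assume "congruent_mat A B"
  then obtain P Q where Pc: "P \<in> carrier_mat ?n ?m" and Qc: "Q \<in> carrier_mat ?m ?n"
    and PQ: "P * Q = 1\<^sub>m ?n" "Q * P = 1\<^sub>m ?m" "A = star P * B * P"
    unfolding congruent_mat_def by blast
  have B': "B \<in> carrier_mat ?n ?n" using B by auto
  have "P *\<^sub>v (Q *\<^sub>v y) = y" if "y \<in> carrier_vec ?n" for y
    using assoc_mult_mat_vec[OF Pc Qc that] PQ that by simp
  moreover have "Q *\<^sub>v (P *\<^sub>v y) = y" if "y \<in> carrier_vec ?m" for y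
    using assoc_mult_mat_vec[OF Qc Pc that] PQ that by simp
  ultimately have "bij_betw (\<lambda>x. P *\<^sub>v x) (carrier_vec ?m) (carrier_vec ?n)"
    by (intro bij_betw_byWitness[where f' = "\<lambda>y. Q *\<^sub>v y"]) (use Pc Qc in auto)
  moreover have "(\<lambda>x. P *\<^sub>v x) \<in> LinearCombinations.module_hom class_ring (coord_space ?m) (coord_space ?n)"
    using Pc by (auto simp: LinearCombinations.module_hom_def mult_add_distrib_mat_vec mult_mat_vec)
  moreover have "gram_form \<sigma> B (P *\<^sub>v x) (P *\<^sub>v y) = gram_form \<sigma> A x y"
    if "x \<in> carrier_vec ?m" "y \<in> carrier_vec ?m" for x y
    using gram_form_congruence[OF Pc B' that] PQ(3) by simp
  ultimately show "mat_isometric \<sigma> A B"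
    unfolding mat_isometric_def isometric_def by auto
qed

end

section \<open>Block sums and Kronecker products\<close>

lemma mat_sum_four_block:
  "mat_sum A B = four_block_mat A (0\<^sub>m (dim_row A) (dim_col B)) (0\<^sub>m (dim_row B) (dim_col A)) B"
  by (simp add: Let_def del: diag_block_mat.simps add: diag_block_mat.simps(2)[of A "[B]"])

text \<open>From here on a block sum is an opaque list of blocks, whose associativity is list
  concatenation (\<open>mat_sum_diag\<close>); the recursive equations would take it apart.\<close>

declare diag_block_mat.simps [simp del]

lemma mat_sum_carrier:
  "A \<in> carrier_mat m n \<Longrightarrow> B \<in> carrier_mat p q \<Longrightarrow> mat_sum A B \<in> carrier_mat (m + p) (n + q)"
  by (auto simp: mat_sum_four_block)

lemma mat_sum_index:
  assumes "i < dim_row A + dim_row B" "j < dim_col A + dim_col B"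
  shows "mat_sum A B $$ (i, j) =
    (if i < dim_row A then if j < dim_col A then A $$ (i, j) else 0
     else if j < dim_col A then 0 else B $$ (i - dim_row A, j - dim_col A))"
  using assms by (simp add: mat_sum_four_block)

lemma mat_sum_diag: "mat_sum (diag_block_mat xs) (diag_block_mat ys) = diag_block_mat (xs @ ys)"
  unfolding mat_sum_four_block by (simp add: diag_block_mat_append Let_def)

lemma mat_sum_mult:
  assumes "A \<in> carrier_mat m n" "B \<in> carrier_mat p q" "C \<in> carrier_mat n l" "D \<in> carrier_mat q r"
  shows "mat_sum A B * mat_sum C D = mat_sum (A * C) (B * D)"
  using assms unfolding mat_sum_four_block
  by (subst mult_four_block_mat[of _ m n _ q _ p]) auto

lemma mat_sum_one: "mat_sum (1\<^sub>m m) (1\<^sub>m n) = 1\<^sub>m (m + n)"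
  unfolding mat_sum_four_block by (rule eq_matI) auto

lemma mat_tensor_carrier [simp]:
  "A \<in> carrier_mat m n \<Longrightarrow> B \<in> carrier_mat p q \<Longrightarrow> mat_tensor A B \<in> carrier_mat (m * p) (n * q)"
  by (auto simp: mat_tensor_def)

lemma dim_mat_tensor [simp]:
  "dim_row (mat_tensor A B) = dim_row A * dim_row B" "dim_col (mat_tensor A B) = dim_col A * dim_col B"
  by (auto simp: mat_tensor_def)

lemma div_mod_less_mult:
  fixes i :: nat
  assumes "i < m * n"
  shows "i div n < m" "i mod n < n"
  using assms by (simp add: less_mult_imp_div_less, metis mod_less_divisor mult_0_right not_less0 gr0I)

lemma div_mod_diff_mult:
  fixes i :: nat
  assumes "\<not> i < a * p"
  shows "(i - a * p) div p = i div p - a" "(i - a * p) mod p = i mod p"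
proof -
  obtain x where "i = x + a * p" using assms by (metis le_add_diff_inverse2 not_less)
  then show "(i - a * p) div p = i div p - a" "(i - a * p) mod p = i mod p"
    by (cases "p = 0"; simp)+
qed

lemma mat_tensor_index:
  assumes "i < dim_row A * dim_row B" "j < dim_col A * dim_col B"
  shows "mat_tensor A B $$ (i, j) =
    A $$ (i div dim_row B, j div dim_col B) * B $$ (i mod dim_row B, j mod dim_col B)"
  using assms by (simp add: mat_tensor_def)

lemma bij_betw_div_mod:
  "bij_betw (\<lambda>k. (k div q, k mod q)) {..<n * q :: nat} ({..<n} \<times> {..<q})"
proof (rule bij_betw_byWitness[where f' = "\<lambda>(a, b). a * q + b"])
  have "a * q + b < n * q" if "a < n" "b < q" for a b
  proof -
    have "a * q + b < (a + 1) * q" using that by simp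
    also have "\<dots> \<le> n * q" using that by (intro mult_right_mono) auto
    finally show ?thesis .
  qed
  then show "(\<lambda>(a, b). a * q + b) ` ({..<n} \<times> {..<q}) \<subseteq> {..<n * q}" by auto
qed (auto dest: div_mod_less_mult)

lemma sum_div_mod:
  "(\<Sum>k<n * q. f (k div q) (k mod q)) = (\<Sum>a<n. \<Sum>b<(q::nat). f a b)"
  using sum.reindex_bij_betw[OF bij_betw_div_mod, of "\<lambda>(a, b). f a b" q n]
  by (simp add: sum.cartesian_product)

lemma mat_tensor_mult:
  assumes A: "A \<in> carrier_mat m n" and B: "B \<in> carrier_mat p q"
    and C: "C \<in> carrier_mat n l" and D: "D \<in> carrier_mat q r"
  shows "mat_tensor A B * mat_tensor C D = mat_tensor (A * C) (B * D)"
proof (rule eq_matI)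
  fix i j assume "i < dim_row (mat_tensor (A * C) (B * D))" "j < dim_col (mat_tensor (A * C) (B * D))"
  then have ij: "i < m * p" "j < l * r" using assms by auto
  note dm = div_mod_less_mult[OF ij(1)] div_mod_less_mult[OF ij(2)]
  have "(mat_tensor A B * mat_tensor C D) $$ (i, j)
      = (\<Sum>k<n * q. mat_tensor A B $$ (i, k) * mat_tensor C D $$ (k, j))"
    using ij assms by (simp add: scalar_prod_def lessThan_atLeast0)
  also have "\<dots> = (\<Sum>k<n * q. (A $$ (i div p, k div q) * C $$ (k div q, j div r)) *
        (B $$ (i mod p, k mod q) * D $$ (k mod q, j mod r)))"
    using ij assms by (intro sum.cong) (auto simp: mat_tensor_index mult_ac)
  \<comment> \<open>The summation index is a pair in disguise; as a double sum over its two
    components the expression factors.\<close>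
  also have "\<dots> = (\<Sum>a<n. \<Sum>b<q. (A $$ (i div p, a) * C $$ (a, j div r)) * (B $$ (i mod p, b) * D $$ (b, j mod r)))"
    by (rule sum_div_mod)
  also have "\<dots> = (A * C) $$ (i div p, j div r) * (B * D) $$ (i mod p, j mod r)"
    using dm assms by (simp add: scalar_prod_def lessThan_atLeast0 sum_product)
  also have "\<dots> = mat_tensor (A * C) (B * D) $$ (i, j)"
    using ij assms by (simp add: mat_tensor_index)
  finally show "(mat_tensor A B * mat_tensor C D) $$ (i, j) = mat_tensor (A * C) (B * D) $$ (i, j)" .
qed (use assms in auto)

lemma mat_tensor_one: "mat_tensor (1\<^sub>m m) (1\<^sub>m n) = 1\<^sub>m (m * n)"
proof (rule eq_matI)
  fix i j assume "i < dim_row (1\<^sub>m (m * n))" "j < dim_col (1\<^sub>m (m * n))"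
  then have ij: "i < m * n" "j < m * n" by auto
  have "i = j" if "i div n = j div n" "i mod n = j mod n" using that by (metis div_mult_mod_eq)
  then show "mat_tensor (1\<^sub>m m) (1\<^sub>m n) $$ (i, j) = 1\<^sub>m (m * n) $$ (i, j)"
    using ij div_mod_less_mult[OF ij(1)] div_mod_less_mult[OF ij(2)] by (auto simp: mat_tensor_index)
qed auto

text \<open>The left factor indexes the outer blocks, so this distributivity is an equality of
  matrices. On the other side the basis vectors come in a different order and only an isometry
  remains (\<open>hiso_tensor_sum_right\<close>).\<close>

lemma mat_tensor_sum_left: "mat_tensor (mat_sum A B) C = mat_sum (mat_tensor A C) (mat_tensor B C)"
proof (rule eq_matI)
  let ?p = "dim_row C" and ?q = "dim_col C"
  fix i j assume "i < dim_row (mat_sum (mat_tensor A C) (mat_tensor B C))"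
    "j < dim_col (mat_sum (mat_tensor A C) (mat_tensor B C))"
  then have ij: "i < (dim_row A + dim_row B) * ?p" "j < (dim_col A + dim_col B) * ?q"
    by (simp_all add: mat_sum_four_block algebra_simps)
  note dm = div_mod_less_mult[OF ij(1)] div_mod_less_mult[OF ij(2)]
  have a: "i < dim_row A * ?p \<longleftrightarrow> i div ?p < dim_row A" "j < dim_col A * ?q \<longleftrightarrow> j div ?q < dim_col A"
    using dm by (simp_all add: div_less_iff_less_mult)
  have b: "(i - dim_row A * ?p) div ?p = i div ?p - dim_row A" "(i - dim_row A * ?p) mod ?p = i mod ?p"
    if "\<not> i div ?p < dim_row A"
    using that a(1) by (simp_all add: div_mod_diff_mult)
  have c: "(j - dim_col A * ?q) div ?q = j div ?q - dim_col A" "(j - dim_col A * ?q) mod ?q = j mod ?q"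
    if "\<not> j div ?q < dim_col A"
    using that a(2) by (simp_all add: div_mod_diff_mult)
  have "mat_tensor (mat_sum A B) C $$ (i, j) = mat_sum A B $$ (i div ?p, j div ?q) * C $$ (i mod ?p, j mod ?q)"
    using ij by (subst mat_tensor_index) (simp_all add: mat_sum_four_block)
  also have "\<dots> = mat_sum (mat_tensor A C) (mat_tensor B C) $$ (i, j)"
    using ij dm a b c by (auto simp: mat_sum_index mat_tensor_index add_mult_distrib)
  finally show "mat_tensor (mat_sum A B) C $$ (i, j) = mat_sum (mat_tensor A C) (mat_tensor B C) $$ (i, j)" .
qed (simp_all add: mat_sum_four_block algebra_simps)

lemma mat_tensor_assoc: "mat_tensor (mat_tensor A B) C = mat_tensor A (mat_tensor B C)"
proof (rule eq_matI)
  let ?p = "dim_row B" and ?q = "dim_col B" and ?r = "dim_row C" and ?s = "dim_col C"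
  fix i j assume "i < dim_row (mat_tensor A (mat_tensor B C))" "j < dim_col (mat_tensor A (mat_tensor B C))"
  then have ij: "i < dim_row A * (?p * ?r)" "j < dim_col A * (?q * ?s)" by auto
  then have ij': "i < (dim_row A * ?p) * ?r" "j < (dim_col A * ?q) * ?s" by (simp_all add: mult.assoc)
  note dm = div_mod_less_mult[OF ij(1)] div_mod_less_mult[OF ij(2)] div_mod_less_mult[OF ij'(1)] div_mod_less_mult[OF ij'(2)]
  show "mat_tensor (mat_tensor A B) C $$ (i, j) = mat_tensor A (mat_tensor B C) $$ (i, j)"
    using ij ij' dm
    by (simp add: mat_tensor_index div_mult2_eq mod_mult2_eq mult.commute[of ?p] mult.commute[of ?q] mult.assoc)
qed (simp_all add: mult.assoc)

lemma mat_tensor_one_left: "mat_tensor (1\<^sub>m 1) A = A"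
  by (rule eq_matI) (auto simp: mat_tensor_index)

section \<open>Congruence as an equivalence compatible with sums and products\<close>

context involutive_field
begin

lemma congruent_mat_refl: "square_mat A \<Longrightarrow> congruent_mat A A"
  unfolding congruent_mat_def
  by (intro bexI[of _ "1\<^sub>m (dim_row A)"]) (auto simp: left_mult_one_mat right_mult_one_mat)

lemma congruent_mat_sym:
  assumes "square_mat A" "square_mat B" "congruent_mat A B"
  shows "congruent_mat B A"
proof -
  let ?m = "dim_row A" and ?n = "dim_row B"
  have A: "A \<in> carrier_mat ?m ?m" and B: "B \<in> carrier_mat ?n ?n" using assms by auto
  obtain P Q where P: "P \<in> carrier_mat ?n ?m" and Q: "Q \<in> carrier_mat ?m ?n"
    and PQ: "P * Q = 1\<^sub>m ?n" "Q * P = 1\<^sub>m ?m" "A = star P * B * P"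
    using assms(3) unfolding congruent_mat_def by blast
  have sP: "star P \<in> carrier_mat ?m ?n" and sQ: "star Q \<in> carrier_mat ?n ?m" by (rule star_carrier[OF P], rule star_carrier[OF Q])
  have BP: "B * P \<in> carrier_mat ?n ?m" by (rule mult_carrier_mat[OF B P])
  have "star Q * A = star Q * (star P * (B * P))" unfolding assoc_mult_mat[OF sP B P, symmetric] PQ(3)[symmetric] ..
  also have "\<dots> = (star Q * star P) * (B * P)" by (rule assoc_mult_mat[OF sQ sP BP, symmetric])
  also have "star Q * star P = 1\<^sub>m ?n" unfolding star_mult[OF P Q, symmetric] PQ(1) by (rule star_one)
  also have "1\<^sub>m ?n * (B * P) = B * P" by (rule left_mult_one_mat[OF BP])
  finally have "star Q * A * Q = B * (P * Q)" by (simp only: assoc_mult_mat[OF B P Q])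
  then have "B = star Q * A * Q" unfolding PQ(1) right_mult_one_mat[OF B] ..
  then show ?thesis unfolding congruent_mat_def using P Q PQ by blast
qed

lemma congruent_mat_trans:
  assumes "square_mat A" "square_mat B" "square_mat C" "congruent_mat A B" "congruent_mat B C"
  shows "congruent_mat A C"
proof -
  let ?m = "dim_row A" and ?n = "dim_row B" and ?l = "dim_row C"
  have A: "A \<in> carrier_mat ?m ?m" and B: "B \<in> carrier_mat ?n ?n" and C: "C \<in> carrier_mat ?l ?l"
    using assms by auto
  obtain P Q where P: "P \<in> carrier_mat ?n ?m" and Q: "Q \<in> carrier_mat ?m ?n"
    and PQ: "P * Q = 1\<^sub>m ?n" "Q * P = 1\<^sub>m ?m" "A = star P * B * P"
    using assms(4) unfolding congruent_mat_def by blast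
  obtain R S where R: "R \<in> carrier_mat ?l ?n" and S: "S \<in> carrier_mat ?n ?l"
    and RS: "R * S = 1\<^sub>m ?l" "S * R = 1\<^sub>m ?n" "B = star R * C * R"
    using assms(5) unfolding congruent_mat_def by blast
  have sP: "star P \<in> carrier_mat ?m ?n" and sR: "star R \<in> carrier_mat ?n ?l" by (rule star_carrier[OF P], rule star_carrier[OF R])
  have QS: "Q * S \<in> carrier_mat ?m ?l" and RP: "R * P \<in> carrier_mat ?l ?m"
    by (rule mult_carrier_mat[OF Q S], rule mult_carrier_mat[OF R P])
  have "(R * P) * (Q * S) = R * ((P * Q) * S)"
    unfolding assoc_mult_mat[OF R P QS] assoc_mult_mat[OF P Q S] ..
  then have 1: "(R * P) * (Q * S) = 1\<^sub>m ?l" unfolding PQ(1) left_mult_one_mat[OF S] RS(1) .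
  have "(Q * S) * (R * P) = Q * ((S * R) * P)"
    unfolding assoc_mult_mat[OF Q S RP] assoc_mult_mat[OF S R P] ..
  then have 2: "(Q * S) * (R * P) = 1\<^sub>m ?m" unfolding RS(2) left_mult_one_mat[OF P] PQ(2) .
  have RC: "star R * C \<in> carrier_mat ?n ?l" and PRC: "star P * (star R * C) \<in> carrier_mat ?m ?l"
    by (rule mult_carrier_mat[OF sR C], rule mult_carrier_mat[OF sP mult_carrier_mat[OF sR C]])
  have "A = star P * (star R * C * R) * P" unfolding RS(3)[symmetric] by (rule PQ(3))
  also have "\<dots> = (star P * star R) * C * (R * P)"
    unfolding assoc_mult_mat[OF sP sR C] assoc_mult_mat[OF sP RC R, symmetric]
    by (rule assoc_mult_mat[OF PRC R P])
  also have "star P * star R = star (R * P)" by (rule star_mult[OF R P, symmetric])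
  finally show ?thesis unfolding congruent_mat_def using 1 2 RP QS by blast
qed

lemma star_mat_sum:
  "star (mat_sum P Q) = mat_sum (star P) (star Q)"
proof (rule eq_matI)
  fix i j assume "i < dim_row (mat_sum (star P) (star Q))" "j < dim_col (mat_sum (star P) (star Q))"
  then have "i < dim_col P + dim_col Q" "j < dim_row P + dim_row Q" by (auto simp: mat_sum_four_block)
  then show "star (mat_sum P Q) $$ (i, j) = mat_sum (star P) (star Q) $$ (i, j)"
    by (simp add: mat_sum_index dim_diag_block_mat)
qed (auto simp: mat_sum_four_block)

lemma star_mat_tensor: "star (mat_tensor P Q) = mat_tensor (star P) (star Q)"
proof (rule eq_matI)
  fix i j assume "i < dim_row (mat_tensor (star P) (star Q))" "j < dim_col (mat_tensor (star P) (star Q))"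
  then have ij: "i < dim_col P * dim_col Q" "j < dim_row P * dim_row Q" by auto
  then show "star (mat_tensor P Q) $$ (i, j) = mat_tensor (star P) (star Q) $$ (i, j)"
    using div_mod_less_mult[OF ij(1)] div_mod_less_mult[OF ij(2)]
    by (simp add: mat_tensor_index hom_mult)
qed auto

lemma congruent_mat_sum:
  assumes "square_mat A" "square_mat A'" "square_mat B" "square_mat B'"
    and "congruent_mat A A'" "congruent_mat B B'"
  shows "congruent_mat (mat_sum A B) (mat_sum A' B')"
proof -
  let ?m = "dim_row A" and ?n = "dim_row A'" and ?k = "dim_row B" and ?l = "dim_row B'"
  obtain P Q where P: "P \<in> carrier_mat ?n ?m" and Q: "Q \<in> carrier_mat ?m ?n"
    and PQ: "P * Q = 1\<^sub>m ?n" "Q * P = 1\<^sub>m ?m" "A = star P * A' * P"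
    using assms(5) unfolding congruent_mat_def by blast
  obtain R S where R: "R \<in> carrier_mat ?l ?k" and S: "S \<in> carrier_mat ?k ?l"
    and RS: "R * S = 1\<^sub>m ?l" "S * R = 1\<^sub>m ?k" "B = star R * B' * R"
    using assms(6) unfolding congruent_mat_def by blast
  have A': "A' \<in> carrier_mat ?n ?n" and B': "B' \<in> carrier_mat ?l ?l" using assms by auto
  have "mat_sum P R * mat_sum Q S = 1\<^sub>m (?n + ?l)"
    using P Q R S PQ(1,2) RS(1,2) by (simp add: mat_sum_mult mat_sum_one)
  moreover have "mat_sum Q S * mat_sum P R = 1\<^sub>m (?m + ?k)"
    using P Q R S PQ(1,2) RS(1,2) by (simp add: mat_sum_mult mat_sum_one)
  moreover have "mat_sum A B = star (mat_sum P R) * mat_sum A' B' * mat_sum P R"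
  proof -
    have "star (mat_sum P R) * mat_sum A' B' = mat_sum (star P * A') (star R * B')"
      unfolding star_mat_sum by (rule mat_sum_mult[OF star_carrier[OF P] star_carrier[OF R] A' B'])
    moreover have "mat_sum (star P * A') (star R * B') * mat_sum P R = mat_sum (star P * A' * P) (star R * B' * R)"
      by (rule mat_sum_mult[OF mult_carrier_mat[OF star_carrier[OF P] A'] mult_carrier_mat[OF star_carrier[OF R] B'] P R])
    ultimately show ?thesis unfolding PQ(3)[symmetric] RS(3)[symmetric] by simp
  qed
  moreover have "dim_row (mat_sum A B) = ?m + ?k" "dim_row (mat_sum A' B') = ?n + ?l"
    by (simp_all add: mat_sum_four_block)
  ultimately show ?thesis unfolding congruent_mat_def
    using mat_sum_carrier[OF P R] mat_sum_carrier[OF Q S] by auto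
qed

lemma congruent_mat_tensor:
  assumes "square_mat A" "square_mat A'" "square_mat B" "square_mat B'"
    and "congruent_mat A A'" "congruent_mat B B'"
  shows "congruent_mat (mat_tensor A B) (mat_tensor A' B')"
proof -
  let ?m = "dim_row A" and ?n = "dim_row A'" and ?k = "dim_row B" and ?l = "dim_row B'"
  obtain P Q where P: "P \<in> carrier_mat ?n ?m" and Q: "Q \<in> carrier_mat ?m ?n"
    and PQ: "P * Q = 1\<^sub>m ?n" "Q * P = 1\<^sub>m ?m" "A = star P * A' * P"
    using assms(5) unfolding congruent_mat_def by blast
  obtain R S where R: "R \<in> carrier_mat ?l ?k" and S: "S \<in> carrier_mat ?k ?l"
    and RS: "R * S = 1\<^sub>m ?l" "S * R = 1\<^sub>m ?k" "B = star R * B' * R"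
    using assms(6) unfolding congruent_mat_def by blast
  have A': "A' \<in> carrier_mat ?n ?n" and B': "B' \<in> carrier_mat ?l ?l" using assms by auto
  have "mat_tensor P R * mat_tensor Q S = 1\<^sub>m (?n * ?l)"
    using mat_tensor_mult[OF P R Q S] PQ(1,2) RS(1,2) by (simp add: mat_tensor_one)
  moreover have "mat_tensor Q S * mat_tensor P R = 1\<^sub>m (?m * ?k)"
    using mat_tensor_mult[OF Q S P R] PQ(1,2) RS(1,2) by (simp add: mat_tensor_one)
  moreover have "mat_tensor A B = star (mat_tensor P R) * mat_tensor A' B' * mat_tensor P R"
  proof -
    have "star (mat_tensor P R) * mat_tensor A' B' = mat_tensor (star P * A') (star R * B')"
      unfolding star_mat_tensor by (rule mat_tensor_mult[OF star_carrier[OF P] star_carrier[OF R] A' B'])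
    moreover have "mat_tensor (star P * A') (star R * B') * mat_tensor P R = mat_tensor (star P * A' * P) (star R * B' * R)"
      by (rule mat_tensor_mult[OF mult_carrier_mat[OF star_carrier[OF P] A'] mult_carrier_mat[OF star_carrier[OF R] B'] P R])
    ultimately show ?thesis unfolding PQ(3)[symmetric] RS(3)[symmetric] by simp
  qed
  moreover have "mat_tensor P R \<in> carrier_mat (?n * ?l) (?m * ?k)" "mat_tensor Q S \<in> carrier_mat (?m * ?k) (?n * ?l)"
    using P Q R S by auto
  ultimately show ?thesis unfolding congruent_mat_def dim_mat_tensor by blast
qed

text \<open>The witness is the permutation matrix of p. Only the product Q * P is computed; for
  square matrices the other one follows.\<close>

lemma congruent_mat_reindex:
  assumes A: "A \<in> carrier_mat n n" and B: "B \<in> carrier_mat n n"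
    and p: "bij_betw p {..<n} {..<n}"
    and AB: "\<And>i j. i < n \<Longrightarrow> j < n \<Longrightarrow> A $$ (i, j) = B $$ (p i, p j)"
  shows "congruent_mat A B"
proof -
  define P where "P = mat n n (\<lambda>(i, j). if i = p j then 1 else 0 :: 'k)"
  define Q where "Q = mat n n (\<lambda>(i, j). if j = p i then 1 else 0 :: 'k)"
  have pn: "p i < n" if "i < n" for i using p that by (auto simp: bij_betw_def)
  have pinj: "p i = p j \<longleftrightarrow> i = j" if "i < n" "j < n" for i j
    using p that by (auto simp: bij_betw_def inj_on_def)
  have P: "P \<in> carrier_mat n n" and Q: "Q \<in> carrier_mat n n" by (simp_all add: P_def Q_def)
  have "Q * P = 1\<^sub>m n"
  proof (rule eq_matI)
    fix i j assume "i < dim_row (1\<^sub>m n :: 'k mat)" "j < dim_col (1\<^sub>m n :: 'k mat)"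
    then have ij: "i < n" "j < n" by auto
    have "(Q * P) $$ (i, j) = (\<Sum>k<n. Q $$ (i, k) * P $$ (k, j))"
      using ij P Q by (simp add: scalar_prod_def lessThan_atLeast0)
    also have "\<dots> = (\<Sum>k<n. if k = p i then (if k = p j then 1 else 0) else 0)"
      using ij by (intro sum.cong) (auto simp: P_def Q_def)
    also have "\<dots> = (if p i = p j then 1 else 0)" using pn ij by simp
    finally show "(Q * P) $$ (i, j) = 1\<^sub>m n $$ (i, j)" using ij pinj by simp
  qed (use P Q in auto)
  moreover from this have "P * Q = 1\<^sub>m n" using mat_mult_left_right_inverse[OF Q P] by simp
  moreover have "A = star P * B * P"
  proof (rule eq_matI)
    fix i j assume "i < dim_row (star P * B * P)" "j < dim_col (star P * B * P)"
    then have ij: "i < n" "j < n" using P B by auto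
    have 1: "(star P * B) $$ (i, k) = B $$ (p i, k)" if "k < n" for k
    proof -
      have "(star P * B) $$ (i, k) = (\<Sum>l<n. star P $$ (i, l) * B $$ (l, k))"
        using ij that B P by (simp add: scalar_prod_def lessThan_atLeast0)
      also have "\<dots> = (\<Sum>l<n. if l = p i then B $$ (p i, k) else 0)"
        using ij by (intro sum.cong) (auto simp: P_def)
      finally show ?thesis using pn ij by simp
    qed
    have "(star P * B * P) $$ (i, j) = (\<Sum>k<n. (star P * B) $$ (i, k) * P $$ (k, j))"
      using ij P B by (simp add: scalar_prod_def lessThan_atLeast0)
    also have "\<dots> = (\<Sum>k<n. if k = p j then B $$ (p i, p j) else 0)"
      using ij 1 by (intro sum.cong) (auto simp: P_def)
    finally show "A $$ (i, j) = (star P * B * P) $$ (i, j)" using AB pn ij by simp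
  qed (use A B P in auto)
  ultimately show ?thesis unfolding congruent_mat_def using P Q A B by auto
qed

lemma hermitian_matsD: "A \<in> hermitian_mats \<sigma> \<Longrightarrow> square_mat A"
  by (simp add: hermitian_mats_def)

text \<open>Membership of both sides in \<open>hermitian_mats\<close> is built in, so that chains of
  isometries carry these side conditions along.\<close>

definition hiso :: "'k mat \<Rightarrow> 'k mat \<Rightarrow> bool" (infix "\<doteq>" 50) where
  "A \<doteq> B \<longleftrightarrow> A \<in> hermitian_mats \<sigma> \<and> B \<in> hermitian_mats \<sigma> \<and> mat_isometric \<sigma> A B"

lemma hiso_iff: "A \<doteq> B \<longleftrightarrow> A \<in> hermitian_mats \<sigma> \<and> B \<in> hermitian_mats \<sigma> \<and> congruent_mat A B"
  using mat_isometric_iff hermitian_matsD unfolding hiso_def by blast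

lemma hiso_refl: "A \<in> hermitian_mats \<sigma> \<Longrightarrow> A \<doteq> A"
  by (simp add: hiso_iff congruent_mat_refl hermitian_matsD del: square_mat.simps)

lemma hiso_sym: "A \<doteq> B \<Longrightarrow> B \<doteq> A"
  using congruent_mat_sym hermitian_matsD unfolding hiso_iff by blast

lemma hiso_trans [trans]: "A \<doteq> B \<Longrightarrow> B \<doteq> C \<Longrightarrow> A \<doteq> C"
  using congruent_mat_trans[of A B C] hermitian_matsD unfolding hiso_iff by blast

lemma hermitian_mats_closed [intro]:
  assumes "A \<in> hermitian_mats \<sigma>" "B \<in> hermitian_mats \<sigma>"
  shows "mat_sum A B \<in> hermitian_mats \<sigma>" "mat_tensor A B \<in> hermitian_mats \<sigma>"
proof -
  let ?m = "dim_row A" and ?n = "dim_row B"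
  obtain A' B' where A': "A' \<in> carrier_mat ?m ?m" "A * A' = 1\<^sub>m ?m" and hA: "hermitian_mat A"
    and B': "B' \<in> carrier_mat ?n ?n" "B * B' = 1\<^sub>m ?n" and hB: "hermitian_mat B"
    using assms unfolding hermitian_mats_iff by blast
  have A: "A \<in> carrier_mat ?m ?m" and B: "B \<in> carrier_mat ?n ?n"
    using hA hB unfolding hermitian_mat_def by auto
  have sA: "\<sigma> (A $$ (i, j)) = A $$ (j, i)" if "i < ?m" "j < ?m" for i j
    using hA that unfolding hermitian_mat_def by metis
  have sB: "\<sigma> (B $$ (i, j)) = B $$ (j, i)" if "i < ?n" "j < ?n" for i j
    using hB that unfolding hermitian_mat_def by metis
  have c: "dim_col A = ?m" "dim_col B = ?n" by (rule carrier_matD(2)[OF A], rule carrier_matD(2)[OF B])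
  have "mat_sum A B * mat_sum A' B' = 1\<^sub>m (?m + ?n)"
    unfolding mat_sum_mult[OF A B A'(1) B'(1)] A'(2) B'(2) mat_sum_one ..
  moreover have "hermitian_mat (mat_sum A B)"
    unfolding hermitian_mat_def
  proof (intro conjI allI impI)
    fix i j assume "i < dim_row (mat_sum A B)" "j < dim_row (mat_sum A B)"
    then show "mat_sum A B $$ (j, i) = \<sigma> (mat_sum A B $$ (i, j))"
      by (auto simp: mat_sum_index dim_diag_block_mat c sA sB)
  qed (simp add: dim_diag_block_mat c)
  ultimately show "mat_sum A B \<in> hermitian_mats \<sigma>"
    unfolding hermitian_mats_iff using mat_sum_carrier[OF A'(1) B'(1)] by (auto simp: dim_diag_block_mat)
  have "mat_tensor A B * mat_tensor A' B' = 1\<^sub>m (?m * ?n)"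
    unfolding mat_tensor_mult[OF A B A'(1) B'(1)] A'(2) B'(2) mat_tensor_one ..
  moreover have "hermitian_mat (mat_tensor A B)"
    unfolding hermitian_mat_def
  proof (intro conjI allI impI)
    fix i j assume "i < dim_row (mat_tensor A B)" "j < dim_row (mat_tensor A B)"
    then have ij: "i < ?m * ?n" "j < ?m * ?n" by auto
    show "mat_tensor A B $$ (j, i) = \<sigma> (mat_tensor A B $$ (i, j))"
      using div_mod_less_mult[OF ij(1)] div_mod_less_mult[OF ij(2)] ij
      by (simp add: mat_tensor_index c sA sB hom_mult)
  qed (simp add: c)
  ultimately show "mat_tensor A B \<in> hermitian_mats \<sigma>"
    unfolding hermitian_mats_iff using mat_tensor_carrier[OF A'(1) B'(1)] by auto
qed

lemma zero_hermitian_mats [simp]: "0\<^sub>m 0 0 \<in> hermitian_mats \<sigma>"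
  unfolding hermitian_mats_iff hermitian_mat_def by (auto intro!: bexI[of _ "0\<^sub>m 0 0"] eq_matI)

lemma one_hermitian_mats [simp]: "1\<^sub>m n \<in> hermitian_mats \<sigma>"
  unfolding hermitian_mats_iff hermitian_mat_def by (auto intro!: bexI[of _ "1\<^sub>m n"])

lemma diag_hermitian_mats [intro]: "set xs \<subseteq> hermitian_mats \<sigma> \<Longrightarrow> diag_block_mat xs \<in> hermitian_mats \<sigma>"
proof (induction xs)
  case (Cons A xs)
  have "diag_block_mat (A # xs) = mat_sum A (diag_block_mat xs)"
    using mat_sum_diag[of "[A]" xs] by simp
  with Cons show ?case using hermitian_mats_closed(1) by auto
qed (simp add: diag_block_mat.simps)

lemma hiso_sum: "A \<doteq> A' \<Longrightarrow> B \<doteq> B' \<Longrightarrow> mat_sum A B \<doteq> mat_sum A' B'"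
  using congruent_mat_sum[of A A' B B'] hermitian_matsD hermitian_mats_closed unfolding hiso_iff by blast

lemma hiso_tensor: "A \<doteq> A' \<Longrightarrow> B \<doteq> B' \<Longrightarrow> mat_tensor A B \<doteq> mat_tensor A' B'"
  using congruent_mat_tensor[of A A' B B'] hermitian_matsD hermitian_mats_closed unfolding hiso_iff by blast

lemma hiso_sum_commute:
  assumes "A \<in> hermitian_mats \<sigma>" "B \<in> hermitian_mats \<sigma>"
  shows "mat_sum A B \<doteq> mat_sum B A"
proof -
  let ?m = "dim_row A" and ?n = "dim_row B"
  have c: "dim_col A = ?m" "dim_col B = ?n" using assms hermitian_matsD by auto
  have A: "A \<in> carrier_mat ?m ?m" and B: "B \<in> carrier_mat ?n ?n" using c by auto
  define p where "p i = (if i < ?m then i + ?n else i - ?m)" for i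
  have "congruent_mat (mat_sum A B) (mat_sum B A)"
  proof (rule congruent_mat_reindex)
    show "mat_sum A B \<in> carrier_mat (?m + ?n) (?m + ?n)" by (rule mat_sum_carrier[OF A B])
    show "mat_sum B A \<in> carrier_mat (?m + ?n) (?m + ?n)"
      using mat_sum_carrier[OF B A] by (simp add: add.commute)
    show "bij_betw p {..<?m + ?n} {..<?m + ?n}"
      by (rule bij_betw_byWitness[where f' = "\<lambda>i. if i < ?n then i + ?m else i - ?n"]) (auto simp: p_def)
    fix i j assume "i < ?m + ?n" "j < ?m + ?n"
    then show "mat_sum A B $$ (i, j) = mat_sum B A $$ (p i, p j)"
      by (auto simp: mat_sum_index p_def c)
  qed
  then show ?thesis unfolding hiso_iff using assms hermitian_mats_closed by blast
qed

lemma hiso_tensor_commute: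
  assumes "A \<in> hermitian_mats \<sigma>" "B \<in> hermitian_mats \<sigma>"
  shows "mat_tensor A B \<doteq> mat_tensor B A"
proof -
  let ?m = "dim_row A" and ?n = "dim_row B"
  have c: "dim_col A = ?m" "dim_col B = ?n" using assms hermitian_matsD by auto
  have A: "A \<in> carrier_mat ?m ?m" and B: "B \<in> carrier_mat ?n ?n" using c by auto
  \<comment> \<open>With r = i div n and s = i mod n, position i holds the tensor of the r-th and
    s-th basis vectors; in the product with exchanged factors this tensor sits at position s * m +
    r.\<close>
  define p where "p i = (i mod ?n) * ?m + i div ?n" for i
  have *: "i div n + i mod n * m < m * n \<and> (i div n + i mod n * m) div m = i mod n \<and> (i div n + i mod n * m) mod m = i div n"
    if "i < m * n" for i m n :: nat
  proof -
    have dm: "i div n < m" "i mod n < n" using div_mod_less_mult[OF that] by auto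
    have "i div n + i mod n * m < (i mod n + 1) * m" using dm by simp
    also have "\<dots> \<le> n * m" using dm by (intro mult_right_mono) auto
    finally show ?thesis using dm by (simp add: mult.commute)
  qed
  have p: "p i < ?m * ?n" "p i div ?m = i mod ?n" "p i mod ?m = i div ?n" if "i < ?m * ?n" for i
    using *[OF that] unfolding p_def by (simp_all add: add.commute)
  have "congruent_mat (mat_tensor A B) (mat_tensor B A)"
  proof (rule congruent_mat_reindex)
    show "mat_tensor A B \<in> carrier_mat (?m * ?n) (?m * ?n)" by (rule mat_tensor_carrier[OF A B])
    show "mat_tensor B A \<in> carrier_mat (?m * ?n) (?m * ?n)"
      using mat_tensor_carrier[OF B A] by (simp add: mult.commute)
    have "inj_on p {..<?m * ?n}"
    proof (rule inj_onI)
      fix i j assume "i \<in> {..<?m * ?n}" "j \<in> {..<?m * ?n}" "p i = p j"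
      then have "i div ?n = j div ?n" "i mod ?n = j mod ?n" using p by (metis lessThan_iff)+
      then show "i = j" by (metis div_mult_mod_eq)
    qed
    moreover have "p ` {..<?m * ?n} \<subseteq> {..<?m * ?n}" using p by auto
    ultimately show "bij_betw p {..<?m * ?n} {..<?m * ?n}"
      by (simp add: bij_betw_def endo_inj_surj)
    fix i j assume ij: "i < ?m * ?n" "j < ?m * ?n"
    then show "mat_tensor A B $$ (i, j) = mat_tensor B A $$ (p i, p j)"
      using p[OF ij(1)] p[OF ij(2)] by (simp add: mat_tensor_index c mult.commute)
  qed
  then show ?thesis unfolding hiso_iff using assms hermitian_mats_closed by blast
qed

lemma hiso_tensor_sum_right:
  assumes "A \<in> hermitian_mats \<sigma>" "B \<in> hermitian_mats \<sigma>" "C \<in> hermitian_mats \<sigma>"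
  shows "mat_tensor A (mat_sum B C) \<doteq> mat_sum (mat_tensor A B) (mat_tensor A C)"
proof -
  have "mat_tensor A (mat_sum B C) \<doteq> mat_tensor (mat_sum B C) A"
    using assms by (intro hiso_tensor_commute) auto
  also have "mat_tensor (mat_sum B C) A = mat_sum (mat_tensor B A) (mat_tensor C A)"
    by (rule mat_tensor_sum_left)
  also have "\<dots> \<doteq> mat_sum (mat_tensor A B) (mat_tensor A C)"
    using assms by (intro hiso_sum hiso_tensor_commute)
  finally show ?thesis .
qed

lemma hiso_diag_append:
  assumes "diag_block_mat xs \<doteq> diag_block_mat xs'" "diag_block_mat ys \<doteq> diag_block_mat ys'"
  shows "diag_block_mat (xs @ ys) \<doteq> diag_block_mat (xs' @ ys')"
  using hiso_sum[OF assms] by (simp add: mat_sum_diag)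

text \<open>Every rearrangement of blocks in the proofs of the ring axioms is an instance of this:
  up to isometry an orthogonal sum depends only on the multiset of its blocks.\<close>

lemma hiso_diag_mset:
  assumes "set xs \<subseteq> hermitian_mats \<sigma>" "mset xs = mset ys"
  shows "diag_block_mat xs \<doteq> diag_block_mat ys"
  using assms
proof (induction xs arbitrary: ys)
  case Nil
  then show ?case by (auto intro!: hiso_refl diag_hermitian_mats)
next
  case (Cons A xs)
  then have "A \<in> set ys" by (metis list.set_intros(1) set_mset_mset)
  then obtain us vs where ys: "ys = us @ A # vs" by (meson split_list)
  have set: "set ys \<subseteq> hermitian_mats \<sigma>" using Cons.prems by (metis set_mset_mset)
  have "mset xs = mset (us @ vs)" using Cons.prems ys by simp
  then have "diag_block_mat xs \<doteq> diag_block_mat (us @ vs)" using Cons by simp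
  then have "diag_block_mat ([A] @ xs) \<doteq> diag_block_mat ([A] @ (us @ vs))"
    using Cons.prems by (intro hiso_diag_append hiso_refl diag_hermitian_mats) auto
  also have "diag_block_mat ([A] @ (us @ vs)) = diag_block_mat (([A] @ us) @ vs)" by simp
  also have "\<dots> \<doteq> diag_block_mat ((us @ [A]) @ vs)"
  proof (rule hiso_diag_append)
    have "mat_sum (diag_block_mat [A]) (diag_block_mat us) \<doteq> mat_sum (diag_block_mat us) (diag_block_mat [A])"
      using set ys by (intro hiso_sum_commute diag_hermitian_mats) auto
    then show "diag_block_mat ([A] @ us) \<doteq> diag_block_mat (us @ [A])" unfolding mat_sum_diag .
    show "diag_block_mat vs \<doteq> diag_block_mat vs" using set ys by (intro hiso_refl diag_hermitian_mats) auto
  qed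
  finally show ?case using ys by simp
qed

end

section \<open>The hermitian Witt ring\<close>

lemma diag_nested:
  fixes xs :: "'a::field mat list"
  shows "diag_block_mat (xs @ diag_block_mat ys # zs) = diag_block_mat (xs @ ys @ zs)"
proof -
  have "diag_block_mat (diag_block_mat ys # zs) = diag_block_mat (ys @ zs)"
    using mat_sum_diag[of "[diag_block_mat ys]" zs] mat_sum_diag[of ys zs] by simp
  then show ?thesis
    using mat_sum_diag[of xs "diag_block_mat ys # zs"] mat_sum_diag[of xs "ys @ zs"] by simp
qed

text \<open>Nested block sums become one flat list of blocks, by equality and not merely up to
  isometry; the instances allow up to four blocks in front of the nested one.\<close>

lemmas diag_flatten =
  diag_nested[of "[]", simplified]
  diag_nested[of "[a]" for a, simplified]
  diag_nested[of "[a, b]" for a b, simplified]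
  diag_nested[of "[a, b, c]" for a b c, simplified]
  diag_nested[of "[a, b, c, d]" for a b c d, simplified]

lemma diag_zero [simp]:
  fixes a :: "'a::field mat"
  shows "diag_block_mat (0\<^sub>m 0 0 # zs) = diag_block_mat zs"
    "diag_block_mat (a # 0\<^sub>m 0 0 # zs) = diag_block_mat (a # zs)"
    "diag_block_mat (a # b # 0\<^sub>m 0 0 # zs) = diag_block_mat (a # b # zs)"
  using diag_nested[of "[]" "[]" zs] diag_nested[of "[a]" "[]" zs] diag_nested[of "[a, b]" "[]" zs]
  by (simp_all add: diag_block_mat.simps(1))

lemma mat_tensor_zero [simp]: "mat_tensor (0\<^sub>m 0 0) A = 0\<^sub>m 0 0"
  by (rule eq_matI) auto

lemma mat_tensor_diag_left:
  fixes xs :: "'a::field mat list"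
  shows "mat_tensor (diag_block_mat xs) C = diag_block_mat (map (\<lambda>A. mat_tensor A C) xs)"
proof (induction xs)
  case (Cons A xs)
  then show ?case
    using mat_tensor_sum_left[of A "diag_block_mat xs" C] diag_flatten(2)[of A xs "[]"]
      diag_flatten(2)[of "mat_tensor A C" "map (\<lambda>A. mat_tensor A C) xs" "[]"] by simp
qed (simp add: diag_block_mat.simps)

text \<open>The operations of the Grothendieck ring are unions over representatives; such a union is
  a single class once all representatives give the same one.\<close>

lemma UN_case_prod_const:
  assumes "p \<in> X" "\<And>a b. (a, b) \<in> X \<Longrightarrow> g a b = c"
  shows "(\<Union>(a, b)\<in>X. g a b) = c"
  using assms by (cases p) fastforce

context involutive_field
begin

text \<open>Adds two isometries and reorders both sides. All relations with stabilizing summands are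
  combined in this way.\<close>

lemma hiso_diagI:
  assumes "diag_block_mat xs \<doteq> diag_block_mat xs'" "diag_block_mat ys \<doteq> diag_block_mat ys'"
    and "mset us = mset (xs @ ys)" "mset vs = mset (xs' @ ys')"
    and "set us \<subseteq> hermitian_mats \<sigma>" "set vs \<subseteq> hermitian_mats \<sigma>"
  shows "diag_block_mat us \<doteq> diag_block_mat vs"
proof -
  have "diag_block_mat us \<doteq> diag_block_mat (xs @ ys)" using assms by (intro hiso_diag_mset)
  also have "\<dots> \<doteq> diag_block_mat (xs' @ ys')" using assms by (intro hiso_diag_append)
  also have "\<dots> \<doteq> diag_block_mat vs" using assms hiso_sym hiso_diag_mset by metis
  finally show ?thesis .
qed

lemma groth_rel_iff:
  "((A, B), (C, D)) \<in> groth_rel \<sigma> \<longleftrightarrow>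
     A \<in> hermitian_mats \<sigma> \<and> B \<in> hermitian_mats \<sigma> \<and> C \<in> hermitian_mats \<sigma> \<and> D \<in> hermitian_mats \<sigma> \<and>
     (\<exists>E\<in>hermitian_mats \<sigma>. diag_block_mat [A, D, E] \<doteq> diag_block_mat [C, B, E])"
proof -
  have "mat_isometric \<sigma> (mat_sum (mat_sum A D) E) (mat_sum (mat_sum C B) E) \<longleftrightarrow> diag_block_mat [A, D, E] \<doteq> diag_block_mat [C, B, E]"
    if "A \<in> hermitian_mats \<sigma>" "B \<in> hermitian_mats \<sigma>" "C \<in> hermitian_mats \<sigma>" "D \<in> hermitian_mats \<sigma>" "E \<in> hermitian_mats \<sigma>" for E
    using that diag_hermitian_mats[of "[A, D, E]"] diag_hermitian_mats[of "[C, B, E]"]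
    by (simp add: diag_flatten hiso_def)
  then show ?thesis unfolding groth_rel_def by blast
qed

lemma groth_relE:
  assumes "((A, B), (C, D)) \<in> groth_rel \<sigma>"
  obtains E where "E \<in> hermitian_mats \<sigma>" "diag_block_mat [A, D, E] \<doteq> diag_block_mat [C, B, E]"
  using assms unfolding groth_rel_iff by meson

lemma groth_relD:
  assumes "((A, B), (C, D)) \<in> groth_rel \<sigma>"
  shows "A \<in> hermitian_mats \<sigma>" "B \<in> hermitian_mats \<sigma>" "C \<in> hermitian_mats \<sigma>" "D \<in> hermitian_mats \<sigma>"
  using assms by (simp_all only: groth_rel_iff)

lemma groth_relI:
  assumes "A \<in> hermitian_mats \<sigma>" "B \<in> hermitian_mats \<sigma>" "C \<in> hermitian_mats \<sigma>" "D \<in> hermitian_mats \<sigma>"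
    and "E \<in> hermitian_mats \<sigma>" "diag_block_mat [A, D, E] \<doteq> diag_block_mat [C, B, E]"
  shows "((A, B), (C, D)) \<in> groth_rel \<sigma>"
  unfolding groth_rel_iff by (intro conjI bexI[of _ E] assms)

lemma groth_relI_hiso:
  assumes "A \<doteq> C" "B \<doteq> D"
  shows "((A, B), (C, D)) \<in> groth_rel \<sigma>"
proof -
  have "diag_block_mat [A, D, 0\<^sub>m 0 0] \<doteq> diag_block_mat [C, B, 0\<^sub>m 0 0]"
    using hiso_diag_append[of "[A]" "[C]" "[D]" "[B]"] assms hiso_sym by simp
  then show ?thesis using assms unfolding hiso_def[of A] hiso_def[of B] by (intro groth_relI[OF _ _ _ _ zero_hermitian_mats]) simp_all
qed

lemma equiv_groth_rel: "equiv (hermitian_mats \<sigma> \<times> hermitian_mats \<sigma>) (groth_rel \<sigma>)"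
proof (rule equivI)
  show "groth_rel \<sigma> \<subseteq> (hermitian_mats \<sigma> \<times> hermitian_mats \<sigma>) \<times> (hermitian_mats \<sigma> \<times> hermitian_mats \<sigma>)"
    unfolding groth_rel_def by auto
  show "refl_on (hermitian_mats \<sigma> \<times> hermitian_mats \<sigma>) (groth_rel \<sigma>)"
    by (rule refl_onI) (auto intro: groth_relI_hiso hiso_refl)
  show "sym (groth_rel \<sigma>)"
  proof (rule symI, clarify)
    fix A B C D assume r: "((A, B), (C, D)) \<in> groth_rel \<sigma>"
    obtain E where E: "E \<in> hermitian_mats \<sigma>" "diag_block_mat [A, D, E] \<doteq> diag_block_mat [C, B, E]"
      using r by (rule groth_relE)
    show "((C, D), (A, B)) \<in> groth_rel \<sigma>"
      by (rule groth_relI[OF groth_relD(3)[OF r] groth_relD(4)[OF r] groth_relD(1)[OF r] groth_relD(2)[OF r] E(1) hiso_sym[OF E(2)]])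
  qed
  show "trans (groth_rel \<sigma>)"
  proof (rule transI, clarify)
    fix A B C D G H
    assume 1: "((A, B), (C, D)) \<in> groth_rel \<sigma>" and 2: "((C, D), (G, H)) \<in> groth_rel \<sigma>"
    obtain E where E: "E \<in> hermitian_mats \<sigma>" "diag_block_mat [A, D, E] \<doteq> diag_block_mat [C, B, E]"
      using 1 by (rule groth_relE)
    obtain F where F: "F \<in> hermitian_mats \<sigma>" "diag_block_mat [C, H, F] \<doteq> diag_block_mat [G, D, F]"
      using 2 by (rule groth_relE)
    have M: "A \<in> hermitian_mats \<sigma>" "B \<in> hermitian_mats \<sigma>" "C \<in> hermitian_mats \<sigma>"
      "D \<in> hermitian_mats \<sigma>" "G \<in> hermitian_mats \<sigma>" "H \<in> hermitian_mats \<sigma>"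
      by (fact groth_relD[OF 1] groth_relD[OF 2])+
    \<comment> \<open>Adding the two given isometries leaves C, D, E and F on both sides; their sum
      is the new stabilizing summand.\<close>
    have "diag_block_mat [A, H, C, D, E, F] \<doteq> diag_block_mat [G, B, C, D, E, F]"
      by (rule hiso_diagI[OF E(2) F(2)]) (use M E F in auto)
    then have "diag_block_mat [A, H, diag_block_mat [C, D, E, F]] \<doteq> diag_block_mat [G, B, diag_block_mat [C, D, E, F]]"
      by (simp add: diag_flatten)
    then show "((A, B), (G, H)) \<in> groth_rel \<sigma>"
      using M E F diag_hermitian_mats[of "[C, D, E, F]"] by (intro groth_relI) simp_all
  qed
qed

lemma groth_rel_add:
  assumes "((A, B), (A', B')) \<in> groth_rel \<sigma>" "((C, D), (C', D')) \<in> groth_rel \<sigma>"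
  shows "((mat_sum A C, mat_sum B D), (mat_sum A' C', mat_sum B' D')) \<in> groth_rel \<sigma>"
proof -
  obtain E where E: "E \<in> hermitian_mats \<sigma>" "diag_block_mat [A, B', E] \<doteq> diag_block_mat [A', B, E]"
    using assms(1) by (rule groth_relE)
  obtain F where F: "F \<in> hermitian_mats \<sigma>" "diag_block_mat [C, D', F] \<doteq> diag_block_mat [C', D, F]"
    using assms(2) by (rule groth_relE)
  have M: "A \<in> hermitian_mats \<sigma>" "B \<in> hermitian_mats \<sigma>" "C \<in> hermitian_mats \<sigma>" "D \<in> hermitian_mats \<sigma>"
    "A' \<in> hermitian_mats \<sigma>" "B' \<in> hermitian_mats \<sigma>" "C' \<in> hermitian_mats \<sigma>" "D' \<in> hermitian_mats \<sigma>"
    by (fact groth_relD[OF assms(1)] groth_relD[OF assms(2)])+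
  have "diag_block_mat [A, C, B', D', E, F] \<doteq> diag_block_mat [A', C', B, D, E, F]"
    by (rule hiso_diagI[OF E(2) F(2)]) (use M E F in auto)
  then have "diag_block_mat [mat_sum A C, mat_sum B' D', mat_sum E F] \<doteq> diag_block_mat [mat_sum A' C', mat_sum B D, mat_sum E F]"
    by (simp add: diag_flatten)
  then show ?thesis
    by (rule groth_relI[rotated 5]) (intro hermitian_mats_closed M E F)+
qed

text \<open>Tensor the isometry behind the relation with C and its reverse with D, then add; the
  stabilizing summand becomes the sum of the tensor products of E with C and with D. The second
  factor of a product is reached through commutativity.\<close>

lemma groth_rel_mult_left:
  assumes "((A, B), (A', B')) \<in> groth_rel \<sigma>" "C \<in> hermitian_mats \<sigma>" "D \<in> hermitian_mats \<sigma>"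
  shows "((mat_sum (mat_tensor A C) (mat_tensor B D), mat_sum (mat_tensor A D) (mat_tensor B C)),
          (mat_sum (mat_tensor A' C) (mat_tensor B' D), mat_sum (mat_tensor A' D) (mat_tensor B' C))) \<in> groth_rel \<sigma>"
proof -
  obtain E where E: "E \<in> hermitian_mats \<sigma>" "diag_block_mat [A, B', E] \<doteq> diag_block_mat [A', B, E]"
    using assms(1) by (rule groth_relE)
  have M: "A \<in> hermitian_mats \<sigma>" "B \<in> hermitian_mats \<sigma>" "A' \<in> hermitian_mats \<sigma>" "B' \<in> hermitian_mats \<sigma>"
    by (fact groth_relD[OF assms(1)])+
  note c = hermitian_mats_closed
  have 1: "diag_block_mat [mat_tensor A C, mat_tensor B' C, mat_tensor E C]
    \<doteq> diag_block_mat [mat_tensor A' C, mat_tensor B C, mat_tensor E C]"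
    using hiso_tensor[OF E(2) hiso_refl[OF assms(2)]] by (simp add: mat_tensor_diag_left)
  have 2: "diag_block_mat [mat_tensor A' D, mat_tensor B D, mat_tensor E D]
    \<doteq> diag_block_mat [mat_tensor A D, mat_tensor B' D, mat_tensor E D]"
    using hiso_tensor[OF hiso_sym[OF E(2)] hiso_refl[OF assms(3)]] by (simp add: mat_tensor_diag_left)
  have "diag_block_mat [mat_tensor A C, mat_tensor B D, mat_tensor A' D, mat_tensor B' C, mat_tensor E C, mat_tensor E D]
    \<doteq> diag_block_mat [mat_tensor A' C, mat_tensor B' D, mat_tensor A D, mat_tensor B C, mat_tensor E C, mat_tensor E D]"
    by (rule hiso_diagI[OF 1 2]) (use M E assms c(2) in auto)
  then have "diag_block_mat [mat_sum (mat_tensor A C) (mat_tensor B D), mat_sum (mat_tensor A' D) (mat_tensor B' C), mat_sum (mat_tensor E C) (mat_tensor E D)]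
    \<doteq> diag_block_mat [mat_sum (mat_tensor A' C) (mat_tensor B' D), mat_sum (mat_tensor A D) (mat_tensor B C), mat_sum (mat_tensor E C) (mat_tensor E D)]"
    by (simp add: diag_flatten)
  then show ?thesis
    by (rule groth_relI[rotated 5]) (intro c M E assms)+
qed

lemma groth_rel_mult_commute:
  assumes "A \<in> hermitian_mats \<sigma>" "B \<in> hermitian_mats \<sigma>" "C \<in> hermitian_mats \<sigma>" "D \<in> hermitian_mats \<sigma>"
  shows "((mat_sum (mat_tensor A C) (mat_tensor B D), mat_sum (mat_tensor A D) (mat_tensor B C)),
          (mat_sum (mat_tensor C A) (mat_tensor D B), mat_sum (mat_tensor C B) (mat_tensor D A))) \<in> groth_rel \<sigma>"
proof (rule groth_relI_hiso)
  show "mat_sum (mat_tensor A C) (mat_tensor B D) \<doteq> mat_sum (mat_tensor C A) (mat_tensor D B)"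
    using assms by (intro hiso_sum hiso_tensor_commute)
  have "mat_sum (mat_tensor A D) (mat_tensor B C) \<doteq> mat_sum (mat_tensor D A) (mat_tensor C B)"
    using assms by (intro hiso_sum hiso_tensor_commute)
  also have "\<dots> \<doteq> mat_sum (mat_tensor C B) (mat_tensor D A)"
    using assms by (intro hiso_sum_commute) auto
  finally show "mat_sum (mat_tensor A D) (mat_tensor B C) \<doteq> mat_sum (mat_tensor C B) (mat_tensor D A)" .
qed

abbreviation gcl :: "'k mat \<Rightarrow> 'k mat \<Rightarrow> ('k mat \<times> 'k mat) set" where
  "gcl A B \<equiv> groth_rel \<sigma> `` {(A, B)}"

lemma gcl_eqI: "((A, B), (C, D)) \<in> groth_rel \<sigma> \<Longrightarrow> gcl A B = gcl C D"
  using equiv_class_eq[OF equiv_groth_rel] by blast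

lemma gcl_eqI_hiso: "A \<doteq> C \<Longrightarrow> B \<doteq> D \<Longrightarrow> gcl A B = gcl C D"
  by (intro gcl_eqI groth_relI_hiso)

lemma gcl_carrier: "A \<in> hermitian_mats \<sigma> \<Longrightarrow> B \<in> hermitian_mats \<sigma> \<Longrightarrow> gcl A B \<in> carrier (groth_ring \<sigma>)"
  by (auto simp: groth_ring_def intro: quotientI)

lemma groth_carrierE:
  assumes "x \<in> carrier (groth_ring \<sigma>)"
  obtains A B where "A \<in> hermitian_mats \<sigma>" "B \<in> hermitian_mats \<sigma>" "x = gcl A B"
  using assms by (auto simp: groth_ring_def elim!: quotientE)

lemma gcl_add:
  assumes "A \<in> hermitian_mats \<sigma>" "B \<in> hermitian_mats \<sigma>" "C \<in> hermitian_mats \<sigma>" "D \<in> hermitian_mats \<sigma>"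
  shows "gcl A B \<oplus>\<^bsub>groth_ring \<sigma>\<^esub> gcl C D = gcl (mat_sum A C) (mat_sum B D)"
proof -
  have 1: "(A, B) \<in> gcl A B" "(C, D) \<in> gcl C D"
    using assms by (auto intro: groth_relI_hiso hiso_refl)
  show ?thesis
    unfolding groth_ring_def ring.simps
    by (intro UN_case_prod_const[OF 1(1)] UN_case_prod_const[OF 1(2)] gcl_eqI[symmetric] groth_rel_add) auto
qed

lemma gcl_mult:
  assumes "A \<in> hermitian_mats \<sigma>" "B \<in> hermitian_mats \<sigma>" "C \<in> hermitian_mats \<sigma>" "D \<in> hermitian_mats \<sigma>"
  shows "gcl A B \<otimes>\<^bsub>groth_ring \<sigma>\<^esub> gcl C D =
    gcl (mat_sum (mat_tensor A C) (mat_tensor B D)) (mat_sum (mat_tensor A D) (mat_tensor B C))"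
proof -
  have 1: "(A, B) \<in> gcl A B" "(C, D) \<in> gcl C D"
    using assms by (auto intro: groth_relI_hiso hiso_refl)
  have "gcl (mat_sum (mat_tensor A' C') (mat_tensor B' D')) (mat_sum (mat_tensor A' D') (mat_tensor B' C'))
      = gcl (mat_sum (mat_tensor A C) (mat_tensor B D)) (mat_sum (mat_tensor A D) (mat_tensor B C))"
    if "(A', B') \<in> gcl A B" "(C', D') \<in> gcl C D" for A' B' C' D'
  proof -
    have r: "((A, B), (A', B')) \<in> groth_rel \<sigma>" "((C, D), (C', D')) \<in> groth_rel \<sigma>" using that by auto
    note M = groth_relD(3,4)[OF r(1)] groth_relD(3,4)[OF r(2)]
    \<comment> \<open>Replace the first factor, exchange the factors, replace the one that is now
      first, and exchange back.\<close>
    have "gcl (mat_sum (mat_tensor A C) (mat_tensor B D)) (mat_sum (mat_tensor A D) (mat_tensor B C))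
      = gcl (mat_sum (mat_tensor A' C) (mat_tensor B' D)) (mat_sum (mat_tensor A' D) (mat_tensor B' C))"
      by (intro gcl_eqI groth_rel_mult_left r assms)
    also have "\<dots> = gcl (mat_sum (mat_tensor C A') (mat_tensor D B')) (mat_sum (mat_tensor C B') (mat_tensor D A'))"
      by (intro gcl_eqI groth_rel_mult_commute M assms)
    also have "\<dots> = gcl (mat_sum (mat_tensor C' A') (mat_tensor D' B')) (mat_sum (mat_tensor C' B') (mat_tensor D' A'))"
      by (intro gcl_eqI groth_rel_mult_left r M)
    also have "\<dots> = gcl (mat_sum (mat_tensor A' C') (mat_tensor B' D')) (mat_sum (mat_tensor A' D') (mat_tensor B' C'))"
      by (intro gcl_eqI groth_rel_mult_commute M)
    finally show ?thesis by simp
  qed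
  then show ?thesis
    unfolding groth_ring_def monoid.simps
    by (intro UN_case_prod_const[OF 1(1)] UN_case_prod_const[OF 1(2)]) auto
qed

lemma groth_zero: "\<zero>\<^bsub>groth_ring \<sigma>\<^esub> = gcl (0\<^sub>m 0 0) (0\<^sub>m 0 0)"
  and groth_one: "\<one>\<^bsub>groth_ring \<sigma>\<^esub> = gcl (1\<^sub>m 1) (0\<^sub>m 0 0)"
  by (simp_all add: groth_ring_def)

lemma groth_mult_commute:
  assumes "x \<in> carrier (groth_ring \<sigma>)" "y \<in> carrier (groth_ring \<sigma>)"
  shows "x \<otimes>\<^bsub>groth_ring \<sigma>\<^esub> y = y \<otimes>\<^bsub>groth_ring \<sigma>\<^esub> x"
  using assms by (elim groth_carrierE) (simp add: gcl_mult gcl_eqI[OF groth_rel_mult_commute])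

lemma groth_l_distr:
  assumes "x \<in> carrier (groth_ring \<sigma>)" "y \<in> carrier (groth_ring \<sigma>)" "z \<in> carrier (groth_ring \<sigma>)"
  shows "(x \<oplus>\<^bsub>groth_ring \<sigma>\<^esub> y) \<otimes>\<^bsub>groth_ring \<sigma>\<^esub> z = x \<otimes>\<^bsub>groth_ring \<sigma>\<^esub> z \<oplus>\<^bsub>groth_ring \<sigma>\<^esub> y \<otimes>\<^bsub>groth_ring \<sigma>\<^esub> z"
proof -
  obtain A B where A: "A \<in> hermitian_mats \<sigma>" "B \<in> hermitian_mats \<sigma>" and x: "x = gcl A B"
    using assms groth_carrierE by metis
  obtain C D where C: "C \<in> hermitian_mats \<sigma>" "D \<in> hermitian_mats \<sigma>" and y: "y = gcl C D"
    using assms groth_carrierE by metis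
  obtain E F where E: "E \<in> hermitian_mats \<sigma>" "F \<in> hermitian_mats \<sigma>" and z: "z = gcl E F"
    using assms groth_carrierE by metis
  note c = hermitian_mats_closed
  have 1: "mat_sum (mat_tensor (mat_sum A C) U) (mat_tensor (mat_sum B D) V)
     \<doteq> mat_sum (mat_sum (mat_tensor A U) (mat_tensor B V)) (mat_sum (mat_tensor C U) (mat_tensor D V))"
    if "U \<in> hermitian_mats \<sigma>" "V \<in> hermitian_mats \<sigma>" for U V
    using that A C c hiso_diag_mset[of "[mat_tensor A U, mat_tensor C U, mat_tensor B V, mat_tensor D V]"
        "[mat_tensor A U, mat_tensor B V, mat_tensor C U, mat_tensor D V]"]
    by (simp add: mat_tensor_sum_left diag_flatten)
  show ?thesis
    unfolding x y z using A C E c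
    by (simp add: gcl_add gcl_mult) (intro gcl_eqI_hiso 1)
qed

lemma groth_mult_assoc:
  assumes "x \<in> carrier (groth_ring \<sigma>)" "y \<in> carrier (groth_ring \<sigma>)" "z \<in> carrier (groth_ring \<sigma>)"
  shows "(x \<otimes>\<^bsub>groth_ring \<sigma>\<^esub> y) \<otimes>\<^bsub>groth_ring \<sigma>\<^esub> z = x \<otimes>\<^bsub>groth_ring \<sigma>\<^esub> (y \<otimes>\<^bsub>groth_ring \<sigma>\<^esub> z)"
proof -
  obtain A B where A: "A \<in> hermitian_mats \<sigma>" "B \<in> hermitian_mats \<sigma>" and x: "x = gcl A B"
    using assms groth_carrierE by metis
  obtain C D where C: "C \<in> hermitian_mats \<sigma>" "D \<in> hermitian_mats \<sigma>" and y: "y = gcl C D"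
    using assms groth_carrierE by metis
  obtain E F where E: "E \<in> hermitian_mats \<sigma>" "F \<in> hermitian_mats \<sigma>" and z: "z = gcl E F"
    using assms groth_carrierE by metis
  note c = hermitian_mats_closed
  have 1: "mat_sum (mat_tensor (mat_sum (mat_tensor A C) (mat_tensor B D)) U) (mat_tensor (mat_sum (mat_tensor A D) (mat_tensor B C)) V)
     \<doteq> mat_sum (mat_tensor A (mat_sum (mat_tensor C U) (mat_tensor D V))) (mat_tensor B (mat_sum (mat_tensor C V) (mat_tensor D U)))"
    if UV: "U \<in> hermitian_mats \<sigma>" "V \<in> hermitian_mats \<sigma>" for U V
  proof -
    have "mat_sum (mat_tensor (mat_sum (mat_tensor A C) (mat_tensor B D)) U) (mat_tensor (mat_sum (mat_tensor A D) (mat_tensor B C)) V)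
      = diag_block_mat [mat_tensor A (mat_tensor C U), mat_tensor B (mat_tensor D U), mat_tensor A (mat_tensor D V), mat_tensor B (mat_tensor C V)]"
      by (simp add: mat_tensor_sum_left mat_tensor_assoc diag_flatten)
    also have "\<dots> \<doteq> diag_block_mat [mat_tensor A (mat_tensor C U), mat_tensor A (mat_tensor D V), mat_tensor B (mat_tensor C V), mat_tensor B (mat_tensor D U)]"
      using A C UV c by (intro hiso_diag_mset) auto
    also have "\<dots> = mat_sum (mat_sum (mat_tensor A (mat_tensor C U)) (mat_tensor A (mat_tensor D V)))
        (mat_sum (mat_tensor B (mat_tensor C V)) (mat_tensor B (mat_tensor D U)))"
      by (simp add: diag_flatten)
    also have "\<dots> \<doteq> mat_sum (mat_tensor A (mat_sum (mat_tensor C U) (mat_tensor D V))) (mat_tensor B (mat_sum (mat_tensor C V) (mat_tensor D U)))"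
      using A C UV c by (intro hiso_sum hiso_sym[OF hiso_tensor_sum_right])
    finally show ?thesis .
  qed
  show ?thesis
    unfolding x y z using A C E c
    by (simp add: gcl_mult) (intro gcl_eqI_hiso 1)
qed

lemma ring_groth_ring: "ring (groth_ring \<sigma>)"
proof (rule ringI)
  show "abelian_group (groth_ring \<sigma>)"
  proof (rule abelian_groupI)
    fix x y z
    assume x: "x \<in> carrier (groth_ring \<sigma>)" and y: "y \<in> carrier (groth_ring \<sigma>)"
    obtain A B where A: "A \<in> hermitian_mats \<sigma>" "B \<in> hermitian_mats \<sigma>" and xe: "x = gcl A B"
      using x groth_carrierE by metis
    obtain C D where C: "C \<in> hermitian_mats \<sigma>" "D \<in> hermitian_mats \<sigma>" and ye: "y = gcl C D"
      using y groth_carrierE by metis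
    show "x \<oplus>\<^bsub>groth_ring \<sigma>\<^esub> y \<in> carrier (groth_ring \<sigma>)"
      unfolding xe ye using A C hermitian_mats_closed by (simp add: gcl_add gcl_carrier)
    show "x \<oplus>\<^bsub>groth_ring \<sigma>\<^esub> y = y \<oplus>\<^bsub>groth_ring \<sigma>\<^esub> x"
      unfolding xe ye using A C by (simp add: gcl_add gcl_eqI_hiso hiso_sum_commute)
    assume z: "z \<in> carrier (groth_ring \<sigma>)"
    obtain E F where E: "E \<in> hermitian_mats \<sigma>" "F \<in> hermitian_mats \<sigma>" and ze: "z = gcl E F"
      using z groth_carrierE by metis
    show "x \<oplus>\<^bsub>groth_ring \<sigma>\<^esub> y \<oplus>\<^bsub>groth_ring \<sigma>\<^esub> z = x \<oplus>\<^bsub>groth_ring \<sigma>\<^esub> (y \<oplus>\<^bsub>groth_ring \<sigma>\<^esub> z)"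
      unfolding xe ye ze using A C E hermitian_mats_closed by (simp add: gcl_add diag_flatten)
  next
    fix x assume x: "x \<in> carrier (groth_ring \<sigma>)"
    obtain A B where A: "A \<in> hermitian_mats \<sigma>" "B \<in> hermitian_mats \<sigma>" and xe: "x = gcl A B"
      using x groth_carrierE by metis
    show "\<zero>\<^bsub>groth_ring \<sigma>\<^esub> \<oplus>\<^bsub>groth_ring \<sigma>\<^esub> x = x"
      unfolding xe groth_zero using A by (simp add: gcl_add)
    have "gcl B A \<oplus>\<^bsub>groth_ring \<sigma>\<^esub> x = \<zero>\<^bsub>groth_ring \<sigma>\<^esub>"
    proof -
      have "diag_block_mat [mat_sum B A, 0\<^sub>m 0 0, 0\<^sub>m 0 0] \<doteq> diag_block_mat [0\<^sub>m 0 0, mat_sum A B, 0\<^sub>m 0 0]"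
        using hiso_sum_commute[OF A(2,1)] by simp
      then have "((mat_sum B A, mat_sum A B), (0\<^sub>m 0 0, 0\<^sub>m 0 0)) \<in> groth_rel \<sigma>"
        by (rule groth_relI[rotated 5]) (intro hermitian_mats_closed A zero_hermitian_mats)+
      then show ?thesis unfolding xe groth_zero using A by (simp add: gcl_add gcl_eqI)
    qed
    then show "\<exists>y\<in>carrier (groth_ring \<sigma>). y \<oplus>\<^bsub>groth_ring \<sigma>\<^esub> x = \<zero>\<^bsub>groth_ring \<sigma>\<^esub>"
      using gcl_carrier[OF A(2,1)] by blast
  qed (simp add: groth_zero gcl_carrier)
  have closed: "x \<otimes>\<^bsub>groth_ring \<sigma>\<^esub> y \<in> carrier (groth_ring \<sigma>)"
    if "x \<in> carrier (groth_ring \<sigma>)" "y \<in> carrier (groth_ring \<sigma>)" for x y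
    using that by (elim groth_carrierE) (simp add: gcl_mult gcl_carrier hermitian_mats_closed)
  have l_one: "\<one>\<^bsub>groth_ring \<sigma>\<^esub> \<otimes>\<^bsub>groth_ring \<sigma>\<^esub> x = x" if "x \<in> carrier (groth_ring \<sigma>)" for x
    using that by (elim groth_carrierE) (simp add: groth_one gcl_mult mat_tensor_one_left[unfolded One_nat_def])
  have one: "\<one>\<^bsub>groth_ring \<sigma>\<^esub> \<in> carrier (groth_ring \<sigma>)"
    by (simp add: groth_one gcl_carrier)
  show "Group.monoid (groth_ring \<sigma>)"
    by (rule monoidI) (use closed l_one one groth_mult_assoc groth_mult_commute in auto)
  show "z \<otimes>\<^bsub>groth_ring \<sigma>\<^esub> (x \<oplus>\<^bsub>groth_ring \<sigma>\<^esub> y) = z \<otimes>\<^bsub>groth_ring \<sigma>\<^esub> x \<oplus>\<^bsub>groth_ring \<sigma>\<^esub> z \<otimes>\<^bsub>groth_ring \<sigma>\<^esub> y"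
    if "x \<in> carrier (groth_ring \<sigma>)" "y \<in> carrier (groth_ring \<sigma>)" "z \<in> carrier (groth_ring \<sigma>)" for x y z
  proof -
    have "x \<oplus>\<^bsub>groth_ring \<sigma>\<^esub> y \<in> carrier (groth_ring \<sigma>)"
      using that by (elim groth_carrierE) (simp add: gcl_add gcl_carrier hermitian_mats_closed)
    then show ?thesis using that groth_l_distr groth_mult_commute by metis
  qed
qed (rule groth_l_distr)

section \<open>Classes of Gram matrices in the quotient by hyperbolic spaces\<close>

abbreviation \<W> :: "('k mat \<times> 'k mat) set set ring" where
  "\<W> \<equiv> witt_ring \<sigma>"

definition WC :: "'k mat \<Rightarrow> ('k mat \<times> 'k mat) set set" where
  "WC G = hyperbolic_ideal \<sigma> +>\<^bsub>groth_ring \<sigma>\<^esub> groth_class \<sigma> G"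

lemma groth_class_carrier: "G \<in> hermitian_mats \<sigma> \<Longrightarrow> groth_class \<sigma> G \<in> carrier (groth_ring \<sigma>)"
  by (simp add: groth_class_def gcl_carrier)

lemma ideal_hyperbolic_ideal: "ideal (hyperbolic_ideal \<sigma>) (groth_ring \<sigma>)"
  unfolding hyperbolic_ideal_def
  using groth_class_carrier by (intro ring.genideal_ideal[OF ring_groth_ring]) auto

lemma ring_witt: "ring \<W>"
  unfolding witt_ring_def by (rule ideal.quotient_is_ring[OF ideal_hyperbolic_ideal])

sublocale W: ring \<W> by (rule ring_witt)

lemma WC_carrier: "G \<in> hermitian_mats \<sigma> \<Longrightarrow> WC G \<in> carrier \<W>"
proof -
  assume "G \<in> hermitian_mats \<sigma>"
  then show ?thesis
    unfolding witt_ring_def WC_def FactRing_def partial_object.simps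
    using abelian_group.a_rcosetsI[OF ring.is_abelian_group[OF ring_groth_ring]
        additive_subgroup.a_subset[OF ideal.axioms(1)[OF ideal_hyperbolic_ideal]]] groth_class_carrier
    by blast
qed

lemma WC_sum:
  assumes "A \<in> hermitian_mats \<sigma>" "B \<in> hermitian_mats \<sigma>"
  shows "WC (mat_sum A B) = WC A \<oplus>\<^bsub>\<W>\<^esub> WC B"
proof -
  interpret I: ideal "hyperbolic_ideal \<sigma>" "groth_ring \<sigma>" by (rule ideal_hyperbolic_ideal)
  have "groth_class \<sigma> (mat_sum A B) = groth_class \<sigma> A \<oplus>\<^bsub>groth_ring \<sigma>\<^esub> groth_class \<sigma> B"
    unfolding groth_class_def using assms by (simp add: gcl_add)
  then show ?thesis
    unfolding WC_def witt_ring_def FactRing_def using assms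
    by (simp add: I.a_rcos_sum groth_class_carrier)
qed

lemma WC_eqI: "A \<doteq> B \<Longrightarrow> WC A = WC B"
  unfolding WC_def groth_class_def
  by (rule arg_cong[OF gcl_eqI_hiso[OF _ hiso_refl[OF zero_hermitian_mats]]])

lemma WC_hyperbolic:
  assumes "G \<in> hermitian_mats \<sigma>" "hyperbolic (coord_space (dim_row G)) (gram_form \<sigma> G)"
  shows "WC G = \<zero>\<^bsub>\<W>\<^esub>"
proof -
  interpret I: ideal "hyperbolic_ideal \<sigma>" "groth_ring \<sigma>" by (rule ideal_hyperbolic_ideal)
  have "groth_class \<sigma> G \<in> hyperbolic_ideal \<sigma>"
    unfolding hyperbolic_ideal_def
    using assms groth_class_carrier by (intro subsetD[OF ring.genideal_self[OF ring_groth_ring]]) auto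
  then show ?thesis
    unfolding WC_def witt_ring_def FactRing_def by (simp add: I.a_rcos_const)
qed

end

section \<open>Witt classes of possibly degenerate spaces\<close>

text \<open>Stated for a bare scalar multiplication, outside any vector space locale, so that it
  applies alike to function spaces and to products of spaces; it agrees with \<open>subspace\<close>
  (\<open>vsub_iff\<close>).\<close>

definition vsub :: "('k::field \<Rightarrow> 'v::ab_group_add \<Rightarrow> 'v) \<Rightarrow> 'v set \<Rightarrow> bool" where
  "vsub s S \<longleftrightarrow> 0 \<in> S \<and> (\<forall>x\<in>S. \<forall>y\<in>S. x + y \<in> S) \<and> (\<forall>c. \<forall>x\<in>S. s c x \<in> S)"

text \<open>Packages a subset as a module; the multiplicative fields are placeholders that the
  record type demands.\<close>

definition mrec :: "('k::field \<Rightarrow> 'v::ab_group_add \<Rightarrow> 'v) \<Rightarrow> 'v set \<Rightarrow> ('k, 'v) module" where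
  "mrec s S = \<lparr>carrier = S, mult = (\<lambda>_ _. 0), one = 0, zero = 0, add = (+), smult = s\<rparr>"

lemma mrec_simps [simp]:
  "carrier (mrec s S) = S" "add (mrec s S) = (+)" "module.smult (mrec s S) = s" "zero (mrec s S) = 0"
  by (simp_all add: mrec_def)

text \<open>The closure properties that the comparison of two Witt representations relies on. For
  \<open>quot_module\<close> they can be read off directly, without going through the module
  axioms.\<close>

definition closed_space :: "('k::field, 'v) module \<Rightarrow> bool" where
  "closed_space V \<longleftrightarrow> carrier V \<noteq> {} \<and>
     (\<forall>x\<in>carrier V. \<forall>y\<in>carrier V. x \<oplus>\<^bsub>V\<^esub> y \<in> carrier V) \<and> (\<forall>c. \<forall>x\<in>carrier V. c \<odot>\<^bsub>V\<^esub> x \<in> carrier V)"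

lemma closed_space_mrec: "vsub s S \<Longrightarrow> closed_space (mrec s S)"
  by (auto simp: vsub_def closed_space_def)

context involutive_field
begin

text \<open>G is a Gram matrix of V modulo its kernel: since G is non-degenerate, two vectors have
  the same image under \<pi> exactly if they have the same pairings under H.\<close>

definition witt_rep :: "('k, 'v) module \<Rightarrow> ('v \<Rightarrow> 'v \<Rightarrow> 'k) \<Rightarrow> 'k mat \<Rightarrow> bool" where
  "witt_rep V H G \<longleftrightarrow> G \<in> hermitian_mats \<sigma> \<and>
     (\<exists>\<pi> \<in> LinearCombinations.module_hom class_ring V (coord_space (dim_row G)).
        \<pi> ` carrier V = carrier_vec (dim_row G) \<and>
        (\<forall>x\<in>carrier V. \<forall>y\<in>carrier V. H x y = gram_form \<sigma> G (\<pi> x) (\<pi> y)))"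

lemma module_hom_coord_iff:
  fixes \<pi> :: "'v \<Rightarrow> 'k vec"
  shows "\<pi> \<in> LinearCombinations.module_hom class_ring V (coord_space n) \<longleftrightarrow>
     (\<forall>x\<in>carrier V. \<pi> x \<in> carrier_vec n) \<and>
     (\<forall>x\<in>carrier V. \<forall>y\<in>carrier V. \<pi> (x \<oplus>\<^bsub>V\<^esub> y) = \<pi> x + \<pi> y) \<and>
     (\<forall>c. \<forall>x\<in>carrier V. \<pi> (c \<odot>\<^bsub>V\<^esub> x) = c \<cdot>\<^sub>v \<pi> x)"
  by (auto simp: LinearCombinations.module_hom_def)

text \<open>A form-preserving linear surjection identifies only vectors with the same pairings, so
  it does not change the space modulo its kernel. Isometries, exchanges of factors and orthogonal
  projections all enter through this lemma.\<close>

lemma witt_rep_pullback: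
  assumes "witt_rep V H G"
    and "\<And>x. x \<in> carrier V' \<Longrightarrow> f x \<in> carrier V"
    and "\<And>x y. x \<in> carrier V' \<Longrightarrow> y \<in> carrier V' \<Longrightarrow> f (x \<oplus>\<^bsub>V'\<^esub> y) = f x \<oplus>\<^bsub>V\<^esub> f y"
    and "\<And>c x. x \<in> carrier V' \<Longrightarrow> f (c \<odot>\<^bsub>V'\<^esub> x) = c \<odot>\<^bsub>V\<^esub> f x"
    and "\<And>y. y \<in> carrier V \<Longrightarrow> \<exists>x\<in>carrier V'. f x = y"
    and "\<And>x y. x \<in> carrier V' \<Longrightarrow> y \<in> carrier V' \<Longrightarrow> H' x y = H (f x) (f y)"
  shows "witt_rep V' H' G"
proof -
  obtain \<pi> where \<pi>: "\<pi> \<in> LinearCombinations.module_hom class_ring V (coord_space (dim_row G))"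
    "\<pi> ` carrier V = carrier_vec (dim_row G)"
    "\<forall>x\<in>carrier V. \<forall>y\<in>carrier V. H x y = gram_form \<sigma> G (\<pi> x) (\<pi> y)"
    and G: "G \<in> hermitian_mats \<sigma>"
    using assms(1) unfolding witt_rep_def by blast
  have "f ` carrier V' = carrier V" using assms(2,5) by fast
  then have "(\<lambda>x. \<pi> (f x)) ` carrier V' = carrier_vec (dim_row G)" using \<pi>(2) by (metis image_image)
  moreover have "(\<lambda>x. \<pi> (f x)) \<in> LinearCombinations.module_hom class_ring V' (coord_space (dim_row G))"
    using \<pi>(1) assms(2-4) unfolding module_hom_coord_iff by simp
  moreover have "\<forall>x\<in>carrier V'. \<forall>y\<in>carrier V'. H' x y = gram_form \<sigma> G (\<pi> (f x)) (\<pi> (f y))"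
    using \<pi>(3) assms(2,6) by simp
  ultimately show ?thesis unfolding witt_rep_def using G by blast
qed

lemma hermitian_mats_carrier: "G \<in> hermitian_mats \<sigma> \<Longrightarrow> G \<in> carrier_mat (dim_row G) (dim_row G)"
  by (drule hermitian_matsD) auto

lemma gram_form_nondegenerate:
  assumes G: "G \<in> hermitian_mats \<sigma>" and u: "u \<in> carrier_vec (dim_row G)" and v: "v \<in> carrier_vec (dim_row G)"
    and eq: "\<And>w. w \<in> carrier_vec (dim_row G) \<Longrightarrow> gram_form \<sigma> G u w = gram_form \<sigma> G v w"
  shows "u = v"
proof -
  let ?n = "dim_row G"
  note Gc = hermitian_mats_carrier[OF G]
  have "gram_form \<sigma> G (u - v) w = 0" if w: "w \<in> carrier_vec ?n" for w
  proof -
    have "gram_form \<sigma> G (u - v) w = gram_form \<sigma> G u w - gram_form \<sigma> G v w"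
      unfolding gram_form_sum[OF Gc minus_carrier_vec[OF u v] w] gram_form_sum[OF Gc u w] gram_form_sum[OF Gc v w]
      using u v by (simp add: hom_minus algebra_simps sum_subtractf)
    then show ?thesis using eq[OF w] by simp
  qed
  then have "u - v \<in> form_kernel (coord_space ?n) (gram_form \<sigma> G)"
    using u v by (simp add: orth_def)
  then have "u - v = 0\<^sub>v ?n" using G by (simp add: hermitian_mats_def nondegenerate_def)
  then show ?thesis
    using u v by (metis carrier_vecD eq_vecI index_minus_vec(1) index_zero_vec(1) eq_iff_diff_eq_0)
qed

lemma witt_repE:
  fixes V :: "('k, 'v) module"
  assumes "witt_rep V H G"
  obtains \<pi> where "G \<in> hermitian_mats \<sigma>" "\<forall>x\<in>carrier V. \<pi> x \<in> carrier_vec (dim_row G)"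
     "\<forall>x\<in>carrier V. \<forall>y\<in>carrier V. \<pi> (x \<oplus>\<^bsub>V\<^esub> y) = \<pi> x + \<pi> y"
     "\<forall>c. \<forall>x\<in>carrier V. \<pi> (c \<odot>\<^bsub>V\<^esub> x) = c \<cdot>\<^sub>v \<pi> x"
    "\<pi> ` carrier V = carrier_vec (dim_row G)"
    "\<forall>x\<in>carrier V. \<forall>y\<in>carrier V. H x y = gram_form \<sigma> G (\<pi> x) (\<pi> y)"
proof -
  obtain \<pi> where \<pi>: "\<pi> \<in> LinearCombinations.module_hom class_ring V (coord_space (dim_row G))"
    "\<pi> ` carrier V = carrier_vec (dim_row G)"
    "\<forall>x\<in>carrier V. \<forall>y\<in>carrier V. H x y = gram_form \<sigma> G (\<pi> x) (\<pi> y)"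
    and G: "G \<in> hermitian_mats \<sigma>"
    using assms unfolding witt_rep_def by blast
  show thesis
    using \<pi>(1)[unfolded module_hom_coord_iff]
    by (intro that[OF G _ _ _ \<pi>(2,3)]) (elim conjE, assumption)+
qed

text \<open>Whether \<pi> identifies two vectors is decided by their pairings under H alone. Hence
  \<pi> and \<pi>' have the same fibres, and \<pi>' factors through \<pi> as a bijection of the
  coordinate spaces.\<close>

lemma witt_rep_unique:
  assumes V: "closed_space V" and 1: "witt_rep V H G" and 2: "witt_rep V H G'"
  shows "G \<doteq> G'"
proof -
  let ?n = "dim_row G" and ?n' = "dim_row G'"
  obtain \<pi> where G: "G \<in> hermitian_mats \<sigma>" and \<pi>: "\<forall>x\<in>carrier V. \<pi> x \<in> carrier_vec ?n"
     "\<forall>x\<in>carrier V. \<forall>y\<in>carrier V. \<pi> (x \<oplus>\<^bsub>V\<^esub> y) = \<pi> x + \<pi> y"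
     "\<forall>c. \<forall>x\<in>carrier V. \<pi> (c \<odot>\<^bsub>V\<^esub> x) = c \<cdot>\<^sub>v \<pi> x"
    "\<pi> ` carrier V = carrier_vec ?n"
    "\<forall>x\<in>carrier V. \<forall>y\<in>carrier V. H x y = gram_form \<sigma> G (\<pi> x) (\<pi> y)"
    using 1 by (rule witt_repE)
  obtain \<pi>' where G': "G' \<in> hermitian_mats \<sigma>" and \<pi>': "\<forall>x\<in>carrier V. \<pi>' x \<in> carrier_vec ?n'"
     "\<forall>x\<in>carrier V. \<forall>y\<in>carrier V. \<pi>' (x \<oplus>\<^bsub>V\<^esub> y) = \<pi>' x + \<pi>' y"
     "\<forall>c. \<forall>x\<in>carrier V. \<pi>' (c \<odot>\<^bsub>V\<^esub> x) = c \<cdot>\<^sub>v \<pi>' x"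
    "\<pi>' ` carrier V = carrier_vec ?n'"
    "\<forall>x\<in>carrier V. \<forall>y\<in>carrier V. H x y = gram_form \<sigma> G' (\<pi>' x) (\<pi>' y)"
    using 2 by (rule witt_repE)
  have wd: "\<pi> x = \<pi> y \<longleftrightarrow> \<pi>' x = \<pi>' y" if xy: "x \<in> carrier V" "y \<in> carrier V" for x y
  proof
    assume e: "\<pi> x = \<pi> y"
    show "\<pi>' x = \<pi>' y"
    proof (rule gram_form_nondegenerate[OF G'])
      fix w :: "'k vec" assume "w \<in> carrier_vec ?n'"
      then obtain z where z: "z \<in> carrier V" "w = \<pi>' z" using \<pi>'(4) by blast
      then show "gram_form \<sigma> G' (\<pi>' x) w = gram_form \<sigma> G' (\<pi>' y) w"
        using \<pi>(5) \<pi>'(5) xy e by metis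
    qed (use \<pi>' xy in auto)
  next
    assume e: "\<pi>' x = \<pi>' y"
    show "\<pi> x = \<pi> y"
    proof (rule gram_form_nondegenerate[OF G])
      fix w :: "'k vec" assume "w \<in> carrier_vec ?n"
      then obtain z where z: "z \<in> carrier V" "w = \<pi> z" using \<pi>(4) by blast
      then show "gram_form \<sigma> G (\<pi> x) w = gram_form \<sigma> G (\<pi> y) w"
        using \<pi>(5) \<pi>'(5) xy e by metis
    qed (use \<pi> xy in auto)
  qed
  define pre where "pre v = (SOME x. x \<in> carrier V \<and> \<pi> x = v)" for v
  have pre: "pre v \<in> carrier V" "\<pi> (pre v) = v" if "v \<in> carrier_vec ?n" for v
  proof -
    have "\<exists>x. x \<in> carrier V \<and> \<pi> x = v" using \<pi>(4) that by (metis imageE)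
    then show "pre v \<in> carrier V" "\<pi> (pre v) = v" unfolding pre_def using someI_ex[of "\<lambda>x. x \<in> carrier V \<and> \<pi> x = v"] by blast+
  qed
  define \<phi> where "\<phi> v = \<pi>' (pre v)" for v
  have \<phi>: "\<phi> (\<pi> x) = \<pi>' x" if "x \<in> carrier V" for x
    unfolding \<phi>_def using wd pre that \<pi>(1) by metis
  have "\<phi> \<in> LinearCombinations.module_hom class_ring (coord_space ?n) (coord_space ?n')"
    unfolding module_hom_coord_iff
  proof (intro conjI ballI allI)
    fix x :: "'k vec" assume x: "x \<in> carrier (coord_space ?n)"
    then have x': "x \<in> carrier_vec ?n" by simp
    show "\<phi> x \<in> carrier_vec ?n'" unfolding \<phi>_def using \<pi>'(1) pre x' by blast
    show "\<phi> (c \<odot>\<^bsub>coord_space ?n\<^esub> x) = c \<cdot>\<^sub>v \<phi> x" for c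
    proof -
      have c: "c \<odot>\<^bsub>V\<^esub> pre x \<in> carrier V" using V pre x' unfolding closed_space_def by blast
      have "\<phi> (\<pi> (c \<odot>\<^bsub>V\<^esub> pre x)) = \<pi>' (c \<odot>\<^bsub>V\<^esub> pre x)" by (rule \<phi>[OF c])
      then show ?thesis using \<pi>(3) \<pi>'(3) pre[OF x'] unfolding \<phi>_def[of x] by simp
    qed
    fix y :: "'k vec" assume y: "y \<in> carrier (coord_space ?n)"
    then have y': "y \<in> carrier_vec ?n" by simp
    have c: "pre x \<oplus>\<^bsub>V\<^esub> pre y \<in> carrier V" using V pre x' y' unfolding closed_space_def by blast
    have "\<phi> (\<pi> (pre x \<oplus>\<^bsub>V\<^esub> pre y)) = \<pi>' (pre x \<oplus>\<^bsub>V\<^esub> pre y)" by (rule \<phi>[OF c])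
    then show "\<phi> (x \<oplus>\<^bsub>coord_space ?n\<^esub> y) = \<phi> x + \<phi> y"
      using \<pi>(2) \<pi>'(2) pre[OF x'] pre[OF y'] unfolding \<phi>_def[of x] \<phi>_def[of y] by simp
  qed
  moreover have "bij_betw \<phi> (carrier_vec ?n) (carrier_vec ?n')"
    unfolding bij_betw_def
  proof
    show "inj_on \<phi> (carrier_vec ?n)"
      by (rule inj_onI) (unfold \<phi>_def, metis wd pre)
    show "\<phi> ` carrier_vec ?n = carrier_vec ?n'"
      using \<pi>(4) \<pi>'(4) \<phi> by (metis (no_types, lifting) image_cong image_image)
  qed
  moreover have "gram_form \<sigma> G' (\<phi> x) (\<phi> y) = gram_form \<sigma> G x y"
    if "x \<in> carrier_vec ?n" "y \<in> carrier_vec ?n" for x y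
    unfolding \<phi>_def using \<pi>(5) \<pi>'(5) pre[OF that(1)] pre[OF that(2)] by metis
  ultimately show ?thesis
    unfolding hiso_def mat_isometric_def isometric_def using G G' by auto
qed

text \<open>Bridge to the definition of \<open>witt_class\<close> through a quotient module. The
  fibres \<open>C x\<close> of \<pi> are the cosets of the kernel, so the quotient is isometric to
  the space of G; the Gram matrix picked by SOME is then compared with G by
  \<open>witt_rep_unique\<close>.\<close>

lemma witt_class_quot:
  fixes V :: "('k, 'v) module"
  assumes V: "Module.module class_ring V" and rep: "witt_rep V H G"
  shows "witt_class \<sigma> (quot_module V (form_kernel V H)) (quot_form H) = WC G"
proof -
  interpret V: Module.module class_ring V by (rule V)
  let ?n = "dim_row G" and ?N = "form_kernel V H"
  obtain \<pi> where G: "G \<in> hermitian_mats \<sigma>" and \<pi>: "\<forall>x\<in>carrier V. \<pi> x \<in> carrier_vec ?n"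
     "\<forall>x\<in>carrier V. \<forall>y\<in>carrier V. \<pi> (x \<oplus>\<^bsub>V\<^esub> y) = \<pi> x + \<pi> y"
     "\<forall>c. \<forall>x\<in>carrier V. \<pi> (c \<odot>\<^bsub>V\<^esub> x) = c \<cdot>\<^sub>v \<pi> x"
    "\<pi> ` carrier V = carrier_vec ?n"
    "\<forall>x\<in>carrier V. \<forall>y\<in>carrier V. H x y = gram_form \<sigma> G (\<pi> x) (\<pi> y)"
    using rep by (rule witt_repE)
  have zero: "\<pi> \<zero>\<^bsub>V\<^esub> = 0\<^sub>v ?n"
  proof -
    have "\<pi> \<zero>\<^bsub>V\<^esub> + \<pi> \<zero>\<^bsub>V\<^esub> = \<pi> \<zero>\<^bsub>V\<^esub>" using \<pi>(2) V.zero_closed V.l_zero by metis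
    moreover have "\<pi> \<zero>\<^bsub>V\<^esub> \<in> carrier_vec ?n" using \<pi>(1) by blast
    ultimately show ?thesis
      by (metis carrier_vecD eq_vecI index_add_vec(1) index_zero_vec add_cancel_left_left)
  qed
  have N: "?N = {x \<in> carrier V. \<pi> x = 0\<^sub>v ?n}"
  proof -
    have "(\<forall>y\<in>carrier V. H x y = 0) \<longleftrightarrow> \<pi> x = 0\<^sub>v ?n" if x: "x \<in> carrier V" for x
    proof
      assume *: "\<forall>y\<in>carrier V. H x y = 0"
      show "\<pi> x = 0\<^sub>v ?n"
      proof (rule gram_form_nondegenerate[OF G])
        fix w :: "'k vec" assume w: "w \<in> carrier_vec ?n"
        then obtain y where "y \<in> carrier V" "w = \<pi> y" using \<pi>(4) by blast
        then show "gram_form \<sigma> G (\<pi> x) w = gram_form \<sigma> G (0\<^sub>v ?n) w"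
          using * \<pi>(5) x w by (simp add: gram_form_sum[OF hermitian_mats_carrier[OF G] zero_carrier_vec])
      qed (use \<pi> x in auto)
    next
      assume "\<pi> x = 0\<^sub>v ?n"
      then show "\<forall>y\<in>carrier V. H x y = 0"
        using \<pi>(1,5) x by (simp add: gram_form_sum[OF hermitian_mats_carrier[OF G] zero_carrier_vec])
    qed
    then show ?thesis by (auto simp: orth_def)
  qed
  define C where "C x = {y \<in> carrier V. \<pi> y = \<pi> x}" for x
  have neg: "\<pi> (\<ominus>\<^bsub>V\<^esub> x) + \<pi> x = 0\<^sub>v ?n" if "x \<in> carrier V" for x
    using \<pi>(2) that V.a_inv_closed V.l_neg zero by metis
  have coset: "?N +>\<^bsub>V\<^esub> x = C x" if x: "x \<in> carrier V" for x
  proof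
    show "?N +>\<^bsub>V\<^esub> x \<subseteq> C x"
      unfolding a_r_coset_def' C_def N using x \<pi>(1,2) by auto
    show "C x \<subseteq> ?N +>\<^bsub>V\<^esub> x"
    proof
      fix y assume "y \<in> C x"
      then have y: "y \<in> carrier V" "\<pi> y = \<pi> x" by (auto simp: C_def)
      define d where "d = y \<oplus>\<^bsub>V\<^esub> \<ominus>\<^bsub>V\<^esub> x"
      have "\<pi> d = \<pi> (\<ominus>\<^bsub>V\<^esub> x) + \<pi> x"
        unfolding d_def using \<pi>(1,2) y x comm_add_vec by (metis V.a_inv_closed)
      then have "d \<in> ?N" unfolding N using neg[OF x] y x by (auto simp: d_def)
      moreover have "y = d \<oplus>\<^bsub>V\<^esub> x" unfolding d_def using x y by (simp add: V.a_assoc V.l_neg)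
      ultimately show "y \<in> ?N +>\<^bsub>V\<^esub> x" unfolding a_r_coset_def' by blast
    qed
  qed
  let ?Q = "quot_module V ?N"
  have carQ: "carrier ?Q = C ` carrier V"
    unfolding quot_module_def A_RCOSETS_def' using coset by auto
  have mem: "x \<in> C x" if "x \<in> carrier V" for x using that by (simp add: C_def)
  have C_eq: "C x = C y \<longleftrightarrow> \<pi> x = \<pi> y" if "x \<in> carrier V" "y \<in> carrier V" for x y
    unfolding C_def using that by auto
  have addQ: "C x \<oplus>\<^bsub>?Q\<^esub> C y = C (x \<oplus>\<^bsub>V\<^esub> y)" if xy: "x \<in> carrier V" "y \<in> carrier V" for x y
  proof -
    have "C x \<oplus>\<^bsub>?Q\<^esub> C y = (\<Union>a\<in>C x. \<Union>b\<in>C y. {a \<oplus>\<^bsub>V\<^esub> b})"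
      unfolding quot_module_def by (simp add: set_add_def')
    also have "\<dots> = C (x \<oplus>\<^bsub>V\<^esub> y)"
    proof
      show "(\<Union>a\<in>C x. \<Union>b\<in>C y. {a \<oplus>\<^bsub>V\<^esub> b}) \<subseteq> C (x \<oplus>\<^bsub>V\<^esub> y)"
        unfolding C_def using \<pi>(2) xy by auto
      show "C (x \<oplus>\<^bsub>V\<^esub> y) \<subseteq> (\<Union>a\<in>C x. \<Union>b\<in>C y. {a \<oplus>\<^bsub>V\<^esub> b})"
      proof
        fix z assume "z \<in> C (x \<oplus>\<^bsub>V\<^esub> y)"
        then have z: "z \<in> carrier V" "\<pi> z = \<pi> x + \<pi> y" using \<pi>(2) xy by (auto simp: C_def)
        define a where "a = z \<oplus>\<^bsub>V\<^esub> \<ominus>\<^bsub>V\<^esub> y"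
        have "\<pi> a = \<pi> z + \<pi> (\<ominus>\<^bsub>V\<^esub> y)" unfolding a_def using \<pi>(2) z xy by simp
        also have "\<dots> = \<pi> x + (\<pi> (\<ominus>\<^bsub>V\<^esub> y) + \<pi> y)"
          unfolding z(2) using \<pi>(1) xy
          by (metis V.a_inv_closed assoc_add_vec comm_add_vec)
        also have "\<dots> = \<pi> x" using neg[OF xy(2)] \<pi>(1) xy by simp
        finally have "a \<in> C x" using z xy by (simp add: C_def a_def)
        moreover have "z = a \<oplus>\<^bsub>V\<^esub> y" unfolding a_def using z xy by (simp add: V.a_assoc V.l_neg)
        ultimately show "z \<in> (\<Union>a\<in>C x. \<Union>b\<in>C y. {a \<oplus>\<^bsub>V\<^esub> b})" using mem[OF xy(2)] by blast
      qed
    qed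
    finally show ?thesis .
  qed
  have smultQ: "c \<odot>\<^bsub>?Q\<^esub> C x = C (c \<odot>\<^bsub>V\<^esub> x)" if x: "x \<in> carrier V" for c x
  proof -
    have "?N +>\<^bsub>V\<^esub> (c \<odot>\<^bsub>V\<^esub> y) = C (c \<odot>\<^bsub>V\<^esub> x)" if "y \<in> C x" for y
    proof -
      have y: "y \<in> carrier V" "\<pi> y = \<pi> x" using that by (auto simp: C_def)
      then have cc: "c \<odot>\<^bsub>V\<^esub> y \<in> carrier V" "c \<odot>\<^bsub>V\<^esub> x \<in> carrier V" using x V.smult_closed by auto
      then show ?thesis unfolding coset[OF cc(1)] C_eq[OF cc] using \<pi>(3) x y by simp
    qed
    then show ?thesis unfolding quot_module_def using mem[OF x] by auto
  qed
  have formQ: "quot_form H (C x) (C y) = H x y" if xy: "x \<in> carrier V" "y \<in> carrier V" for x y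
  proof -
    have "{H a b |a b. a \<in> C x \<and> b \<in> C y} = {H x y}"
      using mem[OF xy(1)] mem[OF xy(2)] \<pi>(5) xy by (auto simp: C_def) metis+
    then show ?thesis unfolding quot_form_def by simp
  qed
  define \<phi> where "\<phi> X = the_elem (\<pi> ` X)" for X
  have \<phi>: "\<phi> (C x) = \<pi> x" if x: "x \<in> carrier V" for x
  proof -
    have "\<pi> ` C x = {\<pi> x}" using mem[OF x] by (auto simp: C_def)
    then show ?thesis by (simp add: \<phi>_def)
  qed
  have hom: "\<phi> \<in> LinearCombinations.module_hom class_ring ?Q (coord_space ?n)"
    unfolding module_hom_coord_iff carQ
    using \<phi> addQ smultQ \<pi>(1-3) by (auto simp: V.smult_closed[simplified])
  have bij: "bij_betw \<phi> (carrier ?Q) (carrier_vec ?n)"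
    unfolding bij_betw_def carQ
  proof
    show "inj_on \<phi> (C ` carrier V)" by (rule inj_onI) (metis \<phi> C_eq imageE)
    show "\<phi> ` C ` carrier V = carrier_vec ?n" using \<phi> \<pi>(4) by (simp add: image_image)
  qed
  have form: "gram_form \<sigma> G (\<phi> X) (\<phi> Y) = quot_form H X Y" if "X \<in> carrier ?Q" "Y \<in> carrier ?Q" for X Y
    using that \<phi> formQ \<pi>(5) unfolding carQ by auto
  have iso: "isometric ?Q (quot_form H) (coord_space ?n) (gram_form \<sigma> G)"
    unfolding isometric_def using hom bij form by auto
  have isorep: "witt_rep ?Q (quot_form H) G'"
    if G': "G' \<in> hermitian_mats \<sigma>" and i: "isometric ?Q (quot_form H) (coord_space (dim_row G')) (gram_form \<sigma> G')" for G'
  proof -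
    obtain f where "f \<in> LinearCombinations.module_hom class_ring ?Q (coord_space (dim_row G'))"
      "bij_betw f (carrier ?Q) (carrier_vec (dim_row G'))"
      "\<forall>x\<in>carrier ?Q. \<forall>y\<in>carrier ?Q. gram_form \<sigma> G' (f x) (f y) = quot_form H x y"
      using i unfolding isometric_def carrier_coord_space by blast
    then show ?thesis unfolding witt_rep_def bij_betw_def using G' by metis
  qed
  define G0 where "G0 = (SOME G'. G' \<in> hermitian_mats \<sigma> \<and> isometric ?Q (quot_form H) (coord_space (dim_row G')) (gram_form \<sigma> G'))"
  have G0: "G0 \<in> hermitian_mats \<sigma>" "isometric ?Q (quot_form H) (coord_space (dim_row G0)) (gram_form \<sigma> G0)"
    using someI_ex[of "\<lambda>G'. G' \<in> hermitian_mats \<sigma> \<and> isometric ?Q (quot_form H) (coord_space (dim_row G')) (gram_form \<sigma> G')"] G iso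
    unfolding G0_def by blast+
  have "closed_space ?Q"
    unfolding closed_space_def carQ using addQ smultQ V.zero_closed
    by (auto simp: V.smult_closed[simplified])
  then have "G0 \<doteq> G"
    using witt_rep_unique isorep[OF G0] isorep[OF G iso] by blast
  then have "WC G0 = WC G" by (rule WC_eqI)
  then show ?thesis unfolding witt_class_def WC_def G0_def by simp
qed

end

section \<open>Hermitian and anti-hermitian forms\<close>

definition fin_spanned :: "('k::field \<Rightarrow> 'v::ab_group_add \<Rightarrow> 'v) \<Rightarrow> 'v set \<Rightarrow> bool" where
  "fin_spanned s S \<longleftrightarrow> (\<exists>B. finite B \<and> S \<subseteq> Modules.module.span s B)"

text \<open>One locale for both symmetries: \<epsilon> = 1 is the hermitian case and \<epsilon> = -1
  the anti-hermitian one. The form is total on the type, and the spaces under study are subsets of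
  it.\<close>

locale form_space = involutive_field \<sigma> + Vector_Spaces.vector_space s
  for \<sigma> :: "'k::field \<Rightarrow> 'k" and s :: "'k \<Rightarrow> 'v::ab_group_add \<Rightarrow> 'v" +
  fixes h :: "'v \<Rightarrow> 'v \<Rightarrow> 'k" and \<epsilon> :: 'k
  assumes h_add: "h x (y + z) = h x y + h x z"
    and h_scale: "h x (s c y) = c * h x y"
    and h_swap: "h y x = \<epsilon> * \<sigma> (h x y)"
begin

lemma h_add_left: "h (x + y) z = h x z + h y z"
  by (subst (1 2 3) h_swap) (simp add: h_add hom_add algebra_simps)

lemma h_scale_left: "h (s c x) z = \<sigma> c * h x z"
  by (subst (1 2) h_swap) (simp add: h_scale hom_mult algebra_simps)

lemma h_zero [simp]: "h x 0 = 0" "h 0 x = 0"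
  using h_scale[of x 0 0] h_scale_left[of 0 0 x] by simp_all

lemma h_minus [simp]: "h x (- y) = - h x y" "h (- x) y = - h x y"
  using h_add[of x y "- y"] h_add_left[of x "- x" y] by (simp_all add: eq_neg_iff_add_eq_0 add.commute)

lemma h_diff: "h x (y - z) = h x y - h x z" "h (x - y) z = h x z - h y z"
  using h_add[of x y "- z"] h_add_left[of x "- y" z] by simp_all

lemma h_sum: "h x (sum f A) = (\<Sum>a\<in>A. h x (f a))" "h (sum f A) x = (\<Sum>a\<in>A. h (f a) x)"
  by (induction A rule: infinite_finite_induct) (simp_all add: h_add h_add_left)

lemma h_eq_0_swap: "h x y = 0 \<Longrightarrow> h y x = 0"
  by (subst h_swap) simp

lemma vsub_iff: "vsub s S \<longleftrightarrow> subspace S"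
  by (simp add: vsub_def subspace_def)

text \<open>The linear functionals \<open>h _ y\<close> with \<open>y \<in> Y\<close> span all functionals that vanish on their
  common zeros.\<close>

lemma functional_span:
  assumes "finite Y" "vsub s S" "\<And>z. z \<in> S \<Longrightarrow> \<forall>y\<in>Y. h z y = 0 \<Longrightarrow> h z x = 0"
  shows "\<exists>a\<in>span Y. \<forall>z\<in>S. h z (x - a) = 0"
  using assms
proof (induction Y arbitrary: S)
  case empty
  then show ?case using span_zero by force
next
  case (insert y Y)
  define S' where "S' = {z \<in> S. h z y = 0}"
  have "vsub s S'"
    using insert.prems(1) unfolding vsub_def S'_def by (auto simp: h_add_left h_scale_left)
  moreover have "h z x = 0" if "z \<in> S'" "\<forall>y\<in>Y. h z y = 0" for z
    using that insert.prems(2) unfolding S'_def by auto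
  ultimately obtain a where a: "a \<in> span Y" "\<And>z. z \<in> S' \<Longrightarrow> h z (x - a) = 0"
    using insert.IH by blast
  have aY: "a \<in> span (insert y Y)" using a(1) span_mono[of Y "insert y Y"] by auto
  show ?case
  proof (cases "S' = S")
    case True
    then show ?thesis using a aY by blast
  next
    case False
    then obtain w where w: "w \<in> S" "h w y \<noteq> 0" unfolding S'_def by blast
    \<comment> \<open>Makes x - (a + c y) orthogonal to w as well. Every z in S is a multiple of w
      plus an element of S', on which a is already right and y vanishes.\<close>
    define c where "c = h w (x - a) / h w y"
    have "h z (x - (a + s c y)) = 0" if z: "z \<in> S" for z
    proof -
      define d where "d = \<sigma> (h z y / h w y)"
      have d: "\<sigma> d * h w y = h z y" using w by (simp add: d_def)
      have "z + s (- d) w \<in> S"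
        using z w insert.prems(1) unfolding vsub_def by blast
      then have "z - s d w \<in> S'" using d by (simp add: S'_def h_diff(2) h_scale_left)
      then have "h (z - s d w) (x - a) = 0" by (rule a(2))
      then have "h z (x - a) = \<sigma> d * h w (x - a)" by (simp add: h_diff(2) h_scale_left)
      also have "\<dots> = c * h z y" using w by (simp add: c_def flip: d)
      finally show ?thesis by (simp add: h_diff h_add h_scale algebra_simps)
    qed
    moreover have "a + s c y \<in> span (insert y Y)"
      by (intro span_add[OF aY] span_scale span_base) simp
    ultimately show ?thesis by blast
  qed
qed

definition perp :: "'v set \<Rightarrow> 'v set \<Rightarrow> 'v set" where
  "perp S A = {x \<in> S. \<forall>a\<in>A. h a x = 0}"

lemma vsub_perp: "vsub s S \<Longrightarrow> vsub s (perp S A)"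
  unfolding vsub_def perp_def by (auto simp: h_add h_scale)

lemma finite_basis_exists:
  assumes "fin_spanned s S" "vsub s A" "A \<subseteq> S"
  obtains Y where "finite Y" "independent Y" "Y \<subseteq> A" "A = span Y"
proof -
  obtain B where B: "finite B" "S \<subseteq> span B" using assms by (auto simp: fin_spanned_def)
  obtain Y where Y: "Y \<subseteq> A" "independent Y" "A \<subseteq> span Y" by (rule maximal_independent_subset)
  have "finite Y" using independent_span_bound[OF B(1) Y(2)] Y(1) assms(3) B(2) by blast
  moreover have "span Y \<subseteq> A" using assms(2) Y(1) span_minimal unfolding vsub_iff by blast
  ultimately show thesis using that Y by blast
qed

text \<open>If x is orthogonal to everything orthogonal to A, the functional of x vanishes on the
  common zeros of the functionals of a finite spanning set of A. It is therefore the functional of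
  some a in A, and non-degeneracy gives x = a.\<close>

lemma double_perp:
  assumes S: "vsub s S" "fin_spanned s S"
    and nd: "\<And>x. x \<in> S \<Longrightarrow> \<forall>z\<in>S. h z x = 0 \<Longrightarrow> x = 0"
    and A: "vsub s A" "A \<subseteq> S"
  shows "perp S (perp S A) \<subseteq> A"
proof
  fix x assume x: "x \<in> perp S (perp S A)"
  obtain Y where Y: "finite Y" "Y \<subseteq> A" "A = span Y" by (rule finite_basis_exists[OF S(2) A])
  have "h z x = 0" if z: "z \<in> S" "\<forall>y\<in>Y. h z y = 0" for z
  proof -
    have "subspace {y. h z y = 0}" unfolding subspace_def by (auto simp: h_add h_scale)
    then have "A \<subseteq> {y. h z y = 0}" using z(2) Y(3) span_minimal[of Y "{y. h z y = 0}"] by blast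
    then have "z \<in> perp S A" using z(1) h_eq_0_swap by (auto simp: perp_def)
    then show ?thesis using x by (auto simp: perp_def)
  qed
  then obtain a where a: "a \<in> A" "\<forall>z\<in>S. h z (x - a) = 0"
    using functional_span[OF Y(1) S(1)] Y(3) by blast
  have "x - a \<in> S"
  proof -
    have "x + s (- 1) a \<in> S" using x a(1) A(2) S(1) unfolding vsub_def perp_def by blast
    then show ?thesis by simp
  qed
  then have "x - a = 0" using nd a(2) by blast
  then show "x \<in> A" using a(1) by simp
qed

text \<open>A maximal isotropic M that meets L trivially is the required complement. If L + M were a
  proper subspace, some v in L outside M would be orthogonal to M, and some w orthogonal to M would
  pair non-trivially with v; made isotropic by a multiple of v, this w could be adjoined to M.
  Zorn's lemma takes the place of a count of dimensions.\<close>

lemma metabolic_complement: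
  assumes S: "vsub s S" "fin_spanned s S"
    and nd: "\<And>x. x \<in> S \<Longrightarrow> \<forall>z\<in>S. h z x = 0 \<Longrightarrow> x = 0"
    and hermitian: "\<epsilon> = 1" and two: "(2 :: 'k) \<noteq> 0"
    and L: "vsub s L" "L = perp S L"
  shows "\<exists>L'. vsub s L' \<and> L' = perp S L' \<and> L \<inter> L' = {0} \<and> {a + b | a b. a \<in> L \<and> b \<in> L'} = S"
proof -
  have LS: "L \<subseteq> S" using L(2) by (auto simp: perp_def)
  have Liso: "h a b = 0" if "a \<in> L" "b \<in> L" for a b using L(2) that unfolding perp_def by blast
  define \<A> where "\<A> = {M. vsub s M \<and> M \<subseteq> S \<and> M \<subseteq> perp S M \<and> L \<inter> M = {0}}"
  have "\<exists>M\<in>\<A>. \<forall>X\<in>\<A>. M \<subseteq> X \<longrightarrow> X = M"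
  proof (rule subset_Zorn_nonempty)
    have "{0} \<in> \<A>" using S(1) L(1) by (auto simp: \<A>_def vsub_def perp_def)
    then show "\<A> \<noteq> {}" by blast
    fix \<C> assume ne: "\<C> \<noteq> {}" and ch: "subset.chain \<A> \<C>"
    have C: "\<C> \<subseteq> \<A>" and tot: "\<And>X Y. X \<in> \<C> \<Longrightarrow> Y \<in> \<C> \<Longrightarrow> X \<subseteq> Y \<or> Y \<subseteq> X"
      using ch by (auto simp: subset.chain_def)
    have two_in: "\<exists>Z\<in>\<C>. x \<in> Z \<and> y \<in> Z" if "x \<in> \<Union>\<C>" "y \<in> \<Union>\<C>" for x y
      using that tot by blast
    have mem: "vsub s X" "X \<subseteq> S" "X \<subseteq> perp S X" "L \<inter> X = {0}" if "X \<in> \<C>" for X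
      using that C by (auto simp: \<A>_def)
    have "vsub s (\<Union>\<C>)"
      unfolding vsub_def
    proof (intro conjI ballI allI)
      show "0 \<in> \<Union>\<C>" using ne mem(1) unfolding vsub_def by blast
      fix x assume x: "x \<in> \<Union>\<C>"
      then show "s c x \<in> \<Union>\<C>" for c using mem(1) unfolding vsub_def by blast
      fix y assume "y \<in> \<Union>\<C>"
      then obtain Z where "Z \<in> \<C>" "x \<in> Z" "y \<in> Z" using two_in x by blast
      then show "x + y \<in> \<Union>\<C>" using mem(1)[of Z] unfolding vsub_def by blast
    qed
    moreover have "\<Union>\<C> \<subseteq> perp S (\<Union>\<C>)"
    proof
      fix x assume x: "x \<in> \<Union>\<C>"
      have "h a x = 0" if a: "a \<in> \<Union>\<C>" for a
      proof -
        obtain Z where "Z \<in> \<C>" "x \<in> Z" "a \<in> Z" using two_in x a by blast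
        then show ?thesis using mem(3)[of Z] unfolding perp_def by blast
      qed
      then show "x \<in> perp S (\<Union>\<C>)" using x mem(2) by (auto simp: perp_def)
    qed
    moreover have "L \<inter> \<Union>\<C> = {0}" using ne mem(4) by blast
    ultimately show "\<Union>\<C> \<in> \<A>" using mem(2) by (auto simp: \<A>_def)
  qed
  then obtain M where M\<A>: "M \<in> \<A>" and max: "\<forall>X\<in>\<A>. M \<subseteq> X \<longrightarrow> X = M" by (rule bexE)
  have M: "vsub s M" "M \<subseteq> S" "M \<subseteq> perp S M" "L \<inter> M = {0}"
    using M\<A> by (simp_all only: \<A>_def mem_Collect_eq)
  define A where "A = {a + b | a b. a \<in> L \<and> b \<in> M}"
  have LA: "L \<subseteq> A"
  proof
    fix x assume "x \<in> L"
    then have "x = x + 0 \<and> x \<in> L \<and> 0 \<in> M" using M(1) by (simp add: vsub_def)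
    then show "x \<in> A" unfolding A_def by blast
  qed
  have MA: "M \<subseteq> A"
  proof
    fix x assume "x \<in> M"
    then have "x = 0 + x \<and> 0 \<in> L \<and> x \<in> M" using L(1) by (simp add: vsub_def)
    then show "x \<in> A" unfolding A_def by blast
  qed
  have A: "vsub s A" using L(1) M(1) subspace_sums unfolding vsub_iff A_def by blast
  have AS: "A \<subseteq> S" using LS M(2) S(1) unfolding A_def vsub_def by blast
  have "A = S"
  proof (rule ccontr)
    assume "A \<noteq> S"
    then obtain x where x: "x \<in> S" "x \<notin> A" using AS by blast
    then have "x \<notin> perp S (perp S A)" using double_perp[OF S nd A AS] by blast
    then obtain v where v: "v \<in> perp S A" "h v x \<noteq> 0" using x unfolding perp_def by blast
    have v0: "v \<noteq> 0" using v(2) by auto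
    have vL: "v \<in> L" using v(1) LA by (subst L(2)) (auto simp: perp_def)
    have vM: "v \<in> perp S M" using v(1) MA by (auto simp: perp_def)
    have "v \<notin> M" using vL v0 M(4) by blast
    then have "v \<notin> perp S (perp S M)" using double_perp[OF S nd M(1,2)] by blast
    then obtain w where w: "w \<in> perp S M" "h w v \<noteq> 0" using vL LS unfolding perp_def by blast
    have sym: "h y x = \<sigma> (h x y)" for x y by (rule h_swap[unfolded hermitian mult_1])
    \<comment> \<open>Solves h u u = 0 for u = w - c v: as v is isotropic, only the two cross terms
      appear, and c makes each of them half of h w w.\<close>
    define c where "c = h w w / (2 * h w v)"
    define u where "u = w + s (- c) v"
    have u: "u \<in> perp S M" using vsub_perp[OF S(1)] w(1) vM unfolding u_def vsub_def by blast
    have c: "c * h w v = h w w / 2" using w(2) two by (simp add: c_def field_simps)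
    have s2: "\<sigma> 2 = 2" using hom_add[of 1 1] by simp
    have "\<sigma> c * h v w = \<sigma> (c * h w v)" using sym[of v w] by (simp add: hom_mult)
    also have "\<dots> = \<sigma> (h w w) / 2"
    proof -
      have "\<sigma> (h w w) = \<sigma> (h w w / 2 * 2)" using two by simp
      then show ?thesis unfolding c hom_mult s2 using two by simp
    qed
    also have "\<dots> = h w w / 2" unfolding sym[of w w, symmetric] ..
    finally have c': "\<sigma> c * h v w = h w w / 2" .
    have "h u u = h w w - c * h w v - \<sigma> c * h v w"
      using Liso[OF vL vL] unfolding u_def by (simp add: h_diff h_scale h_scale_left algebra_simps)
    also have "\<dots> = 0" unfolding c c' using two by (simp add: field_simps)
    finally have uu: "h u u = 0" .
    have vu: "h v u \<noteq> 0"
      using w(2) Liso[OF vL vL] h_eq_0_swap[of v w] unfolding u_def by (auto simp: h_add h_scale h_diff)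
    define X where "X = {m + s d u | m d. m \<in> M}"
    have MX: "M \<subseteq> X"
    proof
      fix m assume "m \<in> M"
      then have "m = m + s 0 u \<and> m \<in> M" by simp
      then show "m \<in> X" unfolding X_def by blast
    qed
    have mu: "h m u = 0" "h u m = 0" if "m \<in> M" for m
      using u that h_eq_0_swap unfolding perp_def by auto
    have mm: "h m m' = 0" if "m \<in> M" "m' \<in> M" for m m' using M(3) that unfolding perp_def by blast
    have uS: "u \<in> S" using u by (simp add: perp_def)
    have "vsub s X"
      unfolding vsub_def
    proof (intro conjI ballI allI)
      show "0 \<in> X" using MX M(1) unfolding vsub_def by blast
      fix x assume "x \<in> X"
      then obtain m d where x: "x = m + s d u" "m \<in> M" unfolding X_def by blast
      show "s e x \<in> X" for e
      proof -
        have "s e x = s e m + s (e * d) u" unfolding x by (simp add: scale_right_distrib)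
        then show ?thesis using x(2) M(1) unfolding X_def vsub_def by blast
      qed
      fix y assume "y \<in> X"
      then obtain m' d' where y: "y = m' + s d' u" "m' \<in> M" unfolding X_def by blast
      have "x + y = (m + m') + s (d + d') u" unfolding x y by (simp add: scale_left_distrib)
      then show "x + y \<in> X" using x(2) y(2) M(1) unfolding X_def vsub_def by blast
    qed
    moreover have XS: "X \<subseteq> S" using M(2) uS S(1) unfolding X_def vsub_def by blast
    moreover have "X \<subseteq> perp S X"
      using XS uu mu mm unfolding X_def perp_def by (auto simp: h_add h_add_left h_scale h_scale_left)
    moreover have "L \<inter> X = {0}"
    proof
      show "L \<inter> X \<subseteq> {0}"
      proof
        fix x assume "x \<in> L \<inter> X"
        then obtain m d where x: "x = m + s d u" "m \<in> M" "x \<in> L" unfolding X_def by blast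
        have "h v m = 0" using vM x(2) h_eq_0_swap unfolding perp_def by blast
        then have "d * h v u = 0" using Liso[OF vL x(3)] unfolding x by (simp add: h_add h_scale)
        then have "d = 0" using vu by simp
        then show "x \<in> {0}" using x M(4) by auto
      qed
      show "{0} \<subseteq> L \<inter> X" using L(1) M(1) MX unfolding vsub_def by blast
    qed
    ultimately have "X \<in> \<A>" by (simp only: \<A>_def mem_Collect_eq simp_thms)
    then have "X = M" using bspec[OF max] MX by simp
    moreover have "u \<in> X"
    proof -
      have "u = 0 + s 1 u \<and> 0 \<in> M" using M(1) by (simp add: vsub_def)
      then show ?thesis unfolding X_def by blast
    qed
    ultimately have "u \<in> M" by simp
    then show False using vM vu h_eq_0_swap unfolding perp_def by blast
  qed
  moreover have "perp S M \<subseteq> M"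
  proof
    fix x assume x: "x \<in> perp S M"
    then have "x \<in> A" using \<open>A = S\<close> by (simp add: perp_def)
    then obtain a b where ab: "x = a + b" "a \<in> L" "b \<in> M" unfolding A_def by blast
    have "h z a = 0" if z: "z \<in> S" for z
    proof -
      obtain a' b' where z: "z = a' + b'" "a' \<in> L" "b' \<in> M" using z \<open>A = S\<close> unfolding A_def by blast
      have "h b' a = 0" using x M(3) ab(1,3) z(3) unfolding perp_def by (auto simp: h_add)
      then show ?thesis using Liso[OF z(2) ab(2)] z(1) by (simp add: h_add_left)
    qed
    then have "a = 0" using nd ab(2) LS by blast
    then show "x \<in> M" using ab by simp
  qed
  ultimately show ?thesis using M unfolding A_def by (intro exI[of _ M]) blast
qed

end

context form_space
begin

lemma representation_zero_outside:
  assumes "independent B" "B' \<subseteq> B" "x \<in> span B'" "b \<notin> B'"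
  shows "representation B x b = 0"
  using representation_extend[OF assms(1,3,2)] representation_ne_zero assms(4) by metis

text \<open>A basis of the radical is extended to a basis of S. The added vectors have a
  non-degenerate Gram matrix, and \<pi> reads off the coordinates along them.\<close>

lemma witt_rep_exists:
  assumes S: "vsub s S" "fin_spanned s S" and hermitian: "\<epsilon> = 1"
  shows "\<exists>G. witt_rep (mrec s S) h G"
proof -
  define R where "R = perp S S"
  have R: "vsub s R" "R \<subseteq> S" using vsub_perp[OF S(1)] by (auto simp: R_def perp_def)
  obtain B0 where B0: "finite B0" "S \<subseteq> span B0" using S(2) by (auto simp: fin_spanned_def)
  obtain BR where BR: "BR \<subseteq> R" "independent BR" "R \<subseteq> span BR" by (rule maximal_independent_subset)
  have "BR \<subseteq> S" using BR R by auto
  then obtain B where B: "BR \<subseteq> B" "B \<subseteq> S" "independent B" "S \<subseteq> span B"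
    using maximal_independent_subset_extend[OF _ BR(2)] by blast
  have finB: "finite B" using independent_span_bound[OF B0(1) B(3)] B(2) B0(2) by blast
  have spanB: "span B \<subseteq> S" using S(1) B(2) span_minimal unfolding vsub_iff by blast
  define m where "m = card (B - BR)"
  obtain c where "bij_betw c {0..<m} (B - BR)"
    using ex_bij_betw_nat_finite[of "B - BR"] finB unfolding m_def by blast
  then have c: "bij_betw c {..<m} (B - BR)" by (simp add: lessThan_atLeast0)
  have cB: "c j \<in> B - BR" if "j < m" for j using c that by (auto simp: bij_betw_def)
  have cinj: "c i = c j \<longleftrightarrow> i = j" if "i < m" "j < m" for i j
    using c that by (auto simp: bij_betw_def inj_on_def)
  have cS: "c j \<in> S" if "j < m" for j using cB[OF that] B(2) by blast
  define \<pi> where "\<pi> x = vec m (\<lambda>j. representation B x (c j))" for x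
  define G where "G = mat m m (\<lambda>(i, j). h (c i) (c j))"
  have Gc: "G \<in> carrier_mat m m" by (simp add: G_def)
  have rad: "h r x = 0" "h x r = 0" if "r \<in> BR" "x \<in> S" for r x
  proof -
    show "h x r = 0" using that BR(1) by (auto simp: R_def perp_def)
    then show "h r x = 0" by (rule h_eq_0_swap)
  qed
  define p where "p x = (\<Sum>j<m. s (representation B x (c j)) (c j))" for x
  define q where "q x = (\<Sum>b\<in>BR. s (representation B x b) b)" for x
  have decomp: "x = q x + p x" if x: "x \<in> S" for x
  proof -
    have "x = (\<Sum>b\<in>B. s (representation B x b) b)"
      using sum_representation_eq[OF B(3) _ finB] B(4) x by (metis subset_refl subsetD)
    also have "\<dots> = q x + (\<Sum>b\<in>B - BR. s (representation B x b) b)"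
      unfolding q_def using sum.subset_diff[OF B(1) finB, of "\<lambda>b. s (representation B x b) b"] by (simp add: add.commute)
    also have "(\<Sum>b\<in>B - BR. s (representation B x b) b) = p x"
      unfolding p_def by (rule sum.reindex_bij_betw[OF c, symmetric])
    finally show ?thesis .
  qed
  have pS: "p x \<in> S" for x
    unfolding p_def using cS S(1) unfolding vsub_iff by (intro subspace_sum subspace_scale) auto
  have qS: "q x \<in> S" for x
    unfolding q_def using B(1,2) S(1) unfolding vsub_iff by (intro subspace_sum subspace_scale) auto
  have hq: "h (q x) y = 0" "h y (q x) = 0" if "y \<in> S" for x y
    unfolding q_def h_sum using rad that by (simp_all add: h_scale h_scale_left)
  have gram: "h x y = gram_form \<sigma> G (\<pi> x) (\<pi> y)" if xy: "x \<in> S" "y \<in> S" for x y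
  proof -
    have "h x y = h (q x + p x) (q y + p y)" using decomp xy by metis
    also have "\<dots> = h (p x) (p y)" using hq qS pS by (simp add: h_add h_add_left)
    also have "\<dots> = (\<Sum>i<m. \<Sum>j<m. \<sigma> (representation B x (c i)) * h (c i) (c j) * representation B y (c j))"
      unfolding p_def h_sum(2) by (simp add: h_sum h_scale h_scale_left sum_distrib_left mult_ac)
    also have "\<dots> = gram_form \<sigma> G (\<pi> x) (\<pi> y)"
      by (subst gram_form_sum[OF Gc]) (auto simp: \<pi>_def G_def)
    finally show ?thesis .
  qed
  have hom: "\<pi> \<in> LinearCombinations.module_hom class_ring (mrec s S) (coord_space m)"
    unfolding module_hom_coord_iff mrec_simps
    using B(3,4) by (auto simp: \<pi>_def representation_add representation_scale subset_iff)
  define lift where "lift v = (\<Sum>j<m. s (v $ j) (c j))" for v :: "'k vec"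
  have liftS: "lift v \<in> S" for v
    unfolding lift_def using cS S(1) unfolding vsub_iff by (intro subspace_sum subspace_scale) auto
  have \<pi>lift: "\<pi> (lift v) = v" if v: "v \<in> carrier_vec m" for v
  proof (rule eq_vecI)
    fix i assume "i < dim_vec v"
    then have i: "i < m" using v by simp
    have sp: "s (v $ j) (c j) \<in> span B" if "j \<in> {..<m}" for j
      using cB[of j] that by (intro span_scale span_base) auto
    have "representation B (lift v) (c i) = (\<Sum>j<m. representation B (s (v $ j) (c j)) (c i))"
      unfolding lift_def by (subst representation_sum[OF B(3) sp]) auto
    also have "\<dots> = (\<Sum>j<m. if j = i then v $ i else 0)"
    proof (rule sum.cong[OF refl])
      fix j assume j: "j \<in> {..<m}"
      have "representation B (s (v $ j) (c j)) (c i) = v $ j * representation B (c j) (c i)"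
        using cB[of j] j by (subst representation_scale[OF B(3)]) (auto intro: span_base)
      also have "\<dots> = (if j = i then v $ i else 0)"
        using cB[of j] j i cinj[of i j] by (subst representation_basis[OF B(3)]) auto
      finally show "representation B (s (v $ j) (c j)) (c i) = (if j = i then v $ i else 0)" .
    qed
    finally show "\<pi> (lift v) $ i = v $ i" using i by (simp add: \<pi>_def)
  qed (use v in \<open>simp add: \<pi>_def\<close>)
  have surj: "\<pi> ` S = carrier_vec m"
  proof
    show "\<pi> ` S \<subseteq> carrier_vec m" by (auto simp: \<pi>_def)
    show "carrier_vec m \<subseteq> \<pi> ` S" using \<pi>lift liftS by (metis imageI subsetI)
  qed
  have "hermitian_mat G"
    unfolding hermitian_mat_def
  proof (intro conjI allI impI)
    fix i j assume "i < dim_row G" "j < dim_row G"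
    then show "G $$ (j, i) = \<sigma> (G $$ (i, j))"
      using h_swap[of "c j" "c i"] unfolding hermitian by (simp add: G_def)
  qed (simp add: G_def)
  moreover have "nondegenerate (coord_space m) (gram_form \<sigma> G)"
  proof -
    have "u = 0\<^sub>v m" if u: "u \<in> carrier_vec m" "\<forall>w\<in>carrier_vec m. gram_form \<sigma> G u w = 0" for u
    proof -
      have "h (lift u) z = 0" if "z \<in> S" for z
        using gram[OF liftS that] \<pi>lift[OF u(1)] u(2) surj that by auto
      then have "lift u \<in> R" using liftS h_eq_0_swap by (auto simp: R_def perp_def)
      then have "lift u \<in> span BR" using BR(3) by blast
      then have "representation B (lift u) (c j) = 0" if "j < m" for j
        using representation_zero_outside[OF B(3,1)] cB[OF that] by blast
      then have "\<pi> (lift u) = 0\<^sub>v m" by (auto simp: \<pi>_def)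
      then show ?thesis using \<pi>lift[OF u(1)] by simp
    qed
    moreover have "gram_form \<sigma> G (0\<^sub>v m) w = 0" if "w \<in> carrier_vec m" for w
      using that by (simp add: gram_form_sum[OF Gc])
    ultimately show ?thesis unfolding nondegenerate_def orth_def by auto
  qed
  ultimately have "G \<in> hermitian_mats \<sigma>"
    using hermitian_space_iff[OF Gc] by (simp add: hermitian_mats_def G_def)
  then show ?thesis
    unfolding witt_rep_def using hom surj gram by (intro exI[of _ G]) (auto simp: G_def)
qed

end

section \<open>Coordinate spaces of functions and their products\<close>

definition fscale :: "'k::field \<Rightarrow> ('i \<Rightarrow> 'k) \<Rightarrow> 'i \<Rightarrow> 'k" where
  "fscale c f = (\<lambda>i. c * f i)"

lemma fscale_apply [simp]: "fscale c f i = c * f i"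
  by (simp add: fscale_def)

lemma vector_space_fscale: "Vector_Spaces.vector_space (fscale :: 'k::field \<Rightarrow> ('i \<Rightarrow> 'k) \<Rightarrow> 'i \<Rightarrow> 'k)"
  by unfold_locales (auto simp: algebra_simps fun_eq_iff)

text \<open>Coordinate vectors are represented by functions supported on an initial segment, so that
  they live in an additive group.\<close>

definition fun_space :: "nat \<Rightarrow> (nat \<Rightarrow> 'k::field) set" where
  "fun_space n = {f. \<forall>i\<ge>n. f i = 0}"

definition of_vec :: "'k::field vec \<Rightarrow> nat \<Rightarrow> 'k" where
  "of_vec v = (\<lambda>i. if i < dim_vec v then v $ i else 0)"

lemma of_vec_fun_space: "v \<in> carrier_vec n \<Longrightarrow> of_vec v \<in> fun_space n"
  by (auto simp: of_vec_def fun_space_def)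

lemma vec_of_vec [simp]: "v \<in> carrier_vec n \<Longrightarrow> vec n (of_vec v) = v"
  by (auto simp: of_vec_def)

lemma of_vec_vec [simp]: "f \<in> fun_space n \<Longrightarrow> of_vec (vec n f) = f"
  by (auto simp: of_vec_def fun_space_def)

lemma vec_fun_add: "vec n (f + g) = vec n f + vec n g"
  and vec_fun_scale: "vec n (fscale c f) = c \<cdot>\<^sub>v vec n f"
  by auto

lemma vec_fun_zero: "vec n (0 :: nat \<Rightarrow> 'k::field) = 0\<^sub>v n"
  by auto

lemma vsub_fun_space: "vsub fscale (fun_space n)"
  by (auto simp: vsub_def fun_space_def)

context involutive_field
begin

text \<open>Total on all functions: coordinates beyond the size of G are ignored, so that
  non-degeneracy is meaningful on \<open>fun_space\<close> only.\<close>

definition gform :: "'k mat \<Rightarrow> (nat \<Rightarrow> 'k) \<Rightarrow> (nat \<Rightarrow> 'k) \<Rightarrow> 'k" where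
  "gform G f g = gram_form \<sigma> G (vec (dim_row G) f) (vec (dim_col G) g)"

lemma gform_sum: "gform G f g = (\<Sum>i<dim_row G. \<Sum>j<dim_col G. \<sigma> (f i) * G $$ (i, j) * g j)"
  unfolding gform_def by (subst gram_form_sum) auto

lemma form_space_gform:
  assumes "G \<in> carrier_mat n n" "\<And>i j. i < n \<Longrightarrow> j < n \<Longrightarrow> G $$ (j, i) = \<epsilon> * \<sigma> (G $$ (i, j))"
  shows "form_space \<sigma> fscale (gform G) \<epsilon>"
proof -
  interpret V: Vector_Spaces.vector_space "fscale :: 'k \<Rightarrow> (nat \<Rightarrow> 'k) \<Rightarrow> nat \<Rightarrow> 'k" by (rule vector_space_fscale)
  show ?thesis
  proof (unfold_locales)
    fix x y z :: "nat \<Rightarrow> 'k" and c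
    show "gform G x (y + z) = gform G x y + gform G x z"
      by (simp add: gform_sum algebra_simps sum.distrib)
    show "gform G x (fscale c y) = c * gform G x y"
      by (simp add: gform_sum algebra_simps sum_distrib_left)
    have "\<epsilon> * \<sigma> (gform G x y) = (\<Sum>i<n. \<Sum>j<n. x i * (\<epsilon> * \<sigma> (G $$ (i, j))) * \<sigma> (y j))"
      using assms(1) by (simp add: gform_sum hom_sum hom_mult sum_distrib_left mult_ac)
    also have "\<dots> = (\<Sum>i<n. \<Sum>j<n. x i * G $$ (j, i) * \<sigma> (y j))"
      by (rule sum.cong[OF refl], rule sum.cong[OF refl]) (simp only: assms(2)[symmetric] lessThan_iff)
    also have "\<dots> = (\<Sum>j<n. \<Sum>i<n. x i * G $$ (j, i) * \<sigma> (y j))" by (rule sum.swap)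
    also have "\<dots> = gform G y x"
      using assms(1) by (simp add: gform_sum mult_ac)
    finally show "gform G y x = \<epsilon> * \<sigma> (gform G x y)" ..
  qed
qed

end

lemma fin_spanned_fun_space: "fin_spanned fscale (fun_space n :: (nat \<Rightarrow> 'k::field) set)"
proof -
  interpret V: Vector_Spaces.vector_space "fscale :: 'k \<Rightarrow> (nat \<Rightarrow> 'k) \<Rightarrow> nat \<Rightarrow> 'k" by (rule vector_space_fscale)
  define d :: "nat \<Rightarrow> nat \<Rightarrow> 'k" where "d i = (\<lambda>j. if j = i then 1 else 0)" for i
  have "f \<in> V.span (d ` {..<n})" if f: "f \<in> fun_space n" for f
  proof -
    have eq: "(\<Sum>i\<in>A. fscale (f i) (d i)) j = (\<Sum>i\<in>A. fscale (f i) (d i) j)" if "finite A" for A j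
      using that by induction auto
    have "f = (\<Sum>i<n. fscale (f i) (d i))"
    proof
      fix j
      have "(\<Sum>i<n. fscale (f i) (d i)) j = (\<Sum>i<n. if i = j then f j else 0)"
        unfolding eq[OF finite_lessThan] by (rule sum.cong) (auto simp: d_def)
      then show "f j = (\<Sum>i<n. fscale (f i) (d i)) j" using f by (simp add: fun_space_def)
    qed
    moreover have "(\<Sum>i<n. fscale (f i) (d i)) \<in> V.span (d ` {..<n})"
      by (intro V.span_sum V.span_scale V.span_base) auto
    ultimately show ?thesis by simp
  qed
  then show ?thesis unfolding fin_spanned_def by (intro exI[of _ "d ` {..<n}"]) auto
qed

lemma fin_spanned_mono: "fin_spanned s S \<Longrightarrow> T \<subseteq> S \<Longrightarrow> fin_spanned s T"
  unfolding fin_spanned_def by blast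

definition pscale :: "('k::field \<Rightarrow> 'v \<Rightarrow> 'v) \<Rightarrow> ('k \<Rightarrow> 'w \<Rightarrow> 'w) \<Rightarrow> 'k \<Rightarrow> 'v \<times> 'w \<Rightarrow> 'v \<times> 'w" where
  "pscale s1 s2 c x = (s1 c (fst x), s2 c (snd x))"

lemma pscale_Pair [simp]: "pscale s1 s2 c (x, y) = (s1 c x, s2 c y)"
  by (simp add: pscale_def)

lemma vector_space_pscale:
  assumes "Vector_Spaces.vector_space s1" "Vector_Spaces.vector_space s2"
  shows "Vector_Spaces.vector_space (pscale s1 s2)"
proof -
  interpret I1: Vector_Spaces.vector_space s1 by (rule assms)
  interpret I2: Vector_Spaces.vector_space s2 by (rule assms)
  show ?thesis
    by unfold_locales
      (auto simp: pscale_def I1.scale_right_distrib I2.scale_right_distrib I1.scale_left_distrib I2.scale_left_distrib)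
qed

lemma vsub_Times: "vsub s1 S1 \<Longrightarrow> vsub s2 S2 \<Longrightarrow> vsub (pscale s1 s2) (S1 \<times> S2)"
  by (auto simp: vsub_def zero_prod_def)

lemma fin_spanned_Times:
  assumes vs: "Vector_Spaces.vector_space s1" "Vector_Spaces.vector_space s2"
    and "fin_spanned s1 S1" "fin_spanned s2 S2"
  shows "fin_spanned (pscale s1 s2) (S1 \<times> S2)"
proof -
  interpret I1: Vector_Spaces.vector_space s1 by (rule vs)
  interpret I2: Vector_Spaces.vector_space s2 by (rule vs)
  interpret P: Vector_Spaces.vector_space "pscale s1 s2" by (rule vector_space_pscale[OF vs])
  obtain B1 B2 where B: "finite B1" "S1 \<subseteq> I1.span B1" "finite B2" "S2 \<subseteq> I2.span B2"
    using assms unfolding fin_spanned_def by blast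
  define B where "B = (\<lambda>x. (x, 0)) ` B1 \<union> (\<lambda>y. (0, y)) ` B2"
  have "I1.subspace {x. (x, 0) \<in> P.span B}"
    unfolding I1.subspace_def
  proof (intro conjI ballI allI)
    show "0 \<in> {x. (x, 0) \<in> P.span B}" using P.span_zero by (simp add: zero_prod_def)
    fix x assume x: "x \<in> {x. (x, 0) \<in> P.span B}"
    show "s1 c x \<in> {x. (x, 0) \<in> P.span B}" for c using P.span_scale[of "(x, 0)" B c] x by simp
    fix y assume "y \<in> {x. (x, 0) \<in> P.span B}"
    then show "x + y \<in> {x. (x, 0) \<in> P.span B}" using P.span_add[of "(x, 0)" B "(y, 0)"] x by simp
  qed
  moreover have "B1 \<subseteq> {x. (x, 0) \<in> P.span B}" by (auto simp: B_def intro: P.span_base)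
  ultimately have l: "I1.span B1 \<subseteq> {x. (x, 0) \<in> P.span B}" by (rule I1.span_minimal[rotated])
  have "I2.subspace {x. (0, x) \<in> P.span B}"
    unfolding I2.subspace_def
  proof (intro conjI ballI allI)
    show "0 \<in> {x. (0, x) \<in> P.span B}" using P.span_zero by (simp add: zero_prod_def)
    fix x assume x: "x \<in> {x. (0, x) \<in> P.span B}"
    show "s2 c x \<in> {x. (0, x) \<in> P.span B}" for c using P.span_scale[of "(0, x)" B c] x by simp
    fix y assume "y \<in> {x. (0, x) \<in> P.span B}"
    then show "x + y \<in> {x. (0, x) \<in> P.span B}" using P.span_add[of "(0, x)" B "(0, y)"] x by simp
  qed
  moreover have "B2 \<subseteq> {x. (0, x) \<in> P.span B}" by (auto simp: B_def intro: P.span_base)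
  ultimately have r: "I2.span B2 \<subseteq> {x. (0, x) \<in> P.span B}" by (rule I2.span_minimal[rotated])
  have "(x, y) \<in> P.span B" if "x \<in> S1" "y \<in> S2" for x y
    using P.span_add[of "(x, 0)" B "(0, y)"] l r that B by auto
  then show ?thesis unfolding fin_spanned_def using B by (intro exI[of _ B]) (auto simp: B_def)
qed

section \<open>Witt reduction in characteristic different from 2\<close>

locale witt_field = involutive_field +
  assumes two_neq_0: "(2 :: 'a) \<noteq> 0"
begin

lemma form_space_hermitian_mats:
  assumes "G \<in> hermitian_mats \<sigma>"
  shows "form_space \<sigma> fscale (gform G) 1"
proof (rule form_space_gform[OF hermitian_mats_carrier[OF assms]])
  have "hermitian_mat G" using assms hermitian_mats_iff by blast
  then show "G $$ (j, i) = 1 * \<sigma> (G $$ (i, j))" if "i < dim_row G" "j < dim_row G" for i j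
    unfolding hermitian_mat_def mult_1 using that by blast
qed

text \<open>Carries the lagrangian complement from functions over to the coordinate vectors for
  which \<open>hyperbolic\<close> is required.\<close>

lemma metabolic_hyperbolic:
  assumes G: "G \<in> hermitian_mats \<sigma>"
    and L: "vsub fscale L" "L = form_space.perp (gform G) (fun_space (dim_row G)) L"
  shows "hyperbolic (coord_space (dim_row G)) (gram_form \<sigma> G)"
proof -
  let ?n = "dim_row G"
  interpret F: form_space \<sigma> fscale "gform G" 1 by (rule form_space_hermitian_mats[OF G])
  have Gc: "dim_col G = ?n" using hermitian_matsD[OF G] by simp
  have nd: "x = 0" if x: "x \<in> fun_space ?n" "\<forall>z\<in>fun_space ?n. gform G z x = 0" for x
  proof -
    have "vec ?n x = 0\<^sub>v ?n"
    proof (rule gram_form_nondegenerate[OF G])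
      fix w :: "'a vec" assume w: "w \<in> carrier_vec ?n"
      have "gform G x (of_vec w) = 0" using x of_vec_fun_space[OF w] F.h_eq_0_swap by blast
      then have "gram_form \<sigma> G (vec ?n x) w = 0" using w by (simp add: gform_def Gc)
      then show "gram_form \<sigma> G (vec ?n x) w = gram_form \<sigma> G (0\<^sub>v ?n) w"
        using w by (simp add: gram_form_sum[OF hermitian_mats_carrier[OF G] zero_carrier_vec])
    qed auto
    then have "of_vec (vec ?n x) = of_vec (0\<^sub>v ?n)" by simp
    moreover have "of_vec (0\<^sub>v ?n) = (0 :: nat \<Rightarrow> 'a)" by (auto simp: of_vec_def)
    ultimately show "x = 0" using of_vec_vec[OF x(1)] by simp
  qed
  obtain L' where L': "vsub fscale L'" "L' = F.perp (fun_space ?n) L'" "L \<inter> L' = {0}"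
    "{a + b | a b. a \<in> L \<and> b \<in> L'} = fun_space ?n"
    using F.metabolic_complement[OF vsub_fun_space fin_spanned_fun_space nd refl two_neq_0 L] by blast
  have lagr: "lagrangian (coord_space ?n) (gram_form \<sigma> G) (vec ?n ` M)"
    if M: "vsub fscale M" "M = F.perp (fun_space ?n) M" for M
    unfolding lagrangian_def
  proof
    show "submodule class_ring (vec ?n ` M) (coord_space ?n)"
    proof (rule submodule.intro)
      show "Module.module class_ring (coord_space ?n :: ('a, 'a vec) module)"
        unfolding coord_space_def by (rule vec_module)
      show "\<zero>\<^bsub>coord_space ?n\<^esub> \<in> vec ?n ` M"
        using M(1) vec_fun_zero[of ?n] unfolding vsub_def zero_coord_space by (metis imageI)
      show "v \<oplus>\<^bsub>coord_space ?n\<^esub> w \<in> vec ?n ` M" if "v \<in> vec ?n ` M" "w \<in> vec ?n ` M" for v w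
        using M(1) that unfolding vsub_def add_coord_space by (auto simp flip: vec_fun_add)
      show "c \<odot>\<^bsub>coord_space ?n\<^esub> v \<in> vec ?n ` M" if "c \<in> carrier class_ring" "v \<in> vec ?n ` M" for c v
        using M(1) that unfolding vsub_def smult_coord_space by (auto simp flip: vec_fun_scale)
    qed auto
    show "vec ?n ` M = orth (coord_space ?n) (gram_form \<sigma> G) (vec ?n ` M)"
    proof
      show "vec ?n ` M \<subseteq> orth (coord_space ?n) (gram_form \<sigma> G) (vec ?n ` M)"
      proof
        fix v assume "v \<in> vec ?n ` M"
        then obtain x where x: "x \<in> M" "v = vec ?n x" by blast
        have "gform G x y = 0" if "y \<in> M" for y
          using M(2) x(1) that unfolding F.perp_def by blast
        then show "v \<in> orth (coord_space ?n) (gram_form \<sigma> G) (vec ?n ` M)"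
          using x(2) by (auto simp: orth_def gform_def Gc)
      qed
      show "orth (coord_space ?n) (gram_form \<sigma> G) (vec ?n ` M) \<subseteq> vec ?n ` M"
      proof
        fix v assume "v \<in> orth (coord_space ?n) (gram_form \<sigma> G) (vec ?n ` M)"
        then have v: "v \<in> carrier_vec ?n" "\<And>x. x \<in> M \<Longrightarrow> gram_form \<sigma> G v (vec ?n x) = 0"
          by (auto simp: orth_def)
        have "gform G x (of_vec v) = 0" if "x \<in> M" for x
          by (rule F.h_eq_0_swap) (use v(2)[OF that] v(1) in \<open>simp add: gform_def Gc\<close>)
        then have "of_vec v \<in> M" using of_vec_fun_space[OF v(1)] by (subst M(2)) (simp add: F.perp_def)
        then show "v \<in> vec ?n ` M" using v(1) by (metis imageI vec_of_vec)
      qed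
    qed
  qed
  have sub: "L \<subseteq> fun_space ?n" "L' \<subseteq> fun_space ?n"
    using L(2) L'(2) unfolding F.perp_def by blast+
  have "vec ?n ` L \<inter> vec ?n ` L' = {0\<^sub>v ?n}"
  proof
    show "vec ?n ` L \<inter> vec ?n ` L' \<subseteq> {0\<^sub>v ?n}"
    proof
      fix v assume "v \<in> vec ?n ` L \<inter> vec ?n ` L'"
      then obtain x y where xy: "x \<in> L" "y \<in> L'" "v = vec ?n x" "v = vec ?n y" by blast
      then have "x = y" using sub of_vec_vec by (metis subsetD)
      then have "x = 0" using L'(3) xy by blast
      then show "v \<in> {0\<^sub>v ?n}" using xy vec_fun_zero by simp
    qed
    have "0 \<in> L" "0 \<in> L'" using L(1) L'(1) by (simp_all add: vsub_def)
    then show "{0\<^sub>v ?n} \<subseteq> vec ?n ` L \<inter> vec ?n ` L'" using vec_fun_zero[of ?n] by (metis IntI image_eqI empty_subsetI insert_subset)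
  qed
  moreover have "vec ?n ` L <+>\<^bsub>coord_space ?n\<^esub> vec ?n ` L' = carrier_vec ?n"
  proof
    show "vec ?n ` L <+>\<^bsub>coord_space ?n\<^esub> vec ?n ` L' \<subseteq> carrier_vec ?n"
      by (auto simp: set_add_def')
    show "carrier_vec ?n \<subseteq> vec ?n ` L <+>\<^bsub>coord_space ?n\<^esub> vec ?n ` L'"
    proof
      fix v :: "'a vec" assume v: "v \<in> carrier_vec ?n"
      then obtain a b where ab: "of_vec v = a + b" "a \<in> L" "b \<in> L'"
        using of_vec_fun_space[OF v] L'(4) by blast
      then have "v = vec ?n a + vec ?n b" using vec_of_vec[OF v] vec_fun_add[of ?n a b] by simp
      then show "v \<in> vec ?n ` L <+>\<^bsub>coord_space ?n\<^esub> vec ?n ` L'"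
        unfolding set_add_def' add_coord_space using ab by blast
    qed
  qed
  ultimately show ?thesis
    unfolding hyperbolic_def zero_coord_space carrier_coord_space
    using lagr[OF L] lagr[OF L'(1,2)] by blast
qed

text \<open>The hypothesis \<open>max\<close> says that the orthogonal of L is contained in L plus
  the kernel, membership in the kernel being expressed by equal pairings. It makes the image of L in
  K^n equal to its own orthogonal, so that G is hyperbolic.\<close>

lemma witt_rep_metabolic:
  fixes V :: "('a, 'v) module"
  assumes rep: "witt_rep V H G" and L: "L \<subseteq> carrier V" "L \<noteq> {}"
    and Ladd: "\<And>x y. x \<in> L \<Longrightarrow> y \<in> L \<Longrightarrow> x \<oplus>\<^bsub>V\<^esub> y \<in> L" and Lsmult: "\<And>c x. x \<in> L \<Longrightarrow> c \<odot>\<^bsub>V\<^esub> x \<in> L"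
    and iso: "\<And>x y. x \<in> L \<Longrightarrow> y \<in> L \<Longrightarrow> H x y = 0"
    and max: "\<And>x. x \<in> carrier V \<Longrightarrow> \<forall>l\<in>L. H l x = 0 \<Longrightarrow> \<exists>l\<in>L. \<forall>z\<in>carrier V. H z x = H z l"
  shows "WC G = \<zero>\<^bsub>\<W>\<^esub>"
proof -
  let ?n = "dim_row G"
  obtain \<pi> where G: "G \<in> hermitian_mats \<sigma>" and \<pi>: "\<forall>x\<in>carrier V. \<pi> x \<in> carrier_vec ?n"
     "\<forall>x\<in>carrier V. \<forall>y\<in>carrier V. \<pi> (x \<oplus>\<^bsub>V\<^esub> y) = \<pi> x + \<pi> y"
     "\<forall>c. \<forall>x\<in>carrier V. \<pi> (c \<odot>\<^bsub>V\<^esub> x) = c \<cdot>\<^sub>v \<pi> x"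
    "\<pi> ` carrier V = carrier_vec ?n"
    "\<forall>x\<in>carrier V. \<forall>y\<in>carrier V. H x y = gram_form \<sigma> G (\<pi> x) (\<pi> y)"
    using rep by (rule witt_repE)
  interpret F: form_space \<sigma> fscale "gform G" 1 by (rule form_space_hermitian_mats[OF G])
  have Gc: "dim_col G = ?n" using hermitian_matsD[OF G] by simp
  have gh: "gform G f g = H x y" if "x \<in> carrier V" "y \<in> carrier V" "vec ?n f = \<pi> x" "vec ?n g = \<pi> y" for f g x y
    using \<pi>(5) that by (simp add: gform_def Gc)
  have fs: "vsub fscale (fun_space ?n :: (nat \<Rightarrow> 'a) set)" by (rule vsub_fun_space)
  define \<Lambda> where "\<Lambda> = {f \<in> fun_space ?n. vec ?n f \<in> \<pi> ` L}"
  have lift: "of_vec (\<pi> l) \<in> \<Lambda>" "vec ?n (of_vec (\<pi> l)) = \<pi> l" if "l \<in> L" for l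
    using that \<pi>(1) L(1) of_vec_fun_space by (auto simp: \<Lambda>_def)
  have "vsub fscale \<Lambda>"
    unfolding vsub_def
  proof (intro conjI ballI allI)
    obtain l where l: "l \<in> L" using L(2) by blast
    then have "\<pi> (0 \<odot>\<^bsub>V\<^esub> l) = 0 \<cdot>\<^sub>v \<pi> l" using \<pi>(3) L(1) by blast
    also have "\<dots> = 0\<^sub>v ?n"
    proof -
      have "\<pi> l \<in> carrier_vec ?n" using \<pi>(1) l L(1) by blast
      then show ?thesis by (intro eq_vecI) auto
    qed
    finally have "0\<^sub>v ?n \<in> \<pi> ` L" using Lsmult[OF l] by (metis imageI)
    then show "0 \<in> \<Lambda>" unfolding \<Lambda>_def using fs by (simp add: vec_fun_zero vsub_def)
    fix f assume "f \<in> \<Lambda>"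
    then obtain x where f: "f \<in> fun_space ?n" "vec ?n f = \<pi> x" "x \<in> L" unfolding \<Lambda>_def by blast
    have "vec ?n (fscale c f) = \<pi> (c \<odot>\<^bsub>V\<^esub> x)" for c
      unfolding vec_fun_scale f(2) using \<pi>(3) f(3) L(1) by auto
    then show "fscale c f \<in> \<Lambda>" for c
      unfolding \<Lambda>_def using f Lsmult fs by (auto simp: vsub_def)
    fix g assume "g \<in> \<Lambda>"
    then obtain y where g: "g \<in> fun_space ?n" "vec ?n g = \<pi> y" "y \<in> L" unfolding \<Lambda>_def by blast
    have "vec ?n (f + g) = \<pi> (x \<oplus>\<^bsub>V\<^esub> y)"
      unfolding vec_fun_add f(2) g(2) using \<pi>(2) f(3) g(3) L(1) by (metis subsetD)
    then show "f + g \<in> \<Lambda>"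
      unfolding \<Lambda>_def using f g Ladd fs by (auto simp: vsub_def)
  qed
  moreover have "\<Lambda> = F.perp (fun_space ?n) \<Lambda>"
  proof
    show "\<Lambda> \<subseteq> F.perp (fun_space ?n) \<Lambda>"
    proof
      fix f assume f: "f \<in> \<Lambda>"
      then obtain x where x: "x \<in> L" "vec ?n f = \<pi> x" by (auto simp: \<Lambda>_def)
      have "gform G g f = 0" if gL: "g \<in> \<Lambda>" for g
      proof -
        obtain y where "y \<in> L" "vec ?n g = \<pi> y" using gL unfolding \<Lambda>_def by blast
        then show ?thesis using gh[of y x g f] iso[of y x] x L(1) by (simp add: subset_iff)
      qed
      then show "f \<in> F.perp (fun_space ?n) \<Lambda>" using f by (auto simp: F.perp_def \<Lambda>_def)
    qed
    show "F.perp (fun_space ?n) \<Lambda> \<subseteq> \<Lambda>"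
    proof
      fix f assume "f \<in> F.perp (fun_space ?n) \<Lambda>"
      then have f: "f \<in> fun_space ?n" "\<And>g. g \<in> \<Lambda> \<Longrightarrow> gform G g f = 0" by (auto simp: F.perp_def)
      have "vec ?n f \<in> carrier_vec ?n" by simp
      then obtain x where x: "x \<in> carrier V" "vec ?n f = \<pi> x" using \<pi>(4) by (metis imageE)
      have "H l x = 0" if l: "l \<in> L" for l
        using gh[OF subsetD[OF L(1) l] x(1) lift(2)[OF l] x(2)] f(2)[OF lift(1)[OF l]] by simp
      then obtain l where l: "l \<in> L" "\<forall>z\<in>carrier V. H z x = H z l" using max[OF x(1)] by blast
      have lV: "l \<in> carrier V" using l(1) L(1) by blast
      have "\<pi> x = \<pi> l"
      proof (rule gram_form_nondegenerate[OF G])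
        fix w :: "'a vec" assume w: "w \<in> carrier_vec ?n"
        then obtain z where z: "z \<in> carrier V" "w = \<pi> z" using \<pi>(4) by blast
        have c: "\<pi> x \<in> carrier_vec ?n" "\<pi> l \<in> carrier_vec ?n" using \<pi>(1) x(1) lV by auto
        have hm: "hermitian_mat G" using G hermitian_mats_iff by blast
        have "gram_form \<sigma> G w (\<pi> x) = gram_form \<sigma> G w (\<pi> l)"
          using l(2) \<pi>(5) z x(1) lV by metis
        then show "gram_form \<sigma> G (\<pi> x) w = gram_form \<sigma> G (\<pi> l) w"
          using hermitian_matD[OF hm hermitian_mats_carrier[OF G] w c(1)]
            hermitian_matD[OF hm hermitian_mats_carrier[OF G] w c(2)] by simp
      qed (use \<pi>(1) x(1) lV in auto)
      then show "f \<in> \<Lambda>" using f(1) x(2) l(1) by (auto simp: \<Lambda>_def)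
    qed
  qed
  ultimately show ?thesis by (intro WC_hyperbolic[OF G] metabolic_hyperbolic[OF G])
qed

lemma witt_rep_sum:
  fixes V1 :: "('a, 'v) module" and V2 :: "('a, 'w) module"
  assumes 1: "witt_rep V1 H1 G1" and 2: "witt_rep V2 H2 G2"
  shows "witt_rep (direct_sum V1 V2) (\<lambda>x y. H1 (fst x) (fst y) + H2 (snd x) (snd y)) (mat_sum G1 G2)"
proof -
  let ?m = "dim_row G1" and ?n = "dim_row G2"
  obtain \<pi>1 where G1: "G1 \<in> hermitian_mats \<sigma>" and \<pi>1: "\<forall>x\<in>carrier V1. \<pi>1 x \<in> carrier_vec ?m"
     "\<forall>x\<in>carrier V1. \<forall>y\<in>carrier V1. \<pi>1 (x \<oplus>\<^bsub>V1\<^esub> y) = \<pi>1 x + \<pi>1 y"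
     "\<forall>c. \<forall>x\<in>carrier V1. \<pi>1 (c \<odot>\<^bsub>V1\<^esub> x) = c \<cdot>\<^sub>v \<pi>1 x"
    "\<pi>1 ` carrier V1 = carrier_vec ?m"
    "\<forall>x\<in>carrier V1. \<forall>y\<in>carrier V1. H1 x y = gram_form \<sigma> G1 (\<pi>1 x) (\<pi>1 y)"
    using 1 by (rule witt_repE)
  obtain \<pi>2 where G2: "G2 \<in> hermitian_mats \<sigma>" and \<pi>2: "\<forall>x\<in>carrier V2. \<pi>2 x \<in> carrier_vec ?n"
     "\<forall>x\<in>carrier V2. \<forall>y\<in>carrier V2. \<pi>2 (x \<oplus>\<^bsub>V2\<^esub> y) = \<pi>2 x + \<pi>2 y"
     "\<forall>c. \<forall>x\<in>carrier V2. \<pi>2 (c \<odot>\<^bsub>V2\<^esub> x) = c \<cdot>\<^sub>v \<pi>2 x"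
    "\<pi>2 ` carrier V2 = carrier_vec ?n"
    "\<forall>x\<in>carrier V2. \<forall>y\<in>carrier V2. H2 x y = gram_form \<sigma> G2 (\<pi>2 x) (\<pi>2 y)"
    using 2 by (rule witt_repE)
  note c1 = hermitian_mats_carrier[OF G1] and c2 = hermitian_mats_carrier[OF G2]
  note c12 = mat_sum_carrier[OF c1 c2]
  have dim: "dim_row (mat_sum G1 G2) = ?m + ?n" by (rule carrier_matD(1)[OF c12])
  define \<pi> where "\<pi> x = \<pi>1 (fst x) @\<^sub>v \<pi>2 (snd x)" for x
  have gram: "gram_form \<sigma> (mat_sum G1 G2) (u @\<^sub>v u') (v @\<^sub>v v') = gram_form \<sigma> G1 u v + gram_form \<sigma> G2 u' v'"
    if u: "u \<in> carrier_vec ?m" "v \<in> carrier_vec ?m" and u': "u' \<in> carrier_vec ?n" "v' \<in> carrier_vec ?n" for u u' v v'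
  proof -
    have "mat_sum G1 G2 *\<^sub>v (v @\<^sub>v v') = (G1 *\<^sub>v v) @\<^sub>v (G2 *\<^sub>v v')"
      unfolding mat_sum_four_block carrier_matD(2)[OF c1] carrier_matD(2)[OF c2]
      by (rule mult_mat_vec_split[OF c1 c2 u(2) u'(2)])
    moreover have "map_vec \<sigma> (u @\<^sub>v u') = map_vec \<sigma> u @\<^sub>v map_vec \<sigma> u'" by auto
    ultimately show ?thesis
      unfolding gram_form_def
      by (simp only:)
        (rule scalar_prod_append[OF _ _ mult_mat_vec_carrier[OF c1 u(2)] mult_mat_vec_carrier[OF c2 u'(2)]],
          use u u' in simp_all)
  qed
  have "\<pi> \<in> LinearCombinations.module_hom class_ring (direct_sum V1 V2) (coord_space (?m + ?n))"
    unfolding module_hom_coord_iff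
  proof (intro conjI ballI allI)
    fix x assume x: "x \<in> carrier (direct_sum V1 V2)"
    then have x': "fst x \<in> carrier V1" "snd x \<in> carrier V2" by (auto simp: direct_sum_def)
    show "\<pi> x \<in> carrier_vec (?m + ?n)" unfolding \<pi>_def using \<pi>1(1) \<pi>2(1) x' by auto
    show "\<pi> (c \<odot>\<^bsub>direct_sum V1 V2\<^esub> x) = c \<cdot>\<^sub>v \<pi> x" for c
      using \<pi>1(3) \<pi>2(3) x' by (auto simp: \<pi>_def direct_sum_def intro!: eq_vecI)
    fix y assume y: "y \<in> carrier (direct_sum V1 V2)"
    then have y': "fst y \<in> carrier V1" "snd y \<in> carrier V2" by (auto simp: direct_sum_def)
    have "\<pi> (x \<oplus>\<^bsub>direct_sum V1 V2\<^esub> y) = (\<pi>1 (fst x) + \<pi>1 (fst y)) @\<^sub>v (\<pi>2 (snd x) + \<pi>2 (snd y))"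
      using \<pi>1(2) \<pi>2(2) x' y' by (simp add: \<pi>_def direct_sum_def)
    also have "\<dots> = \<pi> x + \<pi> y"
      unfolding \<pi>_def using \<pi>1(1) \<pi>2(1) x' y' by (intro append_vec_add[symmetric, of _ ?m _ _ ?n]) auto
    finally show "\<pi> (x \<oplus>\<^bsub>direct_sum V1 V2\<^esub> y) = \<pi> x + \<pi> y" .
  qed
  moreover have "\<pi> ` carrier (direct_sum V1 V2) = carrier_vec (?m + ?n)"
  proof
    show "\<pi> ` carrier (direct_sum V1 V2) \<subseteq> carrier_vec (?m + ?n)"
      using \<pi>1(1) \<pi>2(1) by (auto simp: \<pi>_def direct_sum_def)
    show "carrier_vec (?m + ?n) \<subseteq> \<pi> ` carrier (direct_sum V1 V2)"
    proof
      fix v :: "'a vec" assume "v \<in> carrier_vec (?m + ?n)"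
      then have v: "v = vec_first v ?m @\<^sub>v vec_last v ?n" by simp
      obtain x where x: "x \<in> carrier V1" "vec_first v ?m = \<pi>1 x" using \<pi>1(4) vec_first_carrier by (metis imageE)
      obtain y where y: "y \<in> carrier V2" "vec_last v ?n = \<pi>2 y" using \<pi>2(4) vec_last_carrier by (metis imageE)
      have "v = \<pi> (x, y)" using v x y by (simp add: \<pi>_def)
      then show "v \<in> \<pi> ` carrier (direct_sum V1 V2)" using x y by (auto simp: direct_sum_def)
    qed
  qed
  moreover have "H1 (fst x) (fst y) + H2 (snd x) (snd y) = gram_form \<sigma> (mat_sum G1 G2) (\<pi> x) (\<pi> y)"
    if "x \<in> carrier (direct_sum V1 V2)" "y \<in> carrier (direct_sum V1 V2)" for x y
    unfolding \<pi>_def using that \<pi>1(1,5) \<pi>2(1,5) by (auto simp: direct_sum_def gram)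
  ultimately show ?thesis
    unfolding witt_rep_def dim using hermitian_mats_closed(1)[OF G1 G2] by blast
qed

end

section \<open>A calculus of Witt classes\<close>

context witt_field
begin

definition wgood :: "('a, 'v) module \<Rightarrow> ('v \<Rightarrow> 'v \<Rightarrow> 'a) \<Rightarrow> bool" where
  "wgood V H \<longleftrightarrow> closed_space V \<and> (\<exists>G. witt_rep V H G)"

text \<open>In contrast to \<open>witt_class\<close> this is taken on the possibly degenerate space
  itself, before any quotient; \<open>wgood\<close> guarantees that a Gram matrix exists and that
  the choice among them does not matter.\<close>

definition wcl :: "('a, 'v) module \<Rightarrow> ('v \<Rightarrow> 'v \<Rightarrow> 'a) \<Rightarrow> ('a mat \<times> 'a mat) set set" where
  "wcl V H = WC (SOME G. witt_rep V H G)"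

lemma wcl_eq: "closed_space V \<Longrightarrow> witt_rep V H G \<Longrightarrow> wcl V H = WC G"
  unfolding wcl_def using someI[of "witt_rep V H" G] WC_eqI witt_rep_unique by blast

lemma wgoodI: "closed_space V \<Longrightarrow> witt_rep V H G \<Longrightarrow> wgood V H"
  unfolding wgood_def by blast

lemma wgoodE:
  assumes "wgood V H"
  obtains G where "closed_space V" "witt_rep V H G" "wcl V H = WC G" "G \<in> hermitian_mats \<sigma>"
proof -
  obtain G where "closed_space V" "witt_rep V H G" using assms unfolding wgood_def by blast
  moreover from this have "G \<in> hermitian_mats \<sigma>" unfolding witt_rep_def by blast
  ultimately show thesis using that wcl_eq by blast
qed

lemma wcl_carrier: "wgood V H \<Longrightarrow> wcl V H \<in> carrier \<W>"
  by (erule wgoodE) (simp add: WC_carrier)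

lemma wcl_pullback:
  assumes "wgood V H" "closed_space V'"
    and "\<And>x. x \<in> carrier V' \<Longrightarrow> f x \<in> carrier V"
    and "\<And>x y. x \<in> carrier V' \<Longrightarrow> y \<in> carrier V' \<Longrightarrow> f (x \<oplus>\<^bsub>V'\<^esub> y) = f x \<oplus>\<^bsub>V\<^esub> f y"
    and "\<And>c x. x \<in> carrier V' \<Longrightarrow> f (c \<odot>\<^bsub>V'\<^esub> x) = c \<odot>\<^bsub>V\<^esub> f x"
    and "\<And>y. y \<in> carrier V \<Longrightarrow> \<exists>x\<in>carrier V'. f x = y"
    and "\<And>x y. x \<in> carrier V' \<Longrightarrow> y \<in> carrier V' \<Longrightarrow> H' x y = H (f x) (f y)"
  shows "wgood V' H'" "wcl V' H' = wcl V H"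
proof -
  obtain G where G: "closed_space V" "witt_rep V H G" "wcl V H = WC G" by (rule wgoodE[OF assms(1)])
  have "witt_rep V' H' G" by (rule witt_rep_pullback[where f = f, OF G(2) assms(3-7)])
  then show "wgood V' H'" "wcl V' H' = wcl V H"
    using wgoodI wcl_eq G(3) assms(2) by metis+
qed

lemma closed_space_direct_sum: "closed_space V1 \<Longrightarrow> closed_space V2 \<Longrightarrow> closed_space (direct_sum V1 V2)"
  by (auto simp: closed_space_def direct_sum_def)

lemma wcl_sum:
  assumes "wgood V1 H1" "wgood V2 H2"
  shows "wgood (direct_sum V1 V2) (\<lambda>x y. H1 (fst x) (fst y) + H2 (snd x) (snd y))"
    "wcl (direct_sum V1 V2) (\<lambda>x y. H1 (fst x) (fst y) + H2 (snd x) (snd y)) = wcl V1 H1 \<oplus>\<^bsub>\<W>\<^esub> wcl V2 H2"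
proof -
  obtain G1 where 1: "closed_space V1" "witt_rep V1 H1 G1" "wcl V1 H1 = WC G1" "G1 \<in> hermitian_mats \<sigma>"
    by (rule wgoodE[OF assms(1)])
  obtain G2 where 2: "closed_space V2" "witt_rep V2 H2 G2" "wcl V2 H2 = WC G2" "G2 \<in> hermitian_mats \<sigma>"
    by (rule wgoodE[OF assms(2)])
  note c = closed_space_direct_sum[OF 1(1) 2(1)] and r = witt_rep_sum[OF 1(2) 2(2)]
  show "wgood (direct_sum V1 V2) (\<lambda>x y. H1 (fst x) (fst y) + H2 (snd x) (snd y))" by (rule wgoodI[OF c r])
  show "wcl (direct_sum V1 V2) (\<lambda>x y. H1 (fst x) (fst y) + H2 (snd x) (snd y)) = wcl V1 H1 \<oplus>\<^bsub>\<W>\<^esub> wcl V2 H2"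
    unfolding wcl_eq[OF c r] 1(3) 2(3) by (rule WC_sum[OF 1(4) 2(4)])
qed

lemma wcl_metabolic:
  assumes "wgood V H" "L \<subseteq> carrier V" "L \<noteq> {}"
    and "\<And>x y. x \<in> L \<Longrightarrow> y \<in> L \<Longrightarrow> x \<oplus>\<^bsub>V\<^esub> y \<in> L" "\<And>c x. x \<in> L \<Longrightarrow> c \<odot>\<^bsub>V\<^esub> x \<in> L"
    and "\<And>x y. x \<in> L \<Longrightarrow> y \<in> L \<Longrightarrow> H x y = 0"
    and "\<And>x. x \<in> carrier V \<Longrightarrow> \<forall>l\<in>L. H l x = 0 \<Longrightarrow> \<exists>l\<in>L. \<forall>z\<in>carrier V. H z x = H z l"
  shows "wcl V H = \<zero>\<^bsub>\<W>\<^esub>"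
proof -
  obtain G where G: "witt_rep V H G" "wcl V H = WC G" by (rule wgoodE[OF assms(1)])
  show ?thesis unfolding G(2) by (rule witt_rep_metabolic[OF G(1) assms(2-7)])
qed

lemma uminus_hermitian_mats:
  assumes "G \<in> hermitian_mats \<sigma>"
  shows "- G \<in> hermitian_mats \<sigma>"
proof -
  let ?n = "dim_row G"
  have h: "hermitian_mat G" and "\<exists>G'\<in>carrier_mat ?n ?n. G * G' = 1\<^sub>m ?n"
    using assms hermitian_mats_iff by blast+
  then obtain G' where G': "G' \<in> carrier_mat ?n ?n" "G * G' = 1\<^sub>m ?n" by blast
  note c = hermitian_mats_carrier[OF assms]
  have d: "dim_col G = ?n" by (rule carrier_matD(2)[OF c])
  have "- G * (- G') = G * G'"
  proof (rule eq_matI)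
    fix i j assume "i < dim_row (G * G')" "j < dim_col (G * G')"
    then show "(- G * (- G')) $$ (i, j) = (G * G') $$ (i, j)"
      using G'(1) d by (simp add: scalar_prod_def)
  qed auto
  moreover have "hermitian_mat (- G)"
    unfolding hermitian_mat_def
  proof (intro conjI allI impI)
    fix i j assume "i < dim_row (- G)" "j < dim_row (- G)"
    then have ij: "i < ?n" "j < ?n" by auto
    then have "G $$ (j, i) = \<sigma> (G $$ (i, j))" using h unfolding hermitian_mat_def by blast
    then show "(- G) $$ (j, i) = \<sigma> ((- G) $$ (i, j))" using ij d by (simp add: hom_uminus)
  qed (simp add: d)
  ultimately show ?thesis
    unfolding hermitian_mats_iff using G' by (auto intro!: bexI[of _ "- G'"])
qed

text \<open>The diagonal of V + (-V) is isotropic, and a pair orthogonal to it has components with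
  the same pairings; Witt reduction makes the sum of the two classes 0.\<close>

lemma wcl_uminus:
  assumes "wgood V H"
  shows "wgood V (\<lambda>x y. - H x y)" "wcl V (\<lambda>x y. - H x y) = \<ominus>\<^bsub>\<W>\<^esub> wcl V H"
proof -
  obtain G where G: "closed_space V" "witt_rep V H G" by (rule wgoodE[OF assms])
  obtain \<pi> where Gh: "G \<in> hermitian_mats \<sigma>" and \<pi>: "\<forall>x\<in>carrier V. \<pi> x \<in> carrier_vec (dim_row G)"
     "\<forall>x\<in>carrier V. \<forall>y\<in>carrier V. \<pi> (x \<oplus>\<^bsub>V\<^esub> y) = \<pi> x + \<pi> y"
     "\<forall>c. \<forall>x\<in>carrier V. \<pi> (c \<odot>\<^bsub>V\<^esub> x) = c \<cdot>\<^sub>v \<pi> x"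
    "\<pi> ` carrier V = carrier_vec (dim_row G)"
    "\<forall>x\<in>carrier V. \<forall>y\<in>carrier V. H x y = gram_form \<sigma> G (\<pi> x) (\<pi> y)"
    using G(2) by (rule witt_repE)
  note c = hermitian_mats_carrier[OF Gh]
  have d: "dim_col G = dim_row G" by (rule carrier_matD(2)[OF c])
  have c': "- G \<in> carrier_mat (dim_row G) (dim_row G)" by (rule uminus_carrier_mat[OF c])
  have "gram_form \<sigma> (- G) u v = - gram_form \<sigma> G u v" if "u \<in> carrier_vec (dim_row G)" "v \<in> carrier_vec (dim_row G)" for u v
    unfolding gram_form_sum[OF c that] gram_form_sum[OF c' that] by (simp add: sum_negf d)
  then have "witt_rep V (\<lambda>x y. - H x y) (- G)"
    unfolding witt_rep_def using uminus_hermitian_mats[OF Gh] \<pi>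
    by (intro conjI bexI[of _ \<pi>]) (simp_all add: module_hom_coord_iff)
  then show good: "wgood V (\<lambda>x y. - H x y)" by (rule wgoodI[OF G(1)])
  have "wcl (direct_sum V V) (\<lambda>x y. H (fst x) (fst y) + - H (snd x) (snd y)) = \<zero>\<^bsub>\<W>\<^esub>"
  proof (rule wcl_metabolic[OF wcl_sum(1)[OF assms good], where L = "{(x, x) | x. x \<in> carrier V}"])
    show "{(x, x) |x. x \<in> carrier V} \<subseteq> carrier (direct_sum V V)" by (auto simp: direct_sum_def)
    show "{(x, x) |x. x \<in> carrier V} \<noteq> {}" using G(1) by (auto simp: closed_space_def)
    show "x \<oplus>\<^bsub>direct_sum V V\<^esub> y \<in> {(x, x) |x. x \<in> carrier V}"
      if "x \<in> {(x, x) |x. x \<in> carrier V}" "y \<in> {(x, x) |x. x \<in> carrier V}" for x y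
      using that G(1) by (auto simp: direct_sum_def closed_space_def)
    show "c \<odot>\<^bsub>direct_sum V V\<^esub> x \<in> {(x, x) |x. x \<in> carrier V}"
      if "x \<in> {(x, x) |x. x \<in> carrier V}" for c x
      using that G(1) by (auto simp: direct_sum_def closed_space_def)
    show "H (fst x) (fst y) + - H (snd x) (snd y) = 0"
      if "x \<in> {(x, x) |x. x \<in> carrier V}" "y \<in> {(x, x) |x. x \<in> carrier V}" for x y
      using that by auto
    fix x assume x: "x \<in> carrier (direct_sum V V)"
      and orth: "\<forall>l\<in>{(x, x) |x. x \<in> carrier V}. H (fst l) (fst x) + - H (snd l) (snd x) = 0"
    obtain a b where ab: "x = (a, b)" "a \<in> carrier V" "b \<in> carrier V" using x by (auto simp: direct_sum_def)
    have "H z a = H z b" if "z \<in> carrier V" for z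
      using orth that ab(1) by auto
    then show "\<exists>l\<in>{(x, x) |x. x \<in> carrier V}. \<forall>z\<in>carrier (direct_sum V V).
        H (fst z) (fst x) + - H (snd z) (snd x) = H (fst z) (fst l) + - H (snd z) (snd l)"
      using ab by (intro bexI[of _ "(a, a)"]) (auto simp: direct_sum_def)
  qed
  then have "wcl V H \<oplus>\<^bsub>\<W>\<^esub> wcl V (\<lambda>x y. - H x y) = \<zero>\<^bsub>\<W>\<^esub>"
    unfolding wcl_sum(2)[OF assms good] .
  then show "wcl V (\<lambda>x y. - H x y) = \<ominus>\<^bsub>\<W>\<^esub> wcl V H"
    using wcl_carrier[OF assms] wcl_carrier[OF good] by (metis W.a_comm W.minus_equality)
qed

text \<open>A linear correspondence that preserves the forms is an isotropic subspace of V1 + (-V2);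
  \<open>max\<close> makes it its own orthogonal modulo the kernels, so the difference of the
  classes is 0. In the applications L is the graph of a linear map on a subspace of V1.\<close>

lemma wcl_eqI:
  fixes V1 :: "('a, 'v) module" and V2 :: "('a, 'w) module"
  assumes good: "wgood V1 H1" "wgood V2 H2" and L: "L \<subseteq> carrier V1 \<times> carrier V2" "L \<noteq> {}"
    and add: "\<And>x y x' y'. (x, y) \<in> L \<Longrightarrow> (x', y') \<in> L \<Longrightarrow> (x \<oplus>\<^bsub>V1\<^esub> x', y \<oplus>\<^bsub>V2\<^esub> y') \<in> L"
    and smult: "\<And>c x y. (x, y) \<in> L \<Longrightarrow> (c \<odot>\<^bsub>V1\<^esub> x, c \<odot>\<^bsub>V2\<^esub> y) \<in> L"
    and iso: "\<And>x y x' y'. (x, y) \<in> L \<Longrightarrow> (x', y') \<in> L \<Longrightarrow> H1 x x' = H2 y y'"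
    and max: "\<And>x y. x \<in> carrier V1 \<Longrightarrow> y \<in> carrier V2 \<Longrightarrow> (\<And>x' y'. (x', y') \<in> L \<Longrightarrow> H1 x' x = H2 y' y) \<Longrightarrow>
      \<exists>x0 y0. (x0, y0) \<in> L \<and> (\<forall>z\<in>carrier V1. H1 z x = H1 z x0) \<and> (\<forall>z\<in>carrier V2. H2 z y = H2 z y0)"
  shows "wcl V1 H1 = wcl V2 H2"
proof -
  note good' = wcl_uminus(1)[OF good(2)]
  have "wcl (direct_sum V1 V2) (\<lambda>x y. H1 (fst x) (fst y) + - H2 (snd x) (snd y)) = \<zero>\<^bsub>\<W>\<^esub>"
  proof (rule wcl_metabolic[OF wcl_sum(1)[OF good(1) good'], where L = L])
    show "L \<subseteq> carrier (direct_sum V1 V2)" using L by (auto simp: direct_sum_def)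
    show "x \<oplus>\<^bsub>direct_sum V1 V2\<^esub> y \<in> L" if "x \<in> L" "y \<in> L" for x y
      using add[of "fst x" "snd x" "fst y" "snd y"] that by (simp add: direct_sum_def)
    show "c \<odot>\<^bsub>direct_sum V1 V2\<^esub> x \<in> L" if "x \<in> L" for c x
      using smult[of "fst x" "snd x"] that by (simp add: direct_sum_def)
    show "H1 (fst x) (fst y) + - H2 (snd x) (snd y) = 0" if "x \<in> L" "y \<in> L" for x y
      using iso[of "fst x" "snd x" "fst y" "snd y"] that by simp
    fix x assume x: "x \<in> carrier (direct_sum V1 V2)"
      and orth: "\<forall>l\<in>L. H1 (fst l) (fst x) + - H2 (snd l) (snd x) = 0"
    have "H1 x' (fst x) = H2 y' (snd x)" if "(x', y') \<in> L" for x' y'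
      using bspec[OF orth that] by simp
    then obtain x0 y0 where xy: "(x0, y0) \<in> L" "\<forall>z\<in>carrier V1. H1 z (fst x) = H1 z x0"
        "\<forall>z\<in>carrier V2. H2 z (snd x) = H2 z y0"
      using max[of "fst x" "snd x"] x by (auto simp: direct_sum_def)
    then show "\<exists>l\<in>L. \<forall>z\<in>carrier (direct_sum V1 V2).
        H1 (fst z) (fst x) + - H2 (snd z) (snd x) = H1 (fst z) (fst l) + - H2 (snd z) (snd l)"
      by (intro bexI[of _ "(x0, y0)"]) (auto simp: direct_sum_def)
  qed (rule L)
  then have "wcl V1 H1 \<oplus>\<^bsub>\<W>\<^esub> \<ominus>\<^bsub>\<W>\<^esub> wcl V2 H2 = \<zero>\<^bsub>\<W>\<^esub>"
    unfolding wcl_sum(2)[OF good(1) good'] wcl_uminus(2)[OF good(2)] .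
  then show ?thesis
    using wcl_carrier[OF good(1)] wcl_carrier[OF good(2)]
    by (metis W.a_inv_closed W.minus_equality W.minus_minus)
qed

lemma wgood_form_space:
  assumes "form_space \<sigma> s h 1" "vsub s S" "fin_spanned s S"
  shows "wgood (mrec s S) h"
  using form_space.witt_rep_exists[OF assms refl] closed_space_mrec[OF assms(2)] wgoodI by blast

end

section \<open>The Maslov index\<close>

text \<open>The space is the subset D of a possibly larger type: finite dimension and non-degeneracy
  are properties of D, and lagrangians are subsets of D.\<close>

locale antihermitian_space = witt_field \<sigma> + form_space \<sigma> s h "- 1"
  for \<sigma> :: "'a::field \<Rightarrow> 'a" and s :: "'a \<Rightarrow> 'v::ab_group_add \<Rightarrow> 'v" and h :: "'v \<Rightarrow> 'v \<Rightarrow> 'a" +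
  fixes D :: "'v set"
  assumes D: "vsub s D" "fin_spanned s D"
    and nondeg: "\<And>x. x \<in> D \<Longrightarrow> \<forall>z\<in>D. h z x = 0 \<Longrightarrow> x = 0"
begin

lemma conj_h: "\<sigma> (h x y) = - h y x"
  using h_swap[of y x] by simp

definition lagr :: "'v set \<Rightarrow> bool" where
  "lagr L \<longleftrightarrow> vsub s L \<and> L \<subseteq> D \<and> perp D L = L"

lemma lagrD:
  assumes "lagr L"
  shows "vsub s L" "L \<subseteq> D" "\<And>x y. x \<in> L \<Longrightarrow> y \<in> L \<Longrightarrow> h x y = 0"
    "\<And>x. x \<in> D \<Longrightarrow> (\<And>y. y \<in> L \<Longrightarrow> h y x = 0) \<Longrightarrow> x \<in> L"
  using assms unfolding lagr_def perp_def by blast+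

lemma vsubD:
  assumes "vsub s L"
  shows "0 \<in> L" "x \<in> L \<Longrightarrow> y \<in> L \<Longrightarrow> x + y \<in> L" "x \<in> L \<Longrightarrow> y \<in> L \<Longrightarrow> x - y \<in> L" "x \<in> L \<Longrightarrow> s c x \<in> L"
    "x \<in> L \<Longrightarrow> - x \<in> L"
  using assms unfolding vsub_iff
  by (simp_all add: subspace_0 subspace_add subspace_diff subspace_scale subspace_neg)

text \<open>For lagrangians, \<open>(L1 \<inter> (L2 + L3))\<^sup>\<bottom> = L1 + L2 \<inter> L3\<close>.\<close>

lemma perp_inter_sum:
  assumes L: "lagr L1" "lagr L2" "lagr L3" and x: "x \<in> D"
    and orth: "\<And>a b. a \<in> L2 \<Longrightarrow> b \<in> L3 \<Longrightarrow> a + b \<in> L1 \<Longrightarrow> h (a + b) x = 0"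
  obtains p y where "p \<in> L1" "y \<in> L2" "y \<in> L3" "x = p + y"
proof -
  define A where "A = {p + y | p y. p \<in> L1 \<and> y \<in> L2 \<inter> L3}"
  define B where "B = {a + b | a b. a \<in> L2 \<and> b \<in> L3}"
  note l = lagrD(1)[OF L(1)] lagrD(1)[OF L(2)] lagrD(1)[OF L(3)]
  have i: "vsub s (L2 \<inter> L3)" using l unfolding vsub_def by blast
  have A: "vsub s A" "A \<subseteq> D"
    using l(1) i subspace_sums unfolding vsub_iff A_def apply blast
    using lagrD(2) L D(1) unfolding A_def vsub_def by blast
  have B: "vsub s B" "B \<subseteq> D"
    using l(2,3) subspace_sums unfolding vsub_iff B_def apply blast
    using lagrD(2) L D(1) unfolding B_def vsub_def by blast
  have LA: "L1 \<subseteq> A" "L2 \<inter> L3 \<subseteq> A"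
  proof -
    have "a \<in> A" if "a \<in> L1" for a
      unfolding A_def using that vsubD(1)[OF i] by (intro CollectI exI[of _ a] exI[of _ 0]) simp
    then show "L1 \<subseteq> A" by blast
    have "a \<in> A" if "a \<in> L2 \<inter> L3" for a
      unfolding A_def using that vsubD(1)[OF l(1)] by (intro CollectI exI[of _ 0] exI[of _ a]) simp
    then show "L2 \<inter> L3 \<subseteq> A" by blast
  qed
  have LB: "L2 \<subseteq> B" "L3 \<subseteq> B"
  proof -
    have "a \<in> B" if "a \<in> L2" for a
      unfolding B_def using that vsubD(1)[OF l(3)] by (intro CollectI exI[of _ a] exI[of _ 0]) simp
    then show "L2 \<subseteq> B" by blast
    have "a \<in> B" if "a \<in> L3" for a
      unfolding B_def using that vsubD(1)[OF l(2)] by (intro CollectI exI[of _ 0] exI[of _ a]) simp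
    then show "L3 \<subseteq> B" by blast
  qed
  \<comment> \<open>A vector orthogonal to A is orthogonal to L1, hence in L1; it is also orthogonal
    to the orthogonal of B, which lies in L2 \<inter> L3 and so in A, hence it is in B. So
    \<open>orth\<close> applies to it.\<close>
  have "perp D B \<subseteq> L2 \<inter> L3"
    using LB lagrD(4)[OF L(2)] lagrD(4)[OF L(3)] unfolding perp_def by blast
  then have pA: "perp D A \<subseteq> perp D (perp D B)" using LA(2) unfolding perp_def by blast
  have "x \<in> perp D (perp D A)"
  proof -
    have "h z x = 0" if z: "z \<in> perp D A" for z
    proof -
      have "z \<in> B" using z pA double_perp[OF D nondeg B] by blast
      moreover have "z \<in> L1" using z LA(1) lagrD(4)[OF L(1)] unfolding perp_def by blast
      ultimately show ?thesis using orth unfolding B_def by blast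
    qed
    then show ?thesis using x by (simp add: perp_def)
  qed
  then have "x \<in> A" using double_perp[OF D nondeg A] by blast
  then show thesis using that unfolding A_def by blast
qed

definition tform :: "'v \<times> 'v \<times> 'v \<Rightarrow> 'v \<times> 'v \<times> 'v \<Rightarrow> 'a" where
  "tform = (\<lambda>(v1, v2, v3) (w1, w2, w3). h v1 (w2 - w3) + h v2 (w3 - w1) + h v3 (w1 - w2))"

text \<open>The sum of h(v_j, w_i) - h(v_i, w_j) over pairs i < j that avoid the last index. On
  \<open>Z3\<close> the pairs with the last index would contribute 0 in total, because the other
  entries sum to the negative of the last one; \<open>zform4\<close> and \<open>Z4\<close> follow
  the same pattern.\<close>

definition zform3 :: "'v \<times> 'v \<times> 'v \<Rightarrow> 'v \<times> 'v \<times> 'v \<Rightarrow> 'a" where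
  "zform3 = (\<lambda>(v1, v2, v3) (w1, w2, w3). h v2 w1 - h v1 w2)"

definition zform4 :: "'v \<times> 'v \<times> 'v \<times> 'v \<Rightarrow> 'v \<times> 'v \<times> 'v \<times> 'v \<Rightarrow> 'a" where
  "zform4 = (\<lambda>(v1, v2, v3, v4) (w1, w2, w3, w4).
     h v2 w1 - h v1 w2 + h v3 w1 - h v1 w3 + h v3 w2 - h v2 w3)"

abbreviation s3 :: "'a \<Rightarrow> 'v \<times> 'v \<times> 'v \<Rightarrow> 'v \<times> 'v \<times> 'v" where
  "s3 \<equiv> pscale s (pscale s s)"

abbreviation s4 :: "'a \<Rightarrow> 'v \<times> 'v \<times> 'v \<times> 'v \<Rightarrow> 'v \<times> 'v \<times> 'v \<times> 'v" where
  "s4 \<equiv> pscale s s3"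

lemma vector_space_s3: "Vector_Spaces.vector_space s3" and vector_space_s4: "Vector_Spaces.vector_space s4"
  by (intro vector_space_pscale; unfold_locales)+

lemma form_space_tform: "form_space \<sigma> s3 tform 1"
proof -
  interpret s3: Vector_Spaces.vector_space s3 by (rule vector_space_s3)
  show ?thesis
    by unfold_locales
      (auto simp: tform_def h_add h_diff h_scale hom_add hom_minus conj_h algebra_simps)
qed

lemma form_space_zform3: "form_space \<sigma> s3 zform3 1"
proof -
  interpret s3: Vector_Spaces.vector_space s3 by (rule vector_space_s3)
  show ?thesis
    by unfold_locales
      (auto simp: zform3_def h_add h_diff h_scale hom_add hom_minus conj_h algebra_simps)
qed

lemma form_space_zform4: "form_space \<sigma> s4 zform4 1"
proof -
  interpret s4: Vector_Spaces.vector_space s4 by (rule vector_space_s4)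
  show ?thesis
    by unfold_locales
      (auto simp: zform4_def h_add h_diff h_scale hom_add hom_minus conj_h algebra_simps)
qed

lemma space3:
  assumes "lagr L1" "lagr L2" "lagr L3"
  shows "vsub s3 (L1 \<times> L2 \<times> L3)" "fin_spanned s3 (L1 \<times> L2 \<times> L3)"
  using assms lagrD(1,2) fin_spanned_mono[OF D(2)] vector_space_axioms
  by (auto intro!: vsub_Times fin_spanned_Times vector_space_pscale)

lemma space4:
  assumes "lagr L1" "lagr L2" "lagr L3" "lagr L4"
  shows "vsub s4 (L1 \<times> L2 \<times> L3 \<times> L4)" "fin_spanned s4 (L1 \<times> L2 \<times> L3 \<times> L4)"
  using assms lagrD(1,2) fin_spanned_mono[OF D(2)] vector_space_axioms
  by (auto intro!: vsub_Times fin_spanned_Times vector_space_pscale)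

definition \<tau> :: "'v set \<Rightarrow> 'v set \<Rightarrow> 'v set \<Rightarrow> ('a mat \<times> 'a mat) set set" where
  "\<tau> L1 L2 L3 = wcl (mrec s3 (L1 \<times> L2 \<times> L3)) tform"

definition Z3 :: "'v set \<Rightarrow> 'v set \<Rightarrow> 'v set \<Rightarrow> ('v \<times> 'v \<times> 'v) set" where
  "Z3 L1 L2 L3 = {(a, b, c). a \<in> L1 \<and> b \<in> L2 \<and> c \<in> L3 \<and> a + b + c = 0}"

definition Z4 :: "'v set \<Rightarrow> 'v set \<Rightarrow> 'v set \<Rightarrow> 'v set \<Rightarrow> ('v \<times> 'v \<times> 'v \<times> 'v) set" where
  "Z4 L1 L2 L3 L4 = {(a, b, c, d). a \<in> L1 \<and> b \<in> L2 \<and> c \<in> L3 \<and> d \<in> L4 \<and> a + b + c + d = 0}"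

lemma good_tform:
  assumes "lagr L1" "lagr L2" "lagr L3"
  shows "wgood (mrec s3 (L1 \<times> L2 \<times> L3)) tform"
  by (intro wgood_form_space form_space_tform space3 assms)

lemma \<tau>_carrier: "lagr L1 \<Longrightarrow> lagr L2 \<Longrightarrow> lagr L3 \<Longrightarrow> \<tau> L1 L2 L3 \<in> carrier \<W>"
  unfolding \<tau>_def by (intro wcl_carrier good_tform)

lemma s_sum_zero: "a + b + c = 0 \<Longrightarrow> s e a + s e b + s e c = 0"
  by (metis scale_right_distrib scale_zero_right)

lemma vsub_Z3:
  assumes "lagr L1" "lagr L2" "lagr L3"
  shows "vsub s3 (Z3 L1 L2 L3)"
  unfolding vsub_def
proof (intro conjI ballI allI)
  note l = vsubD[OF lagrD(1)[OF assms(1)]] vsubD[OF lagrD(1)[OF assms(2)]] vsubD[OF lagrD(1)[OF assms(3)]]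
  show "0 \<in> Z3 L1 L2 L3" using l by (simp add: Z3_def zero_prod_def)
  fix x assume x: "x \<in> Z3 L1 L2 L3"
  then show "s3 c x \<in> Z3 L1 L2 L3" for c using l by (auto simp: Z3_def s_sum_zero)
  fix y assume y: "y \<in> Z3 L1 L2 L3"
  show "x + y \<in> Z3 L1 L2 L3"
    using x y l by (auto simp: Z3_def) (metis (no_types, lifting) add.assoc add.left_commute add_0)
qed

lemma vsub_Z4:
  assumes "lagr L1" "lagr L2" "lagr L3" "lagr L4"
  shows "vsub s4 (Z4 L1 L2 L3 L4)"
  unfolding vsub_def
proof (intro conjI ballI allI)
  note l = vsubD[OF lagrD(1)[OF assms(1)]] vsubD[OF lagrD(1)[OF assms(2)]]
    vsubD[OF lagrD(1)[OF assms(3)]] vsubD[OF lagrD(1)[OF assms(4)]]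
  show "0 \<in> Z4 L1 L2 L3 L4" using l by (simp add: Z4_def zero_prod_def)
  fix x assume "x \<in> Z4 L1 L2 L3 L4"
  then obtain a b c d where x: "x = (a, b, c, d)" "a \<in> L1" "b \<in> L2" "c \<in> L3" "d \<in> L4" "a + b + c + d = 0"
    unfolding Z4_def by blast
  have "s e a + s e b + s e c + s e d = 0" for e
    using x(6) by (metis scale_right_distrib scale_zero_right)
  then show "s4 e x \<in> Z4 L1 L2 L3 L4" for e using x l by (auto simp: Z4_def)
  fix y assume "y \<in> Z4 L1 L2 L3 L4"
  then obtain a' b' c' d' where y: "y = (a', b', c', d')" "a' \<in> L1" "b' \<in> L2" "c' \<in> L3" "d' \<in> L4" "a' + b' + c' + d' = 0"
    unfolding Z4_def by blast
  have "(a + a') + (b + b') + (c + c') + (d + d') = (a + b + c + d) + (a' + b' + c' + d')" by (simp add: algebra_simps)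
  then have "(a + a') + (b + b') + (c + c') + (d + d') = 0" using x(6) y(6) by simp
  then show "x + y \<in> Z4 L1 L2 L3 L4" using x y l by (auto simp: Z4_def)
qed

lemma good_Z3:
  assumes "lagr L1" "lagr L2" "lagr L3"
  shows "wgood (mrec s3 (Z3 L1 L2 L3)) zform3"
  by (rule wgood_form_space[OF form_space_zform3 vsub_Z3[OF assms] fin_spanned_mono[OF space3(2)[OF assms]]])
    (auto simp: Z3_def)

lemma good_Z4:
  assumes "lagr L1" "lagr L2" "lagr L3" "lagr L4"
  shows "wgood (mrec s4 (Z4 L1 L2 L3 L4)) zform4"
  by (rule wgood_form_space[OF form_space_zform4 vsub_Z4[OF assms] fin_spanned_mono[OF space4(2)[OF assms]]])
    (auto simp: Z4_def)

end

section \<open>Symmetry and vanishing of the Maslov index\<close>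

context antihermitian_space
begin

lemma \<tau>_swap:
  assumes "lagr L1" "lagr L2" "lagr L3"
  shows "\<tau> L2 L1 L3 = \<ominus>\<^bsub>\<W>\<^esub> \<tau> L1 L2 L3"
proof -
  have "wcl (mrec s3 (L2 \<times> L1 \<times> L3)) tform = wcl (mrec s3 (L1 \<times> L2 \<times> L3)) (\<lambda>x y. - tform x y)"
    by (rule wcl_pullback(2)[OF wcl_uminus(1)[OF good_tform[OF assms]]
        closed_space_mrec[OF space3(1)[OF assms(2,1,3)]], where f = "\<lambda>(a, b, c). (b, a, c)"])
      (auto simp: tform_def h_diff)
  then show ?thesis unfolding \<tau>_def wcl_uminus(2)[OF good_tform[OF assms]] .
qed

lemma \<tau>_cyclic:
  assumes "lagr L1" "lagr L2" "lagr L3"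
  shows "\<tau> L2 L3 L1 = \<tau> L1 L2 L3"
  unfolding \<tau>_def
  by (rule wcl_pullback(2)[OF good_tform[OF assms]
      closed_space_mrec[OF space3(1)[OF assms(2,3,1)]], where f = "\<lambda>(b, c, a). (a, b, c)"])
    (auto simp: tform_def h_diff)

lemma \<tau>_eq_zero:
  assumes "lagr L1" "lagr L2" "lagr L3"
    and sum: "\<And>x. x \<in> L1 \<Longrightarrow> \<exists>p q. p \<in> L1 \<and> p \<in> L2 \<and> q \<in> L1 \<and> q \<in> L3 \<and> x = p + q"
  shows "\<tau> L1 L2 L3 = \<zero>\<^bsub>\<W>\<^esub>"
  unfolding \<tau>_def
proof (rule wcl_metabolic[OF good_tform[OF assms(1-3)]])
  note l1 = lagrD[OF assms(1)] and l2 = lagrD[OF assms(2)] and l3 = lagrD[OF assms(3)]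
  note v1 = vsubD[OF l1(1)] and v2 = vsubD[OF l2(1)] and v3 = vsubD[OF l3(1)]
  \<comment> \<open>The orthogonal of L1 x 0 x 0, which contains that subspace; hence anything
    orthogonal to \<open>?L\<close> lies in \<open>?L\<close>. The hypothesis on L1 makes it
    isotropic.\<close>
  let ?L = "{(a, b, c). a \<in> L1 \<and> b \<in> L2 \<and> c \<in> L3 \<and> b - c \<in> L1}"
  show "?L \<subseteq> carrier (mrec s3 (L1 \<times> L2 \<times> L3))" by auto
  show "?L \<noteq> {}" using v1 v2 v3 by (auto intro!: exI[of _ 0])
  show "x \<oplus>\<^bsub>mrec s3 (L1 \<times> L2 \<times> L3)\<^esub> y \<in> ?L" if "x \<in> ?L" "y \<in> ?L" for x y
    using that v1 v2 v3 by (auto simp: add_diff_add)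
  show "c \<odot>\<^bsub>mrec s3 (L1 \<times> L2 \<times> L3)\<^esub> x \<in> ?L" if "x \<in> ?L" for c x
    using that v1 v2 v3 by (auto simp flip: scale_right_diff_distrib)
  show iso: "tform x y = 0" if xy: "x \<in> ?L" "y \<in> ?L" for x y
  proof -
    obtain a b c where x: "x = (a, b, c)" "a \<in> L1" "b \<in> L2" "c \<in> L3" "b - c \<in> L1" using xy by blast
    obtain a' b' c' where y: "y = (a', b', c')" "a' \<in> L1" "b' \<in> L2" "c' \<in> L3" "b' - c' \<in> L1" using xy by blast
    obtain p q where pq: "p \<in> L1" "p \<in> L2" "q \<in> L1" "q \<in> L3" "b - c = p + q" using sum[OF x(5)] by blast
    obtain p' q' where pq': "p' \<in> L1" "p' \<in> L2" "q' \<in> L1" "q' \<in> L3" "b' - c' = p' + q'" using sum[OF y(5)] by blast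
    \<comment> \<open>The vector c + q = b - p lies both in L2 and in L3. Splitting along it leaves
      only pairings inside a single lagrangian.\<close>
    have b: "b = c + q + p" "b' = c' + q' + p'" using pq(5) pq'(5) by (simp_all add: algebra_simps)
    have m: "c + q \<in> L2" "c' + q' \<in> L2"
    proof -
      have "b - p \<in> L2" "b' - p' \<in> L2" using x y pq pq' v2 by auto
      then show "c + q \<in> L2" "c' + q' \<in> L2" using b by simp_all
    qed
    have z1: "h a (b' - c') = 0" "h (b - c) a' = 0" using l1(3) x y by auto
    have "h b c' - h c b' = h (c + q) (c' + q') - h (c + q) q' + h p (c' + q') - h p q'
        - (h c (c' + q') + h (c + q) p' - h q p')"
      unfolding b by (simp add: h_add h_add_left algebra_simps)
    also have "\<dots> = 0"
    proof -
      have "h (c + q) (c' + q') = 0" "h p (c' + q') = 0" "h (c + q) p' = 0" using l2(3) m pq pq' by auto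
      moreover have "h p q' = 0" "h q p' = 0" using l1(3) pq pq' by auto
      moreover have "h (c + q) q' = 0" "h c (c' + q') = 0" using l3(3) x y pq pq' v3 by (auto simp: h_add_left h_add)
      ultimately show ?thesis by simp
    qed
    finally have z2: "h b c' - h c b' = 0" .
    have "tform x y = h a (b' - c') - h (b - c) a' + (h b c' - h c b')"
      unfolding x(1) y(1) tform_def by (simp add: h_diff algebra_simps)
    then show ?thesis unfolding z1 z2 by simp
  qed
  show "\<exists>l\<in>?L. \<forall>z\<in>carrier (mrec s3 (L1 \<times> L2 \<times> L3)). tform z x = tform z l"
    if x: "x \<in> carrier (mrec s3 (L1 \<times> L2 \<times> L3))" and orth: "\<forall>l\<in>?L. tform l x = 0" for x
  proof -
    obtain a b c where abc: "x = (a, b, c)" "a \<in> L1" "b \<in> L2" "c \<in> L3" using x by auto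
    have "b - c \<in> L1"
    proof (rule l1(4))
      show "b - c \<in> D" using abc l2(2) l3(2) vsubD(3)[OF D(1)] by blast
      fix y assume y: "y \<in> L1"
      then have "(y, 0, 0) \<in> ?L" using v1 v2 v3 by auto
      then have "tform (y, 0, 0) x = 0" using orth by blast
      then show "h y (b - c) = 0" unfolding abc(1) tform_def by simp
    qed
    then show ?thesis using abc by blast
  qed
qed

lemma \<tau>_same:
  assumes "lagr L1" "lagr L2"
  shows "\<tau> L1 L1 L2 = \<zero>\<^bsub>\<W>\<^esub>" "\<tau> L1 L2 L1 = \<zero>\<^bsub>\<W>\<^esub>" "\<tau> L2 L1 L1 = \<zero>\<^bsub>\<W>\<^esub>"
proof -
  note v1 = vsubD[OF lagrD(1)[OF assms(1)]] and v2 = vsubD[OF lagrD(1)[OF assms(2)]]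
  show 1: "\<tau> L1 L1 L2 = \<zero>\<^bsub>\<W>\<^esub>"
  proof (rule \<tau>_eq_zero[OF assms(1,1,2)])
    fix x assume "x \<in> L1"
    then show "\<exists>p q. p \<in> L1 \<and> p \<in> L1 \<and> q \<in> L1 \<and> q \<in> L2 \<and> x = p + q"
      using v1(1) v2(1) by (intro exI[of _ x] exI[of _ 0]) simp
  qed
  show "\<tau> L1 L2 L1 = \<zero>\<^bsub>\<W>\<^esub>" "\<tau> L2 L1 L1 = \<zero>\<^bsub>\<W>\<^esub>"
    using 1 \<tau>_cyclic[OF assms(1,1,2)] \<tau>_cyclic[OF assms(1,2,1)] by simp_all
qed

section \<open>The cocycle relation\<close>

lemma \<tau>_zform3:
  assumes "lagr L1" "lagr L2" "lagr L3"
  shows "\<tau> L1 L2 L3 = wcl (mrec s3 (Z3 L1 L2 L3)) zform3"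
  unfolding \<tau>_def
proof (rule wcl_eqI[OF good_tform[OF assms] good_Z3[OF assms]])
  note l1 = lagrD[OF assms(1)] and l2 = lagrD[OF assms(2)] and l3 = lagrD[OF assms(3)]
  note v1 = vsubD[OF l1(1)] and v2 = vsubD[OF l2(1)] and v3 = vsubD[OF l3(1)]
  \<comment> \<open>\<open>?M\<close> is the orthogonal of the isotropic subspace L1 x 0 x 0.
    Dividing by that subspace forgets a, and (c - b, b, - c) identifies the quotient with
    \<open>Z3\<close>; the correspondence \<open>?L\<close> is the graph of this map.\<close>
  let ?z = "\<lambda>(a, b, c). (c - b, b, - c) :: 'v \<times> 'v \<times> 'v"
  let ?M = "{(a, b, c). a \<in> L1 \<and> b \<in> L2 \<and> c \<in> L3 \<and> b - c \<in> L1}"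
  let ?L = "{(v, ?z v) | v. v \<in> ?M}"
  have neg: "c - b \<in> L1" if "b - c \<in> L1" for b c using v1(5)[OF that] by simp
  have zM: "?z v \<in> Z3 L1 L2 L3" if "v \<in> ?M" for v
    using that neg v3(5) by (auto simp: Z3_def)
  show "?L \<subseteq> carrier (mrec s3 (L1 \<times> L2 \<times> L3)) \<times> carrier (mrec s3 (Z3 L1 L2 L3))" using zM by auto
  have "(0, 0, 0) \<in> ?M" using v1 v2 v3 by auto
  then show "?L \<noteq> {}" by blast
  show "(x \<oplus>\<^bsub>mrec s3 (L1 \<times> L2 \<times> L3)\<^esub> x', y \<oplus>\<^bsub>mrec s3 (Z3 L1 L2 L3)\<^esub> y') \<in> ?L"
    if "(x, y) \<in> ?L" "(x', y') \<in> ?L" for x y x' y'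
    using that v1 v2 v3 by (auto simp: add_diff_add)
  show "(c \<odot>\<^bsub>mrec s3 (L1 \<times> L2 \<times> L3)\<^esub> x, c \<odot>\<^bsub>mrec s3 (Z3 L1 L2 L3)\<^esub> y) \<in> ?L"
    if "(x, y) \<in> ?L" for c x y
    using that v1 v2 v3 by (auto simp: scale_right_diff_distrib[symmetric])
  have iso: "tform x x' = zform3 (?z x) (?z x')" if xx: "x \<in> ?M" "x' \<in> ?M" for x x'
  proof -
    obtain a b c where x: "x = (a, b, c)" "a \<in> L1" "b \<in> L2" "c \<in> L3" "b - c \<in> L1" using xx by blast
    obtain a' b' c' where y: "x' = (a', b', c')" "a' \<in> L1" "b' \<in> L2" "c' \<in> L3" "b' - c' \<in> L1" using xx by blast
    have z: "h a b' - h a c' = 0" "h b a' - h c a' = 0" "h b b' = 0"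
      using l1(3)[OF x(2) y(5)] l1(3)[OF x(5) y(2)] l2(3)[OF x(3) y(3)] by (simp_all add: h_diff)
    then show ?thesis unfolding x(1) y(1) tform_def zform3_def by (simp add: h_diff algebra_simps)
  qed
  show "tform x x' = zform3 y y'" if "(x, y) \<in> ?L" "(x', y') \<in> ?L" for x y x' y'
    using that iso by blast
  fix x y assume x: "x \<in> carrier (mrec s3 (L1 \<times> L2 \<times> L3))" and y: "y \<in> carrier (mrec s3 (Z3 L1 L2 L3))"
    and orth: "\<And>x' y'. (x', y') \<in> ?L \<Longrightarrow> tform x' x = zform3 y' y"
  obtain a b c where abc: "x = (a, b, c)" "a \<in> L1" "b \<in> L2" "c \<in> L3" using x by auto
  have "b - c \<in> L1"
  proof (rule l1(4))
    show "b - c \<in> D" using abc l2(2) l3(2) vsubD(3)[OF D(1)] by blast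
    fix y' assume "y' \<in> L1"
    then have "(y', 0, 0) \<in> ?M" using v1 v2 v3 by auto
    then have "tform (y', 0, 0) x = zform3 (?z (y', 0, 0)) y" using orth by blast
    then show "h y' (b - c) = 0" unfolding abc(1) tform_def zform3_def by (cases y) simp
  qed
  then have xM: "x \<in> ?M" using abc by blast
  have "zform3 n y = zform3 n (?z x)" if n: "n \<in> Z3 L1 L2 L3" for n
  proof -
    obtain n1 n2 n3 where n': "n = (n1, n2, n3)" "n1 \<in> L1" "n2 \<in> L2" "n3 \<in> L3" "n1 + n2 + n3 = 0"
      using n unfolding Z3_def by blast
    have n1: "n1 = - n3 - n2" using n'(5) by (simp add: algebra_simps eq_neg_iff_add_eq_0)
    have "n2 + n3 = - n1" unfolding n1 by simp
    \<comment> \<open>The map \<open>?z\<close> is onto: n is the image of (0, n2, - n3), on which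
      the orthogonality hypothesis can be evaluated.\<close>
    then have vM: "(0, n2, - n3) \<in> ?M" using n' v1 v3 by auto
    moreover have "?z (0, n2, - n3) = n" using n' n1 by simp
    ultimately show ?thesis using orth[of "(0, n2, - n3)" n] iso[OF vM xM] by auto
  qed
  then show "\<exists>x0 y0. (x0, y0) \<in> ?L \<and> (\<forall>z\<in>carrier (mrec s3 (L1 \<times> L2 \<times> L3)). tform z x = tform z x0) \<and>
      (\<forall>z\<in>carrier (mrec s3 (Z3 L1 L2 L3)). zform3 z y = zform3 z y0)"
    using xM by (intro exI[of _ x] exI[of _ "?z x"]) auto
qed

text \<open>Eliminating the third entries and using that the lagrangians are isotropic gives h(b,
  a') = - h(a, b'). So the value depends on the right argument only through its middle entry, or
  only through its last one; \<open>zform3_sum\<close> uses the first version for one summand and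
  the second for the other.\<close>

lemma zform3_eq:
  assumes L: "lagr L1" "lagr L2" "lagr L3" and x: "(a, b, c) \<in> Z3 L1 L2 L3" and y: "(a', b', c') \<in> Z3 L1 L2 L3"
  shows "zform3 (a, b, c) (a', b', c') = - 2 * h a b'" "zform3 (a, b, c) (a', b', c') = 2 * h a c'"
proof -
  note l1 = lagrD(3)[OF L(1)] and l2 = lagrD(3)[OF L(2)] and l3 = lagrD(3)[OF L(3)]
  have m: "a \<in> L1" "b \<in> L2" "c \<in> L3" "a' \<in> L1" "b' \<in> L2" "c' \<in> L3" and s: "a + b + c = 0" "a' + b' + c' = 0"
    using x y by (auto simp: Z3_def)
  have c: "c = - a - b" "c' = - a' - b'"
    using s by (simp_all add: algebra_simps eq_neg_iff_add_eq_0)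
  have z: "h a a' = 0" "h b b' = 0" "h c c' = 0" using l1 l2 l3 m by blast+
  then have "h b a' = - h a b'" unfolding c by (simp add: h_diff algebra_simps eq_neg_iff_add_eq_0)
  then show "zform3 (a, b, c) (a', b', c') = - 2 * h a b'" by (simp add: zform3_def)
  then show "zform3 (a, b, c) (a', b', c') = 2 * h a c'" using z by (simp add: c h_diff)
qed

lemma zform4_eq_left:
  assumes L: "lagr L1" "lagr L2" "lagr L3" and x: "(a, b, c) \<in> Z3 L1 L2 L3"
    and y: "a' \<in> L1" "b' \<in> L2" "c' \<in> L3"
  shows "zform4 (a, b, c, 0) (a', b', c', d') = - 2 * h a b'"
proof -
  note l1 = lagrD(3)[OF L(1)] and l2 = lagrD(3)[OF L(2)] and l3 = lagrD(3)[OF L(3)]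
  have m: "a \<in> L1" "b \<in> L2" "c \<in> L3" and s: "a + b + c = 0" using x by (auto simp: Z3_def)
  have c: "c = - a - b" using s by (simp add: algebra_simps eq_neg_iff_add_eq_0)
  have z: "h a a' = 0" "h b b' = 0" "h c c' = 0" using l1 l2 l3 m y by blast+
  then have "h b c' = - h a c'" unfolding c by (simp add: h_diff algebra_simps eq_neg_iff_add_eq_0)
  then show ?thesis using z by (simp add: zform4_def c h_diff)
qed

lemma zform4_eq_right:
  assumes L: "lagr L1" "lagr L3" "lagr L4" and x: "(a, c, d) \<in> Z3 L1 L3 L4"
    and y: "(a', b', c', d') \<in> Z4 L1 L2 L3 L4"
  shows "zform4 (a, 0, c, d) (a', b', c', d') = 2 * h a d'"
proof -
  note l1 = lagrD(3)[OF L(1)] and l3 = lagrD(3)[OF L(2)] and l4 = lagrD(3)[OF L(3)]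
  have m: "a \<in> L1" "c \<in> L3" "d \<in> L4" "a' \<in> L1" "c' \<in> L3" "d' \<in> L4" and s: "a + c + d = 0" "a' + b' + c' + d' = 0"
    using x y by (auto simp: Z3_def Z4_def)
  have d: "d = - a - c" and b': "b' = - a' - c' - d'"
    using s by (simp_all add: algebra_simps eq_neg_iff_add_eq_0)
  have z: "h a a' = 0" "h c c' = 0" "h d d' = 0" using l1 l3 l4 m by blast+
  then have "h c d' = - h a d'" unfolding d by (simp add: h_diff algebra_simps eq_neg_iff_add_eq_0)
  then show ?thesis using z by (simp add: zform4_def b' h_diff)
qed

text \<open>The map j adds the entries in the shared lagrangians L1 and L3 and preserves the forms.
  Its graph is maximal isotropic modulo the kernels: if (x, y) is orthogonal to the graph, then x
  can be changed within its class modulo the kernel so that j sends it to y.\<close>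

lemma zform3_sum:
  assumes L: "lagr L1" "lagr L2" "lagr L3" "lagr L4"
  shows "wcl (mrec s3 (Z3 L1 L2 L3)) zform3 \<oplus>\<^bsub>\<W>\<^esub> wcl (mrec s3 (Z3 L1 L3 L4)) zform3
       = wcl (mrec s4 (Z4 L1 L2 L3 L4)) zform4"
proof -
  note g = good_Z3[OF L(1,2,3)] good_Z3[OF L(1,3,4)]
  note l1 = lagrD[OF L(1)] and l2 = lagrD[OF L(2)] and l3 = lagrD[OF L(3)] and l4 = lagrD[OF L(4)]
  note v1 = vsubD[OF l1(1)] and v2 = vsubD[OF l2(1)] and v3 = vsubD[OF l3(1)] and v4 = vsubD[OF l4(1)]
  note zadd = vsub_Z3[OF L(1,2,3)] vsub_Z3[OF L(1,3,4)]
  define j where "j = (\<lambda>((a1, a2, a3), (b1, b3, b4)). (a1 + b1, a2, a3 + b3, b4) :: 'v \<times> 'v \<times> 'v \<times> 'v)"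
  let ?P = "direct_sum (mrec s3 (Z3 L1 L2 L3)) (mrec s3 (Z3 L1 L3 L4))"
  let ?L = "{(x, j x) | x. x \<in> Z3 L1 L2 L3 \<times> Z3 L1 L3 L4}"
  let ?f = "\<lambda>x y. zform3 (fst x) (fst y) + zform3 (snd x) (snd y)"
  have jZ: "j x \<in> Z4 L1 L2 L3 L4" if x: "x \<in> Z3 L1 L2 L3 \<times> Z3 L1 L3 L4" for x
  proof -
    obtain a1 a2 a3 b1 b3 b4 where x': "x = ((a1, a2, a3), (b1, b3, b4))" by (metis surj_pair)
    have "a1 + b1 + a2 + (a3 + b3) + b4 = (a1 + a2 + a3) + (b1 + b3 + b4)" by (simp add: algebra_simps)
    also have "\<dots> = 0" using x unfolding x' by (auto simp: Z3_def)
    finally show ?thesis using x v1 v3 unfolding x' j_def by (auto simp: Z3_def Z4_def)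
  qed
  have jadd: "j (x + y) = j x + j y" for x y
  proof -
    obtain a1 a2 a3 b1 b3 b4 where x': "x = ((a1, a2, a3), (b1, b3, b4))" by (metis surj_pair)
    obtain c1 c2 c3 d1 d3 d4 where y': "y = ((c1, c2, c3), (d1, d3, d4))" by (metis surj_pair)
    show ?thesis unfolding x' y' j_def by (simp add: algebra_simps)
  qed
  have iso: "?f x y = zform4 (j x) (j y)"
    if x: "x \<in> Z3 L1 L2 L3 \<times> Z3 L1 L3 L4" and y: "y \<in> Z3 L1 L2 L3 \<times> Z3 L1 L3 L4" for x y
  proof -
    obtain a1 a2 a3 b1 b3 b4 where x': "x = ((a1, a2, a3), (b1, b3, b4))" by (metis surj_pair)
    obtain c1 c2 c3 d1 d3 d4 where y': "y = ((c1, c2, c3), (d1, d3, d4))" by (metis surj_pair)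
    have e: "zform4 (j x) (j y) = zform4 (a1, a2, a3, 0) (j y) + zform4 (b1, 0, b3, b4) (j y)"
      unfolding x' y' j_def zform4_def by (simp add: h_add_left h_add)
    have xa: "(a1, a2, a3) \<in> Z3 L1 L2 L3" "(b1, b3, b4) \<in> Z3 L1 L3 L4"
      and ya: "(c1, c2, c3) \<in> Z3 L1 L2 L3" "(d1, d3, d4) \<in> Z3 L1 L3 L4" using x y x' y' by auto
    have jy: "j y = (c1 + d1, c2, c3 + d3, d4)" by (simp add: y' j_def)
    have m: "c1 + d1 \<in> L1" "c2 \<in> L2" "c3 + d3 \<in> L3" using ya v1 v3 by (auto simp: Z3_def)
    have "zform4 (a1, a2, a3, 0) (j y) = zform3 (a1, a2, a3) (c1, c2, c3)"
      unfolding jy zform4_eq_left[OF L(1,2,3) xa(1) m] zform3_eq(1)[OF L(1,2,3) xa(1) ya(1)] ..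
    moreover have "zform4 (b1, 0, b3, b4) (j y) = zform3 (b1, b3, b4) (d1, d3, d4)"
      using zform4_eq_right[OF L(1,3,4) xa(2) jZ[OF y, unfolded jy]]
      unfolding jy zform3_eq(2)[OF L(1,3,4) xa(2) ya(2)] .
    ultimately show ?thesis unfolding e by (simp add: x' y')
  qed
  have "wcl ?P ?f = wcl (mrec s4 (Z4 L1 L2 L3 L4)) zform4"
  proof (rule wcl_eqI[OF wcl_sum(1)[OF g] good_Z4[OF L], where L = ?L])
    show "?L \<subseteq> carrier ?P \<times> carrier (mrec s4 (Z4 L1 L2 L3 L4))"
      using jZ by (auto simp: direct_sum_def)
    have "(0, 0) \<in> Z3 L1 L2 L3 \<times> Z3 L1 L3 L4" using zadd by (auto simp: vsub_def)
    then show "?L \<noteq> {}" by blast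
    show "(x \<oplus>\<^bsub>?P\<^esub> x', y \<oplus>\<^bsub>mrec s4 (Z4 L1 L2 L3 L4)\<^esub> y') \<in> ?L"
      if xy: "(x, y) \<in> ?L" "(x', y') \<in> ?L" for x y x' y'
    proof -
      have m: "x \<in> Z3 L1 L2 L3 \<times> Z3 L1 L3 L4" "x' \<in> Z3 L1 L2 L3 \<times> Z3 L1 L3 L4" "y = j x" "y' = j x'"
        using xy by blast+
      have "x + x' \<in> Z3 L1 L2 L3 \<times> Z3 L1 L3 L4"
        using m(1,2) zadd unfolding vsub_def mem_Times_iff fst_add snd_add by blast
      moreover have "y + y' = j (x + x')" unfolding m jadd ..
      moreover have "x \<oplus>\<^bsub>?P\<^esub> x' = x + x'" by (simp add: direct_sum_def plus_prod_def)
      ultimately show ?thesis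
        unfolding mrec_simps mem_Collect_eq by (intro exI[of _ "x + x'"] conjI) simp_all
    qed
    show "(c \<odot>\<^bsub>?P\<^esub> x, c \<odot>\<^bsub>mrec s4 (Z4 L1 L2 L3 L4)\<^esub> y) \<in> ?L" if xy: "(x, y) \<in> ?L" for c x y
    proof -
      obtain a1 a2 a3 b1 b3 b4 where x': "x = ((a1, a2, a3), (b1, b3, b4))" by (metis surj_pair)
      have m: "x \<in> Z3 L1 L2 L3 \<times> Z3 L1 L3 L4" "y = j x" using xy by blast+
      have "c \<odot>\<^bsub>?P\<^esub> x = (s3 c (fst x), s3 c (snd x))" by (simp add: direct_sum_def)
      moreover have "(s3 c (fst x), s3 c (snd x)) \<in> Z3 L1 L2 L3 \<times> Z3 L1 L3 L4"
        using m(1) zadd unfolding vsub_def mem_Times_iff fst_conv snd_conv by blast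
      moreover have "s4 c y = j (s3 c (fst x), s3 c (snd x))"
        unfolding m(2) x' j_def by (simp add: scale_right_distrib)
      ultimately show ?thesis
        unfolding mrec_simps mem_Collect_eq by (intro exI[of _ "(s3 c (fst x), s3 c (snd x))"] conjI) simp_all
    qed
    show "?f x x' = zform4 y y'" if "(x, y) \<in> ?L" "(x', y') \<in> ?L" for x y x' y'
      using that iso[of x x'] by blast
    fix x y assume "x \<in> carrier ?P" and "y \<in> carrier (mrec s4 (Z4 L1 L2 L3 L4))"
      and orth: "\<And>x' y'. (x', y') \<in> ?L \<Longrightarrow> ?f x' x = zform4 y' y"
    then have x: "x \<in> Z3 L1 L2 L3 \<times> Z3 L1 L3 L4" and y: "y \<in> Z4 L1 L2 L3 L4" by (auto simp: direct_sum_def)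
    obtain a1 a2 a3 b1 b3 b4 where x': "x = ((a1, a2, a3), (b1, b3, b4))" by (metis surj_pair)
    obtain c1 c2 c3 c4 where y': "y = (c1, c2, c3, c4)" by (metis surj_pair)
    have xa: "(a1, a2, a3) \<in> Z3 L1 L2 L3" "(b1, b3, b4) \<in> Z3 L1 L3 L4" using x x' by auto
    have a: "a1 \<in> L1" "a2 \<in> L2" "a3 \<in> L3" "a1 + a2 + a3 = 0" and b: "b1 \<in> L1" "b3 \<in> L3" "b4 \<in> L4" "b1 + b3 + b4 = 0"
      using xa by (auto simp: Z3_def)
    have c: "c1 \<in> L1" "c2 \<in> L2" "c3 \<in> L3" "c4 \<in> L4" "c1 + c2 + c3 + c4 = 0" using y y' by (auto simp: Z4_def)
    have zero: "(0, 0, 0) \<in> Z3 L1 L2 L3" "(0, 0, 0) \<in> Z3 L1 L3 L4" using v1 v2 v3 v4 by (auto simp: Z3_def)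
    \<comment> \<open>Against a triple from the first summand only the middle entries a2 and c2
      count, each with the same factor -2.\<close>
    have o1: "h m (a2 - c2) = 0" if mn: "(m, n, k) \<in> Z3 L1 L2 L3" for m n k
    proof -
      have "((m, n, k), (0, 0, 0)) \<in> Z3 L1 L2 L3 \<times> Z3 L1 L3 L4" using mn zero by auto
      then have "?f ((m, n, k), (0, 0, 0)) x = zform4 (j ((m, n, k), (0, 0, 0))) y" by (intro orth) blast
      then have "zform3 (m, n, k) (a1, a2, a3) = zform4 (m, n, k, 0) (c1, c2, c3, c4)"
        by (simp add: x' y' j_def zform3_def)
      then have "- 2 * h m a2 = - 2 * h m c2"
        unfolding zform3_eq(1)[OF L(1,2,3) mn xa(1)] zform4_eq_left[OF L(1,2,3) mn c(1-3)] .
      then show ?thesis using two_neq_0 by (simp add: h_diff)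
    qed
    have o2: "h m (b4 - c4) = 0" if mn: "(m, n, k) \<in> Z3 L1 L3 L4" for m n k
    proof -
      have "((0, 0, 0), (m, n, k)) \<in> Z3 L1 L2 L3 \<times> Z3 L1 L3 L4" using mn zero by auto
      then have "?f ((0, 0, 0), (m, n, k)) x = zform4 (j ((0, 0, 0), (m, n, k))) y" by (intro orth) blast
      then have "zform3 (m, n, k) (b1, b3, b4) = zform4 (m, 0, n, k) (c1, c2, c3, c4)"
        by (simp add: x' y' j_def zform3_def)
      then have "2 * h m b4 = 2 * h m c4"
        unfolding zform3_eq(2)[OF L(1,3,4) mn xa(2)] zform4_eq_right[OF L(1,3,4) mn y[unfolded y']] .
      then show ?thesis using two_neq_0 by (simp add: h_diff)
    qed
    have dd: "a2 - c2 \<in> D" "b4 - c4 \<in> D"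
      using a b c l2(2) l4(2) vsubD(3)[OF D(1)] by blast+
    \<comment> \<open>The vectors m in \<open>o1\<close> run through L1 \<inter> (L2 + L3). Since a2
      - c2 is orthogonal to all of them, a2 can be moved to c2 at the cost of changing the
      neighbouring entries by p in L1 and q in L3.\<close>
    obtain p q where pq: "p \<in> L1" "q \<in> L2" "q \<in> L3" "a2 - c2 = p + q"
    proof (rule perp_inter_sum[OF L(1,2,3) dd(1)])
      fix u v assume "u \<in> L2" "v \<in> L3" "u + v \<in> L1"
      then have "(u + v, - u, - v) \<in> Z3 L1 L2 L3" using v2 v3 by (auto simp: Z3_def)
      then show "h (u + v) (a2 - c2) = 0" by (rule o1)
    qed blast
    obtain p' q' where pq': "p' \<in> L1" "q' \<in> L3" "q' \<in> L4" "b4 - c4 = p' + q'"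
    proof (rule perp_inter_sum[OF L(1,3,4) dd(2)])
      fix u v assume "u \<in> L3" "v \<in> L4" "u + v \<in> L1"
      then have "(u + v, - u, - v) \<in> Z3 L1 L3 L4" using v3 v4 by (auto simp: Z3_def)
      then show "h (u + v) (b4 - c4) = 0" by (rule o2)
    qed blast
    \<comment> \<open>The defect left in the first coordinate after these corrections. The zero-sum
      conditions show that it lies in L3 too, so it can be added to the first entry and subtracted
      from the third.\<close>
    define z where "z = c1 - (a1 + p) - (b1 + p')"
    have a1: "a1 = - a2 - a3" and b1: "b1 = - b3 - b4" and c1: "c1 = - c2 - c3 - c4"
      using a(4) b(4) c(5) by (simp_all add: algebra_simps eq_neg_iff_add_eq_0)
    have p: "p = a2 - c2 - q" "p' = b4 - c4 - q'" using pq(4) pq'(4) by (simp_all add: algebra_simps)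
    have z': "z = a3 + q + (b3 + q') - c3" unfolding z_def a1 b1 c1 p by (simp add: algebra_simps)
    have zL: "z \<in> L1" "z \<in> L3"
      unfolding z_def using a b c pq pq' v1 apply simp
      unfolding z'[unfolded z_def] using a b c pq pq' v3 by simp
    let ?x0 = "((a1 + p + z, c2, a3 + q - z), (b1 + p', b3 + q', c4))"
    have x0: "(a1 + p + z, c2, a3 + q - z) \<in> Z3 L1 L2 L3" "(b1 + p', b3 + q', c4) \<in> Z3 L1 L3 L4"
    proof -
      have "a1 + p + z + c2 + (a3 + q - z) = 0" "b1 + p' + (b3 + q') + c4 = 0"
        unfolding a1 b1 p by (simp_all add: algebra_simps)
      then show "(a1 + p + z, c2, a3 + q - z) \<in> Z3 L1 L2 L3" "(b1 + p', b3 + q', c4) \<in> Z3 L1 L3 L4"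
        using a b c pq pq' zL v1 v3 by (auto simp: Z3_def)
    qed
    have j0: "j ?x0 = y"
    proof -
      have "a1 + p + z + (b1 + p') = c1" by (simp add: z_def)
      moreover have "a3 + q - z + (b3 + q') = c3" unfolding z' by simp
      ultimately show ?thesis by (simp add: j_def y')
    qed
    have f1: "zform3 u (a1, a2, a3) = zform3 u (a1 + p + z, c2, a3 + q - z)" if u: "u \<in> Z3 L1 L2 L3" for u
    proof -
      obtain m n k where mn: "u = (m, n, k)" by (metis surj_pair)
      show ?thesis
        using o1[OF u[unfolded mn]]
        unfolding mn zform3_eq(1)[OF L(1,2,3) u[unfolded mn] xa(1)] zform3_eq(1)[OF L(1,2,3) u[unfolded mn] x0(1)]
        by (simp add: h_diff)
    qed
    have f2: "zform3 u (b1, b3, b4) = zform3 u (b1 + p', b3 + q', c4)" if u: "u \<in> Z3 L1 L3 L4" for u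
    proof -
      obtain m n k where mn: "u = (m, n, k)" by (metis surj_pair)
      show ?thesis
        using o2[OF u[unfolded mn]]
        unfolding mn zform3_eq(2)[OF L(1,3,4) u[unfolded mn] xa(2)] zform3_eq(2)[OF L(1,3,4) u[unfolded mn] x0(2)]
        by (simp add: h_diff)
    qed
    have "(?x0, y) \<in> ?L" using x0 j0 by blast
    moreover have "?f u x = ?f u ?x0" if "u \<in> carrier ?P" for u
      using that f1[of "fst u"] f2[of "snd u"] by (auto simp: direct_sum_def x')
    ultimately show "\<exists>x0 y0. (x0, y0) \<in> ?L \<and> (\<forall>z\<in>carrier ?P. ?f z x = ?f z x0) \<and>
        (\<forall>z\<in>carrier (mrec s4 (Z4 L1 L2 L3 L4)). zform4 z y = zform4 z y0)"
      by blast
  qed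
  then show ?thesis unfolding wcl_sum(2)[OF g] .
qed

text \<open>The terms with the last index sum to 0 on \<open>Z4\<close>, so the form runs in effect
  over all pairs i < j. The terms with the first index sum to 0 for the same reason, hence either
  end may be the one left out.\<close>

lemma zform4_cyclic:
  assumes L: "lagr L1" "lagr L2" "lagr L3" "lagr L4"
  shows "wcl (mrec s4 (Z4 L2 L3 L4 L1)) zform4 = wcl (mrec s4 (Z4 L1 L2 L3 L4)) zform4"
proof (rule wcl_pullback(2)[OF good_Z4[OF L] closed_space_mrec[OF vsub_Z4[OF L(2,3,4,1)]],
      where f = "\<lambda>(b, c, d, a). (a, b, c, d)"])
  fix x y assume x: "x \<in> carrier (mrec s4 (Z4 L2 L3 L4 L1))" and y: "y \<in> carrier (mrec s4 (Z4 L2 L3 L4 L1))"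
  obtain b c d a where x': "x = (b, c, d, a)" by (metis surj_pair)
  obtain b' c' d' a' where y': "y = (b', c', d', a')" by (metis surj_pair)
  have "b + c + d + a = 0" "b' + c' + d' + a' = 0" using x y unfolding x' y' by (auto simp: Z4_def)
  then have d: "d = - b - c - a" "d' = - b' - c' - a'" by (simp_all add: algebra_simps eq_neg_iff_add_eq_0)
  show "zform4 x y = zform4 (case x of (b, c, d, a) \<Rightarrow> (a, b, c, d)) (case y of (b, c, d, a) \<Rightarrow> (a, b, c, d))"
    unfolding x' y' zform4_def d by (simp add: h_diff h_add h_add_left algebra_simps)
qed (auto simp: Z4_def add_ac intro!: bexI)

lemma \<tau>_cocycle:
  assumes L: "lagr L1" "lagr L2" "lagr L3" "lagr L4"
  shows "\<tau> L1 L2 L3 \<oplus>\<^bsub>\<W>\<^esub> \<tau> L1 L3 L4 = \<tau> L1 L2 L4 \<oplus>\<^bsub>\<W>\<^esub> \<tau> L2 L3 L4"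
proof -
  have "\<tau> L1 L2 L3 \<oplus>\<^bsub>\<W>\<^esub> \<tau> L1 L3 L4 = wcl (mrec s4 (Z4 L1 L2 L3 L4)) zform4"
    using L by (simp add: \<tau>_zform3 zform3_sum)
  also have "\<dots> = wcl (mrec s4 (Z4 L2 L3 L4 L1)) zform4" by (rule zform4_cyclic[OF L, symmetric])
  also have "\<dots> = \<tau> L2 L3 L4 \<oplus>\<^bsub>\<W>\<^esub> \<tau> L2 L4 L1" using L by (simp add: \<tau>_zform3 zform3_sum)
  also have "\<tau> L2 L4 L1 = \<tau> L1 L2 L4" by (rule \<tau>_cyclic[OF L(1,2,4)])
  finally show ?thesis using \<tau>_carrier L W.a_comm by metis
qed

end

section \<open>Maslov indices of graphs\<close>

context antihermitian_space
begin

lemma \<tau>_isometry: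
  assumes L: "lagr L1" "lagr L2" "lagr L3" "lagr L1'" "lagr L2'" "lagr L3'"
    and F: "F ` L1 = L1'" "F ` L2 = L2'" "F ` L3 = L3'"
    and lin: "\<And>x y. F (x + y) = F x + F y" "\<And>c x. F (s c x) = s c (F x)"
    and iso: "\<And>x y. x \<in> D \<Longrightarrow> y \<in> D \<Longrightarrow> h (F x) (F y) = h x y"
  shows "\<tau> L1 L2 L3 = \<tau> L1' L2' L3'"
  unfolding \<tau>_def
proof (rule wcl_pullback(2)[OF good_tform[OF L(4-6)] closed_space_mrec[OF space3(1)[OF L(1-3)]],
      where f = "\<lambda>(x, y, z). (F x, F y, F z)"])
  fix v w assume "v \<in> carrier (mrec s3 (L1 \<times> L2 \<times> L3))" "w \<in> carrier (mrec s3 (L1 \<times> L2 \<times> L3))"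
  then show "tform v w = tform (case v of (x, y, z) \<Rightarrow> (F x, F y, F z)) (case w of (x, y, z) \<Rightarrow> (F x, F y, F z))"
    using lagrD(2)[OF L(1)] lagrD(2)[OF L(2)] lagrD(2)[OF L(3)]
    by (auto simp: tform_def h_diff iso subset_iff)
next
  fix y assume "y \<in> carrier (mrec s3 (L1' \<times> L2' \<times> L3'))"
  then show "\<exists>x\<in>carrier (mrec s3 (L1 \<times> L2 \<times> L3)). (case x of (x, y, z) \<Rightarrow> (F x, F y, F z)) = y"
    unfolding F[symmetric] by force
qed (use F lin in \<open>auto simp: image_iff\<close>)

lemma \<tau>_anti_isometry:
  assumes L: "lagr L1" "lagr L2" "lagr L3" "lagr L1'" "lagr L2'" "lagr L3'"
    and F: "F ` L1 = L1'" "F ` L2 = L2'" "F ` L3 = L3'"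
    and lin: "\<And>x y. F (x + y) = F x + F y" "\<And>c x. F (s c x) = s c (F x)"
    and iso: "\<And>x y. x \<in> D \<Longrightarrow> y \<in> D \<Longrightarrow> h (F x) (F y) = - h x y"
  shows "\<tau> L1 L2 L3 = \<ominus>\<^bsub>\<W>\<^esub> \<tau> L1' L2' L3'"
  unfolding \<tau>_def wcl_uminus(2)[OF good_tform[OF L(4-6)], symmetric]
proof (rule wcl_pullback(2)[OF wcl_uminus(1)[OF good_tform[OF L(4-6)]] closed_space_mrec[OF space3(1)[OF L(1-3)]],
      where f = "\<lambda>(x, y, z). (F x, F y, F z)"])
  fix v w assume "v \<in> carrier (mrec s3 (L1 \<times> L2 \<times> L3))" "w \<in> carrier (mrec s3 (L1 \<times> L2 \<times> L3))"
  then show "tform v w = - tform (case v of (x, y, z) \<Rightarrow> (F x, F y, F z)) (case w of (x, y, z) \<Rightarrow> (F x, F y, F z))"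
    using lagrD(2)[OF L(1)] lagrD(2)[OF L(2)] lagrD(2)[OF L(3)]
    by (auto simp: tform_def h_diff iso subset_iff)
next
  fix y assume "y \<in> carrier (mrec s3 (L1' \<times> L2' \<times> L3'))"
  then show "\<exists>x\<in>carrier (mrec s3 (L1 \<times> L2 \<times> L3)). (case x of (x, y, z) \<Rightarrow> (F x, F y, F z)) = y"
    unfolding F[symmetric] by force
qed (use F lin in \<open>auto simp: image_iff\<close>)

end

section \<open>Graphs of isometries in the doubled space\<close>

locale graph_space = witt_field \<sigma> + form_space \<sigma> "fscale :: 'a \<Rightarrow> (nat \<Rightarrow> 'a) \<Rightarrow> nat \<Rightarrow> 'a" h "- 1"
  for \<sigma> :: "'a::field \<Rightarrow> 'a" and h :: "(nat \<Rightarrow> 'a) \<Rightarrow> (nat \<Rightarrow> 'a) \<Rightarrow> 'a" +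
  fixes N :: nat
  assumes nondegV: "\<And>x. x \<in> fun_space N \<Longrightarrow> \<forall>z\<in>fun_space N. h z x = 0 \<Longrightarrow> x = 0"
begin

abbreviation V :: "(nat \<Rightarrow> 'a) set" where "V \<equiv> fun_space N"

abbreviation sD :: "'a \<Rightarrow> (nat \<Rightarrow> 'a) \<times> (nat \<Rightarrow> 'a) \<Rightarrow> (nat \<Rightarrow> 'a) \<times> (nat \<Rightarrow> 'a)" where
  "sD \<equiv> pscale fscale fscale"

lemma zero_V: "0 \<in> V"
  and add_V: "x \<in> V \<Longrightarrow> y \<in> V \<Longrightarrow> x + y \<in> V"
  and diff_V: "x \<in> V \<Longrightarrow> y \<in> V \<Longrightarrow> x - y \<in> V"
  and scale_V: "x \<in> V \<Longrightarrow> fscale c x \<in> V"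
  by (auto simp: fun_space_def)

sublocale D: antihermitian_space \<sigma> sD "double_form h" "V \<times> V"
proof -
  interpret P: Vector_Spaces.vector_space sD
    by (rule vector_space_pscale[OF vector_space_axioms vector_space_axioms])
  show "antihermitian_space \<sigma> sD (double_form h) (V \<times> V)"
  proof unfold_locales
    fix x y z :: "(nat \<Rightarrow> 'a) \<times> (nat \<Rightarrow> 'a)" and c
    show "double_form h x (y + z) = double_form h x y + double_form h x z"
      by (cases x, cases y, cases z) (simp add: double_form_def h_add)
    show "double_form h x (sD c y) = c * double_form h x y"
      by (cases x, cases y) (simp add: double_form_def h_scale algebra_simps)
    have "\<sigma> (h u v) = - h v u" for u v using h_swap[of v u] by simp
    then show "double_form h y x = - 1 * \<sigma> (double_form h x y)"
      by (cases x, cases y) (simp add: double_form_def hom_add hom_uminus hom_minus)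
    show "vsub sD (V \<times> V)" by (intro vsub_Times vsub_fun_space)
    show "fin_spanned sD (V \<times> V)"
      by (intro fin_spanned_Times vector_space_axioms fin_spanned_fun_space)
    assume x: "x \<in> V \<times> V" and orth: "\<forall>z\<in>V \<times> V. double_form h z x = 0"
    obtain u v where uv: "x = (u, v)" "u \<in> V" "v \<in> V" using x by blast
    have "h z u = 0" if "z \<in> V" for z
      using orth[rule_format, of "(z, 0)"] that zero_V by (simp add: double_form_def uv)
    moreover have "h z v = 0" if "z \<in> V" for z
      using orth[rule_format, of "(0, z)"] that zero_V by (simp add: double_form_def uv)
    ultimately show "x = 0" using uv nondegV by (simp add: zero_prod_def)
  qed
qed

text \<open>Linearity is asked on all functions, to fit the total ambient type, whereas surjectivity
  and invariance of the form concern V. Injectivity on V is a consequence of the non-degenerate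
  form.\<close>

definition isom :: "((nat \<Rightarrow> 'a) \<Rightarrow> nat \<Rightarrow> 'a) \<Rightarrow> bool" where
  "isom g \<longleftrightarrow> (\<forall>x y. g (x + y) = g x + g y) \<and> (\<forall>c x. g (fscale c x) = fscale c (g x)) \<and>
     g ` V = V \<and> (\<forall>x\<in>V. \<forall>y\<in>V. h (g x) (g y) = h x y)"

lemma isomD:
  assumes "isom g"
  shows "g (x + y) = g x + g y" "g (fscale c x) = fscale c (g x)" "x \<in> V \<Longrightarrow> g x \<in> V"
    "x \<in> V \<Longrightarrow> y \<in> V \<Longrightarrow> h (g x) (g y) = h x y" "y \<in> V \<Longrightarrow> \<exists>x\<in>V. g x = y"
proof -
  have a: "\<forall>x y. g (x + y) = g x + g y" "\<forall>c x. g (fscale c x) = fscale c (g x)" "g ` V = V"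
    "\<forall>x\<in>V. \<forall>y\<in>V. h (g x) (g y) = h x y"
    using assms unfolding isom_def by - (elim conjE, assumption)+
  show "g (x + y) = g x + g y" "g (fscale c x) = fscale c (g x)" using a(1,2) by simp_all
  show "x \<in> V \<Longrightarrow> g x \<in> V" using a(3) by (metis imageI)
  show "x \<in> V \<Longrightarrow> y \<in> V \<Longrightarrow> h (g x) (g y) = h x y" using a(4) by simp
  show "y \<in> V \<Longrightarrow> \<exists>x\<in>V. g x = y" using a(3) by (metis imageE)
qed

lemma isom_id: "isom id"
  by (simp add: isom_def)

lemma isom_comp:
  assumes "isom f" "isom g"
  shows "isom (f \<circ> g)"
proof -
  have "(f \<circ> g) ` V = V" using assms unfolding isom_def by (metis image_comp)
  then show ?thesis using isomD[OF assms(1)] isomD[OF assms(2)] unfolding isom_def by (simp add: o_def)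
qed

definition \<Gamma> :: "((nat \<Rightarrow> 'a) \<Rightarrow> nat \<Rightarrow> 'a) \<Rightarrow> ((nat \<Rightarrow> 'a) \<times> (nat \<Rightarrow> 'a)) set" where
  "\<Gamma> g = {(x, g x) | x. x \<in> V}"

lemma lagr_\<Gamma>:
  assumes g: "isom g"
  shows "D.lagr (\<Gamma> g)"
proof -
  have g0: "g 0 = 0" using isomD(2)[OF g, of 0 0] by (simp add: fscale_def zero_fun_def)
  have "vsub sD (\<Gamma> g)"
    unfolding vsub_def
  proof (intro conjI ballI allI)
    show "0 \<in> \<Gamma> g" unfolding \<Gamma>_def using zero_V g0 by (auto simp: zero_prod_def)
    fix x assume "x \<in> \<Gamma> g"
    then obtain u where u: "x = (u, g u)" "u \<in> V" unfolding \<Gamma>_def by blast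
    show "sD c x \<in> \<Gamma> g" for c
      unfolding \<Gamma>_def using u isomD(2)[OF g, of c u] scale_V[OF u(2), of c]
      by (intro CollectI exI[of _ "fscale c u"]) simp
    fix y assume "y \<in> \<Gamma> g"
    then obtain v where v: "y = (v, g v)" "v \<in> V" unfolding \<Gamma>_def by blast
    show "x + y \<in> \<Gamma> g"
      unfolding \<Gamma>_def using u v isomD(1)[OF g, of u v] add_V[OF u(2) v(2)]
      by (intro CollectI exI[of _ "u + v"]) simp
  qed
  moreover have sub: "\<Gamma> g \<subseteq> V \<times> V" unfolding \<Gamma>_def using isomD(3)[OF g] by blast
  moreover have "D.perp (V \<times> V) (\<Gamma> g) = \<Gamma> g"
  proof
    show "D.perp (V \<times> V) (\<Gamma> g) \<subseteq> \<Gamma> g"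
    proof
      fix x assume x: "x \<in> D.perp (V \<times> V) (\<Gamma> g)"
      then obtain a b where ab: "x = (a, b)" "a \<in> V" "b \<in> V" unfolding D.perp_def by blast
      obtain b' where b': "b' \<in> V" "g b' = b" using isomD(5)[OF g ab(3)] by blast
      have "h z (b' - a) = 0" if z: "z \<in> V" for z
      proof -
        have "(z, g z) \<in> \<Gamma> g" using z unfolding \<Gamma>_def by blast
        then have "double_form h (z, g z) x = 0" using x unfolding D.perp_def by blast
        then have "h (g z) (g b') = h z a" unfolding ab(1) b'(2)[symmetric] double_form_def by simp
        then show ?thesis using isomD(4)[OF g z b'(1)] by (simp add: h_diff)
      qed
      then have "b' - a = 0" using nondegV diff_V[OF b'(1) ab(2)] by blast
      then show "x \<in> \<Gamma> g" using ab b' unfolding \<Gamma>_def by auto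
    qed
    show "\<Gamma> g \<subseteq> D.perp (V \<times> V) (\<Gamma> g)"
      using sub isomD(4)[OF g] unfolding D.perp_def \<Gamma>_def by (auto simp: double_form_def)
  qed
  ultimately show ?thesis unfolding D.lagr_def by blast
qed

definition T :: "((nat \<Rightarrow> 'a) \<Rightarrow> nat \<Rightarrow> 'a) \<Rightarrow> ((nat \<Rightarrow> 'a) \<Rightarrow> nat \<Rightarrow> 'a) \<Rightarrow> ((nat \<Rightarrow> 'a) \<Rightarrow> nat \<Rightarrow> 'a) \<Rightarrow>
    ('a mat \<times> 'a mat) set set" where
  "T g1 g2 g3 = D.\<tau> (\<Gamma> g1) (\<Gamma> g2) (\<Gamma> g3)"

lemma T_carrier: "isom g1 \<Longrightarrow> isom g2 \<Longrightarrow> isom g3 \<Longrightarrow> T g1 g2 g3 \<in> carrier \<W>"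
  unfolding T_def by (intro D.\<tau>_carrier lagr_\<Gamma>)

text \<open>Composition with k on the left moves graphs by (x, y) -> (x, k y), an isometry of the
  doubled space. Together with \<open>T_right\<close> this gives invariance under
  conjugation.\<close>

lemma T_left:
  assumes k: "isom k" and g: "isom g1" "isom g2" "isom g3"
  shows "T (k \<circ> g1) (k \<circ> g2) (k \<circ> g3) = T g1 g2 g3"
proof -
  define F where "F = (\<lambda>(x, y). (x :: nat \<Rightarrow> 'a, k y))"
  have F: "F ` \<Gamma> g = \<Gamma> (k \<circ> g)" for g unfolding F_def \<Gamma>_def by (auto simp: image_iff)
  have "T g1 g2 g3 = T (k \<circ> g1) (k \<circ> g2) (k \<circ> g3)"
    unfolding T_def
    by (rule D.\<tau>_isometry[OF lagr_\<Gamma>[OF g(1)] lagr_\<Gamma>[OF g(2)] lagr_\<Gamma>[OF g(3)] lagr_\<Gamma>[OF isom_comp[OF k g(1)]]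
        lagr_\<Gamma>[OF isom_comp[OF k g(2)]] lagr_\<Gamma>[OF isom_comp[OF k g(3)]] F F F])
      (auto simp: F_def double_form_def isomD[OF k])
  then show ?thesis ..
qed

lemma T_right:
  assumes k: "isom k" and g: "isom g1" "isom g2" "isom g3"
  shows "T (g1 \<circ> k) (g2 \<circ> k) (g3 \<circ> k) = T g1 g2 g3"
proof -
  define F where "F = (\<lambda>(x, y). (k x, y :: nat \<Rightarrow> 'a))"
  have F: "F ` \<Gamma> (g \<circ> k) = \<Gamma> g" for g
  proof -
    have "F ` \<Gamma> (g \<circ> k) = {(k x, g (k x)) | x. x \<in> V}" unfolding F_def \<Gamma>_def by (auto simp: image_iff)
    also have "\<dots> = \<Gamma> g" unfolding \<Gamma>_def using isomD(3,5)[OF k] by blast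
    finally show ?thesis .
  qed
  show ?thesis
    unfolding T_def
    by (rule D.\<tau>_isometry[OF lagr_\<Gamma>[OF isom_comp[OF g(1) k]] lagr_\<Gamma>[OF isom_comp[OF g(2) k]] lagr_\<Gamma>[OF isom_comp[OF g(3) k]]
        lagr_\<Gamma>[OF g(1)] lagr_\<Gamma>[OF g(2)] lagr_\<Gamma>[OF g(3)] F F F])
      (auto simp: F_def double_form_def isomD[OF k])
qed

text \<open>Exchanging the two coordinates turns the graph of an isometry into that of its inverse
  and reverses the sign of the doubled form.\<close>

lemma T_inverse:
  assumes g: "isom g1" "isom g2" "isom g3" and k: "isom k1" "isom k2" "isom k3"
    and gk: "g1 \<circ> k1 = id" "g2 \<circ> k2 = id" "g3 \<circ> k3 = id"
  shows "T k1 k2 k3 = \<ominus>\<^bsub>\<W>\<^esub> T g1 g2 g3"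
proof -
  define F where "F = (\<lambda>(x :: nat \<Rightarrow> 'a, y :: nat \<Rightarrow> 'a). (y, x))"
  have F: "F ` \<Gamma> k = \<Gamma> g" if "isom g" "isom k" and gk: "g \<circ> k = id" for g k
  proof -
    have kg: "g (k x) = x" for x using fun_cong[OF gk, of x] by simp
    have "F ` \<Gamma> k = {(k x, g (k x)) | x. x \<in> V}" unfolding F_def \<Gamma>_def kg by (auto simp: image_iff)
    also have "\<dots> = \<Gamma> g" unfolding \<Gamma>_def using isomD(3,5)[OF that(2)] by blast
    finally show ?thesis .
  qed
  show ?thesis
    unfolding T_def
    by (rule D.\<tau>_anti_isometry[OF lagr_\<Gamma>[OF k(1)] lagr_\<Gamma>[OF k(2)] lagr_\<Gamma>[OF k(3)]
        lagr_\<Gamma>[OF g(1)] lagr_\<Gamma>[OF g(2)] lagr_\<Gamma>[OF g(3)] F[OF g(1) k(1) gk(1)] F[OF g(2) k(2) gk(2)] F[OF g(3) k(3) gk(3)]])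
      (auto simp: F_def double_form_def)
qed

text \<open>Vectors fixed by g are the points common to the graphs of the identity and of g, so the
  splitting of V is exactly the hypothesis of the vanishing criterion for lagrangians.\<close>

lemma T_eq_zero:
  assumes g: "isom g" "isom k"
    and split: "\<And>x. x \<in> V \<Longrightarrow> \<exists>p q. p \<in> V \<and> q \<in> V \<and> g p = p \<and> k q = q \<and> x = p + q"
  shows "T id g k = \<zero>\<^bsub>\<W>\<^esub>"
  unfolding T_def
proof (rule D.\<tau>_eq_zero[OF lagr_\<Gamma>[OF isom_id] lagr_\<Gamma>[OF g(1)] lagr_\<Gamma>[OF g(2)]])
  fix x assume "x \<in> \<Gamma> id"
  then obtain u where u: "x = (u, u)" "u \<in> V" unfolding \<Gamma>_def by auto
  obtain p q where pq: "p \<in> V" "q \<in> V" "g p = p" "k q = q" "u = p + q" using split[OF u(2)] by blast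
  have "(p, p) \<in> \<Gamma> id" "(q, q) \<in> \<Gamma> id" using pq unfolding \<Gamma>_def by auto
  moreover have "(p, p) \<in> \<Gamma> g" "(q, q) \<in> \<Gamma> k"
    unfolding \<Gamma>_def using pq by (auto intro!: exI[of _ p] exI[of _ q])
  ultimately show "\<exists>p q. p \<in> \<Gamma> id \<and> p \<in> \<Gamma> g \<and> q \<in> \<Gamma> id \<and> q \<in> \<Gamma> k \<and> x = p + q"
    using u pq(5) by (intro exI[of _ "(p, p)"] exI[of _ "(q, q)"]) simp
qed

lemma T_same: "isom g \<Longrightarrow> isom k \<Longrightarrow> T g g k = \<zero>\<^bsub>\<W>\<^esub>" "isom g \<Longrightarrow> isom k \<Longrightarrow> T g k g = \<zero>\<^bsub>\<W>\<^esub>"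
  "isom g \<Longrightarrow> isom k \<Longrightarrow> T k g g = \<zero>\<^bsub>\<W>\<^esub>"
  unfolding T_def by (simp_all add: D.\<tau>_same lagr_\<Gamma>)

lemma T_swap: "isom g1 \<Longrightarrow> isom g2 \<Longrightarrow> isom g3 \<Longrightarrow> T g2 g1 g3 = \<ominus>\<^bsub>\<W>\<^esub> T g1 g2 g3"
  unfolding T_def by (intro D.\<tau>_swap lagr_\<Gamma>)

lemma T_cyclic: "isom g1 \<Longrightarrow> isom g2 \<Longrightarrow> isom g3 \<Longrightarrow> T g2 g3 g1 = T g1 g2 g3"
  unfolding T_def by (intro D.\<tau>_cyclic lagr_\<Gamma>)

lemma T_cocycle:
  "isom g1 \<Longrightarrow> isom g2 \<Longrightarrow> isom g3 \<Longrightarrow> isom g4 \<Longrightarrow>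
    T g1 g2 g3 \<oplus>\<^bsub>\<W>\<^esub> T g1 g3 g4 = T g1 g2 g4 \<oplus>\<^bsub>\<W>\<^esub> T g2 g3 g4"
  unfolding T_def by (intro D.\<tau>_cocycle lagr_\<Gamma>)

end

text \<open>The orthogonal projection onto the smaller space is equivariant, and the Maslov form of the
  larger space is pulled back along it from that of the smaller one.\<close>

lemma graph_space_T_restrict:
  assumes "graph_space \<sigma> h N" "graph_space \<sigma> h' N'" "N \<le> N'"
    and hh': "\<And>x y. x \<in> fun_space N \<Longrightarrow> y \<in> fun_space N \<Longrightarrow> h' x y = h x y"
    and iso: "\<And>g. g \<in> {g1, g2, g3} \<Longrightarrow> graph_space.isom h N g" "\<And>g. g \<in> {g1, g2, g3} \<Longrightarrow> graph_space.isom h' N' g"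
    and triv: "\<And>g x. g \<in> {g1, g2, g3} \<Longrightarrow> x \<in> fun_space N' \<Longrightarrow> g x - x \<in> fun_space N"
  shows "graph_space.T \<sigma> h' N' g1 g2 g3 = graph_space.T \<sigma> h N g1 g2 g3"
proof -
  interpret A: graph_space \<sigma> h N by (rule assms)
  interpret B: graph_space \<sigma> h' N' by (rule assms)
  have sub: "A.V \<subseteq> B.V" using assms(3) by (auto simp: fun_space_def)
  obtain Y where Y: "finite Y" "Y \<subseteq> A.V" "A.V = A.span Y"
    by (rule B.finite_basis_exists[OF fin_spanned_fun_space vsub_fun_space subset_refl])
  \<comment> \<open>Existence of the orthogonal projection: the small space is non-degenerate, so 0
    is the only common zero in it of the functionals of a spanning set, and
    \<open>functional_span\<close> represents the functional of any x by a vector y.\<close>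
  have "\<exists>y\<in>A.V. \<forall>z\<in>A.V. h' z (x - y) = 0" for x
  proof -
    have "h' z x = 0" if z: "z \<in> A.V" "\<forall>y\<in>Y. h' z y = 0" for z
    proof -
      have "A.subspace {y. h' z y = 0}" unfolding A.subspace_def by (auto simp: B.h_add B.h_scale)
      then have "A.V \<subseteq> {y. h' z y = 0}" using z(2) Y(3) A.span_minimal[of Y "{y. h' z y = 0}"] by blast
      then have "h y z = 0" if "y \<in> A.V" for y
        using that z(1) hh' A.h_eq_0_swap by (metis (mono_tags) mem_Collect_eq subsetD)
      then have "z = 0" using A.nondegV z(1) by blast
      then show ?thesis by simp
    qed
    then show ?thesis using B.functional_span[OF Y(1) vsub_fun_space] Y(3) by blast
  qed
  then obtain p where p: "\<And>x. p x \<in> A.V" "\<And>x z. z \<in> A.V \<Longrightarrow> h' z (x - p x) = 0" by metis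
  have uniq: "p x = y" if "y \<in> A.V" "\<And>z. z \<in> A.V \<Longrightarrow> h' z (x - y) = 0" for x y
  proof -
    have d: "p x - y \<in> A.V" using A.diff_V p(1) that(1) by blast
    have "h z (p x - y) = 0" if z: "z \<in> A.V" for z
    proof -
      have "p x - y = (x - y) - (x - p x)" by simp
      then have "h' z (p x - y) = h' z (x - y) - h' z (x - p x)" by (metis B.h_diff(1))
      also have "\<dots> = 0" using p(2)[OF z] \<open>\<And>z. z \<in> A.V \<Longrightarrow> h' z (x - y) = 0\<close>[OF z] by simp
      finally show ?thesis using hh' z d by simp
    qed
    then have "p x - y = 0" using A.nondegV d by blast
    then show ?thesis by simp
  qed
  have padd: "p (x + y) = p x + p y" for x y
  proof (rule uniq)
    show "p x + p y \<in> A.V" using A.add_V p(1) by blast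
    fix z assume "z \<in> A.V"
    then show "h' z (x + y - (p x + p y)) = 0" using p(2)[of z x] p(2)[of z y] by (simp add: B.h_add B.h_diff)
  qed
  have pscale: "p (fscale c x) = fscale c (p x)" for c x
  proof (rule uniq)
    show "fscale c (p x) \<in> A.V" using A.scale_V p(1) by blast
    fix z assume "z \<in> A.V"
    then have "c * h' z x = c * h' z (p x)" using p(2)[of z x] by (simp add: B.h_diff)
    then show "h' z (fscale c x - fscale c (p x)) = 0" by (simp add: B.h_scale B.h_diff)
  qed
  have pid: "p x = x" if "x \<in> A.V" for x by (rule uniq[OF that]) simp
  have equiv: "g x - x = g (p x) - p x" "p (g x) = g (p x)" if g: "g \<in> {g1, g2, g3}" and x: "x \<in> B.V" for g x
  proof -
    note a = A.isomD[OF iso(1)[OF g]] and b = B.isomD[OF iso(2)[OF g]]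
    define e where "e = x - p x"
    have eV: "e \<in> B.V" unfolding e_def using x p(1) sub B.diff_V by blast
    have xe: "x = p x + e" by (simp add: e_def)
    have gpV: "g (p x) \<in> A.V" using a(3) p(1) by blast
    \<comment> \<open>Both e and g e are orthogonal to the small space, while their difference lies
      in it by \<open>triv\<close>; non-degeneracy makes the difference 0.\<close>
    have "g e = e"
    proof -
      have d: "g e - e \<in> A.V" by (rule triv[OF g eV])
      have "h z (g e - e) = 0" if z: "z \<in> A.V" for z
      proof -
        obtain z' where z': "z' \<in> A.V" "g z' = z" using a(5)[OF z] by blast
        have "h' z (g e) = h' z' e" unfolding z'(2)[symmetric] using b(4) z'(1) sub eV by blast
        also have "\<dots> = 0" unfolding e_def by (rule p(2)[OF z'(1)])
        finally have "h' z (g e) = 0" .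
        moreover have "h' z e = 0" unfolding e_def by (rule p(2)[OF z])
        ultimately show ?thesis using hh'[OF z d] by (simp add: B.h_diff)
      qed
      then have "g e - e = 0" using A.nondegV d by blast
      then show ?thesis by simp
    qed
    then have gx: "g x = g (p x) + e" using b(1)[of "p x" e] xe by simp
    then show "g x - x = g (p x) - p x" by (simp add: e_def)
    show "p (g x) = g (p x)"
    proof (rule uniq[OF gpV])
      fix z assume "z \<in> A.V"
      then show "h' z (g x - g (p x)) = 0" unfolding gx using p(2)[of z x] by (simp add: e_def)
    qed
  qed
  \<comment> \<open>The components e and f orthogonal to the small space contribute h' e f twice to
    the doubled form, once with each sign.\<close>
  have form: "double_form h' (x, g x) (y, k y) = double_form h (p x, p (g x)) (p y, p (k y))"
    if g: "g \<in> {g1, g2, g3}" "k \<in> {g1, g2, g3}" and xy: "x \<in> B.V" "y \<in> B.V" for g k x y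
  proof -
    define e where "e = x - p x"
    define f where "f = y - p y"
    have x: "x = p x + e" "g x = g (p x) + e" using equiv(1)[OF g(1) xy(1)] by (simp_all add: e_def algebra_simps)
    have y: "y = p y + f" "k y = k (p y) + f" using equiv(1)[OF g(2) xy(2)] by (simp_all add: f_def algebra_simps)
    have m: "g (p x) \<in> A.V" "k (p y) \<in> A.V"
      using A.isomD(3)[OF iso(1)[OF g(1)] p(1)] A.isomD(3)[OF iso(1)[OF g(2)] p(1)] .
    have z: "h' z f = 0" "h' e z = 0" if "z \<in> A.V" for z
      using p(2)[OF that] B.h_eq_0_swap unfolding e_def f_def by blast+
    have 1: "h' x y = h (p x) (p y) + h' e f"
    proof -
      have "h' (p x + e) (p y + f) = h' (p x) (p y) + h' e f"
        using z[OF p(1)] by (simp add: B.h_add B.h_add_left)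
      then show ?thesis using x(1) y(1) hh'[OF p(1) p(1)] by metis
    qed
    have 2: "h' (g x) (k y) = h (g (p x)) (k (p y)) + h' e f"
      unfolding x(2) y(2) using z[OF m(1)] z[OF m(2)] hh'[OF m] by (simp add: B.h_add B.h_add_left)
    show ?thesis unfolding double_form_def using 1 2 equiv(2)[OF g(1) xy(1)] equiv(2)[OF g(2) xy(2)] by simp
  qed
  define F where "F = (\<lambda>(x, y). (p x, p y))"
  have F\<Gamma>: "F ` B.\<Gamma> g = A.\<Gamma> g" if g: "g \<in> {g1, g2, g3}" for g
  proof
    show "F ` B.\<Gamma> g \<subseteq> A.\<Gamma> g"
      unfolding F_def A.\<Gamma>_def B.\<Gamma>_def using equiv(2)[OF g] p(1) by auto
    show "A.\<Gamma> g \<subseteq> F ` B.\<Gamma> g"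
    proof
      fix v assume "v \<in> A.\<Gamma> g"
      then obtain x where x: "v = (x, g x)" "x \<in> A.V" unfolding A.\<Gamma>_def by blast
      then have "v = F (x, g x)" unfolding F_def using pid A.isomD(3)[OF iso(1)[OF g] x(2)] by simp
      moreover have "(x, g x) \<in> B.\<Gamma> g" unfolding B.\<Gamma>_def using x sub by blast
      ultimately show "v \<in> F ` B.\<Gamma> g" by blast
    qed
  qed
  have formF: "double_form h' v w = double_form h (F v) (F w)"
    if "v \<in> B.\<Gamma> g" "w \<in> B.\<Gamma> k" "g \<in> {g1, g2, g3}" "k \<in> {g1, g2, g3}" for v w g k
    using that form[of g k] unfolding F_def B.\<Gamma>_def by auto
  have lA: "A.D.lagr (A.\<Gamma> g1)" "A.D.lagr (A.\<Gamma> g2)" "A.D.lagr (A.\<Gamma> g3)"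
    by (rule A.lagr_\<Gamma>[OF iso(1)], simp)+
  have lB: "B.D.lagr (B.\<Gamma> g1)" "B.D.lagr (B.\<Gamma> g2)" "B.D.lagr (B.\<Gamma> g3)"
    by (rule B.lagr_\<Gamma>[OF iso(2)], simp)+
  show ?thesis
    unfolding A.T_def B.T_def A.D.\<tau>_def B.D.\<tau>_def
  proof (rule A.wcl_pullback(2)[OF A.D.good_tform[OF lA] closed_space_mrec[OF B.D.space3(1)[OF lB]],
        where f = "\<lambda>(x, y, z). (F x, F y, F z)"])
    fix v w assume v: "v \<in> carrier (mrec A.D.s3 (B.\<Gamma> g1 \<times> B.\<Gamma> g2 \<times> B.\<Gamma> g3))"
      and w: "w \<in> carrier (mrec A.D.s3 (B.\<Gamma> g1 \<times> B.\<Gamma> g2 \<times> B.\<Gamma> g3))"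
    obtain v1 v2 v3 where v': "v = (v1, v2, v3)" "v1 \<in> B.\<Gamma> g1" "v2 \<in> B.\<Gamma> g2" "v3 \<in> B.\<Gamma> g3" using v by auto
    obtain w1 w2 w3 where w': "w = (w1, w2, w3)" "w1 \<in> B.\<Gamma> g1" "w2 \<in> B.\<Gamma> g2" "w3 \<in> B.\<Gamma> g3" using w by auto
    note f = formF[of _ g1 _ g2] formF[of _ g1 _ g3] formF[of _ g2 _ g1] formF[of _ g2 _ g3] formF[of _ g3 _ g1] formF[of _ g3 _ g2]
    show "B.D.tform v w = A.D.tform (case v of (x, y, z) \<Rightarrow> (F x, F y, F z)) (case w of (x, y, z) \<Rightarrow> (F x, F y, F z))"
      unfolding v'(1) w'(1) A.D.tform_def B.D.tform_def
      using v' w' f by (simp add: A.D.h_diff B.D.h_diff)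
  next
    fix y assume "y \<in> carrier (mrec A.D.s3 (A.\<Gamma> g1 \<times> A.\<Gamma> g2 \<times> A.\<Gamma> g3))"
    then have "y \<in> F ` B.\<Gamma> g1 \<times> F ` B.\<Gamma> g2 \<times> F ` B.\<Gamma> g3" using F\<Gamma> by simp
    then show "\<exists>x\<in>carrier (mrec A.D.s3 (B.\<Gamma> g1 \<times> B.\<Gamma> g2 \<times> B.\<Gamma> g3)). (case x of (x, y, z) \<Rightarrow> (F x, F y, F z)) = y"
      by force
  next
    fix x assume "x \<in> carrier (mrec A.D.s3 (B.\<Gamma> g1 \<times> B.\<Gamma> g2 \<times> B.\<Gamma> g3))"
    then show "(case x of (x, y, z) \<Rightarrow> (F x, F y, F z)) \<in> carrier (mrec A.D.s3 (A.\<Gamma> g1 \<times> A.\<Gamma> g2 \<times> A.\<Gamma> g3))"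
      using F\<Gamma>[of g1] F\<Gamma>[of g2] F\<Gamma>[of g3] by (auto simp flip: F\<Gamma>)
  qed (auto simp: F_def padd pscale)
qed

lemma of_vec_add: "x \<in> carrier_vec n \<Longrightarrow> y \<in> carrier_vec n \<Longrightarrow> of_vec (x + y) = of_vec x + of_vec y"
  and of_vec_diff: "x \<in> carrier_vec n \<Longrightarrow> y \<in> carrier_vec n \<Longrightarrow> of_vec (x - y) = of_vec x - of_vec y"
  and of_vec_smult: "of_vec (c \<cdot>\<^sub>v x) = fscale c (of_vec x)"
  by (auto simp: of_vec_def fun_eq_iff)

lemma a_minus_direct_sum_coord_space:
  fixes x y x' y' :: "'k::field vec"
  assumes "x \<in> carrier_vec n" "x' \<in> carrier_vec n" "y \<in> carrier_vec n" "y' \<in> carrier_vec n"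
  shows "(x, x') \<ominus>\<^bsub>direct_sum (coord_space n) (coord_space n)\<^esub> (y, y') = (x - y, x' - y')"
proof -
  let ?C = "coord_space n :: ('k, 'k vec) module"
  have C: "Module.module class_ring ?C" unfolding coord_space_def by (rule vec_module)
  interpret DS: Module.module class_ring "direct_sum ?C ?C" by (rule direct_sum_is_module[OF C C])
  have s: "carrier ?C = carrier_vec n" "add ?C = (+)" "zero ?C = 0\<^sub>v n"
    by (simp_all add: coord_space_def module_vec_simps)
  have "\<ominus>\<^bsub>direct_sum ?C ?C\<^esub> (y, y') = (- y, - y')"
    by (rule DS.minus_equality) (use assms in \<open>auto simp: direct_sum_def s uminus_l_inv_vec\<close>)
  then show ?thesis
    using assms by (auto simp: a_minus_def direct_sum_def s minus_add_uminus_vec)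
qed

section \<open>Comparison with the defined Maslov index of graphs\<close>

context graph_space
begin

text \<open>The Gram matrix representing the Maslov form over functions is pulled back along the
  coordinate encoding e to the module records of the definition; \<open>witt_class_quot\<close> then
  accounts for the quotient by the kernel.\<close>

lemma graph_maslov_eq:
  fixes hv :: "'a vec \<Rightarrow> 'a vec \<Rightarrow> 'a"
  assumes g: "isom g1" "isom g2" "isom g3"
    and hv: "\<And>x y. x \<in> carrier_vec N \<Longrightarrow> y \<in> carrier_vec N \<Longrightarrow> hv x y = h (of_vec x) (of_vec y)"
    and gv: "\<And>x. x \<in> carrier_vec N \<Longrightarrow> v1 x = vec N (g1 (of_vec x))"
      "\<And>x. x \<in> carrier_vec N \<Longrightarrow> v2 x = vec N (g2 (of_vec x))"
      "\<And>x. x \<in> carrier_vec N \<Longrightarrow> v3 x = vec N (g3 (of_vec x))"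
  shows "graph_maslov \<sigma> (coord_space N) hv v1 v2 v3 = T g1 g2 g3"
proof -
  let ?C = "coord_space N :: ('a, 'a vec) module"
  let ?DS = "direct_sum ?C ?C"
  have C: "Module.module class_ring ?C" unfolding coord_space_def by (rule vec_module)
  interpret DS: Module.module class_ring ?DS by (rule direct_sum_is_module[OF C C])
  define e where "e = (\<lambda>(x :: 'a vec, y :: 'a vec). (of_vec x, of_vec y))"
  have gr: "graph ?C v \<subseteq> carrier_vec N \<times> carrier_vec N" "e ` graph ?C v = \<Gamma> g" "submodule class_ring (graph ?C v) ?DS"
    if g: "isom g" and v: "\<And>x. x \<in> carrier_vec N \<Longrightarrow> v x = vec N (g (of_vec x))" for g v
  proof -
    have ve: "of_vec (v x) = g (of_vec x)" if x: "x \<in> carrier_vec N" for x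
      unfolding v[OF x] by (rule of_vec_vec) (rule isomD(3)[OF g of_vec_fun_space[OF x]])
    have vc: "v x \<in> carrier_vec N" if "x \<in> carrier_vec N" for x using v[OF that] by simp
    show sub: "graph ?C v \<subseteq> carrier_vec N \<times> carrier_vec N" using vc by (auto simp: graph_def)
    show "e ` graph ?C v = \<Gamma> g"
    proof
      show "e ` graph ?C v \<subseteq> \<Gamma> g" using ve of_vec_fun_space by (fastforce simp: graph_def e_def \<Gamma>_def)
      show "\<Gamma> g \<subseteq> e ` graph ?C v"
      proof
        fix z assume "z \<in> \<Gamma> g"
        then obtain f where f: "z = (f, g f)" "f \<in> V" unfolding \<Gamma>_def by blast
        have "e (vec N f, v (vec N f)) = z" using f ve[of "vec N f"] by (simp add: e_def)
        moreover have "(vec N f, v (vec N f)) \<in> graph ?C v" by (auto simp: graph_def)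
        ultimately show "z \<in> e ` graph ?C v" by (metis imageI)
      qed
    qed
    have vadd: "v (x + y) = v x + v y" if "x \<in> carrier_vec N" "y \<in> carrier_vec N" for x y
      using that isomD(1)[OF g] by (simp add: v of_vec_add vec_fun_add)
    have vsmult: "v (c \<cdot>\<^sub>v x) = c \<cdot>\<^sub>v v x" if "x \<in> carrier_vec N" for c x
      using that isomD(2)[OF g] by (simp add: v of_vec_smult vec_fun_scale)
    have g0: "g 0 = 0" using isomD(2)[OF g, of 0 0] by (simp add: fscale_def zero_fun_def)
    have o0: "of_vec (0\<^sub>v N) = (0 :: nat \<Rightarrow> 'a)" by (auto simp: of_vec_def)
    have v0: "v (0\<^sub>v N) = 0\<^sub>v N" by (simp add: v o0 g0 vec_fun_zero)
    show "submodule class_ring (graph ?C v) ?DS"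
    proof (rule submodule.intro)
      show "Module.module class_ring ?DS" by (rule DS.module_axioms)
      show "graph ?C v \<subseteq> carrier ?DS" using sub by (simp add: direct_sum_def)
      show "\<zero>\<^bsub>?DS\<^esub> \<in> graph ?C v" using v0 by (auto simp: direct_sum_def graph_def)
      fix x assume "x \<in> graph ?C v"
      then obtain u where u: "x = (u, v u)" "u \<in> carrier_vec N" by (auto simp: graph_def)
      show "c \<odot>\<^bsub>?DS\<^esub> x \<in> graph ?C v" if "c \<in> carrier class_ring" for c
        using u vsmult[OF u(2), of c] by (auto simp: direct_sum_def graph_def intro!: exI[of _ "c \<cdot>\<^sub>v u"])
      fix y assume "y \<in> graph ?C v"
      then obtain w where w: "y = (w, v w)" "w \<in> carrier_vec N" by (auto simp: graph_def)
      show "x \<oplus>\<^bsub>?DS\<^esub> y \<in> graph ?C v"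
        using u w vadd[OF u(2) w(2)] by (auto simp: direct_sum_def graph_def intro!: exI[of _ "u + w"])
    qed
  qed
  note gr1 = gr[OF g(1) gv(1)] and gr2 = gr[OF g(2) gv(2)] and gr3 = gr[OF g(3) gv(3)]
  let ?S = "maslov_space ?DS (graph ?C v1) (graph ?C v2) (graph ?C v3)"
  let ?H = "maslov_form ?DS (double_form hv)"
  have modS: "Module.module class_ring ?S"
    unfolding maslov_space_def
    by (intro direct_sum_is_module DS.submodule_is_module gr1(3) gr2(3) gr3(3))
  have carS: "carrier ?S = graph ?C v1 \<times> graph ?C v2 \<times> graph ?C v3"
    by (simp add: maslov_space_def direct_sum_def)
  let ?f = "\<lambda>(x, y, z). (e x, e y, e z)"
  obtain G where G: "witt_rep (mrec D.s3 (\<Gamma> g1 \<times> \<Gamma> g2 \<times> \<Gamma> g3)) D.tform G"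
    "wcl (mrec D.s3 (\<Gamma> g1 \<times> \<Gamma> g2 \<times> \<Gamma> g3)) D.tform = WC G"
    by (rule wgoodE[OF D.good_tform[OF lagr_\<Gamma>[OF g(1)] lagr_\<Gamma>[OF g(2)] lagr_\<Gamma>[OF g(3)]]])
  have dbl: "double_form hv u (v \<ominus>\<^bsub>?DS\<^esub> w) = double_form h (e u) (e v - e w)"
    if u: "u \<in> carrier_vec N \<times> carrier_vec N" and v: "v \<in> carrier_vec N \<times> carrier_vec N"
      and w: "w \<in> carrier_vec N \<times> carrier_vec N" for u v w
  proof -
    obtain u1 u2 where u': "u = (u1, u2)" "u1 \<in> carrier_vec N" "u2 \<in> carrier_vec N" using u by blast
    obtain v1 v2 where v': "v = (v1, v2)" "v1 \<in> carrier_vec N" "v2 \<in> carrier_vec N" using v by blast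
    obtain w1 w2 where w': "w = (w1, w2)" "w1 \<in> carrier_vec N" "w2 \<in> carrier_vec N" using w by blast
    show ?thesis
      unfolding u'(1) v'(1) w'(1) a_minus_direct_sum_coord_space[OF v'(2,3) w'(2,3)]
      using u' v' w' by (simp add: double_form_def e_def hv of_vec_diff[of _ N])
  qed
  have eadd: "e (x \<oplus>\<^bsub>?DS\<^esub> y) = e x + e y" if "x \<in> carrier_vec N \<times> carrier_vec N" "y \<in> carrier_vec N \<times> carrier_vec N" for x y
    using that by (auto simp: e_def direct_sum_def of_vec_add[of _ N])
  have esmult: "e (c \<odot>\<^bsub>?DS\<^esub> x) = sD c (e x)" for c x
    by (cases x) (simp add: e_def direct_sum_def of_vec_smult)
  have "witt_rep ?S ?H G"
  proof (rule witt_rep_pullback[OF G(1), where f = ?f])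
    fix x assume "x \<in> carrier ?S"
    then obtain x1 x2 x3 where x: "x = (x1, x2, x3)" "x1 \<in> graph ?C v1" "x2 \<in> graph ?C v2" "x3 \<in> graph ?C v3"
      unfolding carS by blast
    show "?f x \<in> carrier (mrec D.s3 (\<Gamma> g1 \<times> \<Gamma> g2 \<times> \<Gamma> g3))"
      using x gr1(2) gr2(2) gr3(2) by auto
    show "?f (c \<odot>\<^bsub>?S\<^esub> x) = c \<odot>\<^bsub>mrec D.s3 (\<Gamma> g1 \<times> \<Gamma> g2 \<times> \<Gamma> g3)\<^esub> ?f x" for c
    proof -
      have "c \<odot>\<^bsub>?S\<^esub> x = (c \<odot>\<^bsub>?DS\<^esub> x1, c \<odot>\<^bsub>?DS\<^esub> x2, c \<odot>\<^bsub>?DS\<^esub> x3)"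
        unfolding x maslov_space_def direct_sum_def[of "?DS\<lparr>carrier := graph ?C v1\<rparr>"]
          direct_sum_def[of "?DS\<lparr>carrier := graph ?C v2\<rparr>"] by simp
      then show ?thesis unfolding x(1) mrec_simps by (simp add: esmult)
    qed
    fix y assume "y \<in> carrier ?S"
    then obtain y1 y2 y3 where y: "y = (y1, y2, y3)" "y1 \<in> graph ?C v1" "y2 \<in> graph ?C v2" "y3 \<in> graph ?C v3"
      unfolding carS by blast
    have m: "x1 \<in> carrier_vec N \<times> carrier_vec N" "x2 \<in> carrier_vec N \<times> carrier_vec N" "x3 \<in> carrier_vec N \<times> carrier_vec N"
       "y1 \<in> carrier_vec N \<times> carrier_vec N" "y2 \<in> carrier_vec N \<times> carrier_vec N" "y3 \<in> carrier_vec N \<times> carrier_vec N"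
      using x y gr1(1) gr2(1) gr3(1) by blast+
    show "?f (x \<oplus>\<^bsub>?S\<^esub> y) = ?f x \<oplus>\<^bsub>mrec D.s3 (\<Gamma> g1 \<times> \<Gamma> g2 \<times> \<Gamma> g3)\<^esub> ?f y"
    proof -
      have "x \<oplus>\<^bsub>?S\<^esub> y = (x1 \<oplus>\<^bsub>?DS\<^esub> y1, x2 \<oplus>\<^bsub>?DS\<^esub> y2, x3 \<oplus>\<^bsub>?DS\<^esub> y3)"
        unfolding x y maslov_space_def direct_sum_def[of "?DS\<lparr>carrier := graph ?C v1\<rparr>"]
          direct_sum_def[of "?DS\<lparr>carrier := graph ?C v2\<rparr>"] by simp
      then show ?thesis unfolding x(1) y(1) mrec_simps using m by (simp add: eadd)
    qed
    show "?H x y = D.tform (?f x) (?f y)"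
      unfolding x(1) y(1) maslov_form_def D.tform_def using m by (simp add: dbl)
  next
    fix y assume "y \<in> carrier (mrec D.s3 (\<Gamma> g1 \<times> \<Gamma> g2 \<times> \<Gamma> g3))"
    then obtain y1 y2 y3 where y: "y = (y1, y2, y3)" "y1 \<in> \<Gamma> g1" "y2 \<in> \<Gamma> g2" "y3 \<in> \<Gamma> g3" by auto
    obtain x1 where x1: "x1 \<in> graph ?C v1" "y1 = e x1" using subsetD[OF equalityD2[OF gr1(2)] y(2)] by blast
    obtain x2 where x2: "x2 \<in> graph ?C v2" "y2 = e x2" using subsetD[OF equalityD2[OF gr2(2)] y(3)] by blast
    obtain x3 where x3: "x3 \<in> graph ?C v3" "y3 = e x3" using subsetD[OF equalityD2[OF gr3(2)] y(4)] by blast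
    show "\<exists>x\<in>carrier ?S. ?f x = y"
      unfolding carS y(1) x1(2) x2(2) x3(2) using x1(1) x2(1) x3(1) by (intro bexI[of _ "(x1, x2, x3)"]) auto
  qed
  then have "witt_class \<sigma> (quot_module ?S (form_kernel ?S ?H)) (quot_form ?H) = WC G"
    by (rule witt_class_quot[OF modS])
  then show ?thesis
    unfolding graph_maslov_def maslov_def Let_def T_def D.\<tau>_def G(2) .
qed

end

section \<open>The Burau representation\<close>

lemma sum_two_terms:
  fixes f :: "nat \<Rightarrow> 'a::comm_monoid_add"
  assumes "i < n" "j < n" "i \<noteq> j" "\<And>k. k < n \<Longrightarrow> k \<noteq> i \<Longrightarrow> k \<noteq> j \<Longrightarrow> f k = 0"
  shows "(\<Sum>k<n. f k) = f i + f j"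
proof -
  have "(\<Sum>k<n. f k) = (\<Sum>k\<in>{i, j}. f k)"
    by (rule sum.mono_neutral_right) (use assms in auto)
  then show ?thesis using assms by simp
qed

definition winv :: "braid_word \<Rightarrow> braid_word" where
  "winv w = rev (map (\<lambda>(i, b). (i, \<not> b)) w)"

lemma winv_simps [simp]: "winv [] = []" "winv ((i, b) # w) = winv w @ [(i, \<not> b)]"
  by (simp_all add: winv_def)

lemma winv_winv [simp]: "winv (winv w) = w"
  by (simp add: winv_def rev_map o_def split_def)

lemma braid_words_simps [simp]:
  "[] \<in> braid_words n" "(i, b) # w \<in> braid_words n \<longleftrightarrow> 1 \<le> i \<and> i < n \<and> w \<in> braid_words n"
  "v @ w \<in> braid_words n \<longleftrightarrow> v \<in> braid_words n \<and> w \<in> braid_words n"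
  by (auto simp: braid_words_def)

lemma winv_braid_words [simp]: "winv w \<in> braid_words n \<longleftrightarrow> w \<in> braid_words n"
  by (induction w) auto

lemma braid_words_mono: "w \<in> braid_words n \<Longrightarrow> n \<le> m \<Longrightarrow> w \<in> braid_words m"
  by (induction w) auto

locale burau_data = witt_field \<sigma> for \<sigma> :: "'a::field \<Rightarrow> 'a" +
  fixes a :: 'a
  assumes conj_a: "a * \<sigma> a = 1" and a_neq_1: "a \<noteq> 1"
begin

lemma a_neq_0: "a \<noteq> 0"
  using conj_a by auto

lemma conj_a_neq_1: "\<sigma> a - 1 \<noteq> 0"
  using conj_a a_neq_1 by auto

text \<open>Acts on all functions, independently of any dimension, so the same maps serve every
  Burau space that contains the two coordinates involved.\<close>

definition bact :: "nat \<times> bool \<Rightarrow> (nat \<Rightarrow> 'a) \<Rightarrow> nat \<Rightarrow> 'a" where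
  "bact l f = (case l of (i, b) \<Rightarrow>
     if b then f(i - 1 := (1 - a) * f (i - 1) + f i, i := a * f (i - 1))
     else f(i - 1 := f i / a, i := f (i - 1) - (1 - a) * f i / a))"

definition R :: "braid_word \<Rightarrow> (nat \<Rightarrow> 'a) \<Rightarrow> nat \<Rightarrow> 'a" where
  "R w = foldr (\<lambda>l g. bact l \<circ> g) w id"

lemma R_simps [simp]: "R [] = id" "R (l # w) = bact l \<circ> R w"
  by (simp_all add: R_def)

lemma R_append: "R (v @ w) = R v \<circ> R w"
  by (induction v) (simp_all add: o_assoc)

lemma bact_add: "bact l (f + g) = bact l f + bact l g"
  by (cases l) (auto simp: bact_def fun_eq_iff algebra_simps add_divide_distrib diff_divide_distrib)

lemma bact_scale: "bact l (fscale c f) = fscale c (bact l f)"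
  by (cases l) (auto simp: bact_def fun_eq_iff algebra_simps)

lemma bact_inverse:
  assumes "1 \<le> i"
  shows "bact (i, b) \<circ> bact (i, \<not> b) = id"
proof -
  obtain k where "i = Suc k" using assms by (cases i) auto
  then show ?thesis using a_neq_0 by (cases b) (auto simp: bact_def fun_eq_iff field_simps)
qed

lemma bact_comm:
  assumes "1 \<le> i" "i + 2 \<le> j"
  shows "bact (i, True) \<circ> bact (j, True) = bact (j, True) \<circ> bact (i, True)"
proof -
  obtain k where k: "i = Suc k" using assms by (cases i) auto
  obtain l where l: "j = Suc l" "k + 2 \<le> l" using assms k by (cases j) auto
  show ?thesis using l(2) unfolding k l(1) by (auto simp: bact_def fun_eq_iff)
qed

lemma bact_braid:
  assumes "1 \<le> i"
  shows "bact (i, True) \<circ> (bact (i + 1, True) \<circ> bact (i, True)) = bact (i + 1, True) \<circ> (bact (i, True) \<circ> bact (i + 1, True))"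
proof -
  obtain k where k: "i = Suc k" using assms by (cases i) auto
  show ?thesis unfolding k by (auto simp: bact_def fun_eq_iff algebra_simps)
qed

lemma R_winv: "w \<in> braid_words n \<Longrightarrow> R w \<circ> R (winv w) = id"
proof (induction w)
  case (Cons l w)
  obtain i b where l: "l = (i, b)" by (cases l)
  have "R (l # w) \<circ> R (winv (l # w)) = bact (i, b) \<circ> (R w \<circ> R (winv w)) \<circ> bact (i, \<not> b)"
    unfolding l by (simp add: R_append o_assoc)
  also have "R w \<circ> R (winv w) = id" using Cons l by (metis braid_words_simps(2))
  also have "bact (i, b) \<circ> id \<circ> bact (i, \<not> b) = id" using Cons.prems bact_inverse[of i b] l by simp
  finally show ?case .
qed simp

lemma R_winv': "w \<in> braid_words n \<Longrightarrow> R (winv w) \<circ> R w = id"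
  using R_winv[of "winv w" n] by simp

definition burau_mat :: "nat \<Rightarrow> 'a mat" where
  "burau_mat N = burau_omega a N - transpose_mat (map_mat \<sigma> (burau_omega a N))"

abbreviation hB :: "nat \<Rightarrow> (nat \<Rightarrow> 'a) \<Rightarrow> (nat \<Rightarrow> 'a) \<Rightarrow> 'a" where
  "hB N \<equiv> gform (burau_mat N)"

lemma burau_mat_carrier: "burau_mat N \<in> carrier_mat N N"
  by (rule carrier_matI) (simp_all add: burau_mat_def burau_omega_def)

lemma burau_mat_index:
  "i < N \<Longrightarrow> j < N \<Longrightarrow> burau_mat N $$ (i, j) = (if i = j then 0 else if j < i then 1 - a else \<sigma> a - 1)"
  by (auto simp: burau_mat_def burau_omega_def hom_minus)

lemma dim_burau_mat [simp]: "dim_row (burau_mat N) = N" "dim_col (burau_mat N) = N"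
  using burau_mat_carrier[of N] by auto

lemma form_space_hB: "form_space \<sigma> fscale (hB N) (- 1)"
  by (rule form_space_gform[OF burau_mat_carrier]) (auto simp: burau_mat_index hom_minus)

text \<open>A generator differs from the identity by the rank one map with direction
  \<open>bvec i\<close> and functional \<open>bfun i\<close>. Up to the factor \<sigma> a - 1 this
  functional is the pairing with \<open>bvec i\<close> (\<open>hB_bvec\<close>), which reduces
  invariance of the form to one scalar identity.\<close>

definition bvec :: "nat \<Rightarrow> nat \<Rightarrow> 'a" where
  "bvec i = (\<lambda>r. if r = i - 1 then 1 else if r = i then - 1 else 0)"

definition bfun :: "nat \<Rightarrow> (nat \<Rightarrow> 'a) \<Rightarrow> 'a" where
  "bfun i f = f i - a * f (i - 1)"

lemma hB_bvec:
  assumes "1 \<le> i" "i < N"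
  shows "hB N (bvec i) y = (\<sigma> a - 1) * bfun i y"
proof -
  obtain k where k: "i = Suc k" using assms by (cases i) auto
  have kN: "k < N" "Suc k < N" using assms k by auto
  have "hB N (bvec i) y = (\<Sum>j<N. \<Sum>l<N. \<sigma> (bvec i l) * burau_mat N $$ (l, j) * y j)"
    unfolding gform_sum dim_burau_mat by (rule sum.swap)
  also have "\<dots> = (\<Sum>j<N. (burau_mat N $$ (k, j) - burau_mat N $$ (Suc k, j)) * y j)"
  proof (rule sum.cong[OF refl])
    fix j assume "j \<in> {..<N}"
    have "(\<Sum>l<N. \<sigma> (bvec i l) * burau_mat N $$ (l, j) * y j)
        = \<sigma> (bvec i k) * burau_mat N $$ (k, j) * y j + \<sigma> (bvec i (Suc k)) * burau_mat N $$ (Suc k, j) * y j"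
      by (rule sum_two_terms[OF kN]) (auto simp: bvec_def k)
    then show "(\<Sum>l<N. \<sigma> (bvec i l) * burau_mat N $$ (l, j) * y j)
        = (burau_mat N $$ (k, j) - burau_mat N $$ (Suc k, j)) * y j"
      by (simp add: bvec_def k hom_uminus algebra_simps)
  qed
  also have "\<dots> = (burau_mat N $$ (k, k) - burau_mat N $$ (Suc k, k)) * y k +
      (burau_mat N $$ (k, Suc k) - burau_mat N $$ (Suc k, Suc k)) * y (Suc k)"
    by (rule sum_two_terms[OF kN]) (use kN in \<open>auto simp: burau_mat_index\<close>)
  also have "\<dots> = (a - 1) * y k + (\<sigma> a - 1) * y (Suc k)"
    using kN by (simp add: burau_mat_index)
  also have "a - 1 = - ((\<sigma> a - 1) * a)" using conj_a by (simp add: algebra_simps)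
  finally show ?thesis by (simp add: bfun_def k algebra_simps)
qed

lemma bact_True: "1 \<le> i \<Longrightarrow> bact (i, True) f = f + fscale (bfun i f) (bvec i)"
  by (cases i) (auto simp: bact_def bfun_def bvec_def fun_eq_iff algebra_simps)

text \<open>Expanding along \<open>bvec i\<close> leaves three correction terms, all multiples of
  \<sigma> (\<open>bfun i x\<close>) * \<open>bfun i y\<close>; their coefficients sum to 0 because
  a \<sigma> a = 1.\<close>

lemma hB_bact_True:
  assumes i: "1 \<le> i" "i < N"
  shows "hB N (bact (i, True) x) (bact (i, True) y) = hB N x y"
proof -
  interpret F: form_space \<sigma> fscale "hB N" "- 1" by (rule form_space_hB)
  let ?b = "\<sigma> a - 1"
  have u: "hB N (bvec i) y = ?b * bfun i y" for y by (rule hB_bvec[OF i])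
  have "hB N x (bvec i) = - \<sigma> (?b * bfun i x)" for x using F.h_swap[of x "bvec i"] u by simp
  then have u': "hB N x (bvec i) = (1 - a) * \<sigma> (bfun i x)" for x by (simp add: hom_mult hom_minus algebra_simps)
  have uu: "bfun i (bvec i) = - 1 - a" using i by (simp add: bfun_def bvec_def)
  have ab: "\<sigma> a * a = 1" using conj_a by (simp add: mult.commute)
  have "hB N (bact (i, True) x) (bact (i, True) y) = hB N x y + bfun i y * hB N x (bvec i)
      + \<sigma> (bfun i x) * hB N (bvec i) y + \<sigma> (bfun i x) * bfun i y * hB N (bvec i) (bvec i)"
    unfolding bact_True[OF i(1)] by (simp add: F.h_add F.h_add_left F.h_scale F.h_scale_left algebra_simps)
  also have "\<dots> = hB N x y + \<sigma> (bfun i x) * bfun i y * (?b + (1 - a) + ?b * (- 1 - a))"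
    unfolding u'[of x] u[of y] u[of "bvec i"] uu by (simp add: algebra_simps)
  also have "?b + (1 - a) + ?b * (- 1 - a) = 0" using ab by (simp add: algebra_simps)
  finally show ?thesis by simp
qed

lemma hB_bact:
  assumes i: "1 \<le> i" "i < N"
  shows "hB N (bact (i, b) x) (bact (i, b) y) = hB N x y"
proof (cases b)
  case True
  then show ?thesis using hB_bact_True[OF i] by simp
next
  case False
  have "bact (i, True) (bact (i, False) z) = z" for z
    using bact_inverse[OF i(1), of True] by (simp add: fun_eq_iff)
  then show ?thesis using hB_bact_True[OF i, of "bact (i, False) x" "bact (i, False) y"] False by simp
qed

lemma bact_fun_space:
  assumes "1 \<le> i" "i < N" "f \<in> fun_space N"
  shows "bact (i, b) f \<in> fun_space N"
  using assms by (auto simp: bact_def fun_space_def)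

section \<open>Dimensions in which the Burau form is non-degenerate\<close>

definition nondeg_dim :: "nat \<Rightarrow> bool" where
  "nondeg_dim N \<longleftrightarrow> (\<forall>x\<in>fun_space N. (\<forall>z\<in>fun_space N. hB N z x = 0) \<longrightarrow> x = 0)"

lemma graph_space_hB: "nondeg_dim N \<Longrightarrow> graph_space \<sigma> (hB N) N"
  using form_space_hB[of N] witt_field_axioms
  by (auto simp: graph_space_def graph_space_axioms_def nondeg_dim_def)

lemma isom_R:
  assumes "w \<in> braid_words N" "nondeg_dim N"
  shows "graph_space.isom (hB N) N (R w)"
proof -
  interpret G: graph_space \<sigma> "hB N" N by (rule graph_space_hB[OF assms(2)])
  have "G.isom (bact (i, b))" if i: "1 \<le> i" "i < N" for i b
    unfolding G.isom_def
  proof (intro conjI allI ballI)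
    show "bact (i, b) ` fun_space N = fun_space N"
    proof
      show "bact (i, b) ` fun_space N \<subseteq> fun_space N" using bact_fun_space[OF i] by blast
      show "fun_space N \<subseteq> bact (i, b) ` fun_space N"
      proof
        fix f :: "nat \<Rightarrow> 'a" assume f: "f \<in> fun_space N"
        have "bact (i, b) (bact (i, \<not> b) f) = f" using bact_inverse[OF i(1), of b] by (simp add: fun_eq_iff)
        then show "f \<in> bact (i, b) ` fun_space N" using bact_fun_space[OF i f] by (metis imageI)
      qed
    qed
  qed (simp_all add: bact_add bact_scale hB_bact[OF i])
  then show ?thesis using assms(1)
    by (induction w) (auto intro: G.isom_id G.isom_comp)
qed

text \<open>Orthogonality to each \<open>bvec\<close> forces x (Suc k) = a * x k, so a radical
  vector is a geometric sequence; orthogonality to the first unit vector then kills its sum from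
  exponent 1 to N - 1.\<close>

lemma degenerate_sum:
  assumes "\<not> nondeg_dim N"
  shows "(\<Sum>j\<in>{1..<N}. a ^ j) = 0"
proof -
  obtain x where x: "x \<in> fun_space N" "x \<noteq> 0" "\<And>z. z \<in> fun_space N \<Longrightarrow> hB N z x = 0"
    using assms unfolding nondeg_dim_def by blast
  have step: "x (Suc k) = a * x k" if "Suc k < N" for k
  proof -
    have "bvec (Suc k) \<in> fun_space N" using that by (auto simp: fun_space_def bvec_def)
    then have "(\<sigma> a - 1) * bfun (Suc k) x = 0" using x(3) hB_bvec[of "Suc k" N x] that by simp
    then show ?thesis using conj_a_neq_1 by (simp add: bfun_def)
  qed
  have pow: "x k = a ^ k * x 0" if "k < N" for k
    using that by (induction k) (use step in \<open>auto simp: algebra_simps\<close>)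
  have x0: "x 0 \<noteq> 0"
  proof
    assume "x 0 = 0"
    then have "x k = 0" for k using pow[of k] x(1) by (cases "k < N") (auto simp: fun_space_def)
    then show False using x(2) by (auto simp: fun_eq_iff)
  qed
  then have N: "0 < N" using x(1) by (cases N) (auto simp: fun_space_def)
  define d :: "nat \<Rightarrow> 'a" where "d r = (if r = 0 then 1 else 0)" for r
  have "d \<in> fun_space N" using N by (auto simp: d_def fun_space_def)
  then have "0 = hB N d x" using x(3) by simp
  also have "\<dots> = (\<Sum>i<N. if i = 0 then (\<Sum>j<N. burau_mat N $$ (0, j) * x j) else 0)"
    unfolding gform_sum dim_burau_mat by (rule sum.cong) (auto simp: d_def)
  also have "\<dots> = (\<Sum>j<N. burau_mat N $$ (0, j) * x j)" using N by simp
  also have "\<dots> = (\<Sum>j\<in>{1..<N}. (\<sigma> a - 1) * x 0 * a ^ j)"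
  proof (rule sum.mono_neutral_cong_right)
    show "\<forall>j\<in>{..<N} - {1..<N}. burau_mat N $$ (0, j) * x j = 0" using N by (auto simp: burau_mat_index)
    show "burau_mat N $$ (0, j) * x j = (\<sigma> a - 1) * x 0 * a ^ j" if "j \<in> {1..<N}" for j
      using that N pow[of j] by (simp add: burau_mat_index algebra_simps)
  qed auto
  also have "\<dots> = (\<sigma> a - 1) * x 0 * (\<Sum>j\<in>{1..<N}. a ^ j)" by (simp add: sum_distrib_left)
  finally show ?thesis using x0 conj_a_neq_1 by simp
qed

text \<open>The geometric sums for n and n + 1 differ by a power of a, which is not 0, so one of
  these two dimensions is non-degenerate. This makes the LEAST in \<open>burau_dim\<close> well
  defined.\<close>

lemma nondeg_dim_exists:
  assumes "1 \<le> n"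
  shows "\<exists>N\<ge>n. nondeg_dim N"
proof (rule ccontr)
  assume "\<not> ?thesis"
  then have "(\<Sum>j\<in>{1..<n}. a ^ j) = 0" "(\<Sum>j\<in>{1..<Suc n}. a ^ j) = 0"
    using degenerate_sum[of n] degenerate_sum[of "Suc n"] by auto
  moreover have "(\<Sum>j\<in>{1..<Suc n}. a ^ j) = (\<Sum>j\<in>{1..<n}. a ^ j) + a ^ n"
    using assms by (rule sum.atLeastLessThan_Suc)
  ultimately show False using a_neq_0 by simp
qed

lemma burau_form_eq_hB:
  "x \<in> carrier_vec N \<Longrightarrow> y \<in> carrier_vec N \<Longrightarrow> burau_form \<sigma> a N x y = hB N (of_vec x) (of_vec y)"
  by (simp add: burau_form_def gform_def burau_mat_def[symmetric])

lemma nondegenerate_burau_iff: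
  "nondegenerate (coord_space N) (burau_form \<sigma> a N) \<longleftrightarrow> nondeg_dim N"
proof -
  interpret F: form_space \<sigma> fscale "hB N" "- 1" by (rule form_space_hB)
  note b = burau_form_eq_hB
  have 0: "of_vec (0\<^sub>v N) = (0 :: nat \<Rightarrow> 'a)" by (auto simp: of_vec_def)
  show ?thesis
  proof
    assume nd: "nondegenerate (coord_space N) (burau_form \<sigma> a N)"
    show "nondeg_dim N"
      unfolding nondeg_dim_def
    proof (intro ballI impI)
      fix x assume x: "x \<in> fun_space N" and orth: "\<forall>z\<in>fun_space N. hB N z x = 0"
      have "vec N x \<in> form_kernel (coord_space N) (burau_form \<sigma> a N)"
      proof -
        have "hB N x (of_vec w) = 0" if "w \<in> carrier_vec N" for w
          by (rule F.h_eq_0_swap) (use orth of_vec_fun_space[OF that] in blast)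
        then show ?thesis using x by (auto simp: orth_def b)
      qed
      then have "vec N x = 0\<^sub>v N" using nd by (simp add: nondegenerate_def)
      then show "x = 0" using of_vec_vec[OF x] 0 by simp
    qed
  next
    assume nd: "nondeg_dim N"
    have "v = 0\<^sub>v N" if v: "v \<in> carrier_vec N" "\<forall>w\<in>carrier_vec N. burau_form \<sigma> a N v w = 0" for v
    proof -
      have "hB N z (of_vec v) = 0" if z: "z \<in> fun_space N" for z
      proof (rule F.h_eq_0_swap)
        show "hB N (of_vec v) z = 0" using v b[of v N "vec N z"] z by simp
      qed
      then have "of_vec v = 0" using nd of_vec_fun_space[OF v(1)] unfolding nondeg_dim_def by blast
      moreover have "vec N (0 :: nat \<Rightarrow> 'a) = 0\<^sub>v N" by (rule vec_fun_zero)
      ultimately show ?thesis using vec_of_vec[OF v(1)] by simp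
    qed
    moreover have "0\<^sub>v N \<in> form_kernel (coord_space N) (burau_form \<sigma> a N)"
      by (auto simp: orth_def b 0)
    ultimately show "nondegenerate (coord_space N) (burau_form \<sigma> a N)"
      unfolding nondegenerate_def orth_def by auto
  qed
qed

lemma burau_dim:
  assumes "1 \<le> n"
  shows "n \<le> burau_dim \<sigma> a n" "nondeg_dim (burau_dim \<sigma> a n)"
    "n \<le> N \<Longrightarrow> nondeg_dim N \<Longrightarrow> burau_dim \<sigma> a n \<le> N"
proof -
  have "\<exists>N. n \<le> N \<and> nondeg_dim N" using nondeg_dim_exists[OF assms] by blast
  from LeastI_ex[OF this] show "n \<le> burau_dim \<sigma> a n" "nondeg_dim (burau_dim \<sigma> a n)"
    unfolding burau_dim_def nondegenerate_burau_iff by auto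
  show "n \<le> N \<Longrightarrow> nondeg_dim N \<Longrightarrow> burau_dim \<sigma> a n \<le> N"
    unfolding burau_dim_def nondegenerate_burau_iff by (rule Least_le) blast
qed

end

section \<open>Braid groups\<close>

lemma braid_equiv_words: "braid_equiv n v w \<Longrightarrow> v \<in> braid_words n \<and> w \<in> braid_words n"
  by (induction rule: braid_equiv.induct) auto

lemma braid_equiv_context:
  "braid_equiv n v w \<Longrightarrow> x \<in> braid_words n \<Longrightarrow> y \<in> braid_words n \<Longrightarrow> braid_equiv n (x @ v @ y) (x @ w @ y)"
proof (induction rule: braid_equiv.induct)
  case (be_cancel u v i b)
  then show ?case using braid_equiv.be_cancel[of "x @ u" n "v @ y" i b] by simp
next
  case (be_comm u v i j)
  then show ?case using braid_equiv.be_comm[of "x @ u" n "v @ y" i j] by simp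
next
  case (be_braid u v i)
  then show ?case using braid_equiv.be_braid[of "x @ u" n "v @ y" i] by simp
qed (auto intro: braid_equiv.intros)

lemma braid_equiv_append:
  assumes "braid_equiv n v v'" "braid_equiv n w w'"
  shows "braid_equiv n (v @ w) (v' @ w')"
  using braid_equiv_context[OF assms(1), of "[]" w] braid_equiv_context[OF assms(2), of v' "[]"]
    braid_equiv_words[OF assms(1)] braid_equiv_words[OF assms(2)] by (auto intro: be_trans)

lemma braid_equiv_mono: "braid_equiv n v w \<Longrightarrow> n \<le> m \<Longrightarrow> braid_equiv m v w"
proof (induction rule: braid_equiv.induct)
  case (be_cancel u v i b)
  then show ?case by (intro braid_equiv.be_cancel) (auto intro: braid_words_mono)
next
  case (be_comm u v i j)
  then show ?case by (intro braid_equiv.be_comm) (auto intro: braid_words_mono)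
next
  case (be_braid u v i)
  then show ?case by (intro braid_equiv.be_braid) (auto intro: braid_words_mono)
qed (auto intro: braid_equiv.be_refl braid_equiv.be_sym braid_equiv.be_trans braid_words_mono)

lemma braid_equiv_winv: "w \<in> braid_words n \<Longrightarrow> braid_equiv n (w @ winv w) []"
proof (induction w)
  case Nil
  then show ?case by (auto intro: be_refl)
next
  case (Cons l w)
  obtain i b where l: "l = (i, b)" by (cases l)
  then have i: "1 \<le> i" "i < n" and w: "w \<in> braid_words n" using Cons.prems by auto
  have "braid_equiv n ([(i, b)] @ (w @ winv w) @ [(i, \<not> b)]) ([(i, b)] @ [] @ [(i, \<not> b)])"
    using Cons.IH[OF w] i by (intro braid_equiv_context) auto
  moreover have "braid_equiv n ([(i, b)] @ [] @ [(i, \<not> b)]) []"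
    using be_cancel[of "[]" n "[]" i b] i by simp
  ultimately show ?case unfolding l by (auto intro: be_trans)
qed

lemma equiv_braid_rel: "equiv (braid_words n) (braid_rel n)"
proof (rule equivI)
  show "braid_rel n \<subseteq> braid_words n \<times> braid_words n"
    using braid_equiv_words by (auto simp: braid_rel_def)
qed (auto simp: braid_rel_def refl_on_def sym_def trans_def intro: be_refl be_sym be_trans)

abbreviation bcl :: "nat \<Rightarrow> braid_word \<Rightarrow> braid_word set" where
  "bcl n w \<equiv> braid_rel n `` {w}"

lemma bcl_eqI: "braid_equiv n v w \<Longrightarrow> bcl n v = bcl n w"
  by (rule equiv_class_eq[OF equiv_braid_rel]) (simp add: braid_rel_def)

lemma mem_bcl: "v \<in> bcl n w \<longleftrightarrow> braid_equiv n w v"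
  by (simp add: braid_rel_def)

lemma bcl_carrier: "w \<in> braid_words n \<Longrightarrow> bcl n w \<in> carrier (braid_group n)"
  by (auto simp: braid_group_def intro: quotientI)

lemma braid_carrierE:
  assumes "x \<in> carrier (braid_group n)"
  obtains w where "w \<in> braid_words n" "x = bcl n w"
  using assms by (auto simp: braid_group_def elim!: quotientE)

lemma UN_const: "x \<in> X \<Longrightarrow> (\<And>y. y \<in> X \<Longrightarrow> f y = c) \<Longrightarrow> (\<Union>y\<in>X. f y) = c"
  by blast

lemma bcl_mult:
  assumes "v \<in> braid_words n" "w \<in> braid_words n"
  shows "bcl n v \<otimes>\<^bsub>braid_group n\<^esub> bcl n w = bcl n (v @ w)"
proof -
  have "(\<Union>v'\<in>bcl n v. \<Union>w'\<in>bcl n w. bcl n (v' @ w')) = bcl n (v @ w)"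
  proof (rule UN_const)
    show "v \<in> bcl n v" unfolding mem_bcl by (rule be_refl[OF assms(1)])
    fix v' assume "v' \<in> bcl n v"
    then have v': "braid_equiv n v v'" unfolding mem_bcl .
    show "(\<Union>w'\<in>bcl n w. bcl n (v' @ w')) = bcl n (v @ w)"
    proof (rule UN_const)
      show "w \<in> bcl n w" unfolding mem_bcl by (rule be_refl[OF assms(2)])
      fix w' assume "w' \<in> bcl n w"
      then have "braid_equiv n w w'" unfolding mem_bcl .
      then show "bcl n (v' @ w') = bcl n (v @ w)"
        by (intro bcl_eqI be_sym[OF braid_equiv_append[OF v']])
    qed
  qed
  then show ?thesis unfolding braid_group_def monoid.simps .
qed

lemma braid_one: "\<one>\<^bsub>braid_group n\<^esub> = bcl n []"
  by (simp add: braid_group_def)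

lemma group_braid_group: "group (braid_group n)"
proof (rule groupI)
  show "\<one>\<^bsub>braid_group n\<^esub> \<in> carrier (braid_group n)" by (simp add: braid_one bcl_carrier)
  fix x assume x: "x \<in> carrier (braid_group n)"
  then obtain w where w: "w \<in> braid_words n" "x = bcl n w" by (rule braid_carrierE)
  show "\<one>\<^bsub>braid_group n\<^esub> \<otimes>\<^bsub>braid_group n\<^esub> x = x" using w by (simp add: braid_one bcl_mult)
  have "bcl n (winv w) \<otimes>\<^bsub>braid_group n\<^esub> x = \<one>\<^bsub>braid_group n\<^esub>"
    using w braid_equiv_winv[of "winv w" n] by (simp add: braid_one bcl_mult bcl_eqI)
  then show "\<exists>y\<in>carrier (braid_group n). y \<otimes>\<^bsub>braid_group n\<^esub> x = \<one>\<^bsub>braid_group n\<^esub>"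
    using w bcl_carrier winv_braid_words by blast
  fix y assume "y \<in> carrier (braid_group n)"
  then obtain v where v: "v \<in> braid_words n" "y = bcl n v" by (rule braid_carrierE)
  show "x \<otimes>\<^bsub>braid_group n\<^esub> y \<in> carrier (braid_group n)" using w v by (simp add: bcl_mult bcl_carrier)
  fix z assume "z \<in> carrier (braid_group n)"
  then obtain u where u: "u \<in> braid_words n" "z = bcl n u" by (rule braid_carrierE)
  show "x \<otimes>\<^bsub>braid_group n\<^esub> y \<otimes>\<^bsub>braid_group n\<^esub> z = x \<otimes>\<^bsub>braid_group n\<^esub> (y \<otimes>\<^bsub>braid_group n\<^esub> z)"
    using w v u by (simp add: bcl_mult)
qed

lemma braid_inv:
  assumes "w \<in> braid_words n"
  shows "inv\<^bsub>braid_group n\<^esub> bcl n w = bcl n (winv w)"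
  using assms braid_equiv_winv[of "winv w" n]
  by (intro group.inv_equality[OF group_braid_group]) (simp_all add: bcl_mult bcl_carrier braid_one bcl_eqI)

lemma braid_incl_bcl:
  assumes "w \<in> braid_words n" "n \<le> m"
  shows "braid_incl n m (bcl n w) = bcl m w"
  unfolding braid_incl_def
proof (rule UN_const)
  show "w \<in> bcl n w" unfolding mem_bcl by (rule be_refl[OF assms(1)])
  fix v assume "v \<in> bcl n w"
  then have "braid_equiv n w v" unfolding mem_bcl .
  then show "bcl m v = bcl m w" by (rule bcl_eqI[OF be_sym[OF braid_equiv_mono[OF _ assms(2)]]])
qed

lemma braid_gen_bcl: "braid_gen n i = bcl n [(i, True)]"
  by (simp add: braid_gen_def)

section \<open>Burau matrices as matrices of the action on functions\<close>

context burau_data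
begin

definition act_mat :: "nat \<Rightarrow> ((nat \<Rightarrow> 'a) \<Rightarrow> nat \<Rightarrow> 'a) \<Rightarrow> 'a mat" where
  "act_mat N g = mat N N (\<lambda>(i, j). vec N (g (of_vec (unit_vec N j))) $ i)"

lemma act_mat_carrier [simp]: "act_mat N g \<in> carrier_mat N N"
  by (simp add: act_mat_def)

lemma act_mat_mult_vec:
  assumes "\<And>f f'. g (f + f') = g f + g f'" "\<And>c f. g (fscale c f) = fscale c (g f)" "x \<in> carrier_vec N"
  shows "act_mat N g *\<^sub>v x = vec N (g (of_vec x))"
  unfolding act_mat_def
  by (rule linear_vec_eq_mat[of N "\<lambda>x. vec N (g (of_vec x))" N, symmetric])
    (use assms in \<open>auto simp: of_vec_add[of _ N] of_vec_smult vec_fun_add vec_fun_scale simp del: add_carrier_vec\<close>)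

lemma R_add: "R w (f + g) = R w f + R w g"
  and R_scale: "R w (fscale c f) = fscale c (R w f)"
  by (induction w) (simp_all add: bact_add bact_scale)

lemma R_fun_space: "w \<in> braid_words N \<Longrightarrow> f \<in> fun_space N \<Longrightarrow> R w f \<in> fun_space N"
  by (induction w) (auto intro: bact_fun_space)

lemma act_mat_comp:
  assumes g: "\<And>f f'. g (f + f') = g f + g f'" "\<And>c f. g (fscale c f) = fscale c (g f)"
    and k: "\<And>f f'. k (f + f') = k f + k f'" "\<And>c f. k (fscale c f) = fscale c (k f)"
    and kV: "\<And>f. f \<in> fun_space N \<Longrightarrow> k f \<in> fun_space N"
  shows "act_mat N g * act_mat N k = act_mat N (g \<circ> k)"
proof (rule mat_eqI_mult_vec[of _ N N])
  fix x :: "'a vec" assume x: "x \<in> carrier_vec N"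
  have "act_mat N g * act_mat N k *\<^sub>v x = act_mat N g *\<^sub>v (act_mat N k *\<^sub>v x)"
    by (rule assoc_mult_mat_vec[OF act_mat_carrier act_mat_carrier x])
  also have "\<dots> = vec N (g (of_vec (vec N (k (of_vec x)))))"
    unfolding act_mat_mult_vec[OF k x] by (rule act_mat_mult_vec[OF g vec_carrier])
  also have "\<dots> = vec N ((g \<circ> k) (of_vec x))"
    using kV[OF of_vec_fun_space[OF x]] by simp
  also have "\<dots> = act_mat N (g \<circ> k) *\<^sub>v x"
    by (rule act_mat_mult_vec[symmetric]) (simp_all only: comp_apply g k x)
  finally show "act_mat N g * act_mat N k *\<^sub>v x = act_mat N (g \<circ> k) *\<^sub>v x" .
qed (rule mult_carrier_mat[OF act_mat_carrier act_mat_carrier] act_mat_carrier)+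

lemma act_mat_id: "act_mat N id = 1\<^sub>m N"
  by (rule mat_eqI_mult_vec[of _ N N]) (simp_all add: act_mat_mult_vec)

lemma burau_letter_eq:
  assumes i: "1 \<le> i" "i < N"
  shows "burau_letter a N (i, b) = act_mat N (bact (i, b))"
proof -
  obtain k where k: "i = Suc k" using i by (cases i) auto
  have gen: "burau_gen a N i = act_mat N (bact (i, True))"
  proof (rule eq_matI)
    fix r c assume "r < dim_row (act_mat N (bact (i, True)))" "c < dim_col (act_mat N (bact (i, True)))"
    then have "r < N" "c < N" by (auto simp: act_mat_def)
    then show "burau_gen a N i $$ (r, c) = act_mat N (bact (i, True)) $$ (r, c)"
      using i unfolding k by (auto simp: burau_gen_def act_mat_def bact_def of_vec_def unit_vec_def)
  qed (simp_all add: burau_gen_def act_mat_def)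
  show ?thesis
  proof (cases b)
    case True
    then show ?thesis by (simp add: burau_letter_def gen)
  next
    case False
    interpret M: ring "ring_mat TYPE('a) N ()" by (rule ring_mat)
    have inv: "act_mat N (bact (i, c)) * act_mat N (bact (i, \<not> c)) = 1\<^sub>m N" for c
      unfolding act_mat_id[symmetric] bact_inverse[OF i(1), of c, symmetric]
      by (rule act_mat_comp[OF bact_add bact_scale bact_add bact_scale bact_fun_space[OF i]])
    have "inv\<^bsub>ring_mat TYPE('a) N ()\<^esub> act_mat N (bact (i, True)) = act_mat N (bact (i, False))"
      using inv[of True] inv[of False] by (intro M.inv_char) (simp_all add: ring_mat_simps)
    then show ?thesis using False by (simp add: burau_letter_def gen)
  qed
qed

lemma burau_word_eq: "w \<in> braid_words N \<Longrightarrow> burau_word a N w = act_mat N (R w)"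
proof (induction w)
  case Nil
  show ?case unfolding R_simps act_mat_id by (simp add: burau_word_def)
next
  case (Cons l w)
  obtain i b where l: "l = (i, b)" by (cases l)
  then have i: "1 \<le> i" "i < N" "w \<in> braid_words N" using Cons.prems by auto
  have "burau_word a N (l # w) = burau_letter a N l * burau_word a N w" by (simp add: burau_word_def)
  also have "\<dots> = act_mat N (bact (i, b)) * act_mat N (R w)"
    unfolding l burau_letter_eq[OF i(1,2)] Cons.IH[OF i(3)] ..
  also have "\<dots> = act_mat N (bact (i, b) \<circ> R w)"
    by (rule act_mat_comp[OF bact_add bact_scale R_add R_scale R_fun_space[OF i(3)]])
  finally show ?case unfolding l R_simps .
qed

end

section \<open>The Markov function\<close>

locale burau_space = burau_data \<sigma> a for \<sigma> :: "'a::field \<Rightarrow> 'a" and a :: 'a +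
  fixes N :: nat
  assumes nondeg_N: "nondeg_dim N"
begin

sublocale G: graph_space \<sigma> "hB N" N
  by (rule graph_space_hB[OF nondeg_N])

abbreviation "words \<equiv> braid_words N"

lemma iR: "w \<in> words \<Longrightarrow> G.isom (R w)"
  by (rule isom_R[OF _ nondeg_N])

lemma iid: "G.isom id"
  by (rule G.isom_id)

text \<open>The 2-cocycle of the Maslov index, evaluated on words; it sees a word only through its
  isometry (\<open>c_cong\<close>).\<close>

definition c :: "braid_word \<Rightarrow> braid_word \<Rightarrow> ('a mat \<times> 'a mat) set set" where
  "c v w = G.T id (R v) (R (v @ w))"

lemma c_carrier [simp]: "v \<in> words \<Longrightarrow> w \<in> words \<Longrightarrow> c v w \<in> carrier \<W>"
  unfolding c_def by (intro G.T_carrier iid iR) simp_all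

lemma c_cong: "R v = R v' \<Longrightarrow> R w = R w' \<Longrightarrow> c v w = c v' w'"
  by (simp add: c_def R_append)

lemma c_Nil [simp]: "w \<in> words \<Longrightarrow> c [] w = \<zero>\<^bsub>\<W>\<^esub>" "w \<in> words \<Longrightarrow> c w [] = \<zero>\<^bsub>\<W>\<^esub>"
  unfolding c_def by (simp_all add: G.T_same iid iR)

lemma c_shift:
  assumes g: "g \<in> words" "k \<in> words"
  shows "c g k = G.T (R (winv g)) id (R k)"
proof -
  have "G.T (R (winv g) \<circ> id) (R (winv g) \<circ> R g) (R (winv g) \<circ> R (g @ k)) = c g k"
    unfolding c_def using g by (intro G.T_left iR iid) simp_all
  moreover have "R (winv g) \<circ> R (g @ k) = R k"
    using R_winv'[OF g(1)] by (simp add: R_append o_assoc)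
  ultimately show ?thesis using R_winv'[OF g(1)] by simp
qed

text \<open>Start from T(g^-1, 1, k), obtained by left translation. Exchanging the first two
  arguments and inverting all three each change the sign, and the two signs cancel. This form also
  suits the vanishing criterion, since the product of g and k has disappeared.\<close>

lemma c_alt:
  assumes g: "g \<in> words" "k \<in> words"
  shows "c g k = G.T id (R g) (R (winv k))"
proof -
  have g': "winv g \<in> words" "winv k \<in> words" using g by simp_all
  have "c g k = \<ominus>\<^bsub>\<W>\<^esub> G.T id (R (winv g)) (R k)"
    unfolding c_shift[OF g] by (intro G.T_swap iid iR g g')
  also have "G.T id (R (winv g)) (R k) = \<ominus>\<^bsub>\<W>\<^esub> G.T id (R g) (R (winv k))"
    by (intro G.T_inverse iid iR g g' R_winv[OF g(1)] R_winv'[OF g(2)]) simp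
  finally show ?thesis using G.T_carrier[OF iid iR[OF g(1)] iR[OF g'(2)]] by simp
qed

text \<open>Rotating T(1, g, k^-1) gives T(k^-1, 1, g), which is c(k, g) after left translation by
  k.\<close>

lemma c_sym:
  assumes g: "g \<in> words" "k \<in> words"
  shows "c g k = c k g"
proof -
  have "winv k \<in> words" using g by simp
  then have "G.T id (R g) (R (winv k)) = G.T (R (winv k)) id (R g)"
    by (intro G.T_cyclic iid iR g)
  then show ?thesis unfolding c_alt[OF g] c_shift[OF g(2,1)] .
qed

lemma c_cocycle:
  assumes "u \<in> words" "v \<in> words" "w \<in> words"
  shows "c u v \<oplus>\<^bsub>\<W>\<^esub> c (u @ v) w = c u (v @ w) \<oplus>\<^bsub>\<W>\<^esub> c v w"
proof -
  have "c v w = G.T (R u \<circ> id) (R u \<circ> R v) (R u \<circ> R (v @ w))"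
    unfolding c_def using assms by (intro G.T_left[symmetric] iid iR) simp_all
  then have "c v w = G.T (R u) (R (u @ v)) (R (u @ v @ w))" by (simp add: R_append)
  then show ?thesis
    unfolding c_def[of u] c_def[of "u @ v"] append_assoc
    using assms by (simp only:) (intro G.T_cocycle iid iR; simp)
qed

text \<open>Inverse letters receive the value 0 as well; that the characterising property forces
  this is seen in \<open>Fmap_unique\<close>.\<close>

primrec F :: "braid_word \<Rightarrow> ('a mat \<times> 'a mat) set set" where
  "F [] = \<zero>\<^bsub>\<W>\<^esub>"
| "F (l # w) = F w \<oplus>\<^bsub>\<W>\<^esub> c [l] w"

lemma F_carrier [simp]: "w \<in> words \<Longrightarrow> F w \<in> carrier \<W>"
proof (induction w)
  case (Cons l w)
  then show ?case by (cases l) simp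
qed simp

lemma F_append: "v \<in> words \<Longrightarrow> w \<in> words \<Longrightarrow> F (v @ w) = F v \<oplus>\<^bsub>\<W>\<^esub> F w \<oplus>\<^bsub>\<W>\<^esub> c v w"
proof (induction v)
  case (Cons l v)
  then have l: "[l] \<in> words" and v: "v \<in> words" by (cases l; simp)+
  note w = Cons.prems(2)
  have lv: "l # v \<in> words" by (rule Cons.prems(1))
  have cc: "c [l] v \<oplus>\<^bsub>\<W>\<^esub> c (l # v) w = c [l] (v @ w) \<oplus>\<^bsub>\<W>\<^esub> c v w"
    using c_cocycle[OF l v w] by simp
  have "F ((l # v) @ w) = (F v \<oplus>\<^bsub>\<W>\<^esub> F w) \<oplus>\<^bsub>\<W>\<^esub> (c [l] (v @ w) \<oplus>\<^bsub>\<W>\<^esub> c v w)"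
    using Cons.IH[OF v w] l v w by (simp add: W.a_ac)
  also have "\<dots> = F (l # v) \<oplus>\<^bsub>\<W>\<^esub> F w \<oplus>\<^bsub>\<W>\<^esub> c (l # v) w"
    unfolding cc[symmetric] using l v w lv by (simp add: W.a_ac)
  finally show ?case .
qed simp

lemma F_single: "[l] \<in> words \<Longrightarrow> F [l] = \<zero>\<^bsub>\<W>\<^esub>"
  by simp

lemma F_context:
  assumes "u \<in> words" "v \<in> words" "r \<in> words" "r' \<in> words" "R r = R r'" "F r = F r'"
  shows "R (u @ r @ v) = R (u @ r' @ v) \<and> F (u @ r @ v) = F (u @ r' @ v)"
proof
  show "R (u @ r @ v) = R (u @ r' @ v)" using assms by (simp add: R_append)
  show "F (u @ r @ v) = F (u @ r' @ v)"
    using assms c_cong[OF refl, of "r @ v" "r' @ v" u] c_cong[OF assms(5) refl, of v]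
    by (simp add: F_append R_append)
qed

text \<open>Equality of isometries is carried along with equality of values, as
  \<open>F_context\<close> needs it to exchange a relator inside a longer word. The commutation
  relation is the symmetry of c.\<close>

lemma F_braid_equiv:
  assumes "braid_equiv n v w" "n \<le> N"
  shows "R v = R w \<and> F v = F w"
  using assms
proof (induction rule: braid_equiv.induct)
  case (be_cancel u v i b)
  then have i: "1 \<le> i" "i < N" and w: "u \<in> words" "v \<in> words" by (auto intro: braid_words_mono)
  have l: "[(i, b)] \<in> words" "[(i, \<not> b)] \<in> words" using i by simp_all
  have R0: "R [(i, b), (i, \<not> b)] = R []" using bact_inverse[OF i(1), of b] by simp
  have "F [(i, b), (i, \<not> b)] = c [(i, b)] [(i, \<not> b)]" using l by simp
  also have "\<dots> = G.T id (R [(i, b)]) id" unfolding c_def using R0 by simp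
  also have "\<dots> = F []" using G.T_same(2)[OF iid iR[OF l(1)]] by simp
  finally show ?case using F_context[OF w, of "[(i, b), (i, \<not> b)]" "[]"] R0 i by simp
next
  case (be_comm u v i j)
  then have i: "1 \<le> i" "i < N" "1 \<le> j" "j < N" "i + 2 \<le> j" and w: "u \<in> words" "v \<in> words"
    by (auto intro: braid_words_mono)
  have l: "[(i, True)] \<in> words" "[(j, True)] \<in> words" using i by simp_all
  have "F [(i, True), (j, True)] = F [(j, True), (i, True)]" using l c_sym[OF l] by simp
  then show ?case
    using F_context[OF w, of "[(i, True), (j, True)]" "[(j, True), (i, True)]"] bact_comm[OF i(1,5)] i by simp
next
  case (be_braid u v i)
  let ?i = "(i, True)" and ?j = "(i + 1, True)"
  have i: "1 \<le> i" "i + 1 < N" and w: "u \<in> words" "v \<in> words"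
    using be_braid by (auto intro: braid_words_mono)
  have l: "[?i] \<in> words" "[?j] \<in> words" "[?i, ?j] \<in> words" "[?j, ?i] \<in> words" "[?i, ?j, ?i] \<in> words" "[?j, ?i, ?j] \<in> words"
    using i by simp_all
  have RB: "R [?i, ?j, ?i] = R [?j, ?i, ?j]" using bact_braid[OF i(1)] by simp
  \<comment> \<open>The braid D given by either side of the relation commutes with itself and
    conjugates one generator into the other. By invariance of T under conjugation, T(1,
    \<open>R [?i]\<close>, \<open>R ?D\<close>) = T(1, \<open>R [?j]\<close>,
    \<open>R ?D\<close>).\<close>
  have "c [?i] [?j, ?i] = c [?j] [?i, ?j]"
  proof -
    let ?D = "[?i, ?j, ?i]"
    have conj: "R ?D \<circ> R [?i] \<circ> R (winv ?D) = R [?j]"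
    proof -
      have "R ?D \<circ> R [?i] = R [?j] \<circ> R ?D"
        unfolding RB R_append[symmetric] using RB by (simp add: o_assoc)
      then have "R ?D \<circ> R [?i] \<circ> R (winv ?D) = R [?j] \<circ> (R ?D \<circ> R (winv ?D))" by (simp only: o_assoc)
      also have "R ?D \<circ> R (winv ?D) = id" by (rule R_winv[OF l(5)])
      finally show ?thesis unfolding comp_id .
    qed
    have conjD: "R ?D \<circ> R ?D \<circ> R (winv ?D) = R ?D"
    proof -
      have "R ?D \<circ> R ?D \<circ> R (winv ?D) = R ?D \<circ> (R ?D \<circ> R (winv ?D))" by (simp only: o_assoc)
      then show ?thesis unfolding R_winv[OF l(5)] comp_id .
    qed
    have wD: "winv ?D \<in> words" using l(5) by (simp only: winv_braid_words)
    have "c [?i] [?j, ?i] = G.T id (R [?i]) (R ?D)" by (simp add: c_def)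
    also have "\<dots> = G.T (R ?D \<circ> id) (R ?D \<circ> R [?i]) (R ?D \<circ> R ?D)"
      by (intro G.T_left[symmetric] iid iR l)
    also have "\<dots> = G.T (R ?D \<circ> id \<circ> R (winv ?D)) (R ?D \<circ> R [?i] \<circ> R (winv ?D)) (R ?D \<circ> R ?D \<circ> R (winv ?D))"
      by (intro G.T_right[symmetric] G.isom_comp iid iR l wD)
    also have "\<dots> = G.T id (R [?j]) (R ?D)"
      unfolding conj conjD comp_id R_winv[OF l(5)] ..
    also have "\<dots> = c [?j] [?i, ?j]" unfolding c_def RB by simp
    finally show ?thesis .
  qed
  then have "F [?i, ?j, ?i] = F [?j, ?i, ?j]"
    using l c_sym[OF l(1,2)] by simp
  then show ?case using F_context[OF w l(5,6) RB] by simp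
qed auto

text \<open>Symmetry of c and commutativity of addition give F(v w) = F(w v); a conjugate is such a
  rotation of a word followed by a cancellation.\<close>

lemma F_conj:
  assumes "n \<le> N" "b \<in> braid_words n" "g \<in> braid_words n"
  shows "F (winv g @ b @ g) = F b"
proof -
  have m: "b \<in> words" "g \<in> words" using assms braid_words_mono by blast+
  have "F (winv g @ (b @ g)) = F ((b @ g) @ winv g)"
  proof -
    have w: "winv g \<in> words" "b @ g \<in> words" using m by simp_all
    show ?thesis
      unfolding F_append[OF w] F_append[OF w(2,1)] c_sym[OF w] W.a_comm[OF F_carrier F_carrier, OF w] ..
  qed
  moreover have "braid_equiv n (b @ (g @ winv g) @ []) (b @ [] @ [])"
    using assms by (intro braid_equiv_context braid_equiv_winv) auto
  ultimately show ?thesis using F_braid_equiv[OF _ assms(1)] by fastforce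
qed

end

section \<open>From words to braids: existence and uniqueness\<close>

context burau_space
begin

lemma burau_bcl:
  assumes w: "w \<in> words"
  shows "burau a N (bcl N w) = act_mat N (R w)"
proof -
  have word: "burau_word a N v = act_mat N (R w)" if v: "v \<in> bcl N w" for v
  proof -
    have e: "braid_equiv N w v" using v unfolding mem_bcl .
    have "v \<in> words" using braid_equiv_words[OF e] by (rule conjunct2)
    moreover have "R w = R v" using F_braid_equiv[OF e order_refl] by (rule conjunct1)
    ultimately show ?thesis by (simp only: burau_word_eq)
  qed
  have "w \<in> bcl N w" unfolding mem_bcl by (rule be_refl[OF w])
  then have "burau_word a N ` bcl N w = {act_mat N (R w)}"
    using word by (intro equalityI image_subsetI subsetI) (simp_all only: singleton_iff image_eqI[of _ _ w])
  then show ?thesis unfolding burau_def by simp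
qed

lemma burau_maslov_bcl:
  assumes n: "n \<le> N" "burau_dim \<sigma> a n = N" and v: "v \<in> braid_words n" and w: "w \<in> braid_words n"
  shows "burau_maslov \<sigma> a n (bcl n v) (bcl n w) = c v w"
proof -
  have r: "unitary_burau \<sigma> a n (bcl n u) x = vec N (R u (of_vec x))"
    if u: "u \<in> braid_words n" and x: "x \<in> carrier_vec N" for u x
    unfolding unitary_burau_def n(2) braid_incl_bcl[OF u n(1)] burau_bcl[OF braid_words_mono[OF u n(1)]]
    by (rule act_mat_mult_vec[OF R_add R_scale x])
  have vw: "v @ w \<in> braid_words n" using v w by simp
  show ?thesis
    unfolding burau_maslov_def Let_def n(2) bcl_mult[OF v w] c_def
  proof (rule G.graph_maslov_eq[OF iid iR[OF braid_words_mono[OF v n(1)]] iR[OF braid_words_mono[OF vw n(1)]]])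
  qed (simp_all only: burau_form_eq_hB r[OF v] r[OF vw] id_apply vec_of_vec)
qed

text \<open>The restriction fixes the values outside the carrier, as uniqueness among extensional
  functions requires; on the carrier the chosen representative does not matter by
  \<open>F_braid_equiv\<close>.\<close>

definition Fmap :: "nat \<Rightarrow> braid_word set \<Rightarrow> ('a mat \<times> 'a mat) set set" where
  "Fmap n = restrict (\<lambda>X. F (SOME w. w \<in> X)) (carrier (braid_group n))"

lemma Fmap_bcl:
  assumes "n \<le> N" "w \<in> braid_words n"
  shows "Fmap n (bcl n w) = F w"
proof -
  have "(SOME v. v \<in> bcl n w) \<in> bcl n w"
    by (rule someI[where P = "\<lambda>v. v \<in> bcl n w", OF mem_bcl[THEN iffD2, OF be_refl[OF assms(2)]]])
  then have "F w = F (SOME v. v \<in> bcl n w)"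
    by (intro conjunct2[OF F_braid_equiv[OF mem_bcl[THEN iffD1] assms(1)]])
  then show ?thesis unfolding Fmap_def using bcl_carrier[OF assms(2)] by (simp only: restrict_apply if_True)
qed

lemma Fmap_carrier: "n \<le> N \<Longrightarrow> Fmap n \<in> carrier (braid_group n) \<rightarrow>\<^sub>E carrier \<W>"
proof (rule PiE_I)
  fix x assume n: "n \<le> N" and "x \<in> carrier (braid_group n)"
  then obtain w where w: "w \<in> braid_words n" "x = bcl n w" by (elim braid_carrierE)
  show "Fmap n x \<in> carrier \<W>"
    unfolding w(2) Fmap_bcl[OF n w(1)] by (rule F_carrier[OF braid_words_mono[OF w(1) n]])
qed (simp add: Fmap_def)

lemma Fmap_map:
  assumes n: "n \<le> N" "burau_dim \<sigma> a n = N"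
  shows "burau_maslov_map \<sigma> a n (Fmap n)"
  unfolding burau_maslov_map_def
proof (intro conjI ballI)
  fix i assume "i \<in> {1..n - 1}"
  then have "[(i, True)] \<in> braid_words n" by auto
  then show "Fmap n (braid_gen n i) = \<zero>\<^bsub>\<W>\<^esub>"
    unfolding braid_gen_bcl using n(1) by (simp only: Fmap_bcl F_single braid_words_mono)
next
  fix x y assume "x \<in> carrier (braid_group n)" "y \<in> carrier (braid_group n)"
  then obtain v w where v: "v \<in> braid_words n" "x = bcl n v" and w: "w \<in> braid_words n" "y = bcl n w"
    by (elim braid_carrierE)
  have "v @ w \<in> braid_words n" using v w by simp
  then show "Fmap n (x \<otimes>\<^bsub>braid_group n\<^esub> y) = Fmap n x \<oplus>\<^bsub>\<W>\<^esub> Fmap n y \<oplus>\<^bsub>\<W>\<^esub> burau_maslov \<sigma> a n x y"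
    unfolding v(2) w(2) bcl_mult[OF v(1) w(1)] burau_maslov_bcl[OF n v(1) w(1)]
    using F_append[OF braid_words_mono[OF v(1) n(1)] braid_words_mono[OF w(1) n(1)]]
    by (simp only: Fmap_bcl[OF n(1)] v w)
qed

lemma Fmap_unique:
  assumes n: "n \<le> N" "burau_dim \<sigma> a n = N"
    and f: "f \<in> carrier (braid_group n) \<rightarrow>\<^sub>E carrier \<W>" and map: "burau_maslov_map \<sigma> a n f"
  shows "f = Fmap n"
proof -
  have words: "w \<in> words" if "w \<in> braid_words n" for w by (rule braid_words_mono[OF that n(1)])
  have fc: "f (bcl n w) \<in> carrier \<W>" if "w \<in> braid_words n" for w
    using f bcl_carrier[OF that] by (rule PiE_mem)
  have fm: "f (bcl n (v @ w)) = f (bcl n v) \<oplus>\<^bsub>\<W>\<^esub> f (bcl n w) \<oplus>\<^bsub>\<W>\<^esub> c v w"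
    if v: "v \<in> braid_words n" and w: "w \<in> braid_words n" for v w
    using map bcl_carrier[OF v] bcl_carrier[OF w]
    unfolding burau_maslov_map_def bcl_mult[OF v w, symmetric] burau_maslov_bcl[OF n v w, symmetric] by blast
  \<comment> \<open>The correction term of two trivial braids vanishes, so the value at the identity
    satisfies x + x = x.\<close>
  have one: "f (bcl n []) = \<zero>\<^bsub>\<W>\<^esub>"
  proof -
    have nil: "([] :: braid_word) \<in> braid_words n" by simp
    have "f (bcl n []) \<oplus>\<^bsub>\<W>\<^esub> f (bcl n []) = f (bcl n [])"
      using fm[OF nil nil] fc[OF nil] by (simp only: append_Nil c_Nil words[OF nil] W.r_zero W.a_closed)
    then show ?thesis using W.add.l_cancel_one[OF fc[OF nil] fc[OF nil]] by (simp only:)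
  qed
  have letter: "f (bcl n [(i, b)]) = \<zero>\<^bsub>\<W>\<^esub>" if i: "1 \<le> i" "i < n" for i b
  proof -
    have l: "[(i, True)] \<in> braid_words n" "[(i, False)] \<in> braid_words n" using i by simp_all
    have T: "f (bcl n [(i, True)]) = \<zero>\<^bsub>\<W>\<^esub>"
      using map i unfolding burau_maslov_map_def braid_gen_bcl by auto
    have e: "braid_equiv n [(i, True), (i, False)] []" using be_cancel[of "[]" n "[]" i True] i by simp
    \<comment> \<open>The cocycle of a letter and its inverse is 0, because F vanishes on both
      letters and on the cancelling pair. This pins down f on inverse letters, about which the
      characterising property says nothing directly.\<close>
    have "F ([(i, True)] @ [(i, False)]) = \<zero>\<^bsub>\<W>\<^esub>" using F_braid_equiv[OF e n(1)] by simp
    then have "c [(i, True)] [(i, False)] = \<zero>\<^bsub>\<W>\<^esub>"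
      unfolding F_append[OF words[OF l(1)] words[OF l(2)]] F_single[OF words[OF l(1)]] F_single[OF words[OF l(2)]]
      using c_carrier[OF words[OF l(1)] words[OF l(2)]] by (simp only: W.l_zero W.zero_closed)
    then have "f (bcl n [(i, False)]) = \<zero>\<^bsub>\<W>\<^esub>"
      using fm[OF l] bcl_eqI[OF e] fc[OF l(2)] one T
      by (simp only: append_Cons append_Nil W.l_zero W.r_zero)
    then show ?thesis using T by (cases b) (simp_all only:)
  qed
  have val: "f (bcl n w) = F w" if "w \<in> braid_words n" for w
    using that
  proof (induction w)
    case Nil
    show ?case using one by simp
  next
    case (Cons l w)
    obtain i b where l: "l = (i, b)" by (cases l)
    then have i: "1 \<le> i" "i < n" and w: "w \<in> braid_words n" using Cons.prems by auto
    have lw: "[l] \<in> braid_words n" using l i by simp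
    have "f (bcl n ([l] @ w)) = F w \<oplus>\<^bsub>\<W>\<^esub> c [l] w"
      unfolding fm[OF lw w] Cons.IH[OF w] using letter[OF i, of b] F_carrier[OF words[OF w]]
      by (simp only: l W.l_zero)
    then show ?case by (simp only: append_Cons append_Nil F.simps)
  qed
  show ?thesis
  proof (rule PiE_ext[OF f Fmap_carrier[OF n(1)]])
    fix x assume "x \<in> carrier (braid_group n)"
    then obtain w where w: "w \<in> braid_words n" "x = bcl n w" by (rule braid_carrierE)
    show "f x = Fmap n x" unfolding w(2) val[OF w(1)] Fmap_bcl[OF n(1) w(1)] ..
  qed
qed

end

section \<open>Stabilization and change of the ambient dimension\<close>

context burau_data
begin

lemma R_fixed: "w \<in> braid_words n \<Longrightarrow> \<forall>i<n. f i = 0 \<Longrightarrow> R w f = f"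
proof (induction w)
  case (Cons l w)
  obtain i b where l: "l = (i, b)" by (cases l)
  then have i: "1 \<le> i" "i < n" and w: "w \<in> braid_words n" using Cons.prems by auto
  have "f (i - 1) = 0" "f i = 0" using i Cons.prems(2) by simp_all
  then have "bact (i, b) f = f" by (auto simp: bact_def fun_eq_iff)
  then show ?case using Cons.IH[OF w Cons.prems(2)] l by simp
qed simp

lemma R_above: "w \<in> braid_words n \<Longrightarrow> n \<le> i \<Longrightarrow> R w f i = f i"
proof (induction w)
  case (Cons l w)
  then show ?case by (cases l) (auto simp: bact_def)
qed simp

lemma bact_fixed: "1 \<le> i \<Longrightarrow> f i = a * f (i - 1) \<Longrightarrow> bact (i, b) f = f"
  using a_neq_0 by (auto simp: bact_def fun_eq_iff field_simps)

lemma hB_restrict: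
  assumes "x \<in> fun_space N" "y \<in> fun_space N" "N \<le> N'"
  shows "hB N' x y = hB N x y"
proof -
  have "(\<Sum>i<N'. \<Sum>j<N'. \<sigma> (x i) * burau_mat N' $$ (i, j) * y j)
      = (\<Sum>i<N. \<Sum>j<N'. \<sigma> (x i) * burau_mat N' $$ (i, j) * y j)"
    by (rule sum.mono_neutral_right) (use assms in \<open>auto simp: fun_space_def\<close>)
  also have "\<dots> = (\<Sum>i<N. \<Sum>j<N. \<sigma> (x i) * burau_mat N $$ (i, j) * y j)"
  proof (rule sum.cong[OF refl])
    fix i assume "i \<in> {..<N}"
    then show "(\<Sum>j<N'. \<sigma> (x i) * burau_mat N' $$ (i, j) * y j) = (\<Sum>j<N. \<sigma> (x i) * burau_mat N $$ (i, j) * y j)"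
      by (intro sum.mono_neutral_cong_right) (use assms in \<open>auto simp: fun_space_def burau_mat_index\<close>)
  qed
  finally show ?thesis unfolding gform_sum dim_burau_mat .
qed

text \<open>A word on n strands changes only the first n coordinates, so each of its cocycle values
  passes to the smaller space by \<open>graph_space_T_restrict\<close>.\<close>

lemma F_mono:
  assumes A: "burau_space \<sigma> a N" and B: "burau_space \<sigma> a N'" and le: "n \<le> N" "N \<le> N'"
    and w: "w \<in> braid_words n"
  shows "burau_space.F \<sigma> a N' w = burau_space.F \<sigma> a N w"
proof -
  interpret A: burau_space \<sigma> a N by (rule A)
  interpret B: burau_space \<sigma> a N' by (rule B)
  have c: "B.c u v = A.c u v" if u: "u \<in> braid_words n" and v: "v \<in> braid_words n" for u v
    unfolding A.c_def B.c_def
  proof (rule graph_space_T_restrict[OF A.G.graph_space_axioms B.G.graph_space_axioms le(2)])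
    have words: "\<exists>w\<in>braid_words n. g = R w" if "g \<in> {id, R u, R (u @ v)}" for g
      using that u v R_simps(1)[symmetric] braid_words_simps(1,3) by blast
    fix g assume "g \<in> {id, R u, R (u @ v)}"
    then obtain w where w: "w \<in> braid_words n" "g = R w" using words by blast
    show "A.G.isom g" unfolding w(2) by (rule A.iR[OF braid_words_mono[OF w(1) le(1)]])
    show "B.G.isom g" unfolding w(2) by (rule B.iR[OF braid_words_mono[OF w(1) order_trans[OF le]]])
    show "g x - x \<in> fun_space N" for x
      unfolding w(2) using R_above[OF w(1)] le(1) by (simp add: fun_space_def)
  qed (rule hB_restrict[OF _ _ le(2)])
  show ?thesis
    using w
  proof (induction w)
    case (Cons l w)
    have "[l] \<in> braid_words n" "w \<in> braid_words n" using Cons.prems by (cases l; simp)+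
    then show ?case using c Cons.IH by simp
  qed simp
qed

end

context burau_space
begin

text \<open>Every vector is the sum of one supported in coordinate \<open>n\<close>, hence fixed by the braids on \<open>n\<close>
  strands, and one fixed by the new generator; this makes the Maslov correction vanish.\<close>

lemma F_stabilize:
  assumes n: "1 \<le> n" "n < N" and w: "w \<in> braid_words n"
  shows "F (w @ [(n, b)]) = F w"
proof -
  have ww: "w \<in> words" by (rule braid_words_mono[OF w]) (use n in simp)
  have l: "[(n, b)] \<in> words" "[(n, \<not> b)] \<in> words" using n by simp_all
  \<comment> \<open>The third graph is now that of the single inverse letter instead of the whole
    product, so its fixed vectors are known.\<close>
  have "c w [(n, b)] = G.T id (R w) (R [(n, \<not> b)])"
    using c_alt[OF ww l(1)] by (simp only: winv_simps append_Nil)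
  also have "\<dots> = \<zero>\<^bsub>\<W>\<^esub>"
  proof (rule G.T_eq_zero[OF iR[OF ww] iR[OF l(2)]])
    fix x :: "nat \<Rightarrow> 'a" assume x: "x \<in> fun_space N"
    \<comment> \<open>The entry is chosen so that q n = x n - \<open>bfun n x\<close> = a * q (n -
      1), which is the condition for q to be fixed by the letter.\<close>
    define p where "p = (\<lambda>r. if r = n then bfun n x else 0)"
    define q where "q = x - p"
    have "p \<in> fun_space N" "q \<in> fun_space N" "x = p + q"
      using x n by (auto simp: p_def q_def fun_space_def fun_eq_iff)
    moreover have "R w p = p" by (rule R_fixed[OF w]) (simp add: p_def)
    moreover have "R [(n, \<not> b)] q = q"
    proof -
      have "q n = a * q (n - 1)" using n by (simp add: q_def p_def bfun_def)
      then show ?thesis using bact_fixed[OF n(1)] by simp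
    qed
    ultimately show "\<exists>p q. p \<in> fun_space N \<and> q \<in> fun_space N \<and> R w p = p \<and> R [(n, \<not> b)] q = q \<and> x = p + q"
      by blast
  qed
  finally show ?thesis
    unfolding F_append[OF ww l(1)] F_single[OF l(1)] using F_carrier[OF ww]
    by (simp only: W.r_zero)
qed

end

section \<open>The Markov property and the final assembly\<close>

context burau_data
begin

lemma burau_space_burau_dim: "1 \<le> n \<Longrightarrow> burau_space \<sigma> a (burau_dim \<sigma> a n)"
  using burau_dim(2)[of n] burau_data_axioms by (simp add: burau_space_def burau_space_axioms_def)

lemma markov_function_Fmap:
  assumes f: "\<And>n. 2 \<le> n \<Longrightarrow> f n = burau_space.Fmap \<sigma> a (burau_dim \<sigma> a n) n"
  shows "markov_function (carrier \<W>) f"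
  unfolding markov_function_def
proof (intro conjI allI impI ballI)
  fix n :: nat assume n: "2 \<le> n"
  then have n1: "1 \<le> n" "1 \<le> n + 1" "2 \<le> n + 1" by simp_all
  let ?N = "burau_dim \<sigma> a n" and ?N' = "burau_dim \<sigma> a (n + 1)"
  interpret A: burau_space \<sigma> a ?N by (rule burau_space_burau_dim[OF n1(1)])
  interpret B: burau_space \<sigma> a ?N' by (rule burau_space_burau_dim[OF n1(2)])
  note N = burau_dim(1)[OF n1(1)] and N' = burau_dim(1)[OF n1(2)]
  \<comment> \<open>The space for n + 1 strands is also a candidate in the minimum that defines the
    space for n strands. The two may coincide.\<close>
  have NN': "?N \<le> ?N'"
    by (rule burau_dim(3)[OF n1(1) _ burau_dim(2)[OF n1(2)]]) (use N' in simp)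
  show "f n \<in> carrier (braid_group n) \<rightarrow> carrier \<W>"
    unfolding f[OF n] using A.Fmap_carrier[OF N] by (simp add: PiE_def)
  fix x assume "x \<in> carrier (braid_group n)"
  then obtain w where w: "w \<in> braid_words n" "x = bcl n w" by (rule braid_carrierE)
  {
    fix y assume "y \<in> carrier (braid_group n)"
    then obtain v where v: "v \<in> braid_words n" "y = bcl n v" by (rule braid_carrierE)
    have m: "winv v \<in> braid_words n" "winv v @ w \<in> braid_words n" "(winv v @ w) @ v \<in> braid_words n"
      using v w by simp_all
    show "f n (inv\<^bsub>braid_group n\<^esub> y \<otimes>\<^bsub>braid_group n\<^esub> x \<otimes>\<^bsub>braid_group n\<^esub> y) = f n x"
      unfolding f[OF n] v(2) w(2) braid_inv[OF v(1)] bcl_mult[OF m(1) w(1)] bcl_mult[OF m(2) v(1)]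
        A.Fmap_bcl[OF N m(3)] A.Fmap_bcl[OF N w(1)]
      unfolding append_assoc by (rule A.F_conj[OF N w(1) v(1)])
  }
  have w': "w \<in> braid_words (n + 1)" by (rule braid_words_mono[OF w(1)]) simp
  have stab: "f (n + 1) (braid_incl n (n + 1) x \<otimes>\<^bsub>braid_group (n + 1)\<^esub> bcl (n + 1) [(n, b)]) = f n x" for b
  proof -
    have l: "[(n, b)] \<in> braid_words (n + 1)" "w @ [(n, b)] \<in> braid_words (n + 1)" using n w' by simp_all
    have "f (n + 1) (braid_incl n (n + 1) x \<otimes>\<^bsub>braid_group (n + 1)\<^esub> bcl (n + 1) [(n, b)]) = B.F (w @ [(n, b)])"
      unfolding w(2) braid_incl_bcl[OF w(1) le_add1] bcl_mult[OF w' l(1)] f[OF n1(3)] by (rule B.Fmap_bcl[OF N' l(2)])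
    \<comment> \<open>The last generator is removed in the space for n + 1 strands, since that for n
      strands may be too small for it to act; only then is the ambient space changed.\<close>
    also have "\<dots> = B.F w" by (rule B.F_stabilize[OF n1(1) _ w(1)]) (use N' in simp)
    also have "\<dots> = A.F w"
      by (rule F_mono[OF A.burau_space_axioms B.burau_space_axioms N NN' w(1)])
    also have "\<dots> = f n x" unfolding w(2) f[OF n] A.Fmap_bcl[OF N w(1)] ..
    finally show ?thesis .
  qed
  show "f (n + 1) (braid_incl n (n + 1) x \<otimes>\<^bsub>braid_group (n + 1)\<^esub> braid_gen (n + 1) n) = f n x"
    unfolding braid_gen_bcl by (rule stab)
  have "[(n, True)] \<in> braid_words (n + 1)" using n by simp
  then have "inv\<^bsub>braid_group (n + 1)\<^esub> (braid_gen (n + 1) n) = bcl (n + 1) [(n, False)]"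
    unfolding braid_gen_bcl by (simp only: braid_inv winv_simps append_Nil not_True_eq_False)
  then show "f (n + 1) (braid_incl n (n + 1) x \<otimes>\<^bsub>braid_group (n + 1)\<^esub>
      inv\<^bsub>braid_group (n + 1)\<^esub> (braid_gen (n + 1) n)) = f n x"
    using stab[of False] by (simp only:)
qed

end

theorem theorem3p4:
  fixes \<sigma> :: "'k::field \<Rightarrow> 'k"
    and \<alpha> :: "(int \<Rightarrow>\<^sub>0 int) \<Rightarrow> 'k"
  assumes "CHAR('k) \<noteq> 2"
    and "field_involution \<sigma>"
    and "comm_ring_hom \<alpha>"
    and "\<alpha> laurent_t_inv = \<sigma> (\<alpha> laurent_t)"
    and "\<alpha> laurent_t \<noteq> 1"
  shows "(\<forall>n\<ge>2. \<exists>!f. f \<in> carrier (braid_group n) \<rightarrow>\<^sub>E carrier (witt_ring \<sigma>) \<and>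
                     burau_maslov_map \<sigma> (\<alpha> laurent_t) n f) \<and>
         (\<forall>f. (\<forall>n\<ge>2. f n \<in> carrier (braid_group n) \<rightarrow>\<^sub>E carrier (witt_ring \<sigma>) \<and>
                      burau_maslov_map \<sigma> (\<alpha> laurent_t) n (f n)) \<longrightarrow>
              markov_function (carrier (witt_ring \<sigma>)) f)"
proof -
  have two: "(2 :: 'k) \<noteq> 0"
  proof
    assume "(2 :: 'k) = 0"
    then have dvd: "CHAR('k) dvd 2" using of_nat_eq_0_iff_char_dvd[of 2, where ?'a = 'k] by simp
    have "CHAR('k) \<le> 2" "0 < CHAR('k)" using dvd_imp_le[OF dvd] dvd_pos_nat[OF _ dvd] by simp_all
    then show False using assms(1) CHAR_not_1[where ?'a = 'k] by linarith
  qed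
  interpret \<alpha>: comm_ring_hom \<alpha> by (rule assms(3))
  have "\<alpha> laurent_t * \<sigma> (\<alpha> laurent_t) = \<alpha> (laurent_t * laurent_t_inv)"
    unfolding assms(4)[symmetric] \<alpha>.hom_mult ..
  also have "\<dots> = 1" by (simp add: Poly_Mapping.mult_single)
  finally interpret burau_data \<sigma> "\<alpha> laurent_t"
    using assms two by unfold_locales auto
  \<comment> \<open>Both claims rest on this equivalence: for each n the property singles out one
    explicit function, built in the smallest non-degenerate dimension.\<close>
  have *: "(f \<in> carrier (braid_group n) \<rightarrow>\<^sub>E carrier \<W> \<and> burau_maslov_map \<sigma> (\<alpha> laurent_t) n f)
      \<longleftrightarrow> f = burau_space.Fmap \<sigma> (\<alpha> laurent_t) (burau_dim \<sigma> (\<alpha> laurent_t) n) n" if "2 \<le> n" for n f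
  proof -
    have n: "1 \<le> n" using that by simp
    interpret B: burau_space \<sigma> "\<alpha> laurent_t" "burau_dim \<sigma> (\<alpha> laurent_t) n" by (rule burau_space_burau_dim[OF n])
    show ?thesis
      using B.Fmap_carrier[OF burau_dim(1)[OF n]] B.Fmap_map[OF burau_dim(1)[OF n] refl]
        B.Fmap_unique[OF burau_dim(1)[OF n] refl] by blast
  qed
  show ?thesis
  proof (intro conjI allI impI)
    fix n :: nat assume "2 \<le> n"
    then show "\<exists>!f. f \<in> carrier (braid_group n) \<rightarrow>\<^sub>E carrier \<W> \<and> burau_maslov_map \<sigma> (\<alpha> laurent_t) n f"
      by (simp only: *) (rule ex1I, rule refl)
  next
    fix f
    assume f: "\<forall>n\<ge>2. f n \<in> carrier (braid_group n) \<rightarrow>\<^sub>E carrier \<W> \<and> burau_maslov_map \<sigma> (\<alpha> laurent_t) n (f n)"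
    show "markov_function (carrier \<W>) f"
      by (rule markov_function_Fmap) (rule iffD1[OF * mp[OF spec[OF f]]])
  qed
qed

end
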